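(* Let $G$ be a compact Lie group and let $X\neq 0$ be a left-invariant vector field on $G$. For any $T>0$ there exists initial data $u_0\in L^2(G)$ such that, for every $s\in\mathbb{R}$, the Cauchy problem $$\begin{cases}\partial_t u(t,x)+iXu(t,x)=0, & t>0,\ x\in G,\\ u(0,x)=u_0(x), & x\in G,\end{cases}$$ does not admit a solution $u\in C([0,T],L^2_s(G))\cap C^1((0,T),L^2_s(G))$.
   Context: $G$ is equipped with its normalized Haar measure $dx$, and $L^2(G)$ is taken with respect to it. A left-invariant vector field is a real left-invariant vector field (an element of the Lie algebra of $G$), acting on functions as a first-order differential operator, and on distributions by the usual extension; it maps $L^2_s(G)$ continuously into $L^2_{s-1}(G)$ for every $s\in\mathbb{R}$. Here $i=\sqrt{-1}$ and functions are complex-valued. For $s\in\mathbb{R}$, the Sobolev space $L^2_s(G)$ is the completion of $C^\infty(G)$ with respect to the norm $\|f\|_{L^2_s}:=\|(\operatorname{Id}-\Delta_G)^{s/2}f\|_{L^2(G)}$, where $-\Delta_G$ is the (positive) Laplacian of a bi-invariant Riemannian metric on $G$ (the space does not depend on the choice of metric, up to equivalence of norms); all these spaces are viewed as subspaces of the space of distributions on $G$. A solution $u\in C([0,T],L^2_s(G))\cap C^1((0,T),L^2_s(G))$ is a function for which $\partial_t u(t,\cdot)+iXu(t,\cdot)=0$ holds as distributions on $G$ for every $t\in(0,T)$ and $u(0,\cdot)=u_0$ as distributions on $G$. *)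

theory Defs
  imports "HOL-Analysis.Analysis" "HOL-Algebra.Group"
begin

section \<open>Smooth manifolds without boundary\<close>

text \<open>Meant for open \<open>S\<close>, on which \<^const>\<open>frechet_derivative\<close> is unambiguous.\<close>

primrec Ck_on :: "nat \<Rightarrow> 'e::euclidean_space set \<Rightarrow> ('e \<Rightarrow> 'b::real_normed_vector) \<Rightarrow> bool" where
  "Ck_on 0 S f \<longleftrightarrow> continuous_on S f"
| "Ck_on (Suc k) S f \<longleftrightarrow> (\<forall>x\<in>S. f differentiable (at x)) \<and>
     (\<forall>v. Ck_on k S (\<lambda>x. frechet_derivative f (at x) v))"

definition smooth_on :: "'e::euclidean_space set \<Rightarrow> ('e \<Rightarrow> 'b::real_normed_vector) \<Rightarrow> bool" where
  "smooth_on S f \<longleftrightarrow> (\<forall>k. Ck_on k S f)"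

type_synonym ('m, 'e) chart = "'m set \<times> ('m \<Rightarrow> 'e)"

definition is_chart :: "('m::topological_space, 'e::euclidean_space) chart \<Rightarrow> bool" where
  "is_chart c \<longleftrightarrow> (case c of (U, \<phi>) \<Rightarrow>
     open U \<and> open (\<phi> ` U) \<and> homeomorphism U (\<phi> ` U) \<phi> (inv_into U \<phi>))"

definition smooth_atlas :: "('m::topological_space, 'e::euclidean_space) chart set \<Rightarrow> bool" where
  "smooth_atlas A \<longleftrightarrow> (\<forall>c\<in>A. is_chart c) \<and> (\<Union>(U, \<phi>)\<in>A. U) = UNIV \<and>
     (\<forall>(U, \<phi>)\<in>A. \<forall>(V, \<psi>)\<in>A. smooth_on (\<phi> ` (U \<inter> V)) (\<psi> \<circ> inv_into U \<phi>))"

definition smooth_map ::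
  "('m::topological_space, 'e::euclidean_space) chart set \<Rightarrow>
   ('n::topological_space, 'f::euclidean_space) chart set \<Rightarrow> ('m \<Rightarrow> 'n) \<Rightarrow> bool" where
  "smooth_map A B F \<longleftrightarrow> continuous_on UNIV F \<and>
     (\<forall>(U, \<phi>)\<in>A. \<forall>(V, \<psi>)\<in>B. smooth_on (\<phi> ` (U \<inter> F -` V)) (\<psi> \<circ> F \<circ> inv_into U \<phi>))"

definition prod_atlas ::
  "('m, 'e) chart set \<Rightarrow> ('n, 'f) chart set \<Rightarrow> ('m \<times> 'n, 'e \<times> 'f) chart set" where
  "prod_atlas A B = {(U \<times> V, map_prod \<phi> \<psi>) | U \<phi> V \<psi>. (U, \<phi>) \<in> A \<and> (V, \<psi>) \<in> B}"

definition C_inf :: "('m, 'e::euclidean_space) chart set \<Rightarrow> ('m \<Rightarrow> 'b::real_normed_vector) set" where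
  "C_inf A = {f. \<forall>(U, \<phi>)\<in>A. smooth_on (\<phi> ` U) (f \<circ> inv_into U \<phi>)}"


section \<open>Compact Lie groups and Haar measure\<close>

text \<open>The underlying set of the group is a whole type, whose class supplies the topology.
  A zero-dimensional Lie group is not covered by charts in a type of class
  \<open>euclidean_space\<close>, but it carries no non-zero vector field.\<close>

definition compact_lie_group ::
  "('g::{t2_space, second_countable_topology}) monoid \<Rightarrow> ('g, 'e::euclidean_space) chart set \<Rightarrow> bool" where
  "compact_lie_group G A \<longleftrightarrow> group G \<and> carrier G = UNIV \<and> compact (UNIV :: 'g set) \<and>
     smooth_atlas A \<and>
     smooth_map (prod_atlas A A) A (\<lambda>(x, y). x \<otimes>\<^bsub>G\<^esub> y) \<and>
     smooth_map A A (\<lambda>x. inv\<^bsub>G\<^esub> x)"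

definition normalized_haar :: "('g::topological_space) monoid \<Rightarrow> 'g measure \<Rightarrow> bool" where
  "normalized_haar G \<mu> \<longleftrightarrow> sets \<mu> = sets borel \<and> emeasure \<mu> (space \<mu>) = 1 \<and>
     (\<forall>a. distr \<mu> borel (\<lambda>x. a \<otimes>\<^bsub>G\<^esub> x) = \<mu>)"


section \<open>Vector fields\<close>

text \<open>A real vector field is a derivation of the algebra of smooth real functions.  Its value
  on non-smooth functions is fixed to be zero, so that equality of vector fields is equality
  of operators.\<close>

type_synonym 'm vf = "('m \<Rightarrow> real) \<Rightarrow> ('m \<Rightarrow> real)"

definition vector_fields :: "('m, 'e::euclidean_space) chart set \<Rightarrow> 'm vf set" where
  "vector_fields A = {X.
     (\<forall>f\<in>C_inf A. X f \<in> C_inf A) \<and>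
     (\<forall>f. f \<notin> C_inf A \<longrightarrow> X f = (\<lambda>x. 0)) \<and>
     (\<forall>f\<in>C_inf A. \<forall>h\<in>C_inf A. X (\<lambda>x. f x + h x) = (\<lambda>x. X f x + X h x)) \<and>
     (\<forall>c. \<forall>f\<in>C_inf A. X (\<lambda>x. c * f x) = (\<lambda>x. c * X f x)) \<and>
     (\<forall>f\<in>C_inf A. \<forall>h\<in>C_inf A. X (\<lambda>x. f x * h x) = (\<lambda>x. X f x * h x + f x * X h x))}"

definition zero_vf :: "'m vf" where
  "zero_vf = (\<lambda>f x. 0)"

definition left_invariant_vfs ::
  "'g monoid \<Rightarrow> ('g, 'e::euclidean_space) chart set \<Rightarrow> 'g vf set" where
  "left_invariant_vfs G A = {X \<in> vector_fields A.
     \<forall>a. \<forall>f\<in>C_inf A. X (\<lambda>x. f (a \<otimes>\<^bsub>G\<^esub> x)) = (\<lambda>x. X f (a \<otimes>\<^bsub>G\<^esub> x))}"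

text \<open>Complex-linear extension of a real operator to complex-valued functions.\<close>

definition complexify :: "'m vf \<Rightarrow> ('m \<Rightarrow> complex) \<Rightarrow> ('m \<Rightarrow> complex)" where
  "complexify X f = (\<lambda>x. Complex (X (\<lambda>y. Re (f y)) x) (X (\<lambda>y. Im (f y)) x))"

definition pushforward :: "('m \<Rightarrow> 'm) \<Rightarrow> 'm vf \<Rightarrow> 'm vf" where
  "pushforward F X = (\<lambda>f x. X (f \<circ> F) (inv_into UNIV F x))"


section \<open>Bi-invariant Riemannian metrics and the Laplacian\<close>

text \<open>A Riemannian metric is given as a \<open>C\<^sup>\<infinity>\<close>-bilinear form on vector fields with values in the
  smooth functions.\<close>

type_synonym 'm metric_tensor = "'m vf \<Rightarrow> 'm vf \<Rightarrow> 'm \<Rightarrow> real"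

definition riemannian_metric ::
  "('m, 'e::euclidean_space) chart set \<Rightarrow> 'm metric_tensor \<Rightarrow> bool" where
  "riemannian_metric A g \<longleftrightarrow>
     (\<forall>X\<in>vector_fields A. \<forall>Y\<in>vector_fields A. g X Y \<in> C_inf A \<and> g X Y = g Y X) \<and>
     (\<forall>X\<in>vector_fields A. \<forall>Y\<in>vector_fields A. \<forall>Z\<in>vector_fields A.
        g (\<lambda>f x. X f x + Y f x) Z = (\<lambda>x. g X Z x + g Y Z x)) \<and>
     (\<forall>h\<in>C_inf A. \<forall>X\<in>vector_fields A. \<forall>Z\<in>vector_fields A.
        g (\<lambda>f x. h x * X f x) Z = (\<lambda>x. h x * g X Z x)) \<and>
     (\<forall>X\<in>vector_fields A. \<forall>x. g X X x \<ge> 0 \<and> (g X X x = 0 \<longrightarrow> (\<forall>f. X f x = 0)))"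

definition isometry_of ::
  "('m, 'e::euclidean_space) chart set \<Rightarrow> 'm metric_tensor \<Rightarrow> ('m \<Rightarrow> 'm) \<Rightarrow> bool" where
  "isometry_of A g F \<longleftrightarrow>
     (\<forall>X\<in>vector_fields A. \<forall>Y\<in>vector_fields A. \<forall>x.
        g (pushforward F X) (pushforward F Y) (F x) = g X Y x)"

definition bi_invariant_metric ::
  "'g monoid \<Rightarrow> ('g, 'e::euclidean_space) chart set \<Rightarrow> 'g metric_tensor \<Rightarrow> bool" where
  "bi_invariant_metric G A g \<longleftrightarrow> riemannian_metric A g \<and>
     (\<forall>a. isometry_of A g (\<lambda>x. a \<otimes>\<^bsub>G\<^esub> x) \<and> isometry_of A g (\<lambda>x. x \<otimes>\<^bsub>G\<^esub> a))"

definition gradient ::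
  "('m, 'e::euclidean_space) chart set \<Rightarrow> 'm metric_tensor \<Rightarrow> ('m \<Rightarrow> real) \<Rightarrow> 'm vf" where
  "gradient A g f = (THE Y. Y \<in> vector_fields A \<and> (\<forall>Z\<in>vector_fields A. g Y Z = Z f))"

text \<open>The divergence with respect to a volume measure, as minus the formal adjoint of the
  action on functions.  It is unchanged when the measure is multiplied by a positive constant,
  and the Riemannian volume of a bi-invariant metric is a constant multiple of Haar measure.\<close>

definition divergence ::
  "('m::topological_space, 'e::euclidean_space) chart set \<Rightarrow> 'm measure \<Rightarrow> 'm vf \<Rightarrow> 'm \<Rightarrow> real" where
  "divergence A \<mu> Y = (THE d. d \<in> C_inf A \<and>
     (\<forall>h\<in>C_inf A. (LINT x|\<mu>. d x * h x) = - (LINT x|\<mu>. Y h x)))"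

definition laplacian ::
  "('m::topological_space, 'e::euclidean_space) chart set \<Rightarrow> 'm measure \<Rightarrow> 'm metric_tensor \<Rightarrow>
   ('m \<Rightarrow> real) \<Rightarrow> 'm \<Rightarrow> real" where
  "laplacian A \<mu> g f = divergence A \<mu> (gradient A g f)"


section \<open>Sobolev norms of smooth functions\<close>

definition square_integrable :: "'m measure \<Rightarrow> ('m \<Rightarrow> complex) \<Rightarrow> bool" where
  "square_integrable \<mu> f \<longleftrightarrow> f \<in> borel_measurable \<mu> \<and> integrable \<mu> (\<lambda>x. (cmod (f x))\<^sup>2)"

definition L2_inner :: "'m measure \<Rightarrow> ('m \<Rightarrow> complex) \<Rightarrow> ('m \<Rightarrow> complex) \<Rightarrow> complex" where
  "L2_inner \<mu> f h = (LINT x|\<mu>. f x * cnj (h x))"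

definition L2_norm :: "'m measure \<Rightarrow> ('m \<Rightarrow> complex) \<Rightarrow> real" where
  "L2_norm \<mu> f = sqrt (LINT x|\<mu>. (cmod (f x))\<^sup>2)"

definition laplace_eigenspace ::
  "('m::topological_space, 'e::euclidean_space) chart set \<Rightarrow> 'm measure \<Rightarrow> 'm metric_tensor \<Rightarrow>
   real \<Rightarrow> ('m \<Rightarrow> complex) set" where
  "laplace_eigenspace A \<mu> g l =
     {e \<in> C_inf A. \<forall>x. - complexify (laplacian A \<mu> g) e x = complex_of_real l * e x}"

text \<open>The power \<open>(Id - \<Delta>)\<^bsup>s/2\<^esup>\<close> in the sense of the spectral theorem.  The operator \<open>-\<Delta>\<close> has
  eigenvalues \<open>l \<ge> 0\<close> and its eigenspaces span a dense subspace of \<open>L\<^sup>2\<close>, so \<open>(Id - \<Delta>)\<^bsup>s/2\<^esup> f\<close>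
  is the element of \<open>L\<^sup>2\<close>, unique up to null sets, whose component in the eigenspace of \<open>l\<close>
  is \<open>(1 + l)\<^bsup>s/2\<^esup>\<close> times that of \<open>f\<close>.\<close>

definition bessel_power ::
  "('m::topological_space, 'e::euclidean_space) chart set \<Rightarrow> 'm measure \<Rightarrow> 'm metric_tensor \<Rightarrow>
   real \<Rightarrow> ('m \<Rightarrow> complex) \<Rightarrow> ('m \<Rightarrow> complex)" where
  "bessel_power A \<mu> g s f = (SOME h. square_integrable \<mu> h \<and>
     (\<forall>l. \<forall>e\<in>laplace_eigenspace A \<mu> g l.
        L2_inner \<mu> h e = complex_of_real ((1 + l) powr (s / 2)) * L2_inner \<mu> f e))"

definition sobolev_norm_smooth ::
  "('m::topological_space, 'e::euclidean_space) chart set \<Rightarrow> 'm measure \<Rightarrow> 'm metric_tensor \<Rightarrow>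
   real \<Rightarrow> ('m \<Rightarrow> complex) \<Rightarrow> real" where
  "sobolev_norm_smooth A \<mu> g s f = L2_norm \<mu> (bessel_power A \<mu> g s f)"


section \<open>Distributions and Sobolev spaces\<close>

text \<open>The Frechet topology of the smooth functions on a compact manifold is that of uniform
  convergence of all iterated derivatives along smooth vector fields.  Distributions are only
  ever evaluated on smooth functions.\<close>

definition C_inf_null_seq ::
  "('m, 'e::euclidean_space) chart set \<Rightarrow> (nat \<Rightarrow> 'm \<Rightarrow> complex) \<Rightarrow> bool" where
  "C_inf_null_seq A h \<longleftrightarrow> (\<forall>n. h n \<in> C_inf A) \<and>
     (\<forall>Ys. set Ys \<subseteq> vector_fields A \<longrightarrow>
        uniform_limit UNIV (\<lambda>n. foldr complexify Ys (h n)) (\<lambda>x. 0) sequentially)"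

type_synonym 'm functional = "('m \<Rightarrow> complex) \<Rightarrow> complex"

definition distributions :: "('m, 'e::euclidean_space) chart set \<Rightarrow> 'm functional set" where
  "distributions A = {u.
     (\<forall>h\<in>C_inf A. \<forall>k\<in>C_inf A. u (\<lambda>x. h x + k x) = u h + u k) \<and>
     (\<forall>c. \<forall>h\<in>C_inf A. u (\<lambda>x. c * h x) = c * u h) \<and>
     (\<forall>h. C_inf_null_seq A h \<longrightarrow> (\<lambda>n. u (h n)) \<longlonglongrightarrow> 0)}"

definition dist_eq ::
  "('m, 'e::euclidean_space) chart set \<Rightarrow> 'm functional \<Rightarrow> 'm functional \<Rightarrow> bool" where
  "dist_eq A u v \<longleftrightarrow> (\<forall>h\<in>C_inf A. u h = v h)"

definition dist_of_fun :: "'m measure \<Rightarrow> ('m \<Rightarrow> complex) \<Rightarrow> 'm functional" where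
  "dist_of_fun \<mu> f = (\<lambda>h. LINT x|\<mu>. f x * h x)"

text \<open>The extension to distributions of a left-invariant vector field \<open>X\<close>.  The minus sign is
  integration by parts: \<open>\<integral> (X f) h = - \<integral> f (X h)\<close>, as Haar measure is right-invariant.\<close>

definition vf_on_dist :: "'m vf \<Rightarrow> 'm functional \<Rightarrow> 'm functional" where
  "vf_on_dist X u = (\<lambda>h. - u (complexify X h))"

text \<open>The completion of the smooth functions for the Sobolev norm, realised inside the
  distributions: limits, as distributions, of Cauchy sequences of smooth functions.\<close>

definition sobolev_approx ::
  "('m::topological_space, 'e::euclidean_space) chart set \<Rightarrow> 'm measure \<Rightarrow> 'm metric_tensor \<Rightarrow>
   real \<Rightarrow> (nat \<Rightarrow> 'm \<Rightarrow> complex) \<Rightarrow> 'm functional \<Rightarrow> bool" where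
  "sobolev_approx A \<mu> g s f u \<longleftrightarrow> (\<forall>n. f n \<in> C_inf A) \<and>
     (\<forall>\<epsilon>>0. \<exists>N. \<forall>m\<ge>N. \<forall>n\<ge>N. sobolev_norm_smooth A \<mu> g s (\<lambda>x. f m x - f n x) < \<epsilon>) \<and>
     (\<forall>h\<in>C_inf A. (\<lambda>n. dist_of_fun \<mu> (f n) h) \<longlonglongrightarrow> u h)"

definition sobolev_space ::
  "('m::topological_space, 'e::euclidean_space) chart set \<Rightarrow> 'm measure \<Rightarrow> 'm metric_tensor \<Rightarrow>
   real \<Rightarrow> 'm functional set" where
  "sobolev_space A \<mu> g s = {u \<in> distributions A. \<exists>f. sobolev_approx A \<mu> g s f u}"

definition sobolev_norm ::
  "('m::topological_space, 'e::euclidean_space) chart set \<Rightarrow> 'm measure \<Rightarrow> 'm metric_tensor \<Rightarrow>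
   real \<Rightarrow> 'm functional \<Rightarrow> real" where
  "sobolev_norm A \<mu> g s u = (THE r. \<exists>f. sobolev_approx A \<mu> g s f u \<and>
     (\<lambda>n. sobolev_norm_smooth A \<mu> g s (f n)) \<longlonglongrightarrow> r)"


section \<open>Solutions of the Cauchy problem\<close>

definition sobolev_continuous_on ::
  "('m::topological_space, 'e::euclidean_space) chart set \<Rightarrow> 'm measure \<Rightarrow> 'm metric_tensor \<Rightarrow>
   real \<Rightarrow> real set \<Rightarrow> (real \<Rightarrow> 'm functional) \<Rightarrow> bool" where
  "sobolev_continuous_on A \<mu> g s I u \<longleftrightarrow>
     (\<forall>t\<in>I. u t \<in> sobolev_space A \<mu> g s) \<and>
     (\<forall>t\<in>I. ((\<lambda>r. sobolev_norm A \<mu> g s (\<lambda>h. u r h - u t h)) \<longlongrightarrow> 0) (at t within I))"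

definition sobolev_has_derivative_on ::
  "('m::topological_space, 'e::euclidean_space) chart set \<Rightarrow> 'm measure \<Rightarrow> 'm metric_tensor \<Rightarrow>
   real \<Rightarrow> real set \<Rightarrow> (real \<Rightarrow> 'm functional) \<Rightarrow> (real \<Rightarrow> 'm functional) \<Rightarrow> bool" where
  "sobolev_has_derivative_on A \<mu> g s I u u' \<longleftrightarrow>
     (\<forall>t\<in>I. u t \<in> sobolev_space A \<mu> g s \<and> u' t \<in> sobolev_space A \<mu> g s \<and>
        ((\<lambda>r. sobolev_norm A \<mu> g s (\<lambda>h. (u r h - u t h) / complex_of_real (r - t) - u' t h))
           \<longlongrightarrow> 0) (at t within I))"

definition cauchy_solution ::
  "('m::topological_space, 'e::euclidean_space) chart set \<Rightarrow> 'm measure \<Rightarrow> 'm metric_tensor \<Rightarrow>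
   'm vf \<Rightarrow> real \<Rightarrow> real \<Rightarrow> ('m \<Rightarrow> complex) \<Rightarrow> (real \<Rightarrow> 'm functional) \<Rightarrow> bool" where
  "cauchy_solution A \<mu> g X T s u\<^sub>0 u \<longleftrightarrow>
     sobolev_continuous_on A \<mu> g s {0..T} u \<and>
     (\<exists>u'. sobolev_has_derivative_on A \<mu> g s {0<..<T} u u' \<and>
        sobolev_continuous_on A \<mu> g s {0<..<T} u' \<and>
        (\<forall>t\<in>{0<..<T}. dist_eq A (\<lambda>h. u' t h + \<i> * vf_on_dist X (u t) h) (\<lambda>h. 0))) \<and>
     dist_eq A (u 0) (dist_of_fun \<mu> u\<^sub>0)"

end

theory Submission
  imports Defs "HOL-Complex_Analysis.Great_Picard"
begin

text \<open>
  The equation \<open>\<partial>\<^sub>t u + i X u = 0\<close> is ill-posed because \<open>i X\<close> is a symmetric operator with real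
  eigenvalues that are unbounded in both directions.  Suppose that \<open>X \<phi> = i \<kappa> \<phi>\<close> with \<open>\<kappa> < 0\<close> and
  \<open>sup \<bar>\<phi>\<bar> = 1\<close>.  As \<open>X\<close> is a derivation, \<open>X \<phi>\<^sup>n = i n \<kappa> \<phi>\<^sup>n\<close>.  Pairing a solution with \<open>\<phi>\<^sup>n\<close> gives a
  scalar differential equation, whence \<open>u(T)(\<phi>\<^sup>n) = e\<^bsup>-n\<kappa>T\<^esup> \<integral> u\<^sub>0 \<phi>\<^sup>n\<close>, which is the integral multiplied by an
  exponentially large factor.  For \<open>u\<^sub>0 = 1 / (1 - \<sigma> cnj \<phi>)\<close>, the orthogonality of the powers of
  \<open>\<phi>\<close> leaves \<open>\<integral> u\<^sub>0 \<phi>\<^sup>n = \<sigma>\<^sup>n \<integral> \<bar>\<phi>\<bar>\<^bsup>2n\<^esup>\<close>, and the last integral is at least a constant times \<open>\<sigma>\<^bsup>2n\<^esup>\<close>,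
  since Haar measure charges the set where \<open>\<bar>\<phi>\<bar> > \<sigma>\<close>.  On the other hand \<open>\<rho>\<^sup>n \<phi>\<^sup>n\<close> tends to zero with all
  derivatives for each \<open>\<rho> < 1\<close>, so \<open>\<rho>\<^sup>n u(T)(\<phi>\<^sup>n)\<close> tends to zero whenever \<open>u(T)\<close> is a distribution, of
  whatever Sobolev order.  When \<open>\<sigma>\<close> and \<open>\<rho>\<close> are close enough to 1, depending on \<open>T\<close>, the two are
  incompatible.

  Two ingredients need work.

  The eigenfunction comes from a completeness theorem (\<open>eigenfunctions_complete\<close>): a square-integrable
  function orthogonal to all smooth eigenfunctions of a symmetric left-invariant operator vanishes
  almost everywhere.  As in the proof of the Peter-Weyl theorem, convolution with a symmetric smooth
  bump is a compact symmetric operator.  It commutes with the given operator and maps into the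
  smooth functions.  So its eigenspaces for non-zero eigenvalues consist of smooth functions, and on
  each of them the given operator is itself an integral operator with continuous kernel.  Were all
  eigenvalues of \<open>i X\<close> zero, then completeness would give \<open>X = 0\<close>.

  To make use of continuity and differentiability in a Sobolev norm, one needs that pairing with a smooth
  function is continuous for that norm (\<open>sobolev_norm_pairing\<close>).  For this, the Laplacian is
  computed as the sum of squares of an orthonormal left-invariant frame (\<open>laplacian_eq\<close>).  The same
  completeness theorem shows that its eigenfunctions span a dense subspace, from which the power
  \<open>(Id - \<Delta>)\<^bsup>s/2\<^esup>\<close> of a smooth function (\<open>bessel_power\<close>) and the duality between the orders \<open>s\<close> and \<open>-s\<close>
  are obtained by approximation.
\<close>

section \<open>Calculus of functions of class \<open>C\<^sup>k\<close>\<close>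

lemma Ck_on_subset: "Ck_on k S f \<Longrightarrow> T \<subseteq> S \<Longrightarrow> Ck_on k T f"
proof (induction k arbitrary: f)
  case 0
  then show ?case by (auto intro: continuous_on_subset)
next
  case (Suc k)
  then show ?case by (simp del: Ck_on.simps(1)) blast
qed

lemma Ck_on_cong:
  assumes "open S" "\<And>x. x \<in> S \<Longrightarrow> f x = g x" "Ck_on k S f"
  shows "Ck_on k S g"
  using assms(2,3)
proof (induction k arbitrary: f g)
  case 0
  then show ?case by (metis Ck_on.simps(1) continuous_on_cong)
next
  case (Suc k)
  have d: "g differentiable at x" "frechet_derivative f (at x) = frechet_derivative g (at x)" if "x \<in> S" for x
  proof -
    have fx: "f differentiable at x" using Suc.prems that by auto
    show "frechet_derivative f (at x) = frechet_derivative g (at x)"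
      using frechet_derivative_transform_within_open[OF fx assms(1) that] Suc.prems(1) by auto
    show "g differentiable at x"
      using fx assms(1) that Suc.prems(1)
      by (meson differentiable_def has_derivative_transform_within_open)
  qed
  have "Ck_on k S (\<lambda>x. frechet_derivative g (at x) v)" for v
    using Suc.IH[of "\<lambda>x. frechet_derivative f (at x) v" "\<lambda>x. frechet_derivative g (at x) v"]
      Suc.prems(2) d(2) by auto
  then show ?case using d by auto
qed

lemma Ck_on_Suc_imp: "Ck_on (Suc k) S f \<Longrightarrow> Ck_on k S f"
proof (induction k arbitrary: f)
  case 0
  then show ?case
    by (auto simp: differentiable_imp_continuous_within intro!: continuous_at_imp_continuous_on)
next
  case (Suc k)
  have "Ck_on k S (\<lambda>x. frechet_derivative f (at x) v)" for v
    using Suc.prems Suc.IH[of "\<lambda>x. frechet_derivative f (at x) v"] by simp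
  with Suc.prems show ?case by auto
qed

lemma Ck_on_le: "Ck_on k S f \<Longrightarrow> j \<le> k \<Longrightarrow> Ck_on j S f"
  by (induction k) (auto simp: le_Suc_eq dest: Ck_on_Suc_imp simp del: Ck_on.simps)

lemma Ck_on_continuous: "Ck_on k S f \<Longrightarrow> continuous_on S f"
  using Ck_on_le[of k S f 0] by simp

lemma Ck_on_local:
  assumes "\<And>x. x \<in> S \<Longrightarrow> \<exists>N. open N \<and> x \<in> N \<and> Ck_on k N f"
  shows "Ck_on k S f"
  using assms
proof (induction k arbitrary: f)
  case 0
  have "isCont f x" if "x \<in> S" for x
    using 0[OF that] by (auto simp: continuous_on_eq_continuous_at)
  then show ?case by (simp add: continuous_at_imp_continuous_on)
next
  case (Suc k)
  have "Ck_on k S (\<lambda>x. frechet_derivative f (at x) v)" for v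
    by (rule Suc.IH) (use Suc.prems in \<open>(simp, blast)\<close>)
  moreover have "f differentiable at x" if "x \<in> S" for x using Suc.prems[OF that] by auto
  ultimately show ?case by simp
qed

lemma Ck_on_SucI:
  assumes "open S" "\<And>x. x \<in> S \<Longrightarrow> (f has_derivative f' x) (at x)"
    "\<And>v. Ck_on k S (\<lambda>x. f' x v)"
  shows "Ck_on (Suc k) S f"
proof -
  have "frechet_derivative f (at x) = f' x" if "x \<in> S" for x
    using assms(2)[OF that] by (metis frechet_derivative_at)
  then have "Ck_on k S (\<lambda>x. frechet_derivative f (at x) v)" for v
    using Ck_on_cong[OF assms(1) _ assms(3)[of v]] by simp
  then show ?thesis using assms(2) by (auto simp: differentiable_def)
qed

lemma Ck_on_SucD:
  assumes "Ck_on (Suc k) S f" "x \<in> S"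
  shows "(f has_derivative frechet_derivative f (at x)) (at x)"
  using assms by (auto simp: frechet_derivative_works)

lemma Ck_on_const: "open S \<Longrightarrow> Ck_on k S (\<lambda>x. c)"
proof (induction k arbitrary: c)
  case (Suc k)
  show ?case
    by (rule Ck_on_SucI[where f' = "\<lambda>_ _. 0"]) (use Suc in auto)
qed simp

lemma Ck_on_bounded_linear:
  assumes "bounded_linear h" "open S"
  shows "Ck_on k S h"
proof (cases k)
  case 0
  then show ?thesis using assms by (auto intro: linear_continuous_on)
next
  case (Suc j)
  show ?thesis unfolding Suc
    by (rule Ck_on_SucI[where f' = "\<lambda>_. h"])
      (use assms bounded_linear_imp_has_derivative in \<open>auto intro: Ck_on_const\<close>)
qed

lemma Ck_on_bounded_linear_comp:
  assumes "bounded_linear h" "open S" "Ck_on k S f"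
  shows "Ck_on k S (\<lambda>x. h (f x))"
  using assms(3)
proof (induction k arbitrary: f)
  case 0
  then show ?case using assms(1) by (auto intro: bounded_linear.continuous_on)
next
  case (Suc k)
  show ?case
    by (rule Ck_on_SucI[where f' = "\<lambda>x v. h (frechet_derivative f (at x) v)"])
      (use Suc Ck_on_SucD[OF Suc.prems] assms in \<open>auto intro: bounded_linear.has_derivative\<close>)
qed

lemma Ck_on_add:
  assumes "open S" "Ck_on k S f" "Ck_on k S g"
  shows "Ck_on k S (\<lambda>x. f x + g x)"
  using assms(2,3)
proof (induction k arbitrary: f g)
  case 0
  then show ?case by (auto intro: continuous_intros)
next
  case (Suc k)
  show ?case
    by (rule Ck_on_SucI[where f' = "\<lambda>x v. frechet_derivative f (at x) v + frechet_derivative g (at x) v"])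
      (use Suc Ck_on_SucD[OF Suc.prems(1)] Ck_on_SucD[OF Suc.prems(2)] assms(1) in
        \<open>auto intro: has_derivative_add\<close>)
qed

lemma Ck_on_sum:
  assumes "open S" "\<And>i. i \<in> I \<Longrightarrow> Ck_on k S (f i)"
  shows "Ck_on k S (\<lambda>x. \<Sum>i\<in>I. f i x)"
  using assms(2) by (induction I rule: infinite_finite_induct) (auto intro: Ck_on_const Ck_on_add assms(1))

lemma Ck_on_bilinear:
  assumes "bounded_bilinear pr" "open S" "Ck_on k S f" "Ck_on k S g"
  shows "Ck_on k S (\<lambda>x. pr (f x) (g x))"
  using assms(3,4)
proof (induction k arbitrary: f g)
  case 0
  then show ?case using assms(1) by (auto intro: bounded_bilinear.continuous_on)
next
  case (Suc k)
  show ?case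
    by (rule Ck_on_SucI[where f' = "\<lambda>x v. pr (f x) (frechet_derivative g (at x) v) + pr (frechet_derivative f (at x) v) (g x)"])
      (use Suc Ck_on_SucD[OF Suc.prems(1)] Ck_on_SucD[OF Suc.prems(2)] assms(1,2) in
        \<open>auto intro!: bounded_bilinear.FDERIV Ck_on_add Suc.IH intro: Ck_on_Suc_imp[OF Suc.prems(1)] Ck_on_Suc_imp[OF Suc.prems(2)]\<close>)
qed

lemma linear_basis_expansion:
  fixes f :: "'e::euclidean_space \<Rightarrow> 'b::real_vector"
  assumes "linear f"
  shows "f v = (\<Sum>b\<in>Basis. (v \<bullet> b) *\<^sub>R f b)"
proof -
  have "f v = f (\<Sum>b\<in>Basis. (v \<bullet> b) *\<^sub>R b)" by (simp add: euclidean_representation)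
  then show ?thesis by (simp only: linear_sum[OF assms] linear_scale[OF assms])
qed

lemma Ck_on_compose:
  fixes f :: "'e::euclidean_space \<Rightarrow> 'b::real_normed_vector" and h :: "'d::euclidean_space \<Rightarrow> 'e"
  assumes "open S" "open T" "h ` S \<subseteq> T" "Ck_on k T f" "Ck_on k S h"
  shows "Ck_on k S (\<lambda>x. f (h x))"
  using assms(4,5)
proof (induction k arbitrary: f)
  case 0
  then show ?case using assms(3) by (auto intro: continuous_on_compose2)
next
  case (Suc k)
  have fh: "(f has_derivative frechet_derivative f (at (h x))) (at (h x))"
      "(h has_derivative frechet_derivative h (at x)) (at x)" if "x \<in> S" for x
    using that Ck_on_SucD[OF Suc.prems(1)] Ck_on_SucD[OF Suc.prems(2)] assms(3) by auto
  \<comment> \<open>The chain rule in coordinates, so that products and sums of \<open>C\<^sup>k\<close> functions appear.\<close>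
  let ?D = "\<lambda>x v. \<Sum>b\<in>Basis. (frechet_derivative h (at x) v \<bullet> b) *\<^sub>R frechet_derivative f (at (h x)) b"
  have "((\<lambda>x. f (h x)) has_derivative ?D x) (at x)" if "x \<in> S" for x
  proof -
    have "bounded_linear (frechet_derivative f (at (h x)))" using fh(1)[OF that] by (rule has_derivative_bounded_linear)
    then have lin: "linear (frechet_derivative f (at (h x)))" by (simp add: bounded_linear.linear)
    have "frechet_derivative f (at (h x)) w = (\<Sum>b\<in>Basis. (w \<bullet> b) *\<^sub>R frechet_derivative f (at (h x)) b)" for w
      by (rule linear_basis_expansion[OF lin])
    then have "(\<lambda>v. frechet_derivative f (at (h x)) (frechet_derivative h (at x) v)) = ?D x"
      by (intro ext)
    then show ?thesis using has_derivative_compose[OF fh(2)[OF that] fh(1)[OF that]] by (simp only:)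
  qed
  moreover have "Ck_on k S (\<lambda>x. ?D x v)" for v
  proof (rule Ck_on_sum[OF assms(1)], rule Ck_on_bilinear[OF bounded_bilinear_scaleR assms(1)])
    fix b :: 'e
    show "Ck_on k S (\<lambda>x. frechet_derivative h (at x) v \<bullet> b)"
      using Suc.prems(2) by (auto intro!: Ck_on_bounded_linear_comp[OF bounded_linear_inner_left assms(1)])
    show "Ck_on k S (\<lambda>x. frechet_derivative f (at (h x)) b)"
      by (rule Suc.IH) (use Suc.prems Ck_on_Suc_imp in auto)
  qed
  ultimately show ?case by (rule Ck_on_SucI[OF assms(1)])
qed

lemma Ck_on_inverse: "Ck_on k (- {0::real}) (\<lambda>x. inverse x)"
proof (induction k)
  case 0
  then show ?case by (auto intro!: continuous_intros)
next
  case (Suc k)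
  have "Ck_on k (-{0}) (\<lambda>x::real. - (inverse x * v * inverse x))" for v
    by (intro Ck_on_bounded_linear_comp[OF bounded_linear_minus[OF bounded_linear_ident]]
        Ck_on_bilinear[OF bounded_bilinear_mult] Ck_on_const Suc) auto
  then show ?case
    by (intro Ck_on_SucI[where f' = "\<lambda>x v. - (inverse x * v * inverse x)"])
      (auto intro: has_derivative_inverse')
qed

lemma smooth_on_subset: "smooth_on S f \<Longrightarrow> T \<subseteq> S \<Longrightarrow> smooth_on T f"
  unfolding smooth_on_def by (metis Ck_on_subset)

lemma smooth_on_cong:
  assumes "open S" "\<And>x. x \<in> S \<Longrightarrow> f x = g x" "smooth_on S f"
  shows "smooth_on S g"
  using assms(3) Ck_on_cong[OF assms(1,2)] by (simp add: smooth_on_def)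

lemma smooth_on_local:
  assumes "\<And>x. x \<in> S \<Longrightarrow> \<exists>N. open N \<and> x \<in> N \<and> smooth_on N f"
  shows "smooth_on S f"
  unfolding smooth_on_def
proof (intro allI Ck_on_local)
  fix k x assume "x \<in> S"
  from assms[OF this] show "\<exists>N. open N \<and> x \<in> N \<and> Ck_on k N f" unfolding smooth_on_def by blast
qed

lemma smooth_on_continuous: "smooth_on S f \<Longrightarrow> continuous_on S f"
  by (metis Ck_on_continuous smooth_on_def)

lemma smooth_on_has_derivative:
  "smooth_on S f \<Longrightarrow> x \<in> S \<Longrightarrow> (f has_derivative frechet_derivative f (at x)) (at x)"
  by (metis Ck_on_SucD smooth_on_def)

lemma smooth_on_derivative: "smooth_on S f \<Longrightarrow> smooth_on S (\<lambda>x. frechet_derivative f (at x) v)"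
  unfolding smooth_on_def
proof (rule allI)
  fix k assume "\<forall>k. Ck_on k S f"
  then have "Ck_on (Suc k) S f" by blast
  then show "Ck_on k S (\<lambda>x. frechet_derivative f (at x) v)" by simp
qed

lemma smooth_on_const: "open S \<Longrightarrow> smooth_on S (\<lambda>x. c)"
  by (simp add: smooth_on_def Ck_on_const)

lemma smooth_on_bounded_linear: "bounded_linear h \<Longrightarrow> open S \<Longrightarrow> smooth_on S h"
  by (simp add: smooth_on_def Ck_on_bounded_linear)

lemma smooth_on_bounded_linear_comp:
  "bounded_linear h \<Longrightarrow> open S \<Longrightarrow> smooth_on S f \<Longrightarrow> smooth_on S (\<lambda>x. h (f x))"
  by (simp add: smooth_on_def Ck_on_bounded_linear_comp)

lemma smooth_on_add: "open S \<Longrightarrow> smooth_on S f \<Longrightarrow> smooth_on S g \<Longrightarrow> smooth_on S (\<lambda>x. f x + g x)"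
  by (simp add: smooth_on_def Ck_on_add)

lemma smooth_on_sum:
  "open S \<Longrightarrow> (\<And>i. i \<in> I \<Longrightarrow> smooth_on S (f i)) \<Longrightarrow> smooth_on S (\<lambda>x. \<Sum>i\<in>I. f i x)"
  by (simp add: smooth_on_def Ck_on_sum)

lemma smooth_on_bilinear:
  "bounded_bilinear pr \<Longrightarrow> open S \<Longrightarrow> smooth_on S f \<Longrightarrow> smooth_on S g \<Longrightarrow> smooth_on S (\<lambda>x. pr (f x) (g x))"
  by (simp add: smooth_on_def Ck_on_bilinear)

lemmas smooth_on_mult = smooth_on_bilinear[OF bounded_bilinear_mult]

lemma smooth_on_compose:
  assumes "open S" "open T" "h ` S \<subseteq> T" "smooth_on T f" "smooth_on S h"
  shows "smooth_on S (\<lambda>x. f (h x))"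
  using assms(4,5) unfolding smooth_on_def by (blast intro: Ck_on_compose[OF assms(1-3)])

lemma smooth_on_inverse:
  fixes f :: "'e::euclidean_space \<Rightarrow> real"
  assumes "open S" "smooth_on S f" "\<And>x. x \<in> S \<Longrightarrow> f x \<noteq> 0"
  shows "smooth_on S (\<lambda>x. inverse (f x))"
proof (rule smooth_on_compose[OF assms(1) _ _ _ assms(2)])
  show "smooth_on (- {0}) (inverse :: real \<Rightarrow> real)" by (simp add: smooth_on_def Ck_on_inverse)
qed (use assms(3) in auto)

lemma smooth_on_Pair:
  fixes f :: "'d::euclidean_space \<Rightarrow> 'e::euclidean_space" and h :: "'d \<Rightarrow> 'f::euclidean_space"
  assumes "open S" "smooth_on S f" "smooth_on S h"
  shows "smooth_on S (\<lambda>x. (f x, h x))"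
proof -
  have "bounded_linear (\<lambda>x::'e. (x, 0::'f))" "bounded_linear (\<lambda>x::'f. (0::'e, x))"
    by (intro bounded_linear_Pair bounded_linear_zero bounded_linear_ident)+
  from smooth_on_add[OF assms(1) smooth_on_bounded_linear_comp[OF this(1) assms(1,2)]
      smooth_on_bounded_linear_comp[OF this(2) assms(1,3)]]
  show ?thesis by simp
qed

section \<open>Bump functions on Euclidean space\<close>

text \<open>\<open>bump_germ p\<close> is \<open>p(1/t) e\<^bsup>-1/t\<^esup>\<close> for \<open>t > 0\<close>, extended by zero.  Allowing a polynomial
  factor makes the family stable under differentiation, which is how smoothness is proved.\<close>

definition bump_germ :: "real poly \<Rightarrow> real \<Rightarrow> real" where
  "bump_germ p t = (if t > 0 then poly p (inverse t) * exp (- inverse t) else 0)"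

lemma poly_exp_decay: "((\<lambda>s. poly p s * exp (- s)) \<longlongrightarrow> (0::real)) at_top"
proof -
  have "((\<lambda>s. s ^ i * exp (- s)) \<longlongrightarrow> (0::real)) at_top" for i
    using tendsto_power_div_exp_0[of i] by (simp add: exp_minus field_simps)
  then have "((\<lambda>s. \<Sum>i\<le>degree p. coeff p i * (s ^ i * exp (- s))) \<longlongrightarrow> (\<Sum>i\<le>degree p. coeff p i * 0)) at_top"
    by (intro tendsto_sum tendsto_mult tendsto_const)
  then show ?thesis by (simp add: poly_altdef sum_distrib_right mult.assoc)
qed

lemma bump_germ_tendsto_0: "(bump_germ p \<longlongrightarrow> 0) (at 0)"
proof -
  have "((\<lambda>t. poly p (inverse t) * exp (- inverse t)) \<longlongrightarrow> 0) (at_right 0)"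
    by (rule filterlim_compose[OF poly_exp_decay filterlim_inverse_at_top_right])
  then have "(bump_germ p \<longlongrightarrow> 0) (at_right 0)"
    by (rule Lim_transform_eventually) (auto simp: bump_germ_def eventually_at_filter)
  moreover have "(bump_germ p \<longlongrightarrow> 0) (at_left 0)"
    by (rule Lim_transform_eventually[OF tendsto_const]) (auto simp: bump_germ_def eventually_at_filter)
  ultimately show ?thesis by (simp add: filterlim_split_at)
qed

lemma bump_germ_derivative:
  "(bump_germ p has_field_derivative bump_germ ((p - pderiv p) * [:0, 0, 1:]) t) (at t)"
proof (cases t "0::real" rule: linorder_cases)
  case less
  have "((\<lambda>t. 0) has_field_derivative 0) (at t)" by simp
  then have "(bump_germ p has_field_derivative 0) (at t)"
    by (rule DERIV_cong_ev[THEN iffD1, rotated -1, OF _ refl _ refl])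
      (use less in \<open>auto simp: bump_germ_def eventually_nhds intro!: exI[of _ "{..<0}"]\<close>)
  then show ?thesis using less by (simp add: bump_germ_def)
next
  case equal
  have "(bump_germ (p * [:0, 1:]) \<longlongrightarrow> 0) (at 0)" by (rule bump_germ_tendsto_0)
  then have "((\<lambda>h. (bump_germ p (0 + h) - bump_germ p 0) / h) \<longlongrightarrow> 0) (at 0)"
    by (rule Lim_transform_eventually) (auto simp: bump_germ_def eventually_at_filter field_simps)
  then show ?thesis using equal by (simp add: DERIV_def bump_germ_def)
next
  case greater
  have "((\<lambda>t. poly p (inverse t) * exp (- inverse t)) has_field_derivative
      bump_germ ((p - pderiv p) * [:0, 0, 1:]) t) (at t)"
    using greater by (auto simp: bump_germ_def intro!: derivative_eq_intros poly_DERIV[THEN DERIV_chain2])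
      (simp add: field_simps power2_eq_square)
  then show ?thesis
    by (rule DERIV_cong_ev[THEN iffD1, rotated -1, OF _ refl _ refl])
      (use greater in \<open>auto simp: bump_germ_def eventually_nhds intro!: exI[of _ "{0<..}"]\<close>)
qed

lemma smooth_bump_germ: "smooth_on UNIV (bump_germ p)"
proof -
  have "Ck_on k UNIV (bump_germ p)" for k
  proof (induction k arbitrary: p)
    case 0
    have "isCont (bump_germ p) t" for t
      by (rule DERIV_isCont[OF bump_germ_derivative])
    then show ?case by (simp add: continuous_at_imp_continuous_on)
  next
    case (Suc k)
    have "Ck_on k UNIV (\<lambda>x. bump_germ ((p - pderiv p) * [:0, 0, 1:]) x * v)" for v
      by (intro Ck_on_bilinear[OF bounded_bilinear_mult] Suc Ck_on_const) auto
    then show ?case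
      by (intro Ck_on_SucI[where f' = "\<lambda>x v. bump_germ ((p - pderiv p) * [:0, 0, 1:]) x * v"])
        (use bump_germ_derivative[of p, unfolded has_field_derivative_def] in auto)
  qed
  then show ?thesis by (simp add: smooth_on_def)
qed

text \<open>A plateau function: with \<open>e(t) = e\<^bsup>-1/t\<^esup>\<close>, the quotient \<open>e(t) / (e(t) + e(1 - t))\<close> rises
  smoothly from 0 to 1 on the unit interval; it is composed with the squared distance.\<close>

lemma euclidean_plateau:
  fixes p :: "'e::euclidean_space"
  assumes "r > 0"
  shows "\<exists>\<eta>. smooth_on UNIV \<eta> \<and> (\<forall>x. 0 \<le> \<eta> x \<and> \<eta> x \<le> (1::real)) \<and> (\<forall>x. \<eta> x \<noteq> 0 \<longrightarrow> dist p x \<le> r) \<and>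
           (\<exists>N. open N \<and> p \<in> N \<and> (\<forall>x\<in>N. \<eta> x = 1))"
proof -
  define e where "e = bump_germ 1"
  define \<theta> where "\<theta> t = e t * inverse (e t + e (1 - t))" for t
  have pos: "e t \<ge> 0" "e t + e (1 - t) > 0" for t
    by (auto simp: e_def bump_germ_def add_pos_pos)
  have se: "smooth_on UNIV e" by (simp add: e_def smooth_bump_germ)
  have lin1: "smooth_on UNIV (\<lambda>t::real. 1 - t)"
  proof -
    have "smooth_on UNIV (\<lambda>t::real. 1 + (- t))"
      by (intro smooth_on_add smooth_on_const smooth_on_bounded_linear bounded_linear_minus bounded_linear_ident) auto
    then show ?thesis by simp
  qed
  have s\<theta>: "smooth_on UNIV \<theta>" unfolding \<theta>_def
    using pos(2) by (intro smooth_on_mult smooth_on_inverse smooth_on_add se smooth_on_compose[of UNIV UNIV _ e] lin1)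
      (auto simp: less_imp_neq[symmetric])
  have \<theta>: "0 \<le> \<theta> t" "\<theta> t \<le> 1" for t
    using pos[of t] pos(1)[of "1-t"] by (auto simp: \<theta>_def divide_simps)
  have \<theta>0: "\<theta> t = 0" if "t \<le> 0" for t using that by (simp add: \<theta>_def e_def bump_germ_def)
  have \<theta>1: "\<theta> t = 1" if "t \<ge> 1" for t using that by (simp add: \<theta>_def e_def bump_germ_def)
  define w where "w x = 2 + (- (2 / r\<^sup>2)) * ((x - p) \<bullet> (x - p))" for x
  have sub: "smooth_on UNIV (\<lambda>x. x - p)"
  proof -
    have "smooth_on UNIV (\<lambda>x. x + (- p))"
      by (intro smooth_on_add smooth_on_const smooth_on_bounded_linear bounded_linear_ident) auto
    then show ?thesis by simp
  qed
  have sw: "smooth_on UNIV w" unfolding w_def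
    by (intro smooth_on_add smooth_on_mult smooth_on_const smooth_on_bilinear[OF bounded_bilinear_inner] sub) auto
  define \<eta> where "\<eta> x = \<theta> (w x)" for x
  have "smooth_on UNIV \<eta>" unfolding \<eta>_def by (rule smooth_on_compose[of UNIV UNIV]) (use s\<theta> sw in auto)
  moreover have "dist p x \<le> r" if "\<eta> x \<noteq> 0" for x
  proof -
    have "w x > 0" using that \<theta>0[of "w x"] by (force simp: \<eta>_def)
    then have "(norm (x - p))\<^sup>2 < r\<^sup>2" using assms by (simp add: w_def power2_norm_eq_inner field_simps)
    then show ?thesis using assms by (metis dist_norm dist_commute less_imp_le power2_less_imp_less)
  qed
  moreover have "\<exists>N. open N \<and> p \<in> N \<and> (\<forall>x\<in>N. \<eta> x = 1)"
  proof (intro exI conjI ballI)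
    show "open {x. w x > 1}"
      using smooth_on_continuous[OF sw] by (intro open_Collect_less) (auto intro: continuous_intros)
    show "p \<in> {x. w x > 1}" by (simp add: w_def)
    show "\<eta> x = 1" if "x \<in> {x. w x > 1}" for x using that \<theta>1 by (simp add: \<eta>_def)
  qed
  ultimately show ?thesis using \<theta> by (intro exI[of _ \<eta>]) (auto simp: \<eta>_def)
qed

section \<open>Smooth maps between manifolds\<close>

definition topological_atlas :: "('m::topological_space, 'e::euclidean_space) chart set \<Rightarrow> bool" where
  "topological_atlas A \<longleftrightarrow> (\<forall>c\<in>A. is_chart c) \<and> (\<Union>(U, \<phi>)\<in>A. U) = UNIV"

lemma smooth_imp_topological_atlas: "smooth_atlas A \<Longrightarrow> topological_atlas A"
  by (simp add: smooth_atlas_def topological_atlas_def)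

lemma is_chartD:
  assumes "is_chart (U, \<phi>)"
  shows "open U" "open (\<phi> ` U)" "inj_on \<phi> U" "continuous_on U \<phi>"
    "continuous_on (\<phi> ` U) (inv_into U \<phi>)" "\<And>x. x \<in> U \<Longrightarrow> inv_into U \<phi> (\<phi> x) = x"
    "\<And>q. q \<in> \<phi> ` U \<Longrightarrow> inv_into U \<phi> q \<in> U" "\<And>q. q \<in> \<phi> ` U \<Longrightarrow> \<phi> (inv_into U \<phi> q) = q"
proof -
  have h: "open U" "open (\<phi> ` U)" "homeomorphism U (\<phi> ` U) \<phi> (inv_into U \<phi>)"
    using assms by (auto simp: is_chart_def)
  then show "open U" "open (\<phi> ` U)" "continuous_on U \<phi>" "continuous_on (\<phi> ` U) (inv_into U \<phi>)"
    by (auto simp: homeomorphism_def)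
  show "inv_into U \<phi> (\<phi> x) = x" if "x \<in> U" for x
    using h(3) that by (auto simp: homeomorphism_def)
  then show "inj_on \<phi> U" by (rule inj_on_inverseI)
  show "inv_into U \<phi> q \<in> U" "\<phi> (inv_into U \<phi> q) = q" if "q \<in> \<phi> ` U" for q
    using that by (auto simp: inv_into_into f_inv_into_f)
qed

lemma open_chart_image:
  assumes "is_chart (U, \<phi>)" "open V" "V \<subseteq> U"
  shows "open (\<phi> ` V)"
proof -
  have "\<phi> ` V = \<phi> ` U \<inter> inv_into U \<phi> -` V"
    using is_chartD(6)[OF assms(1)] assms(3) by force
  moreover have "open (\<phi> ` U \<inter> inv_into U \<phi> -` V)"
    by (rule continuous_open_preimage[OF is_chartD(5,2)[OF assms(1)] assms(2)])
  ultimately show ?thesis by simp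
qed

lemma atlas_chart_at:
  assumes "topological_atlas A"
  obtains U \<phi> where "(U, \<phi>) \<in> A" "x \<in> U" "is_chart (U, \<phi>)"
proof -
  have "x \<in> (\<Union>(U, \<phi>)\<in>A. U)" "\<forall>c\<in>A. is_chart c" using assms by (auto simp: topological_atlas_def)
  then show thesis using that by auto
qed

lemma smooth_mapD: "smooth_map A B F \<Longrightarrow> (U, \<phi>) \<in> A \<Longrightarrow> (V, \<psi>) \<in> B \<Longrightarrow>
    smooth_on (\<phi> ` (U \<inter> F -` V)) (\<psi> \<circ> F \<circ> inv_into U \<phi>)"
  unfolding smooth_map_def by blast

lemma smooth_map_continuous: "smooth_map A B F \<Longrightarrow> continuous_on UNIV F"
  by (simp add: smooth_map_def)

lemma smooth_atlasD: "smooth_atlas A \<Longrightarrow> (U, \<phi>) \<in> A \<Longrightarrow> (V, \<psi>) \<in> A \<Longrightarrow>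
    smooth_on (\<phi> ` (U \<inter> V)) (\<psi> \<circ> inv_into U \<phi>)"
  unfolding smooth_atlas_def by blast

lemma C_infD: "f \<in> C_inf A \<Longrightarrow> (U, \<phi>) \<in> A \<Longrightarrow> smooth_on (\<phi> ` U) (\<lambda>q. f (inv_into U \<phi> q))"
  unfolding C_inf_def by (auto simp: comp_def)

lemma C_infI: "(\<And>U \<phi>. (U, \<phi>) \<in> A \<Longrightarrow> smooth_on (\<phi> ` U) (\<lambda>q. f (inv_into U \<phi> q))) \<Longrightarrow> f \<in> C_inf A"
  unfolding C_inf_def by (auto simp: comp_def)

text \<open>The assertion is local, and near a given point the image under \<open>F\<close> lies in a single chart.  The sets
  \<open>S\<close> and \<open>R\<close> admit functions \<open>g\<close> defined on part of the target only, such as a chart map.\<close>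

lemma smooth_on_chart_compose:
  assumes "topological_atlas A" "topological_atlas B" "smooth_map A B F" "(U, \<phi>) \<in> A"
    and "open S" "S \<subseteq> U" "F ` S \<subseteq> R" "open R"
    and g: "\<And>V \<psi>. (V, \<psi>) \<in> B \<Longrightarrow> smooth_on (\<psi> ` (V \<inter> R)) (\<lambda>q. g (inv_into V \<psi> q))"
  shows "smooth_on (\<phi> ` S) (\<lambda>q. g (F (inv_into U \<phi> q)))"
proof (rule smooth_on_local)
  have cU: "is_chart (U, \<phi>)" using assms(1,4) by (auto simp: topological_atlas_def)
  fix q assume "q \<in> \<phi> ` S"
  then obtain x where x: "x \<in> S" "q = \<phi> x" by auto
  obtain V \<psi> where V: "(V, \<psi>) \<in> B" "F x \<in> V" "is_chart (V, \<psi>)" by (rule atlas_chart_at[OF assms(2)])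
  have "open (F -` V)"
    using smooth_map_continuous[OF assms(3)] is_chartD(1)[OF V(3)] by (simp add: continuous_on_open_vimage)
  then have oN: "open (\<phi> ` (S \<inter> F -` V))" using assms(5,6) by (intro open_chart_image[OF cU]) auto
  moreover have "smooth_on (\<phi> ` (S \<inter> F -` V)) (\<lambda>q. g (F (inv_into U \<phi> q)))"
  proof (rule smooth_on_cong[OF oN])
    show "smooth_on (\<phi> ` (S \<inter> F -` V)) (\<lambda>q. g (inv_into V \<psi> ((\<psi> \<circ> F \<circ> inv_into U \<phi>) q)))"
    proof (rule smooth_on_compose[OF oN _ _ g[OF V(1)]])
      show "open (\<psi> ` (V \<inter> R))" using V is_chartD(1)[OF V(3)] assms(8) by (intro open_chart_image) auto
      show "(\<psi> \<circ> F \<circ> inv_into U \<phi>) ` \<phi> ` (S \<inter> F -` V) \<subseteq> \<psi> ` (V \<inter> R)"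
        using assms(6,7) is_chartD(6)[OF cU] by fastforce
      show "smooth_on (\<phi> ` (S \<inter> F -` V)) (\<psi> \<circ> F \<circ> inv_into U \<phi>)"
        by (rule smooth_on_subset[OF smooth_mapD[OF assms(3,4) V(1)]]) (use assms(6) in auto)
    qed
    fix q assume "q \<in> \<phi> ` (S \<inter> F -` V)"
    then show "g (inv_into V \<psi> ((\<psi> \<circ> F \<circ> inv_into U \<phi>) q)) = g (F (inv_into U \<phi> q))"
      using is_chartD(6)[OF cU] is_chartD(6)[OF V(3)] assms(6) by fastforce
  qed
  ultimately show "\<exists>N. open N \<and> q \<in> N \<and> smooth_on N (\<lambda>q. g (F (inv_into U \<phi> q)))"
    using x V(2) by blast
qed

lemma C_inf_compose:
  assumes "topological_atlas A" "topological_atlas B" "smooth_map A B F" "f \<in> C_inf B"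
  shows "(\<lambda>x. f (F x)) \<in> C_inf A"
proof (rule C_infI)
  fix U \<phi> assume U: "(U, \<phi>) \<in> A"
  have "open U" using U assms(1) by (auto simp: topological_atlas_def dest: is_chartD)
  then show "smooth_on (\<phi> ` U) (\<lambda>q. f (F (inv_into U \<phi> q)))"
    by (rule smooth_on_chart_compose[OF assms(1-3) U _ _ subset_UNIV]) (use C_infD[OF assms(4)] in auto)
qed

lemma smooth_map_compose:
  assumes "topological_atlas A" "topological_atlas B" "topological_atlas C"
    "smooth_map A B F" "smooth_map B C H"
  shows "smooth_map A C (\<lambda>x. H (F x))"
  unfolding smooth_map_def
proof (intro conjI)
  show "continuous_on UNIV (\<lambda>x. H (F x))"
    by (rule continuous_on_compose2[OF smooth_map_continuous[OF assms(5)] smooth_map_continuous[OF assms(4)]]) auto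
next
  show "\<forall>(U, \<phi>)\<in>A. \<forall>(V, \<psi>)\<in>C. smooth_on (\<phi> ` (U \<inter> (\<lambda>x. H (F x)) -` V)) (\<psi> \<circ> (\<lambda>x. H (F x)) \<circ> inv_into U \<phi>)"
  proof (clarify)
    fix U \<phi> W \<theta> assume U: "(U, \<phi>) \<in> A" and W: "(W, \<theta>) \<in> C"
    have oU: "open U" "open W"
      using U W assms(1,3) by (auto simp: topological_atlas_def dest: is_chartD)
    have oH: "open (H -` W)" using smooth_map_continuous[OF assms(5)] oU(2) by (simp add: continuous_on_open_vimage)
    then have oS: "open (U \<inter> F -` (H -` W))"
      using oU(1) smooth_map_continuous[OF assms(4)] by (simp add: continuous_on_open_vimage open_Int)
    have "smooth_on (\<phi> ` (U \<inter> F -` (H -` W))) (\<lambda>q. \<theta> (H (F (inv_into U \<phi> q))))"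
      by (rule smooth_on_chart_compose[OF assms(1,2,4) U oS _ _ oH])
        (use smooth_mapD[OF assms(5) _ W] in \<open>auto simp: comp_def\<close>)
    then show "smooth_on (\<phi> ` (U \<inter> (\<lambda>x. H (F x)) -` W)) (\<theta> \<circ> (\<lambda>x. H (F x)) \<circ> inv_into U \<phi>)"
      by (simp add: comp_def vimage_def)
  qed
qed

lemma smooth_map_const: "topological_atlas A \<Longrightarrow> smooth_map A B (\<lambda>x. a)"
  unfolding smooth_map_def topological_atlas_def
  by (fastforce simp: comp_def intro: smooth_on_const open_chart_image dest: is_chartD(1))

lemma smooth_map_id: "smooth_atlas A \<Longrightarrow> smooth_map A A (\<lambda>x. x)"
  unfolding smooth_map_def smooth_atlas_def by (fastforce simp: comp_def)

lemma inv_into_map_prod: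
  assumes "inj_on \<phi> U" "inj_on \<psi> V" "p \<in> \<phi> ` U" "q \<in> \<psi> ` V"
  shows "inv_into (U \<times> V) (map_prod \<phi> \<psi>) (p, q) = (inv_into U \<phi> p, inv_into V \<psi> q)"
  by (rule inv_into_f_eq) (use assms in \<open>auto simp: inj_on_def\<close>)

lemma is_chart_prod:
  assumes "is_chart (U, \<phi>)" "is_chart (V, \<psi>)"
  shows "is_chart (U \<times> V, map_prod \<phi> \<psi>)"
proof -
  note U = is_chartD[OF assms(1)] and V = is_chartD[OF assms(2)]
  have im: "map_prod \<phi> \<psi> ` (U \<times> V) = \<phi> ` U \<times> \<psi> ` V" by force
  have inv: "inv_into (U \<times> V) (map_prod \<phi> \<psi>) x = (inv_into U \<phi> (fst x), inv_into V \<psi> (snd x))"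
    if "x \<in> \<phi> ` U \<times> \<psi> ` V" for x
    using inv_into_map_prod[OF U(3) V(3), of "fst x" "snd x"] that by auto
  have "continuous_on (\<phi> ` U \<times> \<psi> ` V) (\<lambda>x. (inv_into U \<phi> (fst x), inv_into V \<psi> (snd x)))"
    by (intro continuous_on_Pair continuous_on_compose2[OF U(5)] continuous_on_compose2[OF V(5)])
      (auto intro: continuous_intros)
  then have "continuous_on (\<phi> ` U \<times> \<psi> ` V) (inv_into (U \<times> V) (map_prod \<phi> \<psi>))"
    using inv by (subst continuous_on_cong[OF refl]) auto
  moreover have "continuous_on (U \<times> V) (map_prod \<phi> \<psi>)"
    unfolding map_prod_def case_prod_beta
    by (intro continuous_on_Pair continuous_on_compose2[OF U(4)] continuous_on_compose2[OF V(4)])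
      (auto intro: continuous_intros)
  moreover have "inv_into (U \<times> V) (map_prod \<phi> \<psi>) (map_prod \<phi> \<psi> x) = x" if "x \<in> U \<times> V" for x
    using that U(6) V(6) by (auto simp: inv)
  moreover have "map_prod \<phi> \<psi> (inv_into (U \<times> V) (map_prod \<phi> \<psi>) q) = q" if "q \<in> \<phi> ` U \<times> \<psi> ` V" for q
    using that U(8) V(8) by (auto simp: inv)
  moreover have "inv_into (U \<times> V) (map_prod \<phi> \<psi>) ` (\<phi> ` U \<times> \<psi> ` V) = U \<times> V"
    by (metis im inv_into_image_cancel[OF _ order_refl] inj_on_inverseI calculation(3) image_cong)
  ultimately show ?thesis
    using U(1,2,6) V(1,2,6) by (simp add: is_chart_def im homeomorphism_def open_Times inv)
qed

lemma topological_atlas_prod: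
  assumes "topological_atlas A" "topological_atlas B"
  shows "topological_atlas (prod_atlas A B)"
  unfolding topological_atlas_def
proof (intro conjI ballI)
  show "is_chart c" if "c \<in> prod_atlas A B" for c
    using that assms by (auto simp: prod_atlas_def topological_atlas_def intro: is_chart_prod)
  have "x \<in> (\<Union>(U, \<phi>)\<in>prod_atlas A B. U)" for x :: "'a \<times> 'c"
  proof -
    obtain U \<phi> where "(U, \<phi>) \<in> A" "fst x \<in> U" by (rule atlas_chart_at[OF assms(1)])
    moreover obtain V \<psi> where "(V, \<psi>) \<in> B" "snd x \<in> V" by (rule atlas_chart_at[OF assms(2)])
    ultimately have "(U \<times> V, map_prod \<phi> \<psi>) \<in> prod_atlas A B" "x \<in> U \<times> V"
      by (auto simp: prod_atlas_def mem_Times_iff)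
    then show ?thesis by blast
  qed
  then show "(\<Union>(U, \<phi>)\<in>prod_atlas A B. U) = UNIV" by blast
qed

lemma prod_atlasE:
  assumes "c \<in> prod_atlas A B"
  obtains U \<phi> V \<psi> where "c = (U \<times> V, map_prod \<phi> \<psi>)" "(U, \<phi>) \<in> A" "(V, \<psi>) \<in> B"
  using assms by (auto simp: prod_atlas_def)

lemma C_inf_prodD:
  assumes "topological_atlas A" "topological_atlas B" "H \<in> C_inf (prod_atlas A B)"
    "(U, \<phi>) \<in> A" "(V, \<psi>) \<in> B"
  shows "smooth_on (\<phi> ` U \<times> \<psi> ` V) (\<lambda>x. H (inv_into U \<phi> (fst x), inv_into V \<psi> (snd x)))"
proof -
  have c: "is_chart (U, \<phi>)" "is_chart (V, \<psi>)" using assms by (auto simp: topological_atlas_def)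
  have "(U \<times> V, map_prod \<phi> \<psi>) \<in> prod_atlas A B" using assms by (auto simp: prod_atlas_def)
  from C_infD[OF assms(3) this]
  have "smooth_on (\<phi> ` U \<times> \<psi> ` V) (\<lambda>x. H (inv_into (U \<times> V) (map_prod \<phi> \<psi>) x))"
    by (simp add: map_prod_image)
  then show ?thesis
  proof (rule smooth_on_cong[rotated 2])
    show "open (\<phi> ` U \<times> \<psi> ` V)" using is_chartD(2)[OF c(1)] is_chartD(2)[OF c(2)] by (rule open_Times)
    fix x assume "x \<in> \<phi> ` U \<times> \<psi> ` V"
    then show "H (inv_into (U \<times> V) (map_prod \<phi> \<psi>) x) = H (inv_into U \<phi> (fst x), inv_into V \<psi> (snd x))"
      using inv_into_map_prod[OF is_chartD(3)[OF c(1)] is_chartD(3)[OF c(2)], of "fst x" "snd x"] by auto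
  qed
qed

lemma C_inf_prodI:
  assumes "topological_atlas A" "topological_atlas B"
    "\<And>U \<phi> V \<psi>. (U, \<phi>) \<in> A \<Longrightarrow> (V, \<psi>) \<in> B \<Longrightarrow>
      smooth_on (\<phi> ` U \<times> \<psi> ` V) (\<lambda>x. H (inv_into U \<phi> (fst x), inv_into V \<psi> (snd x)))"
  shows "H \<in> C_inf (prod_atlas A B)"
proof (rule C_infI)
  fix W \<theta> assume "(W, \<theta>) \<in> prod_atlas A B"
  then obtain U \<phi> V \<psi> where W: "W = U \<times> V" "\<theta> = map_prod \<phi> \<psi>" and UV: "(U, \<phi>) \<in> A" "(V, \<psi>) \<in> B"
    by (auto elim!: prod_atlasE)
  have c: "is_chart (U, \<phi>)" "is_chart (V, \<psi>)" using UV assms by (auto simp: topological_atlas_def)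
  have "\<theta> ` W = \<phi> ` U \<times> \<psi> ` V" by (simp add: W map_prod_image)
  moreover have "smooth_on (\<phi> ` U \<times> \<psi> ` V) (\<lambda>q. H (inv_into W \<theta> q))"
  proof (rule smooth_on_cong[rotated 2, OF assms(3)[OF UV]])
    show "open (\<phi> ` U \<times> \<psi> ` V)" using is_chartD(2)[OF c(1)] is_chartD(2)[OF c(2)] by (rule open_Times)
    fix x assume "x \<in> \<phi> ` U \<times> \<psi> ` V"
    then show "H (inv_into U \<phi> (fst x), inv_into V \<psi> (snd x)) = H (inv_into W \<theta> x)"
      using inv_into_map_prod[OF is_chartD(3)[OF c(1)] is_chartD(3)[OF c(2)], of "fst x" "snd x"] W by auto
  qed
  ultimately show "smooth_on (\<theta> ` W) (\<lambda>q. H (inv_into W \<theta> q))" by simp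
qed

lemma smooth_map_Pair:
  assumes "topological_atlas C" "topological_atlas A" "topological_atlas B" "smooth_map C A F" "smooth_map C B H"
  shows "smooth_map C (prod_atlas A B) (\<lambda>m. (F m, H m))"
  unfolding smooth_map_def
proof (intro conjI)
  note cont = smooth_map_continuous[OF assms(4)] smooth_map_continuous[OF assms(5)]
  show "continuous_on UNIV (\<lambda>m. (F m, H m))" using cont by (rule continuous_on_Pair)
  have "smooth_on (\<phi> ` (U \<inter> (\<lambda>m. (F m, H m)) -` (V1 \<times> V2))) (map_prod \<psi>1 \<psi>2 \<circ> (\<lambda>m. (F m, H m)) \<circ> inv_into U \<phi>)"
    if "(U, \<phi>) \<in> C" and V: "(V1, \<psi>1) \<in> A" "(V2, \<psi>2) \<in> B" for U \<phi> V1 \<psi>1 V2 \<psi>2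
  proof -
    have c: "is_chart (U, \<phi>)" "open V1" "open V2"
      using that assms(1-3) by (auto simp: topological_atlas_def dest: is_chartD)
    have "open (U \<inter> (F -` V1 \<inter> H -` V2))"
      using c is_chartD(1)[OF c(1)] cont by (auto simp: continuous_on_open_vimage)
    then have o: "open (\<phi> ` (U \<inter> (F -` V1 \<inter> H -` V2)))" by (rule open_chart_image[OF c(1)]) auto
    have "smooth_on (\<phi> ` (U \<inter> (F -` V1 \<inter> H -` V2))) (\<lambda>q. ((\<psi>1 \<circ> F \<circ> inv_into U \<phi>) q, (\<psi>2 \<circ> H \<circ> inv_into U \<phi>) q))"
      by (rule smooth_on_Pair[OF o smooth_on_subset[OF smooth_mapD[OF assms(4) that(1) V(1)]]
          smooth_on_subset[OF smooth_mapD[OF assms(5) that(1) V(2)]]]) auto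
    moreover have "U \<inter> (\<lambda>m. (F m, H m)) -` (V1 \<times> V2) = U \<inter> (F -` V1 \<inter> H -` V2)" by auto
    ultimately show ?thesis by (simp add: comp_def)
  qed
  then show "\<forall>(U, \<phi>)\<in>C. \<forall>(V, \<psi>)\<in>prod_atlas A B.
      smooth_on (\<phi> ` (U \<inter> (\<lambda>m. (F m, H m)) -` V)) (\<psi> \<circ> (\<lambda>m. (F m, H m)) \<circ> inv_into U \<phi>)"
    by (auto elim!: prod_atlasE)
qed

lemma smooth_map_fst:
  assumes "smooth_atlas A" "topological_atlas B"
  shows "smooth_map (prod_atlas A B) A fst"
  unfolding smooth_map_def
proof (intro conjI)
  show "continuous_on UNIV (fst :: 'a \<times> 'c \<Rightarrow> 'a)" by (intro continuous_intros)
  have "smooth_on (map_prod \<phi> \<psi> ` ((U \<times> V) \<inter> fst -` W)) (\<theta> \<circ> fst \<circ> inv_into (U \<times> V) (map_prod \<phi> \<psi>))"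
    if UV: "(U, \<phi>) \<in> A" "(V, \<psi>) \<in> B" and W: "(W, \<theta>) \<in> A" for U \<phi> V \<psi> W \<theta>
  proof -
    have c: "is_chart (U, \<phi>)" "is_chart (V, \<psi>)" "open W"
      using that assms by (auto simp: topological_atlas_def smooth_atlas_def dest: is_chartD)
    have eq: "map_prod \<phi> \<psi> ` ((U \<times> V) \<inter> fst -` W) = \<phi> ` (U \<inter> W) \<times> \<psi> ` V" by force
    have oUW: "open (\<phi> ` (U \<inter> W))" using c is_chartD(1)[OF c(1)] by (intro open_chart_image[OF c(1)]) auto
    then have o: "open (\<phi> ` (U \<inter> W) \<times> \<psi> ` V)" using is_chartD(2)[OF c(2)] by (rule open_Times)
    have "smooth_on (\<phi> ` (U \<inter> W)) (\<theta> \<circ> inv_into U \<phi>)"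
      by (rule smooth_atlasD[OF assms(1) UV(1) W])
    then have "smooth_on (\<phi> ` (U \<inter> W) \<times> \<psi> ` V) (\<lambda>x. (\<theta> \<circ> inv_into U \<phi>) (fst x))"
      by (rule smooth_on_compose[OF o oUW, rotated]) (auto intro: smooth_on_bounded_linear bounded_linear_fst o)
    then have "smooth_on (\<phi> ` (U \<inter> W) \<times> \<psi> ` V) (\<theta> \<circ> fst \<circ> inv_into (U \<times> V) (map_prod \<phi> \<psi>))"
    proof (rule smooth_on_cong[OF o, rotated])
      fix x assume "x \<in> \<phi> ` (U \<inter> W) \<times> \<psi> ` V"
      then have "inv_into (U \<times> V) (map_prod \<phi> \<psi>) (fst x, snd x) = (inv_into U \<phi> (fst x), inv_into V \<psi> (snd x))"
        by (intro inv_into_map_prod is_chartD(3)[OF c(1)] is_chartD(3)[OF c(2)]) auto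
      then show "(\<theta> \<circ> inv_into U \<phi>) (fst x) = (\<theta> \<circ> fst \<circ> inv_into (U \<times> V) (map_prod \<phi> \<psi>)) x" by simp
    qed
    then show ?thesis by (simp add: eq)
  qed
  then show "\<forall>(U, \<phi>)\<in>prod_atlas A B. \<forall>(V, \<psi>)\<in>A. smooth_on (\<phi> ` (U \<inter> fst -` V)) (\<psi> \<circ> fst \<circ> inv_into U \<phi>)"
    by (auto elim!: prod_atlasE)
qed

lemma smooth_map_snd:
  assumes "topological_atlas A" "smooth_atlas B"
  shows "smooth_map (prod_atlas A B) B snd"
  unfolding smooth_map_def
proof (intro conjI)
  show "continuous_on UNIV (snd :: 'a \<times> 'c \<Rightarrow> 'c)" by (intro continuous_intros)
  have "smooth_on (map_prod \<phi> \<psi> ` ((U \<times> V) \<inter> snd -` W)) (\<theta> \<circ> snd \<circ> inv_into (U \<times> V) (map_prod \<phi> \<psi>))"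
    if UV: "(U, \<phi>) \<in> A" "(V, \<psi>) \<in> B" and W: "(W, \<theta>) \<in> B" for U \<phi> V \<psi> W \<theta>
  proof -
    have c: "is_chart (U, \<phi>)" "is_chart (V, \<psi>)" "open W"
      using that assms by (auto simp: topological_atlas_def smooth_atlas_def dest: is_chartD)
    have eq: "map_prod \<phi> \<psi> ` ((U \<times> V) \<inter> snd -` W) = \<phi> ` U \<times> \<psi> ` (V \<inter> W)" by force
    have oVW: "open (\<psi> ` (V \<inter> W))" using c is_chartD(1)[OF c(2)] by (intro open_chart_image[OF c(2)]) auto
    then have o: "open (\<phi> ` U \<times> \<psi> ` (V \<inter> W))" using is_chartD(2)[OF c(1)] by (intro open_Times)
    have "smooth_on (\<psi> ` (V \<inter> W)) (\<theta> \<circ> inv_into V \<psi>)"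
      by (rule smooth_atlasD[OF assms(2) UV(2) W])
    then have "smooth_on (\<phi> ` U \<times> \<psi> ` (V \<inter> W)) (\<lambda>x. (\<theta> \<circ> inv_into V \<psi>) (snd x))"
      by (rule smooth_on_compose[OF o oVW, rotated]) (auto intro: smooth_on_bounded_linear bounded_linear_snd o)
    then have "smooth_on (\<phi> ` U \<times> \<psi> ` (V \<inter> W)) (\<theta> \<circ> snd \<circ> inv_into (U \<times> V) (map_prod \<phi> \<psi>))"
    proof (rule smooth_on_cong[OF o, rotated])
      fix x assume "x \<in> \<phi> ` U \<times> \<psi> ` (V \<inter> W)"
      then have "inv_into (U \<times> V) (map_prod \<phi> \<psi>) (fst x, snd x) = (inv_into U \<phi> (fst x), inv_into V \<psi> (snd x))"
        by (intro inv_into_map_prod is_chartD(3)[OF c(1)] is_chartD(3)[OF c(2)]) auto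
      then show "(\<theta> \<circ> inv_into V \<psi>) (snd x) = (\<theta> \<circ> snd \<circ> inv_into (U \<times> V) (map_prod \<phi> \<psi>)) x" by simp
    qed
    then show ?thesis by (simp add: eq)
  qed
  then show "\<forall>(U, \<phi>)\<in>prod_atlas A B. \<forall>(V, \<psi>)\<in>B. smooth_on (\<phi> ` (U \<inter> snd -` V)) (\<psi> \<circ> snd \<circ> inv_into U \<phi>)"
    by (auto elim!: prod_atlasE)
qed

section \<open>The algebra of smooth functions\<close>

lemma chart_image_open: "topological_atlas A \<Longrightarrow> (U, \<phi>) \<in> A \<Longrightarrow> open (\<phi> ` U)"
  by (auto simp: topological_atlas_def dest: is_chartD)

lemma C_inf_const: "topological_atlas A \<Longrightarrow> (\<lambda>x. c) \<in> C_inf A"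
  by (rule C_infI) (simp add: smooth_on_const chart_image_open)

lemma C_inf_add: "topological_atlas A \<Longrightarrow> f \<in> C_inf A \<Longrightarrow> h \<in> C_inf A \<Longrightarrow> (\<lambda>x. f x + h x) \<in> C_inf A"
  by (rule C_infI) (simp add: smooth_on_add chart_image_open C_infD)

lemma C_inf_bounded_linear: "topological_atlas A \<Longrightarrow> bounded_linear T \<Longrightarrow> f \<in> C_inf A \<Longrightarrow> (\<lambda>x. T (f x)) \<in> C_inf A"
  by (rule C_infI, rule smooth_on_bounded_linear_comp[of T]) (simp_all add: chart_image_open C_infD)

lemma C_inf_bilinear: "topological_atlas A \<Longrightarrow> bounded_bilinear pr \<Longrightarrow> f \<in> C_inf A \<Longrightarrow> h \<in> C_inf A \<Longrightarrow> (\<lambda>x. pr (f x) (h x)) \<in> C_inf A"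
  by (rule C_infI, rule smooth_on_bilinear[of pr]) (simp_all add: chart_image_open C_infD)

lemmas C_inf_mult = C_inf_bilinear[OF _ bounded_bilinear_mult]

lemma C_inf_minus: "topological_atlas A \<Longrightarrow> f \<in> C_inf A \<Longrightarrow> (\<lambda>x. - f x) \<in> C_inf A"
  by (rule C_inf_bounded_linear[OF _ bounded_linear_minus[OF bounded_linear_ident]])

lemma C_inf_diff: "topological_atlas A \<Longrightarrow> f \<in> C_inf A \<Longrightarrow> h \<in> C_inf A \<Longrightarrow> (\<lambda>x. f x - h x) \<in> C_inf A"
  using C_inf_add[OF _ _ C_inf_minus, of A f h] by simp

lemma C_inf_sum: "topological_atlas A \<Longrightarrow> (\<And>i. i \<in> I \<Longrightarrow> f i \<in> C_inf A) \<Longrightarrow> (\<lambda>x. \<Sum>i\<in>I. f i x) \<in> C_inf A"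
  by (induction I rule: infinite_finite_induct) (auto intro: C_inf_const C_inf_add)

lemma C_inf_complex_iff:
  assumes "topological_atlas A"
  shows "f \<in> C_inf A \<longleftrightarrow> (\<lambda>x. Re (f x)) \<in> C_inf A \<and> (\<lambda>x. Im (f x)) \<in> C_inf A"
proof (intro iffI conjI)
  assume "f \<in> C_inf A"
  then show "(\<lambda>x. Re (f x)) \<in> C_inf A" "(\<lambda>x. Im (f x)) \<in> C_inf A"
    by (rule C_inf_bounded_linear[OF assms bounded_linear_Re], rule C_inf_bounded_linear[OF assms bounded_linear_Im])
next
  assume "(\<lambda>x. Re (f x)) \<in> C_inf A \<and> (\<lambda>x. Im (f x)) \<in> C_inf A"
  then have "(\<lambda>x. complex_of_real (Re (f x)) + \<i> * complex_of_real (Im (f x))) \<in> C_inf A"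
    by (intro C_inf_add C_inf_mult C_inf_const assms C_inf_bounded_linear[OF assms bounded_linear_of_real]) auto
  then show "f \<in> C_inf A" by (simp flip: complex_eq)
qed

lemma C_inf_cnj: "topological_atlas A \<Longrightarrow> f \<in> C_inf A \<Longrightarrow> (\<lambda>x. cnj (f x)) \<in> C_inf A"
  by (rule C_inf_bounded_linear[OF _ bounded_linear_cnj])

lemma C_inf_power: "topological_atlas A \<Longrightarrow> f \<in> C_inf A \<Longrightarrow> (\<lambda>x. (f x :: complex) ^ n) \<in> C_inf A"
  by (induction n) (auto intro: C_inf_const C_inf_mult)

lemma C_inf_continuous:
  fixes A :: "('m::t2_space, 'e::euclidean_space) chart set"
  assumes "topological_atlas A" "f \<in> C_inf A"
  shows "continuous_on UNIV f"
proof -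
  have "isCont f x" for x
  proof -
    obtain U \<phi> where U: "(U, \<phi>) \<in> A" "x \<in> U" "is_chart (U, \<phi>)" by (rule atlas_chart_at[OF assms(1)])
    have "continuous_on U (\<lambda>x. f (inv_into U \<phi> (\<phi> x)))"
      by (rule continuous_on_compose2[OF smooth_on_continuous[OF C_infD[OF assms(2) U(1)]]])
        (use is_chartD[OF U(3)] in auto)
    then have "continuous_on U f"
      using is_chartD(6)[OF U(3)] by (subst continuous_on_cong[OF refl]) (auto intro: sym)
    then show ?thesis using U is_chartD(1)[OF U(3)] by (simp add: continuous_on_eq_continuous_at)
  qed
  then show ?thesis by (simp add: continuous_at_imp_continuous_on)
qed

text \<open>Functions given in a chart and vanishing outside a compact subset of its domain extend by
  zero; the Hausdorff property makes the compact set closed in the manifold.\<close>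

lemma C_inf_extend_by_zero:
  fixes A :: "('m::t2_space, 'e::euclidean_space) chart set" and g :: "'e \<Rightarrow> 'b::real_normed_vector"
  assumes "smooth_atlas A" "(U, \<phi>) \<in> A" "open Q" "Q \<subseteq> \<phi> ` U" "compact K" "K \<subseteq> Q"
    "smooth_on Q g" "\<And>q. q \<in> Q - K \<Longrightarrow> g q = 0"
  shows "(\<lambda>x. if x \<in> U \<and> \<phi> x \<in> Q then g (\<phi> x) else 0) \<in> C_inf A" (is "?f \<in> _")
proof (intro C_infI smooth_on_local)
  have cU: "is_chart (U, \<phi>)" using assms(1,2) by (auto simp: smooth_atlas_def)
  note U = is_chartD[OF cU]
  fix V \<psi> p assume V: "(V, \<psi>) \<in> A" and "p \<in> \<psi> ` V"
  then obtain y where y: "y \<in> V" "p = \<psi> y" by auto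
  have cV: "is_chart (V, \<psi>)" using assms(1) V by (auto simp: smooth_atlas_def)
  let ?K = "inv_into U \<phi> ` K" and ?W = "U \<inter> \<phi> -` Q"
  have "compact ?K"
    using assms(4,5,6) by (intro compact_continuous_image continuous_on_subset[OF U(5)]) auto
  then have clK: "closed ?K" by (rule compact_imp_closed)
  have oW: "open ?W" using U(1,4) assms(3) by (intro continuous_open_preimage)
  show "\<exists>N. open N \<and> p \<in> N \<and> smooth_on N (\<lambda>q. ?f (inv_into V \<psi> q))"
  proof (cases "y \<in> ?W")
    case True
    have o: "open (\<psi> ` (V \<inter> ?W))" using oW is_chartD(1)[OF cV] by (intro open_chart_image[OF cV]) auto
    have "smooth_on (\<psi> ` (V \<inter> U)) (\<phi> \<circ> inv_into V \<psi>)"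
      by (rule smooth_atlasD[OF assms(1) V assms(2)])
    then have s: "smooth_on (\<psi> ` (V \<inter> ?W)) (\<phi> \<circ> inv_into V \<psi>)" by (rule smooth_on_subset) auto
    have "smooth_on (\<psi> ` (V \<inter> ?W)) (\<lambda>q. g ((\<phi> \<circ> inv_into V \<psi>) q))"
      by (rule smooth_on_compose[OF o assms(3) _ assms(7) s]) (use is_chartD(6)[OF cV] in auto)
    then have "smooth_on (\<psi> ` (V \<inter> ?W)) (\<lambda>q. ?f (inv_into V \<psi> q))"
      by (rule smooth_on_cong[OF o, rotated]) (use is_chartD(6)[OF cV] in auto)
    then show ?thesis using o y True by blast
  next
    case False
    have nK: "y \<notin> ?K"
    proof
      assume "y \<in> ?K"
      then obtain q where q: "q \<in> K" "y = inv_into U \<phi> q" by blast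
      then have "q \<in> \<phi> ` U" "q \<in> Q" using assms(4,6) by auto
      then show False using False U(7,8) q(2) by simp
    qed
    have o: "open (\<psi> ` (V - ?K))" using clK is_chartD(1)[OF cV] by (intro open_chart_image[OF cV]) auto
    have "smooth_on (\<psi> ` (V - ?K)) (\<lambda>q. 0::'b)" by (rule smooth_on_const[OF o])
    then have "smooth_on (\<psi> ` (V - ?K)) (\<lambda>q. ?f (inv_into V \<psi> q))"
    proof (rule smooth_on_cong[OF o, rotated])
      fix q assume "q \<in> \<psi> ` (V - ?K)"
      then obtain z where z: "z \<in> V" "z \<notin> ?K" "q = \<psi> z" by auto
      then have "z \<in> U \<Longrightarrow> \<phi> z \<notin> K" using U(6)[of z] by (metis imageI)
      then show "0 = ?f (inv_into V \<psi> q)" using z is_chartD(6)[OF cV] assms(8) by auto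
    qed
    then show ?thesis using o y nK by blast
  qed
qed

lemma manifold_bump:
  fixes A :: "('m::t2_space, 'e::euclidean_space) chart set"
  assumes "smooth_atlas A" "open W" "x \<in> W"
  obtains \<eta> :: "'m \<Rightarrow> real" where "\<eta> \<in> C_inf A" "\<And>y. 0 \<le> \<eta> y" "\<And>y. \<eta> y \<noteq> 0 \<Longrightarrow> y \<in> W" "\<eta> x = 1"
proof -
  obtain U \<phi> where U: "(U, \<phi>) \<in> A" "x \<in> U" "is_chart (U, \<phi>)"
    by (rule atlas_chart_at[OF smooth_imp_topological_atlas[OF assms(1)]])
  have o: "open (\<phi> ` (U \<inter> W))" using assms is_chartD(1)[OF U(3)] by (intro open_chart_image[OF U(3)]) auto
  then obtain r where r: "r > 0" "cball (\<phi> x) r \<subseteq> \<phi> ` (U \<inter> W)"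
    using U assms by (meson IntI imageI open_contains_cball_eq)
  obtain \<theta> :: "'e \<Rightarrow> real" where \<theta>: "smooth_on UNIV \<theta>" "\<And>q. 0 \<le> \<theta> q" "\<And>q. \<theta> q \<noteq> 0 \<Longrightarrow> dist (\<phi> x) q \<le> r" "\<theta> (\<phi> x) = 1"
    using euclidean_plateau[OF r(1), of "\<phi> x"] by blast
  let ?f = "\<lambda>y. if y \<in> U \<and> \<phi> y \<in> \<phi> ` (U \<inter> W) then \<theta> (\<phi> y) else 0"
  show thesis
  proof (rule that[of ?f])
    show "?f \<in> C_inf A"
      by (rule C_inf_extend_by_zero[OF assms(1) U(1) o _ compact_cball r(2)])
        (use \<theta> in \<open>auto intro: smooth_on_subset\<close>)
    show "?f y \<noteq> 0 \<Longrightarrow> y \<in> W" for y using is_chartD(3)[OF U(3)] by (auto simp: inj_on_def split: if_splits)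
  qed (use \<theta> U assms in auto)
qed

section \<open>Integrals depending smoothly on a parameter\<close>

text \<open>Differentiability in the parameter \<open>p\<close> alone, with derivatives that are continuous in both
  variables: this is what allows differentiation under an integral over \<open>z\<close> in a compact set.\<close>

primrec parametric_Ck :: "nat \<Rightarrow> 'e::euclidean_space set \<Rightarrow> 'z::topological_space set \<Rightarrow>
    ('e \<Rightarrow> 'z \<Rightarrow> 'b::euclidean_space) \<Rightarrow> bool" where
  "parametric_Ck 0 S Z H \<longleftrightarrow> continuous_on (S \<times> Z) (\<lambda>x. H (fst x) (snd x))"
| "parametric_Ck (Suc k) S Z H \<longleftrightarrow> continuous_on (S \<times> Z) (\<lambda>x. H (fst x) (snd x)) \<and>
     (\<forall>z\<in>Z. \<forall>p\<in>S. (\<lambda>p. H p z) differentiable (at p)) \<and>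
     (\<forall>v. parametric_Ck k S Z (\<lambda>p z. frechet_derivative (\<lambda>p. H p z) (at p) v))"

lemma parametric_Ck_continuous:
  "parametric_Ck k S Z H \<Longrightarrow> continuous_on (S \<times> Z) (\<lambda>x. H (fst x) (snd x))"
  by (cases k) auto

lemma parametric_Ck_cong:
  assumes "open S" "\<And>p z. p \<in> S \<Longrightarrow> z \<in> Z \<Longrightarrow> H p z = H' p z" "parametric_Ck k S Z H"
  shows "parametric_Ck k S Z H'"
  using assms(2,3)
proof (induction k arbitrary: H H')
  case 0
  have "continuous_on (S \<times> Z) (\<lambda>x. H (fst x) (snd x)) = continuous_on (S \<times> Z) (\<lambda>x. H' (fst x) (snd x))"
    by (rule continuous_on_cong) (auto simp: 0(1))
  then show ?case using 0 by simp
next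
  case (Suc k)
  have c: "continuous_on (S \<times> Z) (\<lambda>x. H (fst x) (snd x)) = continuous_on (S \<times> Z) (\<lambda>x. H' (fst x) (snd x))"
    by (rule continuous_on_cong) (auto simp: Suc.prems(1))
  have d: "(\<lambda>p. H' p z) differentiable (at p)"
    "frechet_derivative (\<lambda>p. H p z) (at p) = frechet_derivative (\<lambda>p. H' p z) (at p)"
    if "p \<in> S" "z \<in> Z" for p z
  proof -
    have dH: "(\<lambda>p. H p z) differentiable (at p)" using Suc.prems(2) that by auto
    then show "frechet_derivative (\<lambda>p. H p z) (at p) = frechet_derivative (\<lambda>p. H' p z) (at p)"
      by (rule frechet_derivative_transform_within_open[OF _ assms(1) that(1)]) (use Suc.prems(1) that in auto)
    obtain D where "((\<lambda>p. H p z) has_derivative D) (at p)" using dH by (auto simp: differentiable_def)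
    then have "((\<lambda>p. H' p z) has_derivative D) (at p)"
      by (rule has_derivative_transform_within_open[OF _ assms(1) that(1)]) (use Suc.prems(1) that in auto)
    then show "(\<lambda>p. H' p z) differentiable (at p)" by (auto simp: differentiable_def)
  qed
  have "parametric_Ck k S Z (\<lambda>p z. frechet_derivative (\<lambda>p. H' p z) (at p) v)" for v
    by (rule Suc.IH[of "\<lambda>p z. frechet_derivative (\<lambda>p. H p z) (at p) v"]) (use Suc.prems(2) d(2) in auto)
  then show ?case using Suc.prems(2) c d by simp
qed

lemma parametric_Ck_SucI:
  assumes "open S" "continuous_on (S \<times> Z) (\<lambda>x. H (fst x) (snd x))"
    "\<And>p z. p \<in> S \<Longrightarrow> z \<in> Z \<Longrightarrow> ((\<lambda>p. H p z) has_derivative D p z) (at p)"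
    "\<And>v. parametric_Ck k S Z (\<lambda>p z. D p z v)"
  shows "parametric_Ck (Suc k) S Z H"
proof -
  have "D p z = frechet_derivative (\<lambda>p. H p z) (at p)" if "p \<in> S" "z \<in> Z" for p z
    by (rule frechet_derivative_at[OF assms(3)[OF that]])
  then have "parametric_Ck k S Z (\<lambda>p z. frechet_derivative (\<lambda>p. H p z) (at p) v)" for v
    by (intro parametric_Ck_cong[OF assms(1) _ assms(4)[of v]]) simp
  moreover have "(\<lambda>p. H p z) differentiable (at p)" if "p \<in> S" "z \<in> Z" for p z
    using assms(3)[OF that] by (auto simp: differentiable_def)
  ultimately show ?thesis using assms(2) by simp
qed

lemma parametric_Ck_bilinear:
  assumes "bounded_bilinear pr" "open S" "continuous_on Z w" "parametric_Ck k S Z H"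
  shows "parametric_Ck k S Z (\<lambda>p z. pr (w z) (H p z))"
  using assms(4)
proof (induction k arbitrary: H)
  case 0
  have "continuous_on (S \<times> Z) (\<lambda>x. w (snd x))"
    by (rule continuous_on_compose2[OF assms(3) continuous_on_snd]) (auto intro: continuous_intros)
  then show ?case using 0 by (auto intro: bounded_bilinear.continuous_on[OF assms(1)])
next
  case (Suc k)
  have cw: "continuous_on (S \<times> Z) (\<lambda>x. w (snd x))"
    by (rule continuous_on_compose2[OF assms(3) continuous_on_snd]) (auto intro: continuous_intros)
  have bl: "bounded_linear (pr (w z))" for z by (rule bounded_bilinear.bounded_linear_right[OF assms(1)])
  show ?case
  proof (rule parametric_Ck_SucI[where D = "\<lambda>p z v. pr (w z) (frechet_derivative (\<lambda>p. H p z) (at p) v)"])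
    show "continuous_on (S \<times> Z) (\<lambda>x. pr (w (snd x)) (H (fst x) (snd x)))"
      using cw parametric_Ck_continuous[OF Suc.prems] by (rule bounded_bilinear.continuous_on[OF assms(1)])
    show "((\<lambda>p. pr (w z) (H p z)) has_derivative (\<lambda>v. pr (w z) (frechet_derivative (\<lambda>p. H p z) (at p) v))) (at p)"
      if "p \<in> S" "z \<in> Z" for p z
      by (rule bounded_linear.has_derivative[OF bl]) (use Suc.prems that in \<open>auto simp: frechet_derivative_works\<close>)
    show "parametric_Ck k S Z (\<lambda>p z. pr (w z) (frechet_derivative (\<lambda>p. H p z) (at p) v))" for v
      by (rule Suc.IH) (use Suc.prems in simp)
  qed (rule assms(2))
qed

lemma divide_succ_mult_le: "0 \<le> m \<Longrightarrow> 0 < e \<Longrightarrow> e / (m + 1) * m \<le> (e::real)"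
  using mult_left_mono[of m "m + 1" e] by (simp add: pos_divide_le_eq)

locale compact_measure = finite_measure M for M :: "'z::topological_space measure" +
  fixes Z :: "'z set"
  assumes compact_Z: "compact Z" and sets_M: "sets M = sets (restrict_space borel Z)"
begin

lemma space_M: "space M = Z"
  using sets_eq_imp_space_eq[OF sets_M] by (simp add: space_restrict_space)

lemma integrable_continuous:
  fixes f :: "'z \<Rightarrow> 'b::euclidean_space"
  assumes "continuous_on Z f"
  shows "integrable M f"
proof -
  have "f \<in> borel_measurable M"
    using borel_measurable_continuous_on_restrict[OF assms] by (simp add: measurable_cong_sets[OF sets_M refl])
  moreover have "bounded (f ` Z)" using compact_continuous_image[OF assms compact_Z] by (rule compact_imp_bounded)
  then obtain B where "\<And>z. z \<in> Z \<Longrightarrow> norm (f z) \<le> B" by (auto simp: bounded_iff)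
  ultimately show ?thesis by (intro integrable_const_bound[of _ B]) (auto simp: space_M)
qed

lemma norm_integral_le:
  fixes f :: "'z \<Rightarrow> 'b::euclidean_space"
  assumes "continuous_on Z f" "\<And>z. z \<in> Z \<Longrightarrow> norm (f z) \<le> e"
  shows "norm (integral\<^sup>L M f) \<le> e * measure M Z"
proof -
  have "norm (integral\<^sup>L M f) \<le> integral\<^sup>L M (\<lambda>z. norm (f z))" by (rule integral_norm_bound)
  also have "\<dots> \<le> integral\<^sup>L M (\<lambda>z. e)"
    by (rule integral_mono) (use integrable_continuous[OF assms(1)] assms(2) in \<open>auto simp: space_M\<close>)
  finally show ?thesis by (simp add: space_M mult.commute)
qed

lemma continuous_slice:
  assumes "continuous_on (S \<times> Z) (\<lambda>x. H (fst x) (snd x))" "p \<in> S"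
  shows "continuous_on Z (H p)"
proof -
  have "continuous_on Z (\<lambda>z. (p, z))" by (intro continuous_intros)
  from continuous_on_compose2[OF assms(1) this] show ?thesis using assms(2) by auto
qed

lemma uniform_near:
  assumes "continuous_on (S \<times> Z) (\<lambda>x. H (fst x) (snd x) :: 'b::metric_space)" "p \<in> S" "e > 0"
  shows "\<exists>X. p \<in> X \<and> open X \<and> (\<forall>q\<in>X \<inter> S. \<forall>z\<in>Z. dist (H q z) (H p z) \<le> e)"
proof (rule continuous_on_prod_compactE[OF assms(1) compact_Z assms(2,3)])
  fix X assume X: "p \<in> X" "open X" "\<forall>x\<in>X \<inter> S. \<forall>t\<in>Z. dist (H (fst (x, t)) (snd (x, t))) (H (fst (p, t)) (snd (p, t))) \<le> e"
  then show ?thesis by (intro exI[of _ X] conjI) simp_all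
qed

lemma continuous_on_parametric_integral:
  fixes H :: "'e::t2_space \<Rightarrow> 'z \<Rightarrow> 'b::euclidean_space"
  assumes "continuous_on (S \<times> Z) (\<lambda>x. H (fst x) (snd x))"
  shows "continuous_on S (\<lambda>p. integral\<^sup>L M (H p))"
  unfolding continuous_on_def
proof (intro ballI tendstoI)
  fix p and e :: real assume p: "p \<in> S" and e: "e > 0"
  define d where "d = e / 2 / (measure M Z + 1)"
  have d: "d > 0" using e by (simp add: d_def add_nonneg_pos)
  obtain X where X: "p \<in> X" "open X" "\<forall>q\<in>X \<inter> S. \<forall>z\<in>Z. dist (H q z) (H p z) \<le> d"
    using uniform_near[OF assms p d] by (elim exE conjE)
  have "dist (integral\<^sup>L M (H q)) (integral\<^sup>L M (H p)) < e" if "q \<in> X \<inter> S" for q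
  proof -
    have c: "continuous_on Z (H q)" "continuous_on Z (H p)" using continuous_slice[OF assms] p that by auto
    have "integral\<^sup>L M (H q) - integral\<^sup>L M (H p) = integral\<^sup>L M (\<lambda>z. H q z - H p z)"
      using c by (intro Bochner_Integration.integral_diff[symmetric] integrable_continuous)
    moreover have "norm (integral\<^sup>L M (\<lambda>z. H q z - H p z)) \<le> d * measure M Z"
      by (rule norm_integral_le) (use c bspec[OF X(3) that] in \<open>auto intro: continuous_intros simp: dist_norm\<close>)
    moreover have "d * measure M Z \<le> e / 2"
      unfolding d_def by (rule divide_succ_mult_le) (use e in auto)
    ultimately show ?thesis using e by (simp add: dist_norm)
  qed
  then show "\<forall>\<^sub>F q in at p within S. dist (integral\<^sup>L M (H q)) (integral\<^sup>L M (H p)) < e"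
    unfolding eventually_at_topological using X(1,2) by blast
qed

text \<open>The mean value inequality on each slice, with an error that is uniform in \<open>z\<close> by compactness.\<close>

lemma has_derivative_parametric_integral:
  fixes H :: "'e::euclidean_space \<Rightarrow> 'z \<Rightarrow> 'b::euclidean_space"
  assumes "open S" "continuous_on (S \<times> Z) (\<lambda>x. H (fst x) (snd x))"
    and der: "\<And>p z. p \<in> S \<Longrightarrow> z \<in> Z \<Longrightarrow> ((\<lambda>p. H p z) has_derivative D p z) (at p)"
    and cD: "\<And>v. continuous_on (S \<times> Z) (\<lambda>x. D (fst x) (snd x) v)"
    and p: "p \<in> S"
  shows "((\<lambda>p. integral\<^sup>L M (H p)) has_derivative (\<lambda>v. integral\<^sup>L M (\<lambda>z. D p z v))) (at p)"
  unfolding has_derivative_at_alt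
proof (intro conjI allI impI)
  have lin: "linear (D q z)" if "q \<in> S" "z \<in> Z" for q z
    using der[OF that] by (simp add: has_derivative_bounded_linear bounded_linear.linear)
  have intD: "integrable M (\<lambda>z. D p z v)" for v
    by (rule integrable_continuous[OF continuous_slice[OF cD p]])
  show "bounded_linear (\<lambda>v. integral\<^sup>L M (\<lambda>z. D p z v))"
  proof (rule linear_conv_bounded_linear[THEN iffD1], rule linearI)
    fix v w r
    have "integral\<^sup>L M (\<lambda>z. D p z (v + w)) = integral\<^sup>L M (\<lambda>z. D p z v + D p z w)"
      by (rule Bochner_Integration.integral_cong) (auto simp: space_M linear_add[OF lin[OF p]])
    then show "integral\<^sup>L M (\<lambda>z. D p z (v + w)) = integral\<^sup>L M (\<lambda>z. D p z v) + integral\<^sup>L M (\<lambda>z. D p z w)"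
      using intD by simp
    have "integral\<^sup>L M (\<lambda>z. D p z (r *\<^sub>R v)) = integral\<^sup>L M (\<lambda>z. r *\<^sub>R D p z v)"
      by (rule Bochner_Integration.integral_cong) (auto simp: space_M linear_scale[OF lin[OF p]])
    then show "integral\<^sup>L M (\<lambda>z. D p z (r *\<^sub>R v)) = r *\<^sub>R integral\<^sup>L M (\<lambda>z. D p z v)" by simp
  qed
  fix e :: real assume e: "e > 0"
  define d where "d = e / (measure M Z + 1)"
  have d: "d > 0" using e by (simp add: d_def add_nonneg_pos)
  have de: "d * measure M Z \<le> e" unfolding d_def by (rule divide_succ_mult_le) (use e in auto)
  let ?N = "\<lambda>q z. \<Sum>b\<in>Basis. norm (D q z b - D p z b)"
  have "continuous_on (S \<times> Z) (\<lambda>x. D p (snd x) b)" for b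
    by (rule continuous_on_compose2[OF continuous_slice[OF cD p] continuous_on_snd]) (auto intro: continuous_intros)
  then have cN: "continuous_on (S \<times> Z) (\<lambda>x. ?N (fst x) (snd x))"
    by (intro continuous_intros cD)
  obtain X where X: "p \<in> X" "open X" "\<forall>q\<in>X \<inter> S. \<forall>z\<in>Z. dist (?N q z) (?N p z) \<le> d"
    using uniform_near[of S ?N p d, OF cN p d] by (elim exE conjE)
  have "open (X \<inter> S)" "p \<in> X \<inter> S" using X assms(1) p by auto
  then obtain r where r: "r > 0" "ball p r \<subseteq> X \<inter> S" by (meson open_contains_ball)
  have onorm: "onorm (\<lambda>v. D q z v - D p z v) \<le> d" if q: "q \<in> ball p r" and z: "z \<in> Z" for q z
  proof (rule onorm_bound)
    fix v
    have qS: "q \<in> X \<inter> S" using q r by auto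
    then have N: "?N q z \<le> d" using bspec[OF bspec[OF X(3) qS] z] by (simp add: dist_real_def sum_nonneg)
    have lqp: "linear (\<lambda>v. D q z v - D p z v)" using lin[of q z] lin[of p z] qS p z by (intro linear_compose_sub) auto
    have "D q z v - D p z v = (\<Sum>b\<in>Basis. (v \<bullet> b) *\<^sub>R (D q z b - D p z b))"
      by (rule linear_basis_expansion[OF lqp])
    also have "norm \<dots> \<le> (\<Sum>b\<in>Basis. norm v * norm (D q z b - D p z b))"
      by (rule order_trans[OF norm_sum]) (auto intro!: sum_mono mult_right_mono Basis_le_norm)
    also have "\<dots> \<le> norm v * d" using N by (simp add: mult_left_mono flip: sum_distrib_left)
    finally show "norm (D q z v - D p z v) \<le> d * norm v" by (simp add: mult.commute)
  qed (use d in simp)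
  show "\<exists>r>0. \<forall>y. norm (y - p) < r \<longrightarrow>
      norm (integral\<^sup>L M (H y) - integral\<^sup>L M (H p) - integral\<^sup>L M (\<lambda>z. D p z (y - p))) \<le> e * norm (y - p)"
  proof (intro exI[of _ r] conjI r allI impI)
    fix y assume "norm (y - p) < r"
    then have y: "y \<in> ball p r" by (simp add: dist_norm norm_minus_commute)
    then have yS: "y \<in> S" using r by auto
    have c: "continuous_on Z (H y)" "continuous_on Z (H p)" "continuous_on Z (\<lambda>z. D p z (y - p))"
      using continuous_slice[OF assms(2)] continuous_slice[OF cD p] p yS by auto
    have est: "norm (H y z - H p z - D p z (y - p)) \<le> norm (y - p) * d" if z: "z \<in> Z" for z
    proof -
      have seg: "p + t *\<^sub>R (y - p) \<in> ball p r" if "t \<in> {0..1}" for t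
        using convexD_alt[OF convex_ball, of p p r y t] y r(1) that by (simp add: algebra_simps)
      have dq: "((\<lambda>p. H p z) has_derivative D q z) (at q within ball p r)" if "q \<in> ball p r" for q
      proof -
        have "q \<in> S" using that r(2) by blast
        then show ?thesis using z by (rule has_derivative_at_withinI[OF der])
      qed
      have pb: "p \<in> ball p r" using r(1) by simp
      have on: "onorm (D q z - D p z) \<le> d" if "q \<in> ball p r" for q
        using onorm[OF that z] by (simp add: fun_diff_def)
      show ?thesis
        by (rule differentiable_bound_linearization[where f' = "\<lambda>q. D q z", OF seg dq on pb])
    qed
    have "integral\<^sup>L M (H y) - integral\<^sup>L M (H p) - integral\<^sup>L M (\<lambda>z. D p z (y - p)) =
        integral\<^sup>L M (\<lambda>z. H y z - H p z - D p z (y - p))"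
      using c by (simp add: integrable_continuous)
    also have "norm \<dots> \<le> (norm (y - p) * d) * measure M Z"
      by (rule norm_integral_le) (use c est in \<open>auto intro: continuous_intros\<close>)
    also have "\<dots> \<le> norm (y - p) * e" using mult_left_mono[OF de, of "norm (y - p)"] by (simp add: mult.assoc)
    finally show "norm (integral\<^sup>L M (H y) - integral\<^sup>L M (H p) - integral\<^sup>L M (\<lambda>z. D p z (y - p))) \<le> e * norm (y - p)"
      by (simp add: mult.commute)
  qed
qed

lemma Ck_on_parametric_integral:
  assumes "open S" "parametric_Ck k S Z H"
  shows "Ck_on k S (\<lambda>p. integral\<^sup>L M (H p))"
  using assms(2)
proof (induction k arbitrary: H)
  case 0
  then show ?case by (simp add: continuous_on_parametric_integral)
next
  case (Suc k)
  let ?D = "\<lambda>p z v. frechet_derivative (\<lambda>p. H p z) (at p) v"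
  have cont: "continuous_on (S \<times> Z) (\<lambda>x. ?D (fst x) (snd x) v)" for v
    using Suc.prems parametric_Ck_continuous[of k S Z "\<lambda>p z. ?D p z v"] by simp
  show ?case
  proof (rule Ck_on_SucI[OF assms(1)])
    show "((\<lambda>p. integral\<^sup>L M (H p)) has_derivative (\<lambda>v. integral\<^sup>L M (\<lambda>z. ?D p z v))) (at p)" if "p \<in> S" for p
    proof (rule has_derivative_parametric_integral[OF assms(1) parametric_Ck_continuous[OF Suc.prems] _ cont that])
      show "((\<lambda>p. H p z) has_derivative frechet_derivative (\<lambda>p. H p z) (at q)) (at q)" if "q \<in> S" "z \<in> Z" for q z
        using Suc.prems that by (simp flip: frechet_derivative_works)
    qed
    show "Ck_on k S (\<lambda>p. integral\<^sup>L M (\<lambda>z. ?D p z v))" for v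
      by (rule Suc.IH) (use Suc.prems in simp)
  qed
qed

lemma smooth_on_parametric_integral:
  "open S \<Longrightarrow> (\<And>k. parametric_Ck k S Z H) \<Longrightarrow> smooth_on S (\<lambda>p. integral\<^sup>L M (H p))"
  by (simp add: smooth_on_def Ck_on_parametric_integral)

end

lemma has_derivative_partial_fst:
  assumes "(f has_derivative f') (at (p, q))"
  shows "((\<lambda>p. f (p, q)) has_derivative (\<lambda>v. f' (v, 0))) (at p)"
proof -
  have "((\<lambda>p. (p, q)) has_derivative (\<lambda>v. (v, 0))) (at p)" by (auto intro!: derivative_eq_intros)
  from has_derivative_compose[OF this assms] show ?thesis by simp
qed

lemma has_derivative_partial_snd:
  assumes "(f has_derivative f') (at (p, q))"
  shows "((\<lambda>q. f (p, q)) has_derivative (\<lambda>v. f' (0, v))) (at q)"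
proof -
  have "((\<lambda>q. (p, q)) has_derivative (\<lambda>v. (0, v))) (at q)" by (auto intro!: derivative_eq_intros)
  from has_derivative_compose[OF this assms] show ?thesis by simp
qed

lemma continuous_on_chartwise:
  fixes B :: "('m::t2_space, 'f::euclidean_space) chart set"
    and H :: "'e::euclidean_space \<Rightarrow> 'm \<Rightarrow> 'b::euclidean_space"
  assumes "topological_atlas B" "open S"
    and "\<And>V \<psi>. (V, \<psi>) \<in> B \<Longrightarrow> continuous_on (S \<times> \<psi> ` V) (\<lambda>x. H (fst x) (inv_into V \<psi> (snd x)))"
  shows "continuous_on (S \<times> UNIV) (\<lambda>x. H (fst x) (snd x))"
proof (rule continuous_at_imp_continuous_on, rule ballI)
  fix x :: "'e \<times> 'm" assume x: "x \<in> S \<times> UNIV"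
  obtain V \<psi> where V: "(V, \<psi>) \<in> B" "snd x \<in> V" "is_chart (V, \<psi>)" by (rule atlas_chart_at[OF assms(1)])
  have "continuous_on (S \<times> V) (\<lambda>x. (fst x, \<psi> (snd x)))"
    by (intro continuous_on_Pair continuous_on_compose2[OF is_chartD(4)[OF V(3)]])
      (auto intro: continuous_intros)
  then have "continuous_on (S \<times> V) (\<lambda>x. H (fst (fst x, \<psi> (snd x))) (inv_into V \<psi> (snd (fst x, \<psi> (snd x)))))"
    by (rule continuous_on_compose2[OF assms(3)[OF V(1)]]) auto
  then have c: "continuous_on (S \<times> V) (\<lambda>x. H (fst x) (snd x))"
    by (rule continuous_on_cong[OF refl, THEN iffD1, rotated]) (use is_chartD(6)[OF V(3)] in auto)
  have "open (S \<times> V)" using assms(2) is_chartD(1)[OF V(3)] by (rule open_Times)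
  then show "isCont (\<lambda>x. H (fst x) (snd x)) x"
    using c x V(2) by (metis continuous_on_eq_continuous_at mem_Times_iff)
qed

lemma parametric_Ck_charts:
  fixes B :: "('m::t2_space, 'f::euclidean_space) chart set"
    and H :: "'e::euclidean_space \<Rightarrow> 'm \<Rightarrow> 'b::euclidean_space"
  assumes "topological_atlas B" "open S"
    and "\<And>V \<psi>. (V, \<psi>) \<in> B \<Longrightarrow> Ck_on k (S \<times> \<psi> ` V) (\<lambda>x. H (fst x) (inv_into V \<psi> (snd x)))"
  shows "parametric_Ck k S UNIV H"
  using assms(3)
proof (induction k arbitrary: H)
  case 0
  then show ?case using continuous_on_chartwise[OF assms(1,2), of H] by simp
next
  case (Suc k)
  have c: "continuous_on (S \<times> UNIV) (\<lambda>x. H (fst x) (snd x))"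
    by (rule continuous_on_chartwise[OF assms(1,2)]) (rule Ck_on_continuous[OF Suc.prems])
  have der: "((\<lambda>p. H p (inv_into V \<psi> q)) has_derivative
      (\<lambda>v. frechet_derivative (\<lambda>x. H (fst x) (inv_into V \<psi> (snd x))) (at (p, q)) (v, 0))) (at p)"
    if "(V, \<psi>) \<in> B" "p \<in> S" "q \<in> \<psi> ` V" for V \<psi> p q
    using has_derivative_partial_fst[OF Ck_on_SucD[OF Suc.prems[OF that(1)], of "(p, q)"]] that(2,3) by simp
  have "(\<lambda>p. H p z) differentiable (at p)" if "p \<in> S" for p z
  proof -
    obtain V \<psi> where V: "(V, \<psi>) \<in> B" "z \<in> V" "is_chart (V, \<psi>)" by (rule atlas_chart_at[OF assms(1)])
    then show ?thesis using der[OF V(1) that, of "\<psi> z"] is_chartD(6)[OF V(3)]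
      by (auto simp: differentiable_def)
  qed
  moreover have "parametric_Ck k S UNIV (\<lambda>p z. frechet_derivative (\<lambda>p. H p z) (at p) v)" for v
  proof (rule Suc.IH)
    fix V \<psi> assume V: "(V, \<psi>) \<in> B"
    have o: "open (S \<times> \<psi> ` V)" using assms(2) chart_image_open[OF assms(1) V] by (rule open_Times)
    have "Ck_on k (S \<times> \<psi> ` V) (\<lambda>x. frechet_derivative (\<lambda>x. H (fst x) (inv_into V \<psi> (snd x))) (at x) (v, 0))"
      using Suc.prems[OF V] by simp
    then show "Ck_on k (S \<times> \<psi> ` V) (\<lambda>x. frechet_derivative (\<lambda>p. H p (inv_into V \<psi> (snd x))) (at (fst x)) v)"
    proof (rule Ck_on_cong[OF o, rotated])
      fix x assume "x \<in> S \<times> \<psi> ` V"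
      then obtain p q where x: "x = (p, q)" "p \<in> S" "q \<in> \<psi> ` V" by (cases x) auto
      from fun_cong[OF frechet_derivative_at[OF der[OF V x(2,3)]], of v]
      show "frechet_derivative (\<lambda>x. H (fst x) (inv_into V \<psi> (snd x))) (at x) (v, 0) =
          frechet_derivative (\<lambda>p. H p (inv_into V \<psi> (snd x))) (at (fst x)) v"
        by (simp only: x(1) fst_conv snd_conv)
    qed
  qed
  ultimately show ?case using c by simp
qed

lemma parametric_Ck_C_inf:
  fixes A :: "('m::topological_space, 'e::euclidean_space) chart set" and B :: "('n::t2_space, 'f::euclidean_space) chart set"
    and H :: "'m \<times> 'n \<Rightarrow> 'b::euclidean_space"
  assumes "topological_atlas A" "topological_atlas B" "H \<in> C_inf (prod_atlas A B)" "(U, \<phi>) \<in> A"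
  shows "parametric_Ck k (\<phi> ` U) UNIV (\<lambda>p z. H (inv_into U \<phi> p, z))"
  by (rule parametric_Ck_charts[OF assms(2) chart_image_open[OF assms(1,4)]])
    (use C_inf_prodD[OF assms(1-4)] in \<open>simp add: smooth_on_def\<close>)

section \<open>Hadamard's lemma\<close>

text \<open>Differentiating in \<open>q\<close> produces a factor \<open>t\<close>; the weight \<open>w\<close> absorbs it in the induction.\<close>

lemma parametric_Ck_segment:
  fixes h :: "'e::euclidean_space \<Rightarrow> real"
  assumes "smooth_on (ball q0 r) h" "continuous_on {0..1} w"
  shows "parametric_Ck k (ball q0 r) {0..1} (\<lambda>q t. w t * h (q0 + t *\<^sub>R (q - q0)))"
  using assms
proof (induction k arbitrary: h w)
  case (0 h w)
  have seg: "q0 + t *\<^sub>R (q - q0) \<in> ball q0 r" if "q \<in> ball q0 r" "t \<in> {0..1}" for q t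
    using convexD_alt[OF convex_ball, of q0 q0 r q t] that by (auto simp: algebra_simps dest: le_less_trans[OF zero_le_dist])
  have "continuous_on (ball q0 r \<times> {0..1}) (\<lambda>x. h (q0 + snd x *\<^sub>R (fst x - q0)))"
    by (rule continuous_on_compose2[OF smooth_on_continuous[OF 0(1)]])
      (use seg in \<open>auto intro!: continuous_intros\<close>)
  moreover have "continuous_on (ball q0 r \<times> {0..1}) (\<lambda>x. w (snd x))"
    by (rule continuous_on_compose2[OF 0(2)]) (auto intro!: continuous_intros)
  ultimately show ?case by (simp add: continuous_on_mult)
next
  case (Suc k h w)
  have seg: "q0 + t *\<^sub>R (q - q0) \<in> ball q0 r" if "q \<in> ball q0 r" "t \<in> {0..1}" for q t
    using convexD_alt[OF convex_ball, of q0 q0 r q t] that by (auto simp: algebra_simps dest: le_less_trans[OF zero_le_dist])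
  let ?h' = "\<lambda>x. frechet_derivative h (at x)"
  show ?case
  proof (rule parametric_Ck_SucI[where D = "\<lambda>q t v. (w t * t) * ?h' (q0 + t *\<^sub>R (q - q0)) v"])
    have "continuous_on (ball q0 r \<times> {0..1}) (\<lambda>x. h (q0 + snd x *\<^sub>R (fst x - q0)))"
      by (rule continuous_on_compose2[OF smooth_on_continuous[OF Suc.prems(1)]])
        (use seg in \<open>auto intro!: continuous_intros\<close>)
    moreover have "continuous_on (ball q0 r \<times> {0..1}) (\<lambda>x. w (snd x))"
      by (rule continuous_on_compose2[OF Suc.prems(2)]) (auto intro!: continuous_intros)
    ultimately show "continuous_on (ball q0 r \<times> {0..1}) (\<lambda>x. w (snd x) * h (q0 + snd x *\<^sub>R (fst x - q0)))"
      by (simp add: continuous_on_mult)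
    show "((\<lambda>q. w t * h (q0 + t *\<^sub>R (q - q0))) has_derivative (\<lambda>v. (w t * t) * ?h' (q0 + t *\<^sub>R (q - q0)) v)) (at q)"
      if "q \<in> ball q0 r" "t \<in> {0..1}" for q t
    proof -
      have d: "(h has_derivative ?h' (q0 + t *\<^sub>R (q - q0))) (at (q0 + t *\<^sub>R (q - q0)))"
        by (rule smooth_on_has_derivative[OF Suc.prems(1) seg[OF that]])
      have "((\<lambda>q. q0 + t *\<^sub>R (q - q0)) has_derivative (\<lambda>v. t *\<^sub>R v)) (at q)"
        by (auto intro!: derivative_eq_intros)
      from has_derivative_mult_right[OF has_derivative_compose[OF this d], of "w t"]
      show ?thesis
        using linear_scale[OF has_derivative_linear[OF d], of t] by (simp add: mult.assoc)
    qed
    show "parametric_Ck k (ball q0 r) {0..1} (\<lambda>q t. (w t * t) * ?h' (q0 + t *\<^sub>R (q - q0)) v)" for v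
      by (rule Suc.IH[OF smooth_on_derivative[OF Suc.prems(1)]]) (intro continuous_intros Suc.prems(2))
  qed simp
qed

lemma compact_measure_interval: "compact_measure (restrict_space lborel {0..1::real}) {0..1}"
proof (intro compact_measure.intro compact_measure_axioms.intro)
  show "finite_measure (restrict_space lborel {0..1::real})"
    by (rule finite_measureI) (simp add: emeasure_restrict_space space_restrict_space)
  show "sets (restrict_space lborel {0..1::real}) = sets (restrict_space borel {0..1})"
    by (rule sets_restrict_space_cong) simp
qed simp

text \<open>The coefficients are the averages of the partial derivatives over the segment from \<open>q0\<close> to \<open>q\<close>.\<close>

lemma Hadamard:
  fixes f :: "'e::euclidean_space \<Rightarrow> real"
  assumes "smooth_on (ball q0 r) f"
  obtains h where "\<And>b. b \<in> Basis \<Longrightarrow> smooth_on (ball q0 r) (h b)"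
    "\<And>q. q \<in> ball q0 r \<Longrightarrow> f q = f q0 + (\<Sum>b\<in>Basis. ((q - q0) \<bullet> b) * h b q)"
    "\<And>b. b \<in> Basis \<Longrightarrow> h b q0 = frechet_derivative f (at q0) b"
proof -
  interpret compact_measure "restrict_space lborel {0..1::real}" "{0..1}" by (rule compact_measure_interval)
  let ?M = "restrict_space lborel {0..1::real}"
  define h where "h b q = integral\<^sup>L ?M (\<lambda>t. 1 * frechet_derivative f (at (q0 + t *\<^sub>R (q - q0))) b)" for b q
  show thesis
  proof (rule that)
    show "smooth_on (ball q0 r) (h b)" for b
      unfolding h_def
      by (intro smooth_on_parametric_integral parametric_Ck_segment smooth_on_derivative assms) auto
    show "h b q0 = frechet_derivative f (at q0) b" for b
      by (simp add: h_def measure_restrict_space space_restrict_space)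
    fix q assume q: "q \<in> ball q0 r"
    have seg: "q0 + t *\<^sub>R (q - q0) \<in> ball q0 r" if "t \<in> {0..1}" for t
      using convexD_alt[OF convex_ball, of q0 q0 r q t] that q by (auto simp: algebra_simps dest: le_less_trans[OF zero_le_dist])
    let ?F = "\<lambda>t. f (q0 + t *\<^sub>R (q - q0))" and ?D = "\<lambda>t. frechet_derivative f (at (q0 + t *\<^sub>R (q - q0)))"
    have lin: "linear (?D t)" if "t \<in> {0..1}" for t
      using smooth_on_has_derivative[OF assms seg[OF that]] by (rule has_derivative_linear)
    have contD: "continuous_on {0..1} (\<lambda>t. ?D t v)" for v
      by (rule continuous_on_compose2[OF smooth_on_continuous[OF smooth_on_derivative[OF assms]]])
        (use seg in \<open>auto intro!: continuous_intros\<close>)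
    have "(?F has_vector_derivative ?D t (q - q0)) (at t within {0..1})" if "t \<in> {0..1}" for t
    proof -
      have "((\<lambda>t. q0 + t *\<^sub>R (q - q0)) has_derivative (\<lambda>s. s *\<^sub>R (q - q0))) (at t within {0..1})"
        by (auto intro!: derivative_eq_intros)
      from has_derivative_compose[OF this smooth_on_has_derivative[OF assms seg[OF that]]]
      show ?thesis by (simp add: has_vector_derivative_def linear_scale[OF lin[OF that]])
    qed
    from integral_FTC_Icc[OF zero_le_one this contD]
    have "f q - f q0 = integral\<^sup>L ?M (\<lambda>t. ?D t (q - q0))"
      by (simp add: integral_restrict_space)
    also have "\<dots> = integral\<^sup>L ?M (\<lambda>t. \<Sum>b\<in>Basis. ((q - q0) \<bullet> b) * ?D t b)"
    proof (rule Bochner_Integration.integral_cong[OF refl])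
      fix t assume "t \<in> space ?M"
      then have t: "t \<in> {0..1}" by (simp add: space_restrict_space)
      show "?D t (q - q0) = (\<Sum>b\<in>Basis. ((q - q0) \<bullet> b) * ?D t b)"
        by (rule linear_basis_expansion[OF lin[OF t], unfolded real_scaleR_def])
    qed
    also have "\<dots> = (\<Sum>b\<in>Basis. ((q - q0) \<bullet> b) * h b q)"
      using integrable_continuous[OF contD] by (simp add: h_def)
    finally show "f q = f q0 + (\<Sum>b\<in>Basis. ((q - q0) \<bullet> b) * h b q)" by simp
  qed
qed

section \<open>Derivations at a point and vector fields\<close>

definition derivation_at ::
  "('m::topological_space, 'e::euclidean_space) chart set \<Rightarrow> 'm \<Rightarrow> (('m \<Rightarrow> real) \<Rightarrow> real) \<Rightarrow> bool" where
  "derivation_at A y d \<longleftrightarrow>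
     (\<forall>f\<in>C_inf A. \<forall>h\<in>C_inf A. d (\<lambda>x. f x + h x) = d f + d h) \<and>
     (\<forall>c. \<forall>f\<in>C_inf A. d (\<lambda>x. c * f x) = c * d f) \<and>
     (\<forall>f\<in>C_inf A. \<forall>h\<in>C_inf A. d (\<lambda>x. f x * h x) = d f * h y + f y * d h)"

definition chart_deriv :: "'m set \<Rightarrow> ('m \<Rightarrow> 'e::euclidean_space) \<Rightarrow> 'm \<Rightarrow> 'e \<Rightarrow> ('m \<Rightarrow> real) \<Rightarrow> real" where
  "chart_deriv U \<phi> y v f = frechet_derivative (\<lambda>q. f (inv_into U \<phi> q)) (at (\<phi> y)) v"

lemma derivation_atD:
  assumes "derivation_at A y d" "f \<in> C_inf A" "h \<in> C_inf A"
  shows "d (\<lambda>x. f x + h x) = d f + d h" "d (\<lambda>x. c * f x) = c * d f"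
    "d (\<lambda>x. f x * h x) = d f * h y + f y * d h"
  using assms unfolding derivation_at_def by auto

lemma derivation_at_const:
  assumes "topological_atlas A" "derivation_at A y d"
  shows "d (\<lambda>x. c) = 0"
proof -
  note one = C_inf_const[OF assms(1), of "1::real"]
  have "d (\<lambda>x. 1) = 0" using derivation_atD(3)[OF assms(2) one one] by simp
  then show ?thesis using derivation_atD(2)[OF assms(2) one one, of c] by simp
qed

lemma derivation_at_sum:
  assumes "topological_atlas A" "derivation_at A y d" "finite I" "\<And>i. i \<in> I \<Longrightarrow> f i \<in> C_inf A"
  shows "d (\<lambda>x. \<Sum>i\<in>I. f i x) = (\<Sum>i\<in>I. d (f i))"
  using assms(3,4)
proof (induction I)
  case empty
  then show ?case using derivation_at_const[OF assms(1,2), of 0] by simp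
next
  case (insert i I)
  have s: "(\<lambda>x. \<Sum>i\<in>I. f i x) \<in> C_inf A" by (rule C_inf_sum[OF assms(1)]) (use insert in auto)
  have "d (\<lambda>x. f i x + (\<Sum>i\<in>I. f i x)) = d (f i) + d (\<lambda>x. \<Sum>i\<in>I. f i x)"
    by (rule derivation_atD(1)[OF assms(2) _ s]) (use insert in auto)
  then show ?case using insert by simp
qed

lemma chart_has_derivative:
  assumes "topological_atlas A" "(U, \<phi>) \<in> A" "y \<in> U" "f \<in> C_inf A"
  shows "((\<lambda>q. f (inv_into U \<phi> q)) has_derivative (\<lambda>v. chart_deriv U \<phi> y v f)) (at (\<phi> y))"
  using smooth_on_has_derivative[OF C_infD[OF assms(4,2)]] assms(3) by (simp add: chart_deriv_def)

lemma chart_deriv_eqI: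
  assumes "((\<lambda>q. f (inv_into U \<phi> q)) has_derivative D) (at (\<phi> y))"
  shows "chart_deriv U \<phi> y v f = D v"
  using frechet_derivative_at[OF assms] by (simp add: chart_deriv_def)

lemma linear_chart_deriv:
  assumes "topological_atlas A" "(U, \<phi>) \<in> A" "y \<in> U" "f \<in> C_inf A"
  shows "linear (\<lambda>v. chart_deriv U \<phi> y v f)"
  using chart_has_derivative[OF assms] by (rule has_derivative_linear)

lemma derivation_at_chart_deriv:
  assumes "topological_atlas A" "(U, \<phi>) \<in> A" "y \<in> U"
  shows "derivation_at A y (chart_deriv U \<phi> y v)"
proof -
  have i: "inv_into U \<phi> (\<phi> y) = y"
    using assms by (auto simp: topological_atlas_def dest: is_chartD(6))
  show ?thesis
    unfolding derivation_at_def
  proof (intro conjI ballI allI)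
    fix f h :: "'a \<Rightarrow> real" and c :: real
    assume f: "f \<in> C_inf A"
    note df = chart_has_derivative[OF assms f]
    show "chart_deriv U \<phi> y v (\<lambda>x. c * f x) = c * chart_deriv U \<phi> y v f"
      by (rule chart_deriv_eqI[OF has_derivative_mult_right[OF df]])
    assume h: "h \<in> C_inf A"
    note dh = chart_has_derivative[OF assms h]
    show "chart_deriv U \<phi> y v (\<lambda>x. f x + h x) = chart_deriv U \<phi> y v f + chart_deriv U \<phi> y v h"
      by (rule chart_deriv_eqI[OF has_derivative_add[OF df dh]])
    show "chart_deriv U \<phi> y v (\<lambda>x. f x * h x) = chart_deriv U \<phi> y v f * h y + f y * chart_deriv U \<phi> y v h"
      using chart_deriv_eqI[OF has_derivative_mult[OF df dh], of v] by (simp add: i)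
  qed
qed

text \<open>Hadamard's lemma writes \<open>f - f(y)\<close> near \<open>y\<close> as a combination of the coordinates with smooth coefficients; a cut-off turns
  this into an identity of global smooth functions, to which the Leibniz rule applies.\<close>

lemma derivation_at_eq_chart_deriv:
  fixes A :: "('m::t2_space, 'e::euclidean_space) chart set"
  assumes "smooth_atlas A" "(U, \<phi>) \<in> A" "y \<in> U" "derivation_at A y d"
  obtains w where "\<And>f. f \<in> C_inf A \<Longrightarrow> d f = chart_deriv U \<phi> y w f"
proof -
  have ta: "topological_atlas A" using assms(1) by (rule smooth_imp_topological_atlas)
  have cU: "is_chart (U, \<phi>)" using assms(1,2) by (auto simp: smooth_atlas_def)
  define q0 where "q0 = \<phi> y"
  obtain r where r: "r > 0" "ball q0 r \<subseteq> \<phi> ` U"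
    by (rule openE[OF is_chartD(2)[OF cU], of q0]) (use assms(3) in \<open>simp add: q0_def\<close>)
  have r2: "r / 2 > 0" using r by simp
  obtain \<eta> :: "'e \<Rightarrow> real" where \<eta>: "smooth_on UNIV \<eta>" "\<And>q. \<eta> q \<noteq> 0 \<Longrightarrow> dist q0 q \<le> r / 2" "\<eta> q0 = 1"
    using euclidean_plateau[OF r2, of q0] by blast
  define ext where "ext h x = (if x \<in> U \<and> \<phi> x \<in> ball q0 r then \<eta> (\<phi> x) * h (\<phi> x) else 0)" for h x
  have ext: "ext h \<in> C_inf A" if "smooth_on (ball q0 r) h" for h
  proof -
    have "smooth_on (ball q0 r) (\<lambda>q. \<eta> q * h q)"
      by (rule smooth_on_mult[OF open_ball smooth_on_subset[OF \<eta>(1) subset_UNIV] that])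
    then have "(\<lambda>x. if x \<in> U \<and> \<phi> x \<in> ball q0 r then \<eta> (\<phi> x) * h (\<phi> x) else 0) \<in> C_inf A"
      by (rule C_inf_extend_by_zero[OF assms(1,2) open_ball r(2) compact_cball[of q0 "r/2"], rotated])
        (use r(1) \<eta>(2) in auto)
    then show ?thesis by (simp add: ext_def[abs_def])
  qed
  have ext_y: "ext h y = h q0" for h using assms(3) r(1) \<eta>(3) by (simp add: ext_def q0_def)
  have scoord: "smooth_on (ball q0 r) (\<lambda>q. (q - q0) \<bullet> b)" for b
  proof -
    have "smooth_on (ball q0 r) (\<lambda>q. q \<bullet> b + (- (q0 \<bullet> b)))"
      by (rule smooth_on_add[OF open_ball smooth_on_bounded_linear[OF bounded_linear_inner_left open_ball]
          smooth_on_const[OF open_ball]])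
    then show ?thesis by (simp add: inner_diff_left)
  qed
  define x where "x b = ext (\<lambda>q. (q - q0) \<bullet> b)" for b
  define c where "c = ext (\<lambda>q. 1)"
  have x: "x b \<in> C_inf A" "x b y = 0" for b using ext[OF scoord] ext_y by (auto simp: x_def)
  have c: "c \<in> C_inf A" "c y = 1" using ext[OF smooth_on_const[OF open_ball]] ext_y by (auto simp: c_def)
  define w where "w = (\<Sum>b\<in>Basis. d (x b) *\<^sub>R b)"
  show thesis
  proof (rule that)
    fix f :: "'m \<Rightarrow> real" assume f: "f \<in> C_inf A"
    have sF: "smooth_on (ball q0 r) (\<lambda>q. f (inv_into U \<phi> q))" by (rule smooth_on_subset[OF C_infD[OF f assms(2)] r(2)])
    obtain h where h: "\<And>b. b \<in> Basis \<Longrightarrow> smooth_on (ball q0 r) (h b)"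
      "\<And>q. q \<in> ball q0 r \<Longrightarrow> f (inv_into U \<phi> q) = f (inv_into U \<phi> q0) + (\<Sum>b\<in>Basis. ((q - q0) \<bullet> b) * h b q)"
      "\<And>b. b \<in> Basis \<Longrightarrow> h b q0 = frechet_derivative (\<lambda>q. f (inv_into U \<phi> q)) (at q0) b"
      by (rule Hadamard[OF sF]) blast
    have iy: "inv_into U \<phi> q0 = y" using is_chartD(6)[OF cU assms(3)] by (simp add: q0_def)
    \<comment> \<open>The square of the cut-off \<open>c\<close> matches the cut-offs in \<open>x b\<close> and in \<open>ext (h b)\<close>, one for each.\<close>
    have id: "(\<lambda>z. (c z * c z) * (f z + (- f y))) = (\<lambda>z. \<Sum>b\<in>Basis. x b z * ext (h b) z)"
    proof
      fix z
      show "(c z * c z) * (f z + (- f y)) = (\<Sum>b\<in>Basis. x b z * ext (h b) z)"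
      proof (cases "z \<in> U \<and> \<phi> z \<in> ball q0 r")
        case True
        then have "f z = f y + (\<Sum>b\<in>Basis. ((\<phi> z - q0) \<bullet> b) * h b (\<phi> z))"
          using h(2)[of "\<phi> z"] is_chartD(6)[OF cU, of z] iy by simp
        then show ?thesis using True
          by (simp add: c_def x_def ext_def sum_distrib_left algebra_simps)
      qed (auto simp: c_def x_def ext_def)
    qed
    have fy: "(\<lambda>z. f z + (- f y)) \<in> C_inf A" by (rule C_inf_add[OF ta f C_inf_const[OF ta]])
    have "d (\<lambda>z. (c z * c z) * (f z + (- f y))) = d f"
      using derivation_atD(3)[OF assms(4) C_inf_mult[OF ta c(1) c(1)] fy] c(2)
        derivation_atD(1)[OF assms(4) f C_inf_const[OF ta]] derivation_at_const[OF ta assms(4)] by (simp del: add_uminus_conv_diff)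
    moreover have "d (\<lambda>z. \<Sum>b\<in>Basis. x b z * ext (h b) z) = (\<Sum>b\<in>Basis. d (x b) * h b q0)"
      using derivation_at_sum[OF ta assms(4) finite_Basis, of "\<lambda>b z. x b z * ext (h b) z"]
        derivation_atD(3)[OF assms(4) x(1) ext[OF h(1)]] C_inf_mult[OF ta x(1) ext[OF h(1)]]
      by (simp add: x(2) ext_y)
    moreover have "(\<Sum>b\<in>Basis. d (x b) * h b q0) = chart_deriv U \<phi> y w f"
    proof -
      note lin = linear_chart_deriv[OF ta assms(2,3) f]
      have "chart_deriv U \<phi> y w f = (\<Sum>b\<in>Basis. d (x b) * chart_deriv U \<phi> y b f)"
        unfolding w_def by (simp only: linear_sum[OF lin] linear_scale[OF lin] real_scaleR_def)
      then show ?thesis by (simp add: h(3) chart_deriv_def flip: q0_def)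
    qed
    ultimately show "d f = chart_deriv U \<phi> y w f" using id by simp
  qed
qed

text \<open>Coordinates multiplied by a plateau function are global smooth functions; applying a derivation to
  them gives its components.\<close>

lemma chart_coordinates:
  fixes A :: "('m::t2_space, 'e::euclidean_space) chart set"
  assumes "smooth_atlas A" "(U, \<phi>) \<in> A" "y \<in> U"
  obtains \<xi> N where "\<And>b. \<xi> b \<in> C_inf A" "open N" "y \<in> N" "N \<subseteq> U"
    "\<And>b x v. x \<in> N \<Longrightarrow> chart_deriv U \<phi> x v (\<xi> b) = v \<bullet> b"
proof -
  have ta: "topological_atlas A" using assms(1) by (rule smooth_imp_topological_atlas)
  have cU: "is_chart (U, \<phi>)" using assms(1,2) by (auto simp: smooth_atlas_def)
  obtain r where r: "r > 0" "cball (\<phi> y) r \<subseteq> \<phi> ` U"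
    using is_chartD(2)[OF cU] assms(3) by (auto simp: open_contains_cball)
  obtain \<eta> :: "'e \<Rightarrow> real" and N0 where \<eta>: "smooth_on UNIV \<eta>" "\<And>q. \<eta> q \<noteq> 0 \<Longrightarrow> dist (\<phi> y) q \<le> r"
    "open N0" "\<phi> y \<in> N0" "\<And>q. q \<in> N0 \<Longrightarrow> \<eta> q = 1"
    using euclidean_plateau[OF r(1), of "\<phi> y"] by blast
  define \<xi> where "\<xi> b = (\<lambda>x. if x \<in> U \<and> \<phi> x \<in> \<phi> ` U then \<eta> (\<phi> x) * (\<phi> x \<bullet> b) else 0)" for b
  define N where "N = U \<inter> \<phi> -` N0"
  show thesis
  proof (rule that)
    show "\<xi> b \<in> C_inf A" for b
      unfolding \<xi>_def
    proof (rule C_inf_extend_by_zero[OF assms(1,2) is_chartD(2)[OF cU] order_refl compact_cball r(2)])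
      show "smooth_on (\<phi> ` U) (\<lambda>q. \<eta> q * (q \<bullet> b))"
        by (rule smooth_on_mult[OF is_chartD(2)[OF cU] smooth_on_subset[OF \<eta>(1) subset_UNIV]
            smooth_on_bounded_linear[OF bounded_linear_inner_left is_chartD(2)[OF cU]]])
      show "\<eta> q * (q \<bullet> b) = 0" if "q \<in> \<phi> ` U - cball (\<phi> y) r" for q
        using that \<eta>(2)[of q] by auto
    qed
    show oN: "open N" unfolding N_def
      by (rule continuous_open_preimage[OF is_chartD(4,1)[OF cU] \<eta>(3)])
    show "y \<in> N" "N \<subseteq> U" using assms(3) \<eta>(4) by (auto simp: N_def)
    fix b x v assume x: "x \<in> N"
    have "((\<lambda>q. q \<bullet> b) has_derivative (\<lambda>v. v \<bullet> b)) (at (\<phi> x))"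
      by (rule bounded_linear_imp_has_derivative[OF bounded_linear_inner_left])
    then have "((\<lambda>q. \<xi> b (inv_into U \<phi> q)) has_derivative (\<lambda>v. v \<bullet> b)) (at (\<phi> x))"
    proof (rule has_derivative_transform_within_open)
      show "open (\<phi> ` N)" by (rule open_chart_image[OF cU oN]) (simp add: N_def)
      show "q \<bullet> b = \<xi> b (inv_into U \<phi> q)" if "q \<in> \<phi> ` N" for q
        using that is_chartD(6)[OF cU] \<eta>(5) by (auto simp: N_def \<xi>_def)
    qed (use x in simp)
    then show "chart_deriv U \<phi> x v (\<xi> b) = v \<bullet> b" by (rule chart_deriv_eqI)
  qed
qed

lemma vector_fieldsD:
  assumes "X \<in> vector_fields A"
  shows "f \<in> C_inf A \<Longrightarrow> X f \<in> C_inf A" "f \<notin> C_inf A \<Longrightarrow> X f = (\<lambda>x. 0)"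
    "f \<in> C_inf A \<Longrightarrow> h \<in> C_inf A \<Longrightarrow> X (\<lambda>x. f x + h x) = (\<lambda>x. X f x + X h x)"
    "f \<in> C_inf A \<Longrightarrow> X (\<lambda>x. c * f x) = (\<lambda>x. c * X f x)"
    "f \<in> C_inf A \<Longrightarrow> h \<in> C_inf A \<Longrightarrow> X (\<lambda>x. f x * h x) = (\<lambda>x. X f x * h x + f x * X h x)"
  using assms unfolding vector_fields_def by blast+

lemma vector_fieldsI:
  fixes X :: "('m::topological_space) vf"
  assumes "\<And>f. f \<in> C_inf A \<Longrightarrow> X f \<in> C_inf A" "\<And>f. f \<notin> C_inf A \<Longrightarrow> X f = (\<lambda>x. 0)"
    "\<And>y. derivation_at A y (\<lambda>f. X f y)"
  shows "X \<in> vector_fields A"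
  using assms unfolding vector_fields_def derivation_at_def by (simp add: fun_eq_iff)

lemma derivation_at_vector_field: "X \<in> vector_fields A \<Longrightarrow> derivation_at A y (\<lambda>f. X f y)"
  unfolding derivation_at_def using vector_fieldsD(3-5)[of X A] by simp

lemma vector_field_local:
  fixes A :: "('m::t2_space, 'e::euclidean_space) chart set"
  assumes "smooth_atlas A" "(U, \<phi>) \<in> A" "y \<in> U" "X \<in> vector_fields A"
  obtains a N where "\<And>b. a b \<in> C_inf A" "open N" "y \<in> N" "N \<subseteq> U"
    "\<And>f x. f \<in> C_inf A \<Longrightarrow> x \<in> N \<Longrightarrow> X f x = (\<Sum>b\<in>Basis. a b x * chart_deriv U \<phi> x b f)"
proof -
  have ta: "topological_atlas A" using assms(1) by (rule smooth_imp_topological_atlas)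
  obtain \<xi> N where \<xi>: "\<And>b. \<xi> b \<in> C_inf A" "open N" "y \<in> N" "N \<subseteq> U"
    "\<And>b x v. x \<in> N \<Longrightarrow> chart_deriv U \<phi> x v (\<xi> b) = v \<bullet> b"
    by (rule chart_coordinates[OF assms(1-3)]) blast
  show thesis
  proof (rule that[of "\<lambda>b. X (\<xi> b)" N])
    show "X (\<xi> b) \<in> C_inf A" for b by (rule vector_fieldsD(1)[OF assms(4) \<xi>(1)])
    fix f :: "'m \<Rightarrow> real" and x assume f: "f \<in> C_inf A" and x: "x \<in> N"
    have xU: "x \<in> U" using x \<xi>(4) by auto
    obtain w where w: "\<And>f. f \<in> C_inf A \<Longrightarrow> X f x = chart_deriv U \<phi> x w f"
      by (rule derivation_at_eq_chart_deriv[OF assms(1,2) xU derivation_at_vector_field[OF assms(4)]]) blast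
    have "X (\<xi> b) x = w \<bullet> b" for b using w[OF \<xi>(1)] \<xi>(5)[OF x] by simp
    then show "X f x = (\<Sum>b\<in>Basis. X (\<xi> b) x * chart_deriv U \<phi> x b f)"
      unfolding w[OF f] by (subst linear_basis_expansion[OF linear_chart_deriv[OF ta assms(2) xU f]]) simp
  qed (use \<xi> in auto)
qed

lemma C_inf_slice:
  assumes "topological_atlas B" "smooth_atlas A" "H \<in> C_inf (prod_atlas B A)"
  shows "(\<lambda>y. H (m, y)) \<in> C_inf A"
proof -
  note ta = smooth_imp_topological_atlas[OF assms(2)]
  have "smooth_map A (prod_atlas B A) (\<lambda>y. (m, y))"
    by (rule smooth_map_Pair[OF ta assms(1) ta smooth_map_const[OF ta] smooth_map_id[OF assms(2)]])
  from C_inf_compose[OF ta topological_atlas_prod[OF assms(1) ta] this assms(3)] show ?thesis .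
qed

lemma chart_deriv_slice:
  fixes B :: "('n::topological_space, 'f::euclidean_space) chart set"
  assumes "topological_atlas B" "smooth_atlas A" "H \<in> C_inf (prod_atlas B A)" "(W, \<theta>) \<in> B" "(U, \<phi>) \<in> A"
    "p \<in> \<theta> ` W" "y \<in> U"
  shows "chart_deriv U \<phi> y v (\<lambda>y. H (inv_into W \<theta> p, y)) =
    frechet_derivative (\<lambda>x. H (inv_into W \<theta> (fst x), inv_into U \<phi> (snd x))) (at (p, \<phi> y)) (0, v)"
proof -
  note ta = smooth_imp_topological_atlas[OF assms(2)]
  have "(p, \<phi> y) \<in> \<theta> ` W \<times> \<phi> ` U" using assms(6,7) by simp
  from has_derivative_partial_snd[OF smooth_on_has_derivative[OF C_inf_prodD[OF assms(1) ta assms(3-5)] this]]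
  show ?thesis by (intro chart_deriv_eqI) simp
qed

lemma C_inf_chart_deriv:
  fixes B :: "('n::topological_space, 'f::euclidean_space) chart set"
  assumes "topological_atlas B" "smooth_atlas A" "H \<in> C_inf (prod_atlas B A)" "(U, \<phi>) \<in> A" "y \<in> U"
  shows "(\<lambda>m. chart_deriv U \<phi> y v (\<lambda>y. H (m, y))) \<in> C_inf B"
proof (rule C_infI)
  note ta = smooth_imp_topological_atlas[OF assms(2)]
  fix W \<theta> assume W: "(W, \<theta>) \<in> B"
  have o: "open (\<theta> ` W)" "open (\<phi> ` U)" using chart_image_open assms(1,4) W ta by blast+
  let ?F = "\<lambda>x. frechet_derivative (\<lambda>x. H (inv_into W \<theta> (fst x), inv_into U \<phi> (snd x))) (at x) (0, v)"
  have "smooth_on (\<theta> ` W \<times> \<phi> ` U) ?F"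
    by (rule smooth_on_derivative[OF C_inf_prodD[OF assms(1) ta assms(3) W assms(4)]])
  then have "smooth_on (\<theta> ` W) (\<lambda>p. ?F (p, \<phi> y))"
  proof (rule smooth_on_compose[OF o(1) open_Times[OF o], rotated])
    show "smooth_on (\<theta> ` W) (\<lambda>p. (p, \<phi> y))"
      by (rule smooth_on_Pair[OF o(1) smooth_on_bounded_linear[OF bounded_linear_ident o(1)] smooth_on_const[OF o(1)]])
  qed (use assms(5) in auto)
  then show "smooth_on (\<theta> ` W) (\<lambda>q. chart_deriv U \<phi> y v (\<lambda>y. H (inv_into W \<theta> q, y)))"
    by (rule smooth_on_cong[OF o(1), rotated]) (simp add: chart_deriv_slice[OF assms(1-3) W assms(4) _ assms(5)])
qed

text \<open>In a product chart the field differentiates in the second variable only, with coefficients that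
  do not depend on the first.\<close>

lemma C_inf_vector_field_slice:
  fixes A :: "('m::t2_space, 'e::euclidean_space) chart set" and B :: "('n::topological_space, 'f::euclidean_space) chart set"
  assumes "topological_atlas B" "smooth_atlas A" "H \<in> C_inf (prod_atlas B A)" "X \<in> vector_fields A"
  shows "(\<lambda>x. X (\<lambda>y. H (fst x, y)) (snd x)) \<in> C_inf (prod_atlas B A)"
proof (rule C_inf_prodI[OF assms(1) smooth_imp_topological_atlas[OF assms(2)]], rule smooth_on_local)
  note ta = smooth_imp_topological_atlas[OF assms(2)]
  fix W \<theta> U \<phi> x assume W: "(W, \<theta>) \<in> B" and U: "(U, \<phi>) \<in> A" and x: "x \<in> \<theta> ` W \<times> \<phi> ` U"
  have cU: "is_chart (U, \<phi>)" using ta U by (auto simp: topological_atlas_def)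
  have oW: "open (\<theta> ` W)" by (rule chart_image_open[OF assms(1) W])
  obtain p y where py: "x = (p, \<phi> y)" "p \<in> \<theta> ` W" "y \<in> U" using x by (cases x) auto
  obtain a N where a: "\<And>b. a b \<in> C_inf A" "open N" "y \<in> N" "N \<subseteq> U"
    "\<And>f x. f \<in> C_inf A \<Longrightarrow> x \<in> N \<Longrightarrow> X f x = (\<Sum>b\<in>Basis. a b x * chart_deriv U \<phi> x b f)"
    by (rule vector_field_local[OF assms(2) U py(3) assms(4)]) blast
  have oN: "open (\<phi> ` N)" by (rule open_chart_image[OF cU a(2,4)])
  have o: "open (\<theta> ` W \<times> \<phi> ` N)" using oW oN by (rule open_Times)
  let ?F = "\<lambda>b x. frechet_derivative (\<lambda>x. H (inv_into W \<theta> (fst x), inv_into U \<phi> (snd x))) (at x) (0, b)"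
  have F: "smooth_on (\<theta> ` W \<times> \<phi> ` N) (?F b)" for b
    by (rule smooth_on_subset[OF smooth_on_derivative[OF C_inf_prodD[OF assms(1) ta assms(3) W U]]])
      (use a(4) in auto)
  have ab: "smooth_on (\<theta> ` W \<times> \<phi> ` N) (\<lambda>x. a b (inv_into U \<phi> (snd x)))" for b
    by (rule smooth_on_compose[OF o oN _ smooth_on_subset[OF C_infD[OF a(1) U]]
        smooth_on_bounded_linear[OF bounded_linear_snd o]]) (use a(4) in auto)
  have "smooth_on (\<theta> ` W \<times> \<phi> ` N) (\<lambda>x. \<Sum>b\<in>Basis. a b (inv_into U \<phi> (snd x)) * ?F b x)"
    by (rule smooth_on_sum[OF o smooth_on_mult[OF o ab F]])
  then have "smooth_on (\<theta> ` W \<times> \<phi> ` N)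
      (\<lambda>x. X (\<lambda>y. H (inv_into W \<theta> (fst x), y)) (inv_into U \<phi> (snd x)))"
  proof (rule smooth_on_cong[OF o, rotated])
    fix x assume "x \<in> \<theta> ` W \<times> \<phi> ` N"
    then obtain p y where x: "x = (p, \<phi> y)" and p: "p \<in> \<theta> ` W" and y: "y \<in> N" by (cases x) auto
    have yU: "y \<in> U" using y a(4) by auto
    show "(\<Sum>b\<in>Basis. a b (inv_into U \<phi> (snd x)) * ?F b x) =
        X (\<lambda>y. H (inv_into W \<theta> (fst x), y)) (inv_into U \<phi> (snd x))"
      using a(5)[OF C_inf_slice[OF assms(1-3)] y] is_chartD(6)[OF cU yU]
      by (simp add: x chart_deriv_slice[OF assms(1-3) W U p yU])
  qed
  then show "\<exists>N. open N \<and> x \<in> N \<and>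
      smooth_on N (\<lambda>x. X (\<lambda>y. H (fst (inv_into W \<theta> (fst x), inv_into U \<phi> (snd x)), y)) (snd (inv_into W \<theta> (fst x), inv_into U \<phi> (snd x))))"
    using o py a(3) by (intro exI[of _ "\<theta> ` W \<times> \<phi> ` N"]) simp
qed

section \<open>Translations and Haar measure\<close>

locale lie_haar =
  fixes G :: "'g::{t2_space, second_countable_topology} monoid"
    and A :: "('g, 'e::euclidean_space) chart set"
    and \<mu> :: "'g measure"
  assumes lie: "compact_lie_group G A" and haar: "normalized_haar G \<mu>"
begin

abbreviation mul (infixl "\<cdot>" 70) where "x \<cdot> y \<equiv> x \<otimes>\<^bsub>G\<^esub> y"
abbreviation iv where "iv x \<equiv> inv\<^bsub>G\<^esub> x"
abbreviation e where "e \<equiv> \<one>\<^bsub>G\<^esub>"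

lemma group_G: "group G" and carrier_G: "carrier G = UNIV" and compact_G: "compact (UNIV :: 'g set)"
  and sa: "smooth_atlas A"
  and smooth_mul: "smooth_map (prod_atlas A A) A (\<lambda>(x, y). x \<cdot> y)"
  and smooth_iv: "smooth_map A A (\<lambda>x. iv x)"
  using lie by (auto simp: compact_lie_group_def)

lemma ta: "topological_atlas A" using sa by (rule smooth_imp_topological_atlas)
lemma ta2: "topological_atlas (prod_atlas A A)" using ta ta by (rule topological_atlas_prod)

lemma grp [simp]:
  "(x \<cdot> y) \<cdot> z = x \<cdot> (y \<cdot> z)" "e \<cdot> x = x" "x \<cdot> e = x" "iv x \<cdot> x = e" "x \<cdot> iv x = e" "iv (iv x) = x"
  "iv (x \<cdot> y) = iv y \<cdot> iv x" "x \<cdot> (iv x \<cdot> y) = y" "iv x \<cdot> (x \<cdot> y) = y" "iv e = e"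
proof -
  interpret group G by (rule group_G)
  note [simp] = carrier_G
  show "(x \<cdot> y) \<cdot> z = x \<cdot> (y \<cdot> z)" "e \<cdot> x = x" "x \<cdot> e = x" "iv x \<cdot> x = e" "x \<cdot> iv x = e" "iv (iv x) = x"
    "iv (x \<cdot> y) = iv y \<cdot> iv x" "iv e = e" by (simp_all add: m_assoc inv_mult_group)
  show "x \<cdot> (iv x \<cdot> y) = y" "iv x \<cdot> (x \<cdot> y) = y" by (simp_all flip: m_assoc)
qed

lemma continuous_mul: "continuous_on UNIV (\<lambda>x. fst x \<cdot> snd x)"
  using smooth_map_continuous[OF smooth_mul] by (simp add: case_prod_beta)

lemma continuous_iv: "continuous_on UNIV (\<lambda>x. iv x)" using smooth_map_continuous[OF smooth_iv] .

lemma continuous_on_mul [continuous_intros]: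
  "continuous_on S a \<Longrightarrow> continuous_on S b \<Longrightarrow> continuous_on S (\<lambda>x. a x \<cdot> b x)"
  using continuous_on_compose2[OF continuous_mul continuous_on_Pair, of S a b] by simp

lemma continuous_on_iv [continuous_intros]: "continuous_on S a \<Longrightarrow> continuous_on S (\<lambda>x. iv (a x))"
  using continuous_on_compose2[OF continuous_iv, of S a] by simp

lemma C_inf_mul:
  assumes "topological_atlas B" "smooth_map B A a" "smooth_map B A b" "f \<in> C_inf A"
  shows "(\<lambda>x. f (a x \<cdot> b x)) \<in> C_inf B"
proof -
  have "smooth_map B A (\<lambda>x. (\<lambda>(x, y). x \<cdot> y) (a x, b x))"
    by (rule smooth_map_compose[OF assms(1) ta2 ta smooth_map_Pair[OF assms(1) ta ta assms(2,3)] smooth_mul])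
  then show ?thesis using C_inf_compose[OF assms(1) ta _ assms(4)] by simp
qed

lemma C_inf_left_translate: "f \<in> C_inf A \<Longrightarrow> (\<lambda>x. f (a \<cdot> x)) \<in> C_inf A"
  by (rule C_inf_mul[OF ta smooth_map_const[OF ta] smooth_map_id[OF sa]])

lemma C_inf_iv: "f \<in> C_inf A \<Longrightarrow> (\<lambda>x. f (iv x)) \<in> C_inf A"
  by (rule C_inf_compose[OF ta ta smooth_iv])

lemma smooth_iv_comp: "topological_atlas B \<Longrightarrow> smooth_map B A a \<Longrightarrow> smooth_map B A (\<lambda>x. iv (a x))"
  by (rule smooth_map_compose[OF _ ta ta _ smooth_iv])

lemma C_inf_diagonal: "H \<in> C_inf (prod_atlas A A) \<Longrightarrow> (\<lambda>x. H (x, x)) \<in> C_inf A"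
  by (rule C_inf_compose[OF ta ta2 smooth_map_Pair[OF ta ta ta smooth_map_id[OF sa] smooth_map_id[OF sa]]])

lemma sets_mu: "sets \<mu> = sets borel" and space_mu [simp]: "space \<mu> = UNIV"
  and left_invariant: "distr \<mu> borel (\<lambda>x. a \<cdot> x) = \<mu>"
proof -
  show s: "sets \<mu> = sets borel" using haar by (simp add: normalized_haar_def)
  show "space \<mu> = UNIV" using sets_eq_imp_space_eq[OF s] by simp
  show "distr \<mu> borel (\<lambda>x. a \<cdot> x) = \<mu>" using haar by (simp add: normalized_haar_def)
qed

lemma emeasure_UNIV: "emeasure \<mu> UNIV = 1"
  using haar by (simp add: normalized_haar_def)

sublocale compact_measure \<mu> UNIV
proof (intro compact_measure.intro compact_measure_axioms.intro)
  show "finite_measure \<mu>" by (rule finite_measureI) (simp add: emeasure_UNIV)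
  show "sets \<mu> = sets (restrict_space borel UNIV)" by (simp add: sets_mu restrict_UNIV)
qed (rule compact_G)

lemma measure_UNIV: "measure \<mu> UNIV = 1"
  by (simp add: measure_def emeasure_UNIV)

lemma measurable_mu: "borel_measurable \<mu> = borel_measurable borel"
  by (rule measurable_cong_sets[OF sets_mu refl])

lemma sets_mu2: "sets (\<mu> \<Otimes>\<^sub>M \<mu>) = sets (borel :: ('g \<times> 'g) measure)"
  using sets_pair_measure_cong[OF sets_mu sets_mu] by (simp only: borel_prod)

lemma measurable_mu2: "borel_measurable (\<mu> \<Otimes>\<^sub>M \<mu>) = borel_measurable borel"
  by (rule measurable_cong_sets[OF sets_mu2 refl])

lemma measurable_translations [measurable]:
  "(\<lambda>x. a \<cdot> x) \<in> borel_measurable borel" "(\<lambda>x. x \<cdot> a) \<in> borel_measurable borel" "(\<lambda>x. iv x) \<in> borel_measurable borel"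
  by (intro borel_measurable_continuous_onI continuous_intros)+

sublocale pair_sigma_finite \<mu> \<mu> ..

text \<open>The inverse image of Haar measure is again Haar measure: integrate \<open>f(y\<^sup>-\<^sup>1 x)\<close> over both
  variables in the two possible orders.  Hence Haar measure is also right-invariant.\<close>

lemma inverse_invariant: "distr \<mu> borel (\<lambda>x. iv x) = \<mu>"
proof (rule measure_eqI)
  fix B assume "B \<in> sets (distr \<mu> borel (\<lambda>x. iv x))"
  then have B: "B \<in> sets borel" by simp
  define f where "f x = (indicator B x :: ennreal)" for x
  have f [measurable]: "f \<in> borel_measurable borel" using B by (simp add: f_def[abs_def])
  have tr: "(\<integral>\<^sup>+ x. h (a \<cdot> x) \<partial>\<mu>) = (\<integral>\<^sup>+ x. h x \<partial>\<mu>)" if "h \<in> borel_measurable borel" for h :: "'g \<Rightarrow> ennreal" and a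
    using that by (subst (2) left_invariant[of a, symmetric]) (simp add: nn_integral_distr measurable_mu)
  have m: "(\<lambda>(y, x). f (iv y \<cdot> x)) \<in> borel_measurable (\<mu> \<Otimes>\<^sub>M \<mu>)"
    unfolding measurable_mu2 case_prod_beta
    by (rule measurable_compose[OF borel_measurable_continuous_onI f]) (intro continuous_intros)
  have fi: "(\<lambda>x. f (iv x)) \<in> borel_measurable borel" by measurable
  have "(\<integral>\<^sup>+ x. f x \<partial>\<mu>) = (\<integral>\<^sup>+ y. (\<integral>\<^sup>+ x. f (iv y \<cdot> x) \<partial>\<mu>) \<partial>\<mu>)"
    by (simp add: tr[OF f] emeasure_UNIV)
  also have "\<dots> = (\<integral>\<^sup>+ x. (\<integral>\<^sup>+ y. f (iv y \<cdot> x) \<partial>\<mu>) \<partial>\<mu>)"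
    using Fubini'[OF m] by simp
  also have "\<dots> = (\<integral>\<^sup>+ x. (\<integral>\<^sup>+ y. f (iv (iv x \<cdot> y)) \<partial>\<mu>) \<partial>\<mu>)" by simp
  also have "\<dots> = (\<integral>\<^sup>+ x. (\<integral>\<^sup>+ y. f (iv y) \<partial>\<mu>) \<partial>\<mu>)" by (subst tr[OF fi]) (rule refl)
  also have "\<dots> = (\<integral>\<^sup>+ y. f (iv y) \<partial>\<mu>)" by (simp add: emeasure_UNIV)
  also have "\<dots> = (\<integral>\<^sup>+ y. f y \<partial>distr \<mu> borel (\<lambda>x. iv x))"
    by (subst nn_integral_distr) (simp_all add: measurable_mu)
  finally show "emeasure (distr \<mu> borel (\<lambda>x. iv x)) B = emeasure \<mu> B"
    using B by (simp add: f_def sets_mu)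
qed (simp add: sets_mu)

lemma haar_integral_left:
  fixes f :: "'g \<Rightarrow> 'b::{banach, second_countable_topology}"
  assumes "f \<in> borel_measurable borel"
  shows "(LINT x|\<mu>. f (a \<cdot> x)) = integral\<^sup>L \<mu> f"
  using assms by (subst (2) left_invariant[of a, symmetric]) (simp add: integral_distr measurable_mu)

lemma haar_integral_iv:
  fixes f :: "'g \<Rightarrow> 'b::{banach, second_countable_topology}"
  assumes "f \<in> borel_measurable borel"
  shows "(LINT x|\<mu>. f (iv x)) = integral\<^sup>L \<mu> f"
  using assms by (subst (2) inverse_invariant[symmetric]) (simp add: integral_distr measurable_mu)

lemma haar_integral_right:
  fixes f :: "'g \<Rightarrow> 'b::{banach, second_countable_topology}"
  assumes [measurable]: "f \<in> borel_measurable borel"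
  shows "(LINT x|\<mu>. f (x \<cdot> a)) = integral\<^sup>L \<mu> f"
proof -
  have "(LINT x|\<mu>. f (x \<cdot> a)) = (LINT x|\<mu>. f (iv x \<cdot> a))"
    using haar_integral_iv[of "\<lambda>x. f (x \<cdot> a)"] by simp
  also have "\<dots> = (LINT x|\<mu>. f (iv (iv a \<cdot> x)))" by simp
  also have "\<dots> = (LINT x|\<mu>. f (iv x))" using haar_integral_left[of "\<lambda>x. f (iv x)" "iv a"] by simp
  finally show ?thesis using haar_integral_iv[of f] by simp
qed

text \<open>Finitely many translates of a non-empty open set cover the group.\<close>

lemma open_null_empty:
  assumes "open U" "emeasure \<mu> U = 0"
  shows "U = {}"
proof (rule ccontr)
  assume "U \<noteq> {}"
  then obtain u where u: "u \<in> U" by auto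
  let ?V = "\<lambda>a. (\<lambda>x. a \<cdot> x) -` U"
  have oV: "open (?V a)" for a
    by (rule open_vimage[OF assms(1)]) (intro continuous_intros)
  have null: "?V a \<in> null_sets \<mu>" for a
  proof -
    have "emeasure \<mu> (?V a) = emeasure (distr \<mu> borel (\<lambda>x. a \<cdot> x)) U"
      using assms(1) by (subst emeasure_distr) (simp_all add: measurable_mu)
    then show ?thesis using assms(2) oV by (simp add: left_invariant null_sets_def sets_mu)
  qed
  have "x \<in> ?V (u \<cdot> iv x)" for x using u by simp
  then have "(UNIV :: 'g set) \<subseteq> (\<Union>a\<in>UNIV. ?V a)" by blast
  obtain C where C: "finite C" "UNIV \<subseteq> (\<Union>a\<in>C. ?V a)"
    by (rule compactE_image[OF compact_G oV \<open>UNIV \<subseteq> (\<Union>a\<in>UNIV. ?V a)\<close>])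
  have "(\<Union>a\<in>C. ?V a) \<in> null_sets \<mu>" using C(1) null by (intro null_sets_UN') (auto intro: countable_finite)
  moreover have "(\<Union>a\<in>C. ?V a) = UNIV" using C(2) by auto
  ultimately show False using emeasure_UNIV by (simp add: null_sets_def)
qed

lemma AE_continuous_eq:
  fixes f h :: "'g \<Rightarrow> 'b::real_normed_vector"
  assumes "continuous_on UNIV f" "continuous_on UNIV h" "AE x in \<mu>. f x = h x"
  shows "f = h"
proof -
  have o: "open {x. f x \<noteq> h x}" using assms(1,2) by (rule open_Collect_neq)
  from assms(3) obtain N where N: "{x \<in> space \<mu>. \<not> f x = h x} \<subseteq> N" "emeasure \<mu> N = 0" "N \<in> sets \<mu>"
    by (rule AE_E)
  have "emeasure \<mu> {x. f x \<noteq> h x} \<le> emeasure \<mu> N" using N by (intro emeasure_mono) auto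
  then have "emeasure \<mu> {x. f x \<noteq> h x} = 0" using N(2) by simp
  from open_null_empty[OF o this] show ?thesis by auto
qed

lemma continuous_integral_zero:
  assumes "continuous_on UNIV f" "\<And>x. 0 \<le> f x" "integral\<^sup>L \<mu> f = (0::real)"
  shows "f = (\<lambda>x. 0)"
proof (rule AE_continuous_eq[OF assms(1) continuous_on_const])
  show "AE x in \<mu>. f x = 0"
    using integral_nonneg_eq_0_iff_AE[OF integrable_continuous[OF assms(1)]] assms(2,3) by simp
qed

section \<open>Left-invariant vector fields\<close>

definition base_chart :: "('g, 'e) chart" where
  "base_chart = (SOME c. c \<in> A \<and> e \<in> fst c)"

abbreviation "U0 \<equiv> fst base_chart"
abbreviation "\<phi>0 \<equiv> snd base_chart"

lemma base_chart: "(U0, \<phi>0) \<in> A" "e \<in> U0"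
proof -
  obtain U \<phi> where "(U, \<phi>) \<in> A" "e \<in> U" by (rule atlas_chart_at[OF ta])
  then have "\<exists>c. c \<in> A \<and> e \<in> fst c" by (intro exI[of _ "(U, \<phi>)"]) simp
  from someI_ex[OF this] show "(U0, \<phi>0) \<in> A" "e \<in> U0" by (simp_all add: base_chart_def)
qed

text \<open>The left-invariant field whose value at the identity is the directional derivative along \<open>v\<close>.\<close>

definition inv_field :: "'e \<Rightarrow> 'g vf" where
  "inv_field v f = (if f \<in> C_inf A then \<lambda>x. chart_deriv U0 \<phi>0 e v (\<lambda>y. f (x \<cdot> y)) else (\<lambda>x. 0))"

lemma inv_field_apply: "f \<in> C_inf A \<Longrightarrow> inv_field v f x = chart_deriv U0 \<phi>0 e v (\<lambda>y. f (x \<cdot> y))"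
  by (simp add: inv_field_def)

lemma C_inf_mul2: "f \<in> C_inf A \<Longrightarrow> (\<lambda>x. f (fst x \<cdot> snd x)) \<in> C_inf (prod_atlas A A)"
  by (rule C_inf_mul[OF ta2 smooth_map_fst[OF sa ta] smooth_map_snd[OF ta sa]])

lemma inv_field_vector_field: "inv_field v \<in> vector_fields A"
proof (rule vector_fieldsI)
  fix f :: "'g \<Rightarrow> real" assume f: "f \<in> C_inf A"
  have "(\<lambda>x. chart_deriv U0 \<phi>0 e v (\<lambda>y. (\<lambda>x. f (fst x \<cdot> snd x)) (x, y))) \<in> C_inf A"
    by (rule C_inf_chart_deriv[OF ta sa C_inf_mul2[OF f] base_chart])
  then show "inv_field v f \<in> C_inf A" using f by (simp add: inv_field_def)
next
  fix y
  note d = derivation_at_chart_deriv[OF ta base_chart, of v]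
  show "derivation_at A y (\<lambda>f. inv_field v f y)"
    unfolding derivation_at_def
    by (simp add: inv_field_apply C_inf_add[OF ta] C_inf_mult[OF ta] C_inf_mult[OF ta C_inf_const[OF ta]]
        derivation_atD[OF d C_inf_left_translate C_inf_left_translate])
qed (simp add: inv_field_def)

lemma inv_field_left_invariant: "inv_field v \<in> left_invariant_vfs G A"
  unfolding left_invariant_vfs_def
  by (simp add: inv_field_vector_field inv_field_apply C_inf_left_translate fun_eq_iff)

lemma inv_field_expand:
  assumes "f \<in> C_inf A"
  shows "inv_field v f x = (\<Sum>b\<in>Basis. (v \<bullet> b) * inv_field b f x)"
  unfolding inv_field_apply[OF assms]
  by (rule linear_basis_expansion[OF linear_chart_deriv[OF ta base_chart C_inf_left_translate[OF assms]],
        unfolded real_scaleR_def])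

lemma linear_inv_field: "f \<in> C_inf A \<Longrightarrow> linear (\<lambda>v. inv_field v f x)"
  using linear_chart_deriv[OF ta base_chart C_inf_left_translate, of f x] by (simp add: inv_field_apply)

lemma left_invariantD:
  assumes "X \<in> left_invariant_vfs G A"
  shows "X \<in> vector_fields A" "f \<in> C_inf A \<Longrightarrow> X (\<lambda>x. f (a \<cdot> x)) = (\<lambda>x. X f (a \<cdot> x))"
  using assms by (auto simp: left_invariant_vfs_def)

text \<open>A left-invariant field is determined by its value at the identity, which is a directional
  derivative in the base chart.\<close>

lemma left_invariant_eq_inv_field:
  assumes "X \<in> left_invariant_vfs G A"
  obtains v where "X = inv_field v"
proof -
  note X = left_invariantD[OF assms]
  obtain v where v: "\<And>f. f \<in> C_inf A \<Longrightarrow> X f e = chart_deriv U0 \<phi>0 e v f"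
    by (rule derivation_at_eq_chart_deriv[OF sa base_chart derivation_at_vector_field[OF X(1)]]) blast
  have "X f = inv_field v f" for f
  proof (cases "f \<in> C_inf A")
    case True
    have "X f x = inv_field v f x" for x
      using v[OF C_inf_left_translate[OF True, of x]] fun_cong[OF X(2)[OF True, of x], of e]
      by (simp add: inv_field_apply[OF True])
    then show ?thesis by blast
  next
    case False
    then show ?thesis using vector_fieldsD(2)[OF X(1)] by (simp add: inv_field_def)
  qed
  then show thesis using that by blast
qed

text \<open>A left-invariant field generates right translations, which preserve the integral:
  differentiate \<open>\<integral> f(x y) dx\<close>, which does not depend on \<open>y\<close>, at the identity.\<close>

lemma integral_inv_field:
  assumes "f \<in> C_inf A"
  shows "integral\<^sup>L \<mu> (inv_field v f) = 0"
proof -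
  let ?H = "\<lambda>q x. f (x \<cdot> inv_into U0 \<phi>0 q)"
  let ?D = "\<lambda>p x. frechet_derivative (\<lambda>q. ?H q x) (at p)"
  have o: "open (\<phi>0 ` U0)" by (rule chart_image_open[OF ta base_chart(1)])
  have "(\<lambda>x. f (snd x \<cdot> fst x)) \<in> C_inf (prod_atlas A A)"
    by (rule C_inf_mul[OF ta2 smooth_map_snd[OF ta sa] smooth_map_fst[OF sa ta] assms])
  from parametric_Ck_C_inf[OF ta ta this base_chart(1), of "Suc 0"]
  have "parametric_Ck (Suc 0) (\<phi>0 ` U0) UNIV ?H" by simp
  note P' = this[unfolded parametric_Ck.simps]
  have "((\<lambda>q. integral\<^sup>L \<mu> (?H q)) has_derivative (\<lambda>v. integral\<^sup>L \<mu> (\<lambda>x. ?D (\<phi>0 e) x v))) (at (\<phi>0 e))"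
  proof (rule has_derivative_parametric_integral[OF o])
    have "\<forall>z\<in>UNIV. \<forall>p\<in>\<phi>0 ` U0. (\<lambda>p. ?H p z) differentiable (at p)"
      using P' by (elim conjE)
    then show "((\<lambda>p. ?H p z) has_derivative ?D p z) (at p)" if "p \<in> \<phi>0 ` U0" for p z
      using that unfolding frechet_derivative_works by blast
    show "continuous_on (\<phi>0 ` U0 \<times> UNIV) (\<lambda>x. ?H (fst x) (snd x))" using P' by (elim conjE)
    show "continuous_on (\<phi>0 ` U0 \<times> UNIV) (\<lambda>x. ?D (fst x) (snd x) v)" for v using P' by (elim conjE allE)
    show "\<phi>0 e \<in> \<phi>0 ` U0" using base_chart(2) by (rule imageI)
  qed
  moreover have "integral\<^sup>L \<mu> (?H q) = integral\<^sup>L \<mu> f" for q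
    by (rule haar_integral_right) (rule borel_measurable_continuous_onI[OF C_inf_continuous[OF ta assms]])
  ultimately have "((\<lambda>q. integral\<^sup>L \<mu> f) has_derivative (\<lambda>v. integral\<^sup>L \<mu> (\<lambda>x. ?D (\<phi>0 e) x v))) (at (\<phi>0 e))"
    by simp
  from has_derivative_unique[OF this has_derivative_const]
  have "integral\<^sup>L \<mu> (\<lambda>x. ?D (\<phi>0 e) x v) = 0" by meson
  then show ?thesis using assms by (simp add: inv_field_def chart_deriv_def)
qed

text \<open>Integrate the Leibniz rule.\<close>

lemma inv_field_skew:
  assumes "f \<in> C_inf A" "h \<in> C_inf A"
  shows "(LINT x|\<mu>. inv_field v f x * h x) = - (LINT x|\<mu>. f x * inv_field v h x)"
proof -
  note V = vector_fieldsD[OF inv_field_vector_field[of v]]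
  have i: "integrable \<mu> (\<lambda>x. inv_field v f x * h x)" "integrable \<mu> (\<lambda>x. f x * inv_field v h x)"
    by (rule integrable_continuous[OF C_inf_continuous[OF ta C_inf_mult[OF ta V(1)[OF assms(1)] assms(2)]]],
        rule integrable_continuous[OF C_inf_continuous[OF ta C_inf_mult[OF ta assms(1) V(1)[OF assms(2)]]]])
  have "integral\<^sup>L \<mu> (\<lambda>x. inv_field v f x * h x + f x * inv_field v h x) = 0"
    using integral_inv_field[OF C_inf_mult[OF ta assms], of v] V(5)[OF assms] by simp
  then show ?thesis using i by simp
qed

text \<open>The left-invariant fields form a global frame.  The coefficients at \<open>x\<close> are read off after
  translating \<open>x\<close> to the identity, which makes their smoothness evident.\<close>

lemma vector_field_frame:
  assumes Z: "Z \<in> vector_fields A"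
  obtains c where "\<And>b. c b \<in> C_inf A"
    "\<And>f x. f \<in> C_inf A \<Longrightarrow> Z f x = (\<Sum>b\<in>Basis. c b x * inv_field b f x)"
proof -
  obtain \<beta> N where \<beta>: "\<And>b. \<beta> b \<in> C_inf A" "e \<in> N"
    "\<And>b x v. x \<in> N \<Longrightarrow> chart_deriv U0 \<phi>0 x v (\<beta> b) = v \<bullet> b"
    by (rule chart_coordinates[OF sa base_chart]) blast
  define c where "c b x = Z (\<lambda>y. \<beta> b (iv x \<cdot> y)) x" for b x
  show thesis
  proof (rule that[of c])
    fix b
    have "(\<lambda>x. \<beta> b (iv (fst x) \<cdot> snd x)) \<in> C_inf (prod_atlas A A)"
      by (rule C_inf_mul[OF ta2 smooth_iv_comp[OF ta2 smooth_map_fst[OF sa ta]] smooth_map_snd[OF ta sa] \<beta>(1)])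
    from C_inf_diagonal[OF C_inf_vector_field_slice[OF ta sa this Z]] show "c b \<in> C_inf A"
      by (simp add: c_def[abs_def])
  next
    fix f :: "'g \<Rightarrow> real" and x assume f: "f \<in> C_inf A"
    have d: "derivation_at A e (\<lambda>f. Z (\<lambda>y. f (iv x \<cdot> y)) x)"
      unfolding derivation_at_def using derivation_atD[OF derivation_at_vector_field[OF Z, of x]
          C_inf_left_translate[of _ "iv x"] C_inf_left_translate[of _ "iv x"]] by simp
    obtain w where w: "\<And>f. f \<in> C_inf A \<Longrightarrow> Z (\<lambda>y. f (iv x \<cdot> y)) x = chart_deriv U0 \<phi>0 e w f"
      by (rule derivation_at_eq_chart_deriv[OF sa base_chart d]) blast
    have wb: "c b x = w \<bullet> b" for b using w[OF \<beta>(1)] \<beta>(3)[OF \<beta>(2)] by (simp add: c_def)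
    have "Z f x = inv_field w f x"
      using w[OF C_inf_left_translate[OF f, of x]] by (simp add: inv_field_apply[OF f])
    then show "Z f x = (\<Sum>b\<in>Basis. c b x * inv_field b f x)"
      using inv_field_expand[OF f, of w x] by (simp add: wb)
  qed
qed

end

section \<open>The Laplacian as a sum of squares\<close>

text \<open>Gram-Schmidt, taking in the basis vectors one at a time.\<close>

lemma orthonormal_family:
  fixes B :: "'e::euclidean_space \<Rightarrow> 'e \<Rightarrow> real"
  assumes bil: "bilinear B" and sym: "\<And>v w. B v w = B w v" and pos: "\<And>v. v \<noteq> 0 \<Longrightarrow> B v v > 0"
  shows "\<exists>V. finite V \<and> (\<forall>v\<in>V. \<forall>w\<in>V. B v w = (if v = w then 1 else 0)) \<and>
    (\<forall>x. x = (\<Sum>v\<in>V. B x v *\<^sub>R v))"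
proof -
  have lin: "linear (\<lambda>x. B x v)" for v using bil by (simp add: bilinear_def)
  have linr: "linear (B v)" for v using bil by (simp add: bilinear_def)
  have "\<exists>V. finite V \<and> (\<forall>v\<in>V. \<forall>w\<in>V. B v w = (if v = w then 1 else 0)) \<and>
    (\<forall>x\<in>span S. x = (\<Sum>v\<in>V. B x v *\<^sub>R v))" if "finite S" for S
    using that
  proof (induction S)
    case empty
    then show ?case by (intro exI[of _ "{}"]) simp
  next
    case (insert a S)
    then obtain V where V: "finite V" "\<And>v w. v \<in> V \<Longrightarrow> w \<in> V \<Longrightarrow> B v w = (if v = w then 1 else 0)"
      "\<And>x. x \<in> span S \<Longrightarrow> x = (\<Sum>v\<in>V. B x v *\<^sub>R v)" by metis
    have Bsum: "B (\<Sum>v\<in>V. c v *\<^sub>R v) w = (\<Sum>v\<in>V. c v * B v w)" for c w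
      by (simp add: linear_sum[OF lin] linear_scale[OF lin])
    have subsp: "subspace {x. x = (\<Sum>v\<in>W. B x v *\<^sub>R v)}" for W
    proof (rule subspaceI)
      show "0 \<in> {x. x = (\<Sum>v\<in>W. B x v *\<^sub>R v)}" by (simp add: linear_0[OF lin])
      show "x + y \<in> {x. x = (\<Sum>v\<in>W. B x v *\<^sub>R v)}"
        if "x \<in> {x. x = (\<Sum>v\<in>W. B x v *\<^sub>R v)}" "y \<in> {x. x = (\<Sum>v\<in>W. B x v *\<^sub>R v)}" for x y
        using that by (simp add: linear_add[OF lin] scaleR_add_left sum.distrib)
      show "c *\<^sub>R x \<in> {x. x = (\<Sum>v\<in>W. B x v *\<^sub>R v)}" if "x \<in> {x. x = (\<Sum>v\<in>W. B x v *\<^sub>R v)}" for c x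
      proof -
        have "(\<Sum>v\<in>W. B (c *\<^sub>R x) v *\<^sub>R v) = c *\<^sub>R (\<Sum>v\<in>W. B x v *\<^sub>R v)"
          by (simp add: linear_scale[OF lin] scaleR_sum_right)
        then show ?thesis using that by simp
      qed
    qed
    define u where "u = a - (\<Sum>v\<in>V. B a v *\<^sub>R v)"
    have uV: "B u w = 0" if "w \<in> V" for w
    proof -
      have "(\<Sum>v\<in>V. B a v * B v w) = (\<Sum>v\<in>V. if v = w then B a v else 0)"
        by (rule sum.cong) (use V(2) that in auto)
      then show ?thesis using that V(1) by (simp add: u_def linear_diff[OF lin] Bsum)
    qed
    have "\<exists>W. finite W \<and> (\<forall>v\<in>W. \<forall>w\<in>W. B v w = (if v = w then 1 else 0)) \<and>
        (\<forall>x\<in>insert a S. x = (\<Sum>v\<in>W. B x v *\<^sub>R v))"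
    proof (cases "u = 0")
      case True
      then show ?thesis using V span_base[of _ S] by (intro exI[of _ V]) (auto simp: u_def)
    next
      case False
      define n where "n = (1 / sqrt (B u u)) *\<^sub>R u"
      have Buu: "B u u > 0" using pos[OF False] .
      have nV: "B n w = 0" if "w \<in> V" for w using uV[OF that] by (simp add: n_def linear_scale[OF lin])
      have un: "B u n = sqrt (B u u)"
        using Buu by (simp add: n_def linear_scale[OF linr] real_div_sqrt)
      have nn: "B n n = 1"
      proof -
        have "B n n = (1 / sqrt (B u u)) * B u n" by (subst (1) n_def) (simp add: linear_scale[OF lin])
        then show ?thesis using Buu un by simp
      qed
      have nV': "B w n = 0" if "w \<in> V" for w using nV[OF that] by (simp add: sym[of w n])
      have nin: "n \<notin> V" using nV nn by force
      have rep: "x = (\<Sum>v\<in>insert n V. B x v *\<^sub>R v)" if "x \<in> insert a S" for x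
      proof (cases "x = a")
        case True
        have "B u n = B a n" by (simp add: u_def linear_diff[OF lin] Bsum nV')
        then have an: "B a n *\<^sub>R n = u" using un Buu by (simp add: n_def)
        have "(\<Sum>v\<in>insert n V. B a v *\<^sub>R v) = u + (\<Sum>v\<in>V. B a v *\<^sub>R v)"
          using V(1) nin by (simp add: an)
        then show ?thesis using True by (simp add: u_def)
      next
        case False
        then have xs: "x = (\<Sum>v\<in>V. B x v *\<^sub>R v)" using that by (intro V(3) span_base) auto
        have "B x n = B (\<Sum>v\<in>V. B x v *\<^sub>R v) n" by (rule arg_cong[OF xs, of "\<lambda>y. B y n"])
        then have xn: "B x n = 0" by (simp add: Bsum nV')
        show ?thesis by (rule trans[OF xs]) (simp add: V(1) nin xn)
      qed
      show ?thesis
      proof (intro exI[of _ "insert n V"] conjI ballI)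
        show "B v w = (if v = w then 1 else 0)" if "v \<in> insert n V" "w \<in> insert n V" for v w
          using that V(2)[of v w] nV nV' nn nin by auto
        show "x = (\<Sum>v\<in>insert n V. B x v *\<^sub>R v)" if "x \<in> insert a S" for x by (rule rep[OF that])
      qed (simp add: V(1))
    qed
    then obtain W where W: "finite W" "\<forall>v\<in>W. \<forall>w\<in>W. B v w = (if v = w then 1 else 0)"
      "\<forall>x\<in>insert a S. x = (\<Sum>v\<in>W. B x v *\<^sub>R v)" by (elim exE conjE)
    have "span (insert a S) \<subseteq> {x. x = (\<Sum>v\<in>W. B x v *\<^sub>R v)}"
      by (rule span_minimal[OF _ subsp]) (use W(3) in auto)
    then show ?case by (intro exI[of _ W] conjI W(1,2) ballI) blast
  qed
  from this[OF finite_Basis] show ?thesis by simp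
qed

locale lie_metric = lie_haar G A \<mu>
  for G :: "'g::{t2_space, second_countable_topology} monoid"
    and A :: "('g, 'e::euclidean_space) chart set" and \<mu> :: "'g measure" +
  fixes g :: "'g metric_tensor"
  assumes bi: "bi_invariant_metric G A g"
begin

lemma riemannian: "riemannian_metric A g"
  using bi by (simp add: bi_invariant_metric_def)

lemma g_sym: "X \<in> vector_fields A \<Longrightarrow> Y \<in> vector_fields A \<Longrightarrow> g X Y = g Y X"
  and g_smooth: "X \<in> vector_fields A \<Longrightarrow> Y \<in> vector_fields A \<Longrightarrow> g X Y \<in> C_inf A"
  and g_add: "X \<in> vector_fields A \<Longrightarrow> Y \<in> vector_fields A \<Longrightarrow> Z \<in> vector_fields A \<Longrightarrow>
     g (\<lambda>f x. X f x + Y f x) Z = (\<lambda>x. g X Z x + g Y Z x)"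
  and g_scale: "h \<in> C_inf A \<Longrightarrow> X \<in> vector_fields A \<Longrightarrow> Z \<in> vector_fields A \<Longrightarrow>
     g (\<lambda>f x. h x * X f x) Z = (\<lambda>x. h x * g X Z x)"
  and g_nonneg: "X \<in> vector_fields A \<Longrightarrow> g X X x \<ge> 0"
  and g_definite: "X \<in> vector_fields A \<Longrightarrow> g X X x = 0 \<Longrightarrow> X f x = 0"
  using riemannian unfolding riemannian_metric_def by blast+

lemma vf_add: "X \<in> vector_fields A \<Longrightarrow> Y \<in> vector_fields A \<Longrightarrow> (\<lambda>f x. X f x + Y f x) \<in> vector_fields A"
proof (rule vector_fieldsI)
  fix y assume XY: "X \<in> vector_fields A" "Y \<in> vector_fields A"
  show "derivation_at A y (\<lambda>f. X f y + Y f y)"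
    unfolding derivation_at_def
    by (simp add: vector_fieldsD(3-5)[OF XY(1)] vector_fieldsD(3-5)[OF XY(2)] algebra_simps)
qed (auto simp: C_inf_add[OF ta] vector_fieldsD)

lemma vf_scale: "h \<in> C_inf A \<Longrightarrow> X \<in> vector_fields A \<Longrightarrow> (\<lambda>f x. h x * X f x) \<in> vector_fields A"
proof (rule vector_fieldsI)
  fix y assume X: "X \<in> vector_fields A"
  show "derivation_at A y (\<lambda>f. h y * X f y)"
    unfolding derivation_at_def
    by (simp add: vector_fieldsD(3-5)[OF X] algebra_simps)
qed (auto simp: C_inf_mult[OF ta] vector_fieldsD)

lemma vf_zero: "(\<lambda>f x. 0) \<in> vector_fields A"
  using vf_scale[OF C_inf_const[OF ta, of 0] inv_field_vector_field] by simp

lemma vf_sum: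
  assumes "finite I" "\<And>i. i \<in> I \<Longrightarrow> z i \<in> C_inf A" "\<And>i. i \<in> I \<Longrightarrow> X i \<in> vector_fields A"
  shows "(\<lambda>f x. \<Sum>i\<in>I. z i x * X i f x) \<in> vector_fields A"
  using assms by (induction I) (auto simp: vf_zero intro!: vf_add[of "\<lambda>f x. z _ x * X _ f x"] vf_scale)

lemma g_sum:
  assumes "finite I" "\<And>i. i \<in> I \<Longrightarrow> z i \<in> C_inf A" "\<And>i. i \<in> I \<Longrightarrow> X i \<in> vector_fields A" "Z \<in> vector_fields A"
  shows "g (\<lambda>f x. \<Sum>i\<in>I. z i x * X i f x) Z = (\<lambda>x. \<Sum>i\<in>I. z i x * g (X i) Z x)"
  using assms(1-3)
proof (induction I)
  case empty
  show ?case using g_scale[OF C_inf_const[OF ta, of 0] vf_zero assms(4)] by simp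
next
  case (insert i I)
  have "g (\<lambda>f x. z i x * X i f x + (\<Sum>i\<in>I. z i x * X i f x)) Z =
      (\<lambda>x. g (\<lambda>f x. z i x * X i f x) Z x + g (\<lambda>f x. \<Sum>i\<in>I. z i x * X i f x) Z x)"
    by (rule g_add) (use insert assms(4) in \<open>auto intro!: vf_scale vf_sum\<close>)
  then show ?case using insert g_scale[of "z i" "X i" Z] assms(4) by simp
qed

lemma inv_field_add: "inv_field (v + w) = (\<lambda>f x. inv_field v f x + inv_field w f x)"
  using linear_add[OF linear_inv_field] by (fastforce simp: inv_field_def fun_eq_iff)

lemma inv_field_scale: "inv_field (r *\<^sub>R v) = (\<lambda>f x. r * inv_field v f x)"
  using linear_scale[OF linear_inv_field] by (fastforce simp: inv_field_def fun_eq_iff)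

lemma inj_left_translate: "inv_into UNIV (\<lambda>x. a \<cdot> x) y = iv a \<cdot> y"
proof (rule inv_into_f_eq)
  show "inj (\<lambda>x. a \<cdot> x)" by (rule injI) (metis grp(9))
qed auto

lemma pushforward_inv_field: "pushforward (\<lambda>x. a \<cdot> x) (inv_field v) = inv_field v"
proof (intro ext)
  fix f x
  have "inv_field v (\<lambda>x. f (a \<cdot> x)) (iv a \<cdot> x) = inv_field v f x"
  proof (cases "f \<in> C_inf A")
    case True
    then show ?thesis using left_invariantD(2)[OF inv_field_left_invariant True] by simp
  next
    case False
    have "(\<lambda>x. f (a \<cdot> x)) \<notin> C_inf A"
    proof
      assume "(\<lambda>x. f (a \<cdot> x)) \<in> C_inf A"
      from C_inf_left_translate[OF this, of "iv a"] show False using False by simp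
    qed
    then show ?thesis using False by (simp add: inv_field_def)
  qed
  then show "pushforward (\<lambda>x. a \<cdot> x) (inv_field v) f x = inv_field v f x"
    by (simp add: pushforward_def comp_def inj_left_translate)
qed

text \<open>Left translations are isometries and preserve the left-invariant fields.\<close>

lemma g_inv_field_const: "g (inv_field v) (inv_field w) x = g (inv_field v) (inv_field w) e"
proof -
  have "isometry_of A g (\<lambda>y. x \<cdot> y)" using bi by (simp add: bi_invariant_metric_def)
  then have "g (pushforward (\<lambda>y. x \<cdot> y) (inv_field v)) (pushforward (\<lambda>y. x \<cdot> y) (inv_field w)) (x \<cdot> e) =
      g (inv_field v) (inv_field w) e"
    using inv_field_vector_field unfolding isometry_of_def by blast
  then show ?thesis by (simp add: pushforward_inv_field)
qed

lemma inv_field_zero_imp: "(\<And>f. inv_field v f e = 0) \<Longrightarrow> v = 0"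
proof (rule euclidean_eqI)
  fix b :: 'e
  assume z: "\<And>f. inv_field v f e = 0"
  obtain \<beta> N where \<beta>: "\<And>b. \<beta> b \<in> C_inf A" "e \<in> N"
    "\<And>b x v. x \<in> N \<Longrightarrow> chart_deriv U0 \<phi>0 x v (\<beta> b) = v \<bullet> b"
    by (rule chart_coordinates[OF sa base_chart]) blast
  show "v \<bullet> b = 0 \<bullet> b" using z[of "\<beta> b"] \<beta>(3)[OF \<beta>(2), of v b] by (simp add: inv_field_apply[OF \<beta>(1)])
qed

text \<open>An orthonormal basis of the tangent space at the identity, so that the corresponding left-invariant
  fields are orthonormal at every point.\<close>

definition frame :: "'e set" where
  "frame = (SOME V. finite V \<and> (\<forall>v\<in>V. \<forall>w\<in>V. g (inv_field v) (inv_field w) e = (if v = w then 1 else 0)) \<and>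
    (\<forall>x. x = (\<Sum>v\<in>V. g (inv_field x) (inv_field v) e *\<^sub>R v)))"

lemma frame: "finite frame"
  "v \<in> frame \<Longrightarrow> w \<in> frame \<Longrightarrow> g (inv_field v) (inv_field w) x = (if v = w then 1 else 0)"
  "u = (\<Sum>v\<in>frame. g (inv_field u) (inv_field v) e *\<^sub>R v)"
proof -
  let ?B = "\<lambda>v w. g (inv_field v) (inv_field w) e"
  note V = inv_field_vector_field
  have "linear (\<lambda>v. ?B v w)" for w
  proof (rule linearI)
    show "?B (v + v') w = ?B v w + ?B v' w" for v v'
      by (simp add: inv_field_add g_add[OF V V V])
    show "?B (r *\<^sub>R v) w = r *\<^sub>R ?B v w" for r v
      by (simp add: inv_field_scale g_scale[OF C_inf_const[OF ta] V V])
  qed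
  moreover have s: "?B v w = ?B w v" for v w by (simp add: g_sym[OF V V])
  ultimately have "bilinear ?B" unfolding bilinear_def by simp
  moreover have "?B v v > 0" if "v \<noteq> 0" for v
    using g_nonneg[OF V, of v e] g_definite[OF V, of v e] inv_field_zero_imp[of v] that by (metis less_eq_real_def)
  ultimately have "\<exists>V. finite V \<and> (\<forall>v\<in>V. \<forall>w\<in>V. ?B v w = (if v = w then 1 else 0)) \<and>
      (\<forall>x. x = (\<Sum>v\<in>V. ?B x v *\<^sub>R v))"
    using s by (intro orthonormal_family)
  note F = someI_ex[OF this, folded frame_def]
  show "finite frame" by (rule conjunct1[OF F])
  show "g (inv_field v) (inv_field w) x = (if v = w then 1 else 0)" if "v \<in> frame" "w \<in> frame"
    using conjunct1[OF conjunct2[OF F]] that g_inv_field_const[of v w x] by simp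
  show "u = (\<Sum>v\<in>frame. ?B u v *\<^sub>R v)" by (rule spec[OF conjunct2[OF conjunct2[OF F]]])
qed

lemma vector_field_orthonormal_frame:
  assumes Z: "Z \<in> vector_fields A"
  obtains z where "\<And>v. z v \<in> C_inf A" "Z = (\<lambda>f x. \<Sum>v\<in>frame. z v x * inv_field v f x)"
proof -
  obtain c where c: "\<And>b. c b \<in> C_inf A"
    "\<And>f x. f \<in> C_inf A \<Longrightarrow> Z f x = (\<Sum>b\<in>Basis. c b x * inv_field b f x)"
    by (rule vector_field_frame[OF Z]) blast
  define z where "z v x = (\<Sum>b\<in>Basis. c b x * g (inv_field b) (inv_field v) e)" for v x
  have sm: "z v \<in> C_inf A" for v
    unfolding z_def[abs_def] by (rule C_inf_sum[OF ta C_inf_mult[OF ta c(1) C_inf_const[OF ta]]])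
  have "Z f x = (\<Sum>v\<in>frame. z v x * inv_field v f x)" for f x
  proof (cases "f \<in> C_inf A")
    case True
    note lin = linear_inv_field[OF True, of x]
    have "inv_field b f x = (\<Sum>v\<in>frame. g (inv_field b) (inv_field v) e * inv_field v f x)" for b
      by (subst frame(3)[of b]) (simp only: linear_sum[OF lin] linear_scale[OF lin] real_scaleR_def)
    then have "Z f x = (\<Sum>b\<in>Basis. c b x * (\<Sum>v\<in>frame. g (inv_field b) (inv_field v) e * inv_field v f x))"
      unfolding c(2)[OF True] by (intro sum.cong refl arg_cong[where f = "(*) _"])
    also have "\<dots> = (\<Sum>b\<in>Basis. \<Sum>v\<in>frame. c b x * g (inv_field b) (inv_field v) e * inv_field v f x)"
      by (simp only: sum_distrib_left mult.assoc)
    also have "\<dots> = (\<Sum>v\<in>frame. z v x * inv_field v f x)"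
      by (subst sum.swap) (simp add: z_def sum_distrib_right)
    finally show ?thesis .
  next
    case False
    then show ?thesis using vector_fieldsD(2)[OF Z] by (simp add: inv_field_def)
  qed
  then have "Z = (\<lambda>f x. \<Sum>v\<in>frame. z v x * inv_field v f x)" by (intro ext)
  then show thesis by (rule that[of z, OF sm])
qed

text \<open>Expanding a field in the orthonormal frame shows that the sum represents the differential of \<open>f\<close>;
  definiteness of the metric gives uniqueness.\<close>

lemma gradient_eq:
  assumes f: "f \<in> C_inf A"
  shows "gradient A g f = (\<lambda>h x. \<Sum>v\<in>frame. inv_field v f x * inv_field v h x)"
  unfolding gradient_def
proof (rule the_equality)
  let ?Y = "\<lambda>h x. \<Sum>v\<in>frame. inv_field v f x * inv_field v h x"
  have Ef: "inv_field v f \<in> C_inf A" for v by (rule vector_fieldsD(1)[OF inv_field_vector_field f])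
  have Y: "?Y \<in> vector_fields A" by (rule vf_sum[OF frame(1) Ef inv_field_vector_field])
  have gY: "g ?Y Z = Z f" if Z: "Z \<in> vector_fields A" for Z
  proof -
    obtain z where z: "\<And>v. z v \<in> C_inf A" "Z = (\<lambda>f x. \<Sum>v\<in>frame. z v x * inv_field v f x)"
      by (rule vector_field_orthonormal_frame[OF Z]) blast
    have "g (inv_field v) Z x = z v x" if "v \<in> frame" for v x
    proof -
      have "g (inv_field v) Z x = g Z (inv_field v) x" using g_sym[OF inv_field_vector_field Z] by simp
      also have "\<dots> = (\<Sum>w\<in>frame. z w x * g (inv_field w) (inv_field v) x)"
        unfolding z(2) using g_sum[OF frame(1) z(1) inv_field_vector_field inv_field_vector_field] by simp
      also have "\<dots> = (\<Sum>w\<in>frame. if w = v then z w x else 0)"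
        by (rule sum.cong) (simp_all add: frame(2) that)
      finally show ?thesis using that frame(1) by simp
    qed
    moreover have "g ?Y Z x = (\<Sum>v\<in>frame. inv_field v f x * g (inv_field v) Z x)" for x
      by (rule fun_cong[OF g_sum[OF frame(1) Ef inv_field_vector_field Z]])
    ultimately show ?thesis by (subst (2) z(2)) (simp add: fun_eq_iff mult.commute)
  qed
  show "?Y \<in> vector_fields A \<and> (\<forall>Z\<in>vector_fields A. g ?Y Z = Z f)" using Y gY by blast
  fix W assume W: "W \<in> vector_fields A \<and> (\<forall>Z\<in>vector_fields A. g W Z = Z f)"
  let ?D = "\<lambda>h x. ?Y h x + (-1) * W h x"
  have mW: "(\<lambda>h x. (-1) * W h x) \<in> vector_fields A"
    by (rule vf_scale[OF C_inf_const[OF ta]]) (use W in blast)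
  have D: "?D \<in> vector_fields A" by (rule vf_add[OF Y mW])
  have "g ?D ?D x = g ?Y ?D x + (-1) * g W ?D x" for x
    using fun_cong[OF g_add[OF Y mW D], of x] fun_cong[OF g_scale[OF C_inf_const[OF ta, of "-1"] _ D, of W], of x] W by simp
  then have "g ?D ?D x = 0" for x using gY[OF D] W D by simp
  then have z: "?D h x = 0" for x h by (rule g_definite[OF D])
  have "W h x = ?Y h x" for h x using z[where h = h and x = x] by linarith
  then show "W = ?Y" by (intro ext)
qed

text \<open>The formal adjoint of a frame field is its negative, as the integral is invariant under right
  translations.\<close>

lemma laplacian_eq:
  assumes f: "f \<in> C_inf A"
  shows "laplacian A \<mu> g f = (\<lambda>x. \<Sum>v\<in>frame. inv_field v (inv_field v f) x)"
  unfolding laplacian_def divergence_def gradient_eq[OF f]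
proof (rule the_equality)
  let ?d = "\<lambda>x. \<Sum>v\<in>frame. inv_field v (inv_field v f) x"
  note V = vector_fieldsD(1)[OF inv_field_vector_field]
  have d: "?d \<in> C_inf A" by (rule C_inf_sum[OF ta V[OF V[OF f]]])
  have int: "integrable \<mu> (\<lambda>x. a x * b x)" if "a \<in> C_inf A" "b \<in> C_inf A" for a b :: "'g \<Rightarrow> real"
    by (rule integrable_continuous[OF C_inf_continuous[OF ta C_inf_mult[OF ta that]]])
  have dh: "(LINT x|\<mu>. ?d x * h x) = - (LINT x|\<mu>. (\<Sum>v\<in>frame. inv_field v f x * inv_field v h x))"
    if h: "h \<in> C_inf A" for h
    using int[OF V[OF V[OF f]] h] int[OF V[OF f] V[OF h]]
    by (simp add: sum_distrib_right inv_field_skew[OF V[OF f] h] sum_negf)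
  show "?d \<in> C_inf A \<and> (\<forall>h\<in>C_inf A. (LINT x|\<mu>. ?d x * h x) =
      - (LINT x|\<mu>. (\<Sum>v\<in>frame. inv_field v f x * inv_field v h x)))" using d dh by blast
  fix d' assume d': "d' \<in> C_inf A \<and> (\<forall>h\<in>C_inf A. (LINT x|\<mu>. d' x * h x) =
      - (LINT x|\<mu>. (\<Sum>v\<in>frame. inv_field v f x * inv_field v h x)))"
  let ?h = "\<lambda>x. d' x - ?d x"
  have h: "?h \<in> C_inf A" using d d' by (intro C_inf_diff[OF ta]) auto
  have "(LINT x|\<mu>. d' x * ?h x) = (LINT x|\<mu>. ?d x * ?h x)" using dh[OF h] d' h by simp
  then have "(LINT x|\<mu>. d' x * ?h x - ?d x * ?h x) = 0" using int[OF _ h, of d'] int[OF d h] d' by simp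
  then have "(LINT x|\<mu>. ?h x * ?h x) = 0" by (simp add: left_diff_distrib)
  from continuous_integral_zero[OF C_inf_continuous[OF ta C_inf_mult[OF ta h h]] zero_le_square this]
  have "(\<lambda>x. ?h x * ?h x) = (\<lambda>x. 0)" .
  from fun_cong[OF this] have "d' x = ?d x" for x by simp
  then show "d' = ?d" by (intro ext)
qed

end

section \<open>Square-integrable functions on a finite measure space\<close>

context finite_measure
begin

lemma square_integrable_measurable: "square_integrable M f \<Longrightarrow> f \<in> borel_measurable M"
  by (simp add: square_integrable_def)

lemma square_integrable_scale: "square_integrable M f \<Longrightarrow> square_integrable M (\<lambda>x. c * f x)"
  by (auto simp: square_integrable_def norm_mult power_mult_distrib)

lemma square_integrable_add:
  assumes "square_integrable M f" "square_integrable M h"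
  shows "square_integrable M (\<lambda>x. f x + h x)"
  unfolding square_integrable_def
proof
  note [measurable] = square_integrable_measurable[OF assms(1)] square_integrable_measurable[OF assms(2)]
  show "(\<lambda>x. f x + h x) \<in> borel_measurable M" by measurable
  show "integrable M (\<lambda>x. (cmod (f x + h x))\<^sup>2)"
  proof (rule Bochner_Integration.integrable_bound)
    show "integrable M (\<lambda>x. 2 * (cmod (f x))\<^sup>2 + 2 * (cmod (h x))\<^sup>2)"
      using assms by (simp add: square_integrable_def)
    have "(cmod (a + b))\<^sup>2 \<le> 2 * (cmod a)\<^sup>2 + 2 * (cmod b)\<^sup>2" for a b
    proof -
      have "(cmod (a + b))\<^sup>2 \<le> (cmod a + cmod b)\<^sup>2" by (intro power_mono norm_triangle_ineq) simp
      also have "\<dots> \<le> 2 * (cmod a)\<^sup>2 + 2 * (cmod b)\<^sup>2"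
        using zero_le_power2[of "cmod a - cmod b"] by (simp add: power2_eq_square algebra_simps)
      finally show ?thesis .
    qed
    then show "AE x in M. norm ((cmod (f x + h x))\<^sup>2) \<le> norm (2 * (cmod (f x))\<^sup>2 + 2 * (cmod (h x))\<^sup>2)"
      by simp
  qed measurable
qed

lemma square_integrable_diff:
  "square_integrable M f \<Longrightarrow> square_integrable M h \<Longrightarrow> square_integrable M (\<lambda>x. f x - h x)"
  using square_integrable_add[OF _ square_integrable_scale, of f h "-1"] by simp

lemma square_integrable_bounded:
  assumes "f \<in> borel_measurable M" "\<And>x. cmod (f x) \<le> B"
  shows "square_integrable M f"
  unfolding square_integrable_def
proof
  note [measurable] = assms(1)
  show "integrable M (\<lambda>x. (cmod (f x))\<^sup>2)"
  proof (rule integrable_const_bound[of _ "B\<^sup>2"])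
    show "AE x in M. norm ((cmod (f x))\<^sup>2) \<le> B\<^sup>2" using assms(2) by (simp add: power_mono)
  qed measurable
qed (rule assms(1))

lemma integrable_inner:
  assumes "square_integrable M f" "square_integrable M h"
  shows "integrable M (\<lambda>x. f x * cnj (h x))"
proof (rule Bochner_Integration.integrable_bound)
  note [measurable] = square_integrable_measurable[OF assms(1)] square_integrable_measurable[OF assms(2)]
  show "integrable M (\<lambda>x. (cmod (f x))\<^sup>2 + (cmod (h x))\<^sup>2)" using assms by (simp add: square_integrable_def)
  have [measurable]: "(\<lambda>x. cnj (h x)) \<in> borel_measurable M"
    by (rule measurable_compose[OF square_integrable_measurable[OF assms(2)]
        borel_measurable_continuous_onI[OF continuous_on_cnj[OF continuous_on_id]]])
  show "(\<lambda>x. f x * cnj (h x)) \<in> borel_measurable M" by measurable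
  have "cmod a * cmod b \<le> (cmod a)\<^sup>2 + (cmod b)\<^sup>2" for a b
    using sum_squares_bound[of "cmod a" "cmod b"] mult_nonneg_nonneg[OF norm_ge_zero norm_ge_zero, of a b] by linarith
  then show "AE x in M. norm (f x * cnj (h x)) \<le> norm ((cmod (f x))\<^sup>2 + (cmod (h x))\<^sup>2)"
    by (simp add: norm_mult)
qed

lemma integrable_square: "square_integrable M f \<Longrightarrow> integrable M f"
proof -
  assume f: "square_integrable M f"
  have "square_integrable M (\<lambda>x. 1)" by (rule square_integrable_bounded[of _ 1]) auto
  from integrable_inner[OF f this] show ?thesis by simp
qed

lemma inner_add: "square_integrable M f \<Longrightarrow> square_integrable M f' \<Longrightarrow> square_integrable M h \<Longrightarrow>
    L2_inner M (\<lambda>x. f x + f' x) h = L2_inner M f h + L2_inner M f' h"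
  unfolding L2_inner_def by (simp add: distrib_right integrable_inner)

lemma inner_scale: "L2_inner M (\<lambda>x. c * f x) h = c * L2_inner M f h"
  unfolding L2_inner_def by (simp add: mult.assoc)

lemma inner_cnj: "L2_inner M h f = cnj (L2_inner M f h)"
  unfolding L2_inner_def by (subst Bochner_Integration.integral_cnj[symmetric]) (simp add: mult.commute)

lemma inner_scale_right: "L2_inner M f (\<lambda>x. c * h x) = cnj c * L2_inner M f h"
  by (subst (1 2) inner_cnj) (simp add: inner_scale)

lemma inner_add_right: "square_integrable M f \<Longrightarrow> square_integrable M h \<Longrightarrow> square_integrable M h' \<Longrightarrow>
    L2_inner M f (\<lambda>x. h x + h' x) = L2_inner M f h + L2_inner M f h'"
  by (subst (1 2 3) inner_cnj) (simp add: inner_add)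

lemma inner_diff: "square_integrable M f \<Longrightarrow> square_integrable M f' \<Longrightarrow> square_integrable M h \<Longrightarrow>
    L2_inner M (\<lambda>x. f x - f' x) h = L2_inner M f h - L2_inner M f' h"
  unfolding L2_inner_def by (simp add: left_diff_distrib integrable_inner)

lemma inner_diff_right: "square_integrable M f \<Longrightarrow> square_integrable M h \<Longrightarrow> square_integrable M h' \<Longrightarrow>
    L2_inner M f (\<lambda>x. h x - h' x) = L2_inner M f h - L2_inner M f h'"
  by (subst (1 2 3) inner_cnj) (simp add: inner_diff)

lemma norm_nonneg: "L2_norm M f \<ge> 0"
  by (simp add: L2_norm_def)

lemma norm_square: "(L2_norm M f)\<^sup>2 = (LINT x|M. (cmod (f x))\<^sup>2)"
  by (simp add: L2_norm_def)

lemma inner_self: "L2_inner M f f = complex_of_real ((L2_norm M f)\<^sup>2)"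
  unfolding norm_square L2_inner_def integral_complex_of_real[symmetric] complex_norm_square ..

lemma norm_scale: "L2_norm M (\<lambda>x. c * f x) = cmod c * L2_norm M f"
  by (simp add: L2_norm_def norm_mult power_mult_distrib real_sqrt_mult)

lemma norm_minus_commute: "L2_norm M (\<lambda>x. f x - h x) = L2_norm M (\<lambda>x. h x - f x)"
  by (simp add: L2_norm_def Real_Vector_Spaces.norm_minus_commute)

lemma norm_square_diff:
  assumes "square_integrable M f" "square_integrable M h"
  shows "(L2_norm M (\<lambda>x. f x - h x))\<^sup>2 = (L2_norm M f)\<^sup>2 - 2 * Re (L2_inner M f h) + (L2_norm M h)\<^sup>2"
proof -
  note d = square_integrable_diff[OF assms]
  have "L2_inner M (\<lambda>x. f x - h x) (\<lambda>x. f x - h x) =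
      L2_inner M f f - L2_inner M f h - cnj (L2_inner M f h) + L2_inner M h h"
    using inner_diff[OF assms d] inner_diff_right[OF assms(1) assms] inner_diff_right[OF assms(2) assms]
      inner_cnj[of h f] by simp
  then have "complex_of_real ((L2_norm M (\<lambda>x. f x - h x))\<^sup>2) =
      complex_of_real ((L2_norm M f)\<^sup>2) - L2_inner M f h - cnj (L2_inner M f h) + complex_of_real ((L2_norm M h)\<^sup>2)"
    by (simp only: inner_self)
  then show ?thesis by (simp add: complex_eq_iff)
qed

lemma Cauchy_Schwarz:
  assumes "square_integrable M f" "square_integrable M h"
  shows "cmod (L2_inner M f h) \<le> L2_norm M f * L2_norm M h"
proof -
  define a b c where "a = (L2_norm M f)\<^sup>2" and "b = (L2_norm M h)\<^sup>2" and "c = L2_inner M f h"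
  have q: "0 \<le> a - 2 * s * (cmod c)\<^sup>2 + s\<^sup>2 * (cmod c)\<^sup>2 * b" for s :: real
  proof -
    have "0 \<le> (L2_norm M (\<lambda>x. f x - (of_real s * c) * h x))\<^sup>2" by simp
    also have "\<dots> = a - 2 * Re (cnj (of_real s * c) * c) + (cmod (of_real s * c))\<^sup>2 * b"
      using norm_square_diff[OF assms(1) square_integrable_scale[OF assms(2)], of "of_real s * c"]
      by (simp add: inner_scale_right norm_scale power_mult_distrib a_def b_def c_def)
    also have "Re (cnj (of_real s * c) * c) = s * (cmod c)\<^sup>2"
      unfolding cmod_power2 by (simp add: power2_eq_square algebra_simps)
    also have "(cmod (of_real s * c))\<^sup>2 = s\<^sup>2 * (cmod c)\<^sup>2" by (simp add: norm_mult power_mult_distrib)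
    finally show ?thesis by simp
  qed
  have ab: "a \<ge> 0" "b \<ge> 0" by (simp_all add: a_def b_def)
  have "(cmod c)\<^sup>2 \<le> a * b"
  proof (cases "b = 0")
    case True
    have "(cmod c)\<^sup>2 = 0"
    proof (rule ccontr)
      assume c: "(cmod c)\<^sup>2 \<noteq> 0"
      have "0 \<le> a - 2 * ((a + 1) / (2 * (cmod c)\<^sup>2)) * (cmod c)\<^sup>2" using q[of "(a + 1) / (2 * (cmod c)\<^sup>2)"] True by simp
      also have "\<dots> = -1" using c by (simp add: field_simps)
      finally show False by simp
    qed
    then show ?thesis using ab by simp
  next
    case False
    then have b: "b > 0" using ab by simp
    have "0 \<le> a - (cmod c)\<^sup>2 / b" using q[of "1 / b"] b by (simp add: power2_eq_square field_simps)
    then show ?thesis using b by (simp add: field_simps)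
  qed
  then have "(cmod c)\<^sup>2 \<le> (L2_norm M f * L2_norm M h)\<^sup>2" by (simp add: a_def b_def power_mult_distrib)
  then show ?thesis unfolding c_def by (rule power2_le_imp_le) (simp add: norm_nonneg)
qed

lemma norm_triangle:
  assumes "square_integrable M f" "square_integrable M h"
  shows "L2_norm M (\<lambda>x. f x - h x) \<le> L2_norm M f + L2_norm M h"
proof (rule power2_le_imp_le)
  have "- Re (L2_inner M f h) \<le> L2_norm M f * L2_norm M h"
    using Cauchy_Schwarz[OF assms] abs_Re_le_cmod[of "L2_inner M f h"] by linarith
  then show "(L2_norm M (\<lambda>x. f x - h x))\<^sup>2 \<le> (L2_norm M f + L2_norm M h)\<^sup>2"
    by (simp add: norm_square_diff[OF assms] power2_sum)
qed (simp add: norm_nonneg)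

lemma norm_triangle_diff:
  assumes "square_integrable M f" "square_integrable M h" "square_integrable M k"
  shows "L2_norm M (\<lambda>x. f x - h x) \<le> L2_norm M (\<lambda>x. f x - k x) + L2_norm M (\<lambda>x. h x - k x)"
  using norm_triangle[OF square_integrable_diff[OF assms(1,3)] square_integrable_diff[OF assms(2,3)]] by simp

lemma norm_zero_iff:
  assumes "square_integrable M f"
  shows "L2_norm M f = 0 \<longleftrightarrow> (AE x in M. f x = 0)"
proof -
  have "L2_norm M f = 0 \<longleftrightarrow> (LINT x|M. (cmod (f x))\<^sup>2) = 0" by (simp add: L2_norm_def)
  also have "\<dots> \<longleftrightarrow> (AE x in M. (cmod (f x))\<^sup>2 = 0)"
    by (rule integral_nonneg_eq_0_iff_AE) (use assms in \<open>auto simp: square_integrable_def\<close>)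
  finally show ?thesis by simp
qed

lemma norm_bounded:
  assumes "f \<in> borel_measurable M" "\<And>x. cmod (f x) \<le> B"
  shows "L2_norm M f \<le> B * sqrt (measure M (space M))"
proof -
  have B: "0 \<le> B" using assms(2)[of undefined] norm_ge_zero order_trans by blast
  have "(LINT x|M. (cmod (f x))\<^sup>2) \<le> (LINT x|M. B\<^sup>2)"
    using square_integrable_bounded[OF assms] by (intro integral_mono) (auto simp: square_integrable_def assms(2) power_mono)
  then have "L2_norm M f \<le> sqrt (measure M (space M) * B\<^sup>2)" by (simp add: L2_norm_def)
  then show ?thesis using B by (simp add: real_sqrt_mult mult.commute)
qed

lemma norm_le_nn_integral:
  assumes [measurable]: "f \<in> borel_measurable M" and "(\<integral>\<^sup>+ x. ennreal ((cmod (f x))\<^sup>2) \<partial>M) \<le> ennreal (C\<^sup>2)" "C \<ge> 0"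
  shows "square_integrable M f" "L2_norm M f \<le> C"
proof -
  have lt: "(\<integral>\<^sup>+ x. ennreal ((cmod (f x))\<^sup>2) \<partial>M) < \<infinity>" using assms(2) by (rule le_less_trans) simp
  have i: "integrable M (\<lambda>x. (cmod (f x))\<^sup>2)"
    by (rule integrableI_bounded) (use lt in auto)
  then show "square_integrable M f" by (simp add: square_integrable_def)
  have "ennreal (LINT x|M. (cmod (f x))\<^sup>2) = (\<integral>\<^sup>+ x. ennreal ((cmod (f x))\<^sup>2) \<partial>M)"
    by (rule nn_integral_eq_integral[symmetric, OF i]) simp
  then have "ennreal (LINT x|M. (cmod (f x))\<^sup>2) \<le> ennreal (C\<^sup>2)" using assms(2) by simp
  then have "(LINT x|M. (cmod (f x))\<^sup>2) \<le> C\<^sup>2" by (subst (asm) ennreal_le_iff) auto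
  then show "L2_norm M f \<le> C" using assms(3) by (simp add: L2_norm_def real_le_lsqrt)
qed

text \<open>Completeness: a subsequence with summable \<open>L\<^sup>2\<close>-increments has summable \<open>L\<^sup>1\<close>-increments, as
  the measure is finite, and so converges almost everywhere; Fatou's lemma gives convergence in norm.\<close>

lemma L2_complete:
  assumes f: "\<And>n. square_integrable M (f n)"
    and Cauchy: "\<And>\<epsilon>. \<epsilon> > 0 \<Longrightarrow> \<exists>N. \<forall>m\<ge>N. \<forall>n\<ge>N. L2_norm M (\<lambda>x. f m x - f n x) < \<epsilon>"
  obtains u where "square_integrable M u" "(\<lambda>n. L2_norm M (\<lambda>x. f n x - u x)) \<longlonglongrightarrow> 0"
proof -
  have [measurable]: "f n \<in> borel_measurable M" for n using f by (rule square_integrable_measurable)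
  have "\<exists>N. \<forall>m\<ge>N. \<forall>n\<ge>N. L2_norm M (\<lambda>x. f m x - f n x) < (1/2) ^ k" for k
    by (rule Cauchy) simp
  then obtain N where N: "\<And>k m n. m \<ge> N k \<Longrightarrow> n \<ge> N k \<Longrightarrow> L2_norm M (\<lambda>x. f m x - f n x) < (1/2) ^ k" by metis
  define r where "r k = (\<Sum>i\<le>k. N i)" for k
  have rN: "N k \<le> r k" for k unfolding r_def by (rule member_le_sum) auto
  have rS: "r k \<le> r (Suc k)" for k by (simp add: r_def)
  define d where "d k x = f (r (Suc k)) x - f (r k) x" for k x
  have [measurable]: "d k \<in> borel_measurable M" for k unfolding d_def by measurable
  have dsq: "square_integrable M (d k)" for k unfolding d_def[abs_def] by (rule square_integrable_diff[OF f f])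
  define s where "s = sqrt (measure M (space M))"
  have one: "square_integrable M (\<lambda>x. 1)" "L2_norm M (\<lambda>x. 1) = s"
    by (rule square_integrable_bounded[of _ 1]) (auto simp: L2_norm_def s_def)
  have L1: "(\<integral>\<^sup>+ x. ennreal (cmod (d k x)) \<partial>M) \<le> ennreal (s * (1/2) ^ k)" for k
  proof -
    have "square_integrable M (\<lambda>x. complex_of_real (cmod (d k x)))"
      using dsq[of k] by (simp add: square_integrable_def)
    from Cauchy_Schwarz[OF this one(1)]
    have "\<bar>LINT x|M. cmod (d k x)\<bar> \<le> L2_norm M (d k) * s"
      by (simp add: L2_inner_def one(2)) (simp add: L2_norm_def)
    also have "\<dots> \<le> (1/2) ^ k * s"
    proof (rule mult_right_mono)
      have "N k \<le> r (Suc k)" using rN[of k] rS[of k] by (rule order_trans)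
      then show "L2_norm M (d k) \<le> (1/2) ^ k"
        using N[of k "r (Suc k)" "r k"] rN[of k] by (simp add: d_def[abs_def])
    qed (simp add: s_def)
    finally have "(LINT x|M. cmod (d k x)) \<le> s * (1/2) ^ k" by (simp add: mult.commute)
    moreover have "(\<integral>\<^sup>+ x. ennreal (cmod (d k x)) \<partial>M) = ennreal (LINT x|M. cmod (d k x))"
      by (rule nn_integral_eq_integral) (use integrable_square[OF dsq] in auto)
    ultimately show ?thesis by (simp add: ennreal_leI)
  qed
  have "(\<integral>\<^sup>+ x. (\<Sum>k. ennreal (cmod (d k x))) \<partial>M) = (\<Sum>k. \<integral>\<^sup>+ x. ennreal (cmod (d k x)) \<partial>M)"
    by (rule nn_integral_suminf) measurable
  also have "\<dots> \<le> (\<Sum>k. ennreal (s * (1/2) ^ k))" by (rule suminf_le) (auto simp: L1)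
  also have "\<dots> = ennreal (\<Sum>k. s * (1/2) ^ k)"
    by (rule suminf_ennreal2) (auto simp: s_def intro: summable_mult summable_geometric)
  also have "\<dots> < \<infinity>" by simp
  finally have "(\<integral>\<^sup>+ x. (\<Sum>k. ennreal (cmod (d k x))) \<partial>M) \<noteq> \<infinity>" by simp
  then have "AE x in M. (\<Sum>k. ennreal (cmod (d k x))) \<noteq> \<infinity>"
    by (intro nn_integral_PInf_AE) measurable
  then have conv: "AE x in M. convergent (\<lambda>k. f (r k) x)"
  proof eventually_elim
    case (elim x)
    have "summable (\<lambda>k. cmod (d k x))"
      by (rule summable_suminf_not_top) (use elim in \<open>simp_all add: infinity_ennreal_def\<close>)
    then have "summable (\<lambda>k. d k x)" by (rule summable_norm_cancel)
    then have "summable (\<lambda>k. f (r (Suc k)) x - f (r k) x)" by (simp add: d_def)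
    then have "convergent (\<lambda>n. \<Sum>k<n. f (r (Suc k)) x - f (r k) x)" by (simp add: summable_iff_convergent)
    then have "convergent (\<lambda>n. f (r n) x - f (r 0) x)" by (simp add: sum_lessThan_telescope[of "\<lambda>k. f (r k) x"])
    from convergent_add[OF this convergent_const[of "f (r 0) x"]] show ?case by simp
  qed
  define u where "u x = lim (\<lambda>k. f (r k) x)" for x
  have [measurable]: "u \<in> borel_measurable M" unfolding u_def[abs_def] by (rule borel_measurable_lim_metric) measurable
  have est: "square_integrable M (\<lambda>x. f m x - u x) \<and> L2_norm M (\<lambda>x. f m x - u x) \<le> (1/2) ^ k" if "m \<ge> N k" for m k
  proof -
    have "(\<integral>\<^sup>+ x. ennreal ((cmod (f m x - u x))\<^sup>2) \<partial>M) \<le> (\<integral>\<^sup>+ x. liminf (\<lambda>j. ennreal ((cmod (f m x - f (r j) x))\<^sup>2)) \<partial>M)"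
    proof (rule nn_integral_mono_AE, use conv in eventually_elim)
      case (elim x)
      then have "(\<lambda>j. f (r j) x) \<longlonglongrightarrow> u x" by (simp add: u_def convergent_LIMSEQ_iff)
      then have "(\<lambda>j. ennreal ((cmod (f m x - f (r j) x))\<^sup>2)) \<longlonglongrightarrow> ennreal ((cmod (f m x - u x))\<^sup>2)"
        by (intro tendsto_intros)
      from lim_imp_Liminf[OF _ this] show ?case by simp
    qed
    also have "\<dots> \<le> liminf (\<lambda>j. \<integral>\<^sup>+ x. ennreal ((cmod (f m x - f (r j) x))\<^sup>2) \<partial>M)"
      by (rule nn_integral_liminf) measurable
    also have "\<dots> \<le> liminf (\<lambda>j. ennreal (((1/2) ^ k)\<^sup>2))"
    proof (rule Liminf_mono, rule eventually_sequentiallyI[of k])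
      fix j assume "k \<le> j"
      then have "r k \<le> r j" using lift_Suc_mono_le[of r, OF rS] by blast
      then have "N k \<le> r j" using rN[of k] by linarith
      then have "L2_norm M (\<lambda>x. f m x - f (r j) x) \<le> (1/2) ^ k" using N[OF that] by (simp add: less_imp_le)
      then have "(LINT x|M. (cmod (f m x - f (r j) x))\<^sup>2) \<le> ((1/2) ^ k)\<^sup>2"
        by (metis norm_square norm_nonneg power_mono)
      moreover have "(\<integral>\<^sup>+ x. ennreal ((cmod (f m x - f (r j) x))\<^sup>2) \<partial>M) = ennreal (LINT x|M. (cmod (f m x - f (r j) x))\<^sup>2)"
        by (rule nn_integral_eq_integral) (use square_integrable_diff[OF f f] in \<open>auto simp: square_integrable_def\<close>)
      ultimately show "(\<integral>\<^sup>+ x. ennreal ((cmod (f m x - f (r j) x))\<^sup>2) \<partial>M) \<le> ennreal (((1/2) ^ k)\<^sup>2)"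
        by (simp add: ennreal_leI)
    qed
    also have "\<dots> = ennreal (((1/2) ^ k)\<^sup>2)" by (simp add: Liminf_const)
    finally show ?thesis using norm_le_nn_integral[of "\<lambda>x. f m x - u x" "(1/2)^k"] by simp
  qed
  show thesis
  proof (rule that)
    have "square_integrable M (\<lambda>x. f (N 0) x - (f (N 0) x - u x))"
      by (rule square_integrable_diff[OF f conjunct1[OF est[OF order_refl]]])
    then show "square_integrable M u" by simp
    show "(\<lambda>n. L2_norm M (\<lambda>x. f n x - u x)) \<longlonglongrightarrow> 0"
    proof (rule LIMSEQ_I)
      fix \<epsilon> :: real assume "\<epsilon> > 0"
      then obtain k where k: "(1/2::real) ^ k < \<epsilon>" using real_arch_pow_inv[of \<epsilon> "1/2"] by auto
      have "norm (L2_norm M (\<lambda>x. f n x - u x) - 0) < \<epsilon>" if "n \<ge> N k" for n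
        using est[OF that] k norm_nonneg[of "\<lambda>x. f n x - u x"] by simp
      then show "\<exists>no. \<forall>n\<ge>no. norm (L2_norm M (\<lambda>x. f n x - u x) - 0) < \<epsilon>" by blast
    qed
  qed
qed

lemma inner_tendsto:
  assumes "\<And>n. square_integrable M (f n)" "square_integrable M u" "square_integrable M h"
    "(\<lambda>n. L2_norm M (\<lambda>x. f n x - u x)) \<longlonglongrightarrow> 0"
  shows "(\<lambda>n. L2_inner M (f n) h) \<longlonglongrightarrow> L2_inner M u h"
proof (rule LIM_zero_cancel, rule Lim_null_comparison)
  show "\<forall>\<^sub>F n in sequentially. norm (L2_inner M (f n) h - L2_inner M u h) \<le> L2_norm M (\<lambda>x. f n x - u x) * L2_norm M h"
    using Cauchy_Schwarz[OF square_integrable_diff[OF assms(1,2)] assms(3)] by (simp add: inner_diff assms(1-3))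
  show "(\<lambda>n. L2_norm M (\<lambda>x. f n x - u x) * L2_norm M h) \<longlonglongrightarrow> 0"
    using tendsto_mult_left_zero[OF assms(4)] .
qed

text \<open>A subspace with trivial orthogonal complement is dense: a minimizing sequence for the distance
  is Cauchy by the parallelogram law, and the minimal difference is orthogonal to the subspace.\<close>

lemma L2_dense:
  assumes P: "\<And>p. p \<in> P \<Longrightarrow> square_integrable M p"
    and add: "\<And>p q. p \<in> P \<Longrightarrow> q \<in> P \<Longrightarrow> (\<lambda>x. p x + q x) \<in> P"
    and scale: "\<And>c p. p \<in> P \<Longrightarrow> (\<lambda>x. c * p x) \<in> P" and zero: "(\<lambda>x. 0) \<in> P"
    and orth: "\<And>f. square_integrable M f \<Longrightarrow> (\<And>p. p \<in> P \<Longrightarrow> L2_inner M f p = 0) \<Longrightarrow> (AE x in M. f x = 0)"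
    and f: "square_integrable M f" and \<epsilon>: "\<epsilon> > 0"
  shows "\<exists>p\<in>P. L2_norm M (\<lambda>x. f x - p x) < \<epsilon>"
proof -
  define D where "D = (\<lambda>p. (L2_norm M (\<lambda>x. f x - p x))\<^sup>2) ` P"
  define \<delta> where "\<delta> = Inf D"
  have D: "D \<noteq> {}" "bdd_below D" using zero by (auto simp: D_def intro!: bdd_belowI2[of _ 0])
  have low: "\<delta> \<le> (L2_norm M (\<lambda>x. f x - p x))\<^sup>2" if "p \<in> P" for p
    unfolding \<delta>_def by (rule cInf_lower[OF _ D(2)]) (use that in \<open>auto simp: D_def\<close>)
  have "\<exists>p\<in>P. (L2_norm M (\<lambda>x. f x - p x))\<^sup>2 < \<delta> + 1 / Suc n" for n
    using cInf_lessD[OF D(1), of "\<delta> + 1 / Suc n"] by (auto simp: \<delta>_def D_def)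
  then obtain p where p: "\<And>n. p n \<in> P" "\<And>n. (L2_norm M (\<lambda>x. f x - p n x))\<^sup>2 < \<delta> + 1 / Suc n" by metis
  note sp = P[OF p(1)]
  have para: "(L2_norm M (\<lambda>x. p m x - p n x))\<^sup>2 \<le> 2 / Suc m + 2 / Suc n" for m n
  proof -
    let ?a = "\<lambda>x. f x - p n x" and ?b = "\<lambda>x. f x - p m x"
    have ab: "square_integrable M ?a" "square_integrable M ?b" by (rule square_integrable_diff[OF f sp])+
    have nb: "square_integrable M (\<lambda>x. (-1) * ?b x)" by (rule square_integrable_scale[OF ab(2)])
    have "(L2_norm M (\<lambda>x. ?a x - ?b x))\<^sup>2 + (L2_norm M (\<lambda>x. ?a x - (-1) * ?b x))\<^sup>2 = 2 * (L2_norm M ?a)\<^sup>2 + 2 * (L2_norm M ?b)\<^sup>2"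
      unfolding norm_square_diff[OF ab] norm_square_diff[OF ab(1) nb] by (simp only: inner_scale_right norm_scale) simp
    moreover have "(L2_norm M (\<lambda>x. ?a x - (-1) * ?b x))\<^sup>2 = 4 * (L2_norm M (\<lambda>x. f x - (1/2) * (p n x + p m x)))\<^sup>2"
    proof -
      have "(\<lambda>x. ?a x - (-1) * ?b x) = (\<lambda>x. 2 * (f x - (1/2) * (p n x + p m x)))" by (simp add: algebra_simps)
      then show ?thesis by (simp only: norm_scale power_mult_distrib) simp
    qed
    moreover have "\<delta> \<le> (L2_norm M (\<lambda>x. f x - (1/2) * (p n x + p m x)))\<^sup>2"
      by (rule low[OF scale[OF add[OF p(1) p(1)]]])
    moreover have "(\<lambda>x. ?a x - ?b x) = (\<lambda>x. p m x - p n x)" by simp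
    ultimately show ?thesis using p(2)[of n] p(2)[of m] by simp
  qed
  have Cauchy: "\<exists>N. \<forall>m\<ge>N. \<forall>n\<ge>N. L2_norm M (\<lambda>x. p m x - p n x) < \<eta>" if "\<eta> > 0" for \<eta>
  proof -
    obtain N where N: "4 / \<eta>\<^sup>2 < real N" using reals_Archimedean2 by blast
    have "L2_norm M (\<lambda>x. p m x - p n x) < \<eta>" if mn: "m \<ge> N" "n \<ge> N" for m n
    proof (rule power2_less_imp_less)
      have "4 < \<eta>\<^sup>2 * real N" using N that \<open>\<eta> > 0\<close> by (simp add: field_simps)
      then have "4 / real (Suc N) < \<eta>\<^sup>2" using \<open>\<eta> > 0\<close> by (simp add: field_simps) (smt (verit) zero_le_power2)
      moreover have "2 / real (Suc m) \<le> 2 / real (Suc N)" "2 / real (Suc n) \<le> 2 / real (Suc N)"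
        using mn by (auto intro!: divide_left_mono)
      ultimately show "(L2_norm M (\<lambda>x. p m x - p n x))\<^sup>2 < \<eta>\<^sup>2" using para[of m n] by simp
    qed (use \<open>\<eta> > 0\<close> in simp)
    then show ?thesis by blast
  qed
  obtain u where u: "square_integrable M u" "(\<lambda>n. L2_norm M (\<lambda>x. p n x - u x)) \<longlonglongrightarrow> 0"
    by (rule L2_complete[OF sp Cauchy])
  have lim: "(\<lambda>n. L2_norm M (\<lambda>x. f x - p n x - c * q x)) \<longlonglongrightarrow> L2_norm M (\<lambda>x. f x - u x - c * q x)" if q: "q \<in> P" for q c
  proof (rule LIM_zero_cancel, rule Lim_null_comparison[OF _ u(2)], rule always_eventually, rule allI)
    fix n
    let ?a = "\<lambda>x. f x - p n x - c * q x" and ?b = "\<lambda>x. f x - u x - c * q x"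
    have s: "square_integrable M ?a" "square_integrable M ?b" "square_integrable M (\<lambda>x. p n x - u x)"
      "square_integrable M (\<lambda>x. u x - p n x)"
      by (intro square_integrable_diff f sp u(1) square_integrable_scale P[OF q])+
    have "L2_norm M ?a \<le> L2_norm M ?b + L2_norm M (\<lambda>x. p n x - u x)"
      using norm_triangle[OF s(2,3)] by (simp add: algebra_simps)
    moreover have "L2_norm M ?b \<le> L2_norm M ?a + L2_norm M (\<lambda>x. p n x - u x)"
      using norm_triangle[OF s(1,4)] norm_minus_commute[of u "p n"] by (simp add: algebra_simps)
    ultimately show "norm (L2_norm M ?a - L2_norm M ?b) \<le> L2_norm M (\<lambda>x. p n x - u x)" by simp
  qed
  let ?d = "\<lambda>x. f x - u x"
  have d: "square_integrable M ?d" by (rule square_integrable_diff[OF f u(1)])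
  have "(L2_norm M ?d)\<^sup>2 \<le> \<delta>"
  proof (rule LIMSEQ_le[OF tendsto_power])
    show "(\<lambda>n. L2_norm M (\<lambda>x. f x - p n x)) \<longlonglongrightarrow> L2_norm M ?d" using lim[OF zero, of 0] by simp
    show "(\<lambda>n. \<delta> + 1 / real (Suc n)) \<longlonglongrightarrow> \<delta>"
      using tendsto_add[OF tendsto_const LIMSEQ_Suc[OF lim_inverse_n'], of \<delta>] by (simp add: inverse_eq_divide)
    show "\<exists>N. \<forall>n\<ge>N. (L2_norm M (\<lambda>x. f x - p n x))\<^sup>2 \<le> \<delta> + 1 / real (Suc n)" using p(2) by (auto intro: less_imp_le)
  qed
  moreover have "\<delta> \<le> (L2_norm M (\<lambda>x. f x - u x - c * q x))\<^sup>2" if "q \<in> P" for q c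
  proof (rule LIMSEQ_le_const[OF tendsto_power[OF lim[OF that]]], intro exI[of _ 0] allI impI)
    fix n
    have "\<delta> \<le> (L2_norm M (\<lambda>x. f x - (p n x + c * q x)))\<^sup>2" by (rule low[OF add[OF p(1) scale[OF that]]])
    then show "\<delta> \<le> (L2_norm M (\<lambda>x. f x - p n x - c * q x))\<^sup>2" by (simp add: diff_diff_add)
  qed
  ultimately have min: "(L2_norm M ?d)\<^sup>2 \<le> (L2_norm M (\<lambda>x. ?d x - c * q x))\<^sup>2" if "q \<in> P" for q c
    using that by (meson order_trans)
  have "L2_inner M ?d q = 0" if q: "q \<in> P" for q
  proof (rule ccontr)
    define z where "z = L2_inner M ?d q"
    define b where "b = (L2_norm M q)\<^sup>2 + 1"
    assume "L2_inner M ?d q \<noteq> 0"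
    then have z: "(cmod z)\<^sup>2 > 0" by (simp add: z_def)
    have b: "b > 0" "(L2_norm M q)\<^sup>2 \<le> b" by (simp_all add: b_def add_nonneg_pos)
    define c where "c = z / of_real b"
    have "(L2_norm M (\<lambda>x. ?d x - c * q x))\<^sup>2 = (L2_norm M ?d)\<^sup>2 - 2 * Re (cnj c * z) + (cmod c)\<^sup>2 * (L2_norm M q)\<^sup>2"
      using norm_square_diff[OF d square_integrable_scale[OF P[OF q]], of c]
      by (simp add: inner_scale_right norm_scale power_mult_distrib z_def)
    also have "Re (cnj c * z) = (cmod z)\<^sup>2 / b"
      unfolding c_def cmod_power2 by (simp add: power2_eq_square add_divide_distrib)
    also have "(cmod c)\<^sup>2 = (cmod z)\<^sup>2 / b\<^sup>2" using b(1) by (simp add: c_def norm_divide power_divide)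
    also have "(cmod z)\<^sup>2 / b\<^sup>2 * (L2_norm M q)\<^sup>2 \<le> (cmod z)\<^sup>2 / b\<^sup>2 * b"
      by (rule mult_left_mono[OF b(2)]) simp
    also have "(cmod z)\<^sup>2 / b\<^sup>2 * b = (cmod z)\<^sup>2 / b" using b(1) by (simp add: power2_eq_square)
    finally have "(cmod z)\<^sup>2 / b \<le> 0" using min[OF q, of c] by simp
    then show False using z b(1) by (simp add: divide_le_0_iff)
  qed
  from orth[OF d this] have "L2_norm M ?d = 0" using norm_zero_iff[OF d] by simp
  then have "(\<lambda>n. L2_norm M (\<lambda>x. f x - p n x)) \<longlonglongrightarrow> 0" using lim[OF zero, of 0] by simp
  from order_tendstoD(2)[OF this \<epsilon>] obtain n where "L2_norm M (\<lambda>x. f x - p n x) < \<epsilon>"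
    unfolding eventually_sequentially by blast
  then show ?thesis using p(1) by blast
qed

end

section \<open>Integral operators with continuous kernel\<close>

context lie_haar
begin

lemma continuous_bounded:
  fixes f :: "'g \<Rightarrow> 'b::real_normed_vector"
  assumes "continuous_on UNIV f"
  obtains B where "B > 0" "\<And>x. norm (f x) \<le> B"
proof -
  have "bounded (range f)" using compact_continuous_image[OF assms compact_G] by (rule compact_imp_bounded)
  then obtain B where "B > 0" "\<forall>y\<in>range f. norm y \<le> B" by (auto simp: bounded_pos)
  then show thesis using that[of B] by auto
qed

lemma continuous_measurable: "continuous_on UNIV f \<Longrightarrow> f \<in> borel_measurable \<mu>"
  unfolding measurable_mu by (rule borel_measurable_continuous_onI)

lemma continuous_square_integrable:
  assumes "continuous_on UNIV f" shows "square_integrable \<mu> f"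
proof -
  obtain B where B: "\<And>x. cmod (f x) \<le> B" by (rule continuous_bounded[OF assms]) blast
  show ?thesis by (rule square_integrable_bounded[OF continuous_measurable[OF assms] B])
qed

lemma C_inf_square_integrable: "f \<in> C_inf A \<Longrightarrow> square_integrable \<mu> f"
  by (rule continuous_square_integrable[OF C_inf_continuous[OF ta]])

lemma continuous_norm_zero:
  assumes "continuous_on UNIV f" "L2_norm \<mu> f = 0"
  shows "f = (\<lambda>x. 0)"
  by (rule AE_continuous_eq[OF assms(1) continuous_on_const])
    (use norm_zero_iff[OF continuous_square_integrable[OF assms(1)]] assms(2) in simp)

lemma norm_le_sup:
  assumes "continuous_on UNIV f" "\<And>x. cmod (f x) \<le> B" shows "L2_norm \<mu> f \<le> B"
  using norm_bounded[OF continuous_measurable[OF assms(1)] assms(2)] by (simp add: measure_UNIV)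

lemma integral_norm_le_L2:
  assumes "square_integrable \<mu> f" shows "(LINT x|\<mu>. cmod (f x)) \<le> L2_norm \<mu> f"
proof -
  have "square_integrable \<mu> (\<lambda>x. complex_of_real (cmod (f x)))"
  proof -
    have [measurable]: "f \<in> borel_measurable \<mu>" by (rule square_integrable_measurable[OF assms])
    have "(\<lambda>x. complex_of_real (cmod (f x))) \<in> borel_measurable \<mu>" by measurable
    then show ?thesis using assms by (simp add: square_integrable_def)
  qed
  moreover have "square_integrable \<mu> (\<lambda>x. 1)" by (rule square_integrable_bounded[of _ 1]) auto
  ultimately have "cmod (L2_inner \<mu> (\<lambda>x. complex_of_real (cmod (f x))) (\<lambda>x. 1)) \<le> L2_norm \<mu> f * 1"
    by (rule order_trans[OF Cauchy_Schwarz]) (simp add: L2_norm_def measure_UNIV)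
  then show ?thesis by (simp add: L2_inner_def)
qed

definition kernel_op :: "('g \<times> 'g \<Rightarrow> complex) \<Rightarrow> ('g \<Rightarrow> complex) \<Rightarrow> ('g \<Rightarrow> complex)" where
  "kernel_op K f = (\<lambda>x. LINT z|\<mu>. K (x, z) * f z)"

lemma kernel_slice_continuous: "continuous_on UNIV K \<Longrightarrow> continuous_on UNIV (\<lambda>z. K (x, z))"
  by (rule continuous_on_compose2[of UNIV K]) (auto intro: continuous_intros)

lemma kernel_integrable:
  assumes "continuous_on UNIV K" "square_integrable \<mu> f"
  shows "integrable \<mu> (\<lambda>z. K (x, z) * f z)"
  using integrable_inner[OF assms(2) continuous_square_integrable[OF continuous_on_cnj[OF kernel_slice_continuous[OF assms(1), of x]]]]
  by (simp add: mult.commute)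

lemma kernel_bound:
  assumes "continuous_on UNIV (K :: 'g \<times> 'g \<Rightarrow> complex)"
  shows "\<exists>C>0. \<forall>x. cmod (K x) \<le> C"
proof -
  have "compact (UNIV :: ('g \<times> 'g) set)" using compact_Times[OF compact_G compact_G] by simp
  from compact_continuous_image[OF assms this] have "bounded (range K)" by (rule compact_imp_bounded)
  then show ?thesis by (auto simp: bounded_pos)
qed

lemma kernel_op_diff_le:
  assumes "continuous_on UNIV K" "square_integrable \<mu> f" "\<And>z. cmod (K (x, z) - K (y, z)) \<le> \<epsilon>"
  shows "cmod (kernel_op K f x - kernel_op K f y) \<le> \<epsilon> * L2_norm \<mu> f"
proof -
  note i = kernel_integrable[OF assms(1,2)]
  have e: "\<epsilon> \<ge> 0" using assms(3)[of undefined] norm_ge_zero order_trans by blast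
  have "kernel_op K f x - kernel_op K f y = (LINT z|\<mu>. (K (x, z) - K (y, z)) * f z)"
    unfolding kernel_op_def by (simp add: left_diff_distrib i)
  also have "cmod \<dots> \<le> (LINT z|\<mu>. cmod ((K (x, z) - K (y, z)) * f z))" by (rule integral_norm_bound)
  also have "\<dots> \<le> (LINT z|\<mu>. \<epsilon> * cmod (f z))"
  proof (rule integral_mono)
    show "integrable \<mu> (\<lambda>z. cmod ((K (x, z) - K (y, z)) * f z))"
      using Bochner_Integration.integrable_diff[OF i[of x] i[of y]] by (simp add: left_diff_distrib)
    show "integrable \<mu> (\<lambda>z. \<epsilon> * cmod (f z))" using integrable_square[OF assms(2)] by simp
    show "cmod ((K (x, z) - K (y, z)) * f z) \<le> \<epsilon> * cmod (f z)" for z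
      by (simp add: norm_mult mult_right_mono assms(3))
  qed
  also have "\<dots> \<le> \<epsilon> * L2_norm \<mu> f" using integral_norm_le_L2[OF assms(2)] e by (simp add: mult_left_mono)
  finally show ?thesis .
qed

lemma kernel_op_bound:
  assumes "continuous_on UNIV K" "square_integrable \<mu> f" "\<And>x. cmod (K x) \<le> C"
  shows "cmod (kernel_op K f x) \<le> C * L2_norm \<mu> f"
proof -
  have C: "C \<ge> 0" using assms(3)[of undefined] norm_ge_zero order_trans by blast
  have "cmod (kernel_op K f x) \<le> (LINT z|\<mu>. cmod (K (x, z) * f z))" unfolding kernel_op_def by (rule integral_norm_bound)
  also have "\<dots> \<le> (LINT z|\<mu>. C * cmod (f z))"
  proof (rule integral_mono)
    show "integrable \<mu> (\<lambda>z. cmod (K (x, z) * f z))" by (rule integrable_norm[OF kernel_integrable[OF assms(1,2)]])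
    show "integrable \<mu> (\<lambda>z. C * cmod (f z))" using integrable_square[OF assms(2)] by simp
    show "cmod (K (x, z) * f z) \<le> C * cmod (f z)" for z by (simp add: norm_mult mult_right_mono assms(3))
  qed
  also have "\<dots> \<le> C * L2_norm \<mu> f" using integral_norm_le_L2[OF assms(2)] C by (simp add: mult_left_mono)
  finally show ?thesis .
qed

lemma kernel_near:
  assumes "continuous_on UNIV (K :: 'g \<times> 'g \<Rightarrow> complex)" "\<epsilon> > 0"
  shows "\<exists>X. x \<in> X \<and> open X \<and> (\<forall>y\<in>X. \<forall>z. cmod (K (y, z) - K (x, z)) \<le> \<epsilon>)"
  using uniform_near[of UNIV "\<lambda>x z. K (x, z)" x \<epsilon>] assms by (simp add: dist_norm)

lemma kernel_op_continuous:
  assumes "continuous_on UNIV K" "square_integrable \<mu> f"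
  shows "continuous_on UNIV (kernel_op K f)"
  unfolding continuous_on_def
proof (intro ballI tendstoI)
  fix x and \<epsilon> :: real assume \<epsilon>: "\<epsilon> > 0"
  define \<delta> where "\<delta> = \<epsilon> / 2 / (L2_norm \<mu> f + 1)"
  have \<delta>: "\<delta> > 0" using \<epsilon> norm_nonneg[of f] by (simp add: \<delta>_def add_nonneg_pos)
  have \<delta>e: "\<delta> * L2_norm \<mu> f \<le> \<epsilon> / 2" unfolding \<delta>_def
    by (rule divide_succ_mult_le[OF norm_nonneg]) (use \<epsilon> in simp)
  obtain X where X: "x \<in> X" "open X" "\<forall>y\<in>X. \<forall>z. cmod (K (y, z) - K (x, z)) \<le> \<delta>"
    using kernel_near[OF assms(1) \<delta>, of x] by (elim exE conjE)
  have "dist (kernel_op K f y) (kernel_op K f x) < \<epsilon>" if "y \<in> X" for y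
    using kernel_op_diff_le[OF assms, of y x \<delta>] X(3) that \<delta>e \<epsilon> by (simp add: dist_norm)
  then show "\<forall>\<^sub>F y in at x within UNIV. dist (kernel_op K f y) (kernel_op K f x) < \<epsilon>"
    unfolding eventually_at_topological using X(1,2) by (intro exI[of _ X]) simp
qed

lemma kernel_net:
  assumes "continuous_on UNIV (K :: 'g \<times> 'g \<Rightarrow> complex)" "\<epsilon> > 0"
  shows "\<exists>F. finite F \<and> (\<forall>x. \<exists>y\<in>F. \<forall>z. cmod (K (x, z) - K (y, z)) \<le> \<epsilon>)"
proof -
  have "\<forall>x. \<exists>X. x \<in> X \<and> open X \<and> (\<forall>y\<in>X. \<forall>z. cmod (K (y, z) - K (x, z)) \<le> \<epsilon>)"
    using kernel_near[OF assms] by blast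
  then obtain X where X: "\<And>x. x \<in> X x" "\<And>x. open (X x)" "\<And>x y z. y \<in> X x \<Longrightarrow> cmod (K (y, z) - K (x, z)) \<le> \<epsilon>"
    by metis
  have "(UNIV :: 'g set) \<subseteq> (\<Union>x\<in>UNIV. X x)" using X(1) by blast
  from compactE_image[OF compact_G X(2) this] obtain F where F: "finite F" "UNIV \<subseteq> (\<Union>x\<in>F. X x)" by metis
  then show ?thesis using X(3) by (intro exI[of _ F]) blast
qed

text \<open>Compactness: within \<open>\<epsilon>\<close>, the value of the integral operator at any point is controlled by its
  values on a finite set.  A subsequence converging on the countable union of these sets therefore
  converges uniformly.\<close>

lemma kernel_op_compact:
  assumes K: "continuous_on UNIV K" and f: "\<And>n. square_integrable \<mu> (f n)" "\<And>n. L2_norm \<mu> (f n) \<le> B"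
  obtains r h where "strict_mono (r :: nat \<Rightarrow> nat)" "uniform_limit UNIV (\<lambda>n. kernel_op K (f (r n))) h sequentially"
    "continuous_on UNIV h"
proof -
  have B: "B \<ge> 0" using f(2)[of 0] norm_nonneg[of "f 0"] by linarith
  obtain C where C0: "C > 0" "\<forall>x. cmod (K x) \<le> C" using kernel_bound[OF K] by (elim exE conjE)
  note C = C0(1) spec[OF C0(2)]
  have "\<forall>j. \<exists>F. finite F \<and> (\<forall>x. \<exists>y\<in>F. \<forall>z. cmod (K (x, z) - K (y, z)) \<le> 1 / Suc j)"
    by (intro allI kernel_net[OF K]) simp
  then obtain F where F: "\<And>j. finite (F j)" "\<And>j x. \<exists>y\<in>F j. \<forall>z. cmod (K (x, z) - K (y, z)) \<le> 1 / Suc j"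
    by metis
  have bd: "cmod (kernel_op K (f n) x) \<le> C * B" for n x
    using kernel_op_bound[OF K f(1) C(2), of n x] mult_left_mono[OF f(2)[of n] less_imp_le[OF C(1)]] by linarith
  have "countable (\<Union>j. F j)" using F(1) by (simp add: countable_finite)
  then obtain r where r: "strict_mono (r :: nat \<Rightarrow> nat)"
    "\<And>x. x \<in> (\<Union>j. F j) \<Longrightarrow> \<exists>l. (\<lambda>n. kernel_op K (f (r n)) x) \<longlonglongrightarrow> l"
    by (rule function_convergent_subsequence[of "\<Union>j. F j" "\<lambda>n. kernel_op K (f n)" "C * B", OF _ bd]) blast
  have "uniformly_Cauchy_on UNIV (\<lambda>n. kernel_op K (f (r n)))"
  proof (rule uniformly_Cauchy_onI)
    fix \<epsilon> :: real assume \<epsilon>: "\<epsilon> > 0"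
    obtain j where j: "4 * (B + 1) / \<epsilon> < real j" using reals_Archimedean2 by blast
    have j': "1 / real (Suc j) * B \<le> \<epsilon> / 4"
    proof -
      have "4 * (B + 1) < \<epsilon> * real j" using j \<epsilon> by (simp add: field_simps)
      then have "4 * B \<le> \<epsilon> * real (Suc j)" using \<epsilon> by (simp add: algebra_simps)
      then show ?thesis by (simp add: field_simps)
    qed
    have "\<exists>N. \<forall>m\<ge>N. \<forall>n\<ge>N. cmod (kernel_op K (f (r m)) y - kernel_op K (f (r n)) y) < \<epsilon> / 4" if "y \<in> F j" for y
    proof -
      have "Cauchy (\<lambda>n. kernel_op K (f (r n)) y)" using r(2)[of y] that by (intro convergent_Cauchy) (auto simp: convergent_def)
      then show ?thesis using \<epsilon> unfolding Cauchy_def dist_norm by (metis divide_pos_pos zero_less_numeral)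
    qed
    then obtain N where N: "\<And>y m n. y \<in> F j \<Longrightarrow> m \<ge> N y \<Longrightarrow> n \<ge> N y \<Longrightarrow>
        cmod (kernel_op K (f (r m)) y - kernel_op K (f (r n)) y) < \<epsilon> / 4" by metis
    have "dist (kernel_op K (f (r m)) x) (kernel_op K (f (r n)) x) < \<epsilon>"
      if mn: "m \<ge> Max (N ` F j)" "n \<ge> Max (N ` F j)" for m n x
    proof -
      obtain y where y: "y \<in> F j" "\<And>z. cmod (K (x, z) - K (y, z)) \<le> 1 / Suc j" using F(2) by blast
      have Ny: "N y \<le> Max (N ` F j)" using y(1) F(1) by (intro Max_ge) auto
      let ?p = "kernel_op K (f (r m)) x - kernel_op K (f (r m)) y" and ?q = "kernel_op K (f (r m)) y - kernel_op K (f (r n)) y"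
        and ?s = "kernel_op K (f (r n)) x - kernel_op K (f (r n)) y"
      have "cmod (kernel_op K (f i) x - kernel_op K (f i) y) \<le> \<epsilon> / 4" for i
      proof -
        have "1 / real (Suc j) * L2_norm \<mu> (f i) \<le> 1 / real (Suc j) * B" by (rule mult_left_mono[OF f(2)]) simp
        then show ?thesis using kernel_op_diff_le[OF K f(1) y(2), of i] j' by linarith
      qed
      from this[of "r m"] this[of "r n"]
      have "cmod (kernel_op K (f (r m)) x - kernel_op K (f (r m)) y) \<le> \<epsilon> / 4"
        "cmod (kernel_op K (f (r n)) x - kernel_op K (f (r n)) y) \<le> \<epsilon> / 4" .
      moreover have "cmod (kernel_op K (f (r m)) y - kernel_op K (f (r n)) y) < \<epsilon> / 4"
        by (rule N[OF y(1)]) (use mn Ny in auto)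
      ultimately have "cmod (?p + ?q - ?s) < \<epsilon>"
        using norm_triangle_ineq4[of "?p + ?q" ?s] norm_triangle_ineq[of ?p ?q] \<epsilon> by linarith
      then show ?thesis by (simp add: dist_norm)
    qed
    then show "\<exists>M. \<forall>x\<in>UNIV. \<forall>m\<ge>M. \<forall>n\<ge>M. dist (kernel_op K (f (r m)) x) (kernel_op K (f (r n)) x) < \<epsilon>"
      by blast
  qed
  then obtain h where h: "uniform_limit UNIV (\<lambda>n. kernel_op K (f (r n))) h sequentially"
    using Cauchy_uniformly_convergent unfolding uniformly_convergent_on_def by blast
  have "continuous_on UNIV h"
    by (rule uniform_limit_theorem[OF always_eventually h]) (auto intro: kernel_op_continuous[OF K f(1)])
  then show thesis using that r(1) h by blast
qed

lemma kernel_op_linear: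
  assumes "continuous_on UNIV K" "square_integrable \<mu> f" "square_integrable \<mu> h"
  shows "kernel_op K (\<lambda>x. f x + h x) = (\<lambda>x. kernel_op K f x + kernel_op K h x)"
    "kernel_op K (\<lambda>x. c * f x) = (\<lambda>x. c * kernel_op K f x)"
    "kernel_op K (\<lambda>x. f x - h x) = (\<lambda>x. kernel_op K f x - kernel_op K h x)"
  using kernel_integrable[OF assms(1,2)] kernel_integrable[OF assms(1,3)]
  by (simp_all add: kernel_op_def fun_eq_iff distrib_left right_diff_distrib mult.left_commute[of _ c])

lemma kernel_op_tendsto:
  assumes K: "continuous_on UNIV K" and f: "\<And>n. square_integrable \<mu> (f n)" "square_integrable \<mu> h"
    and lim: "(\<lambda>n. L2_norm \<mu> (\<lambda>x. f n x - h x)) \<longlonglongrightarrow> 0"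
  shows "(\<lambda>n. kernel_op K (f n) x) \<longlonglongrightarrow> kernel_op K h x"
proof -
  obtain C where C0: "C > 0" "\<forall>x. cmod (K x) \<le> C" using kernel_bound[OF K] by (elim exE conjE)
  note C = C0(1) spec[OF C0(2)]
  have "\<forall>\<^sub>F n in sequentially. norm (kernel_op K (f n) x - kernel_op K h x) \<le> C * L2_norm \<mu> (\<lambda>x. f n x - h x)"
    using kernel_op_bound[OF K square_integrable_diff[OF f(1) f(2)] C(2)] by (simp add: kernel_op_linear(3)[OF K f])
  from Lim_null_comparison[OF this tendsto_mult_right_zero[OF lim]] show ?thesis by (rule LIM_zero_cancel)
qed

lemma uniform_limit_norm:
  assumes "\<And>n. continuous_on UNIV (f n)" "continuous_on UNIV h" "uniform_limit UNIV f h sequentially"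
  shows "(\<lambda>n. L2_norm \<mu> (\<lambda>x. f n x - h x)) \<longlonglongrightarrow> 0"
proof (rule tendstoI)
  fix \<epsilon> :: real assume "\<epsilon> > 0"
  then have e2: "\<epsilon> / 2 > 0" by simp
  from uniform_limitD[OF assms(3) e2] show "\<forall>\<^sub>F n in sequentially. dist (L2_norm \<mu> (\<lambda>x. f n x - h x)) 0 < \<epsilon>"
  proof eventually_elim
    case (elim n)
    have "L2_norm \<mu> (\<lambda>x. f n x - h x) \<le> \<epsilon> / 2"
      by (rule norm_le_sup) (use elim assms(1,2) in \<open>auto simp: dist_norm less_imp_le intro: continuous_intros\<close>)
    then show ?case using \<open>\<epsilon> > 0\<close> norm_nonneg[of "\<lambda>x. f n x - h x"] by simp
  qed
qed

text \<open>The spectral theorem for compact symmetric operators in the form needed here, on a subspace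
  \<open>M\<close> of the continuous functions that is closed under uniform limits.  Let \<open>m\<close> be the operator
  norm.  If \<open>\<parallel>T f\<^sub>n\<parallel> \<rightarrow> m\<close> with \<open>\<parallel>f\<^sub>n\<parallel> \<le> 1\<close>, then \<open>T\<^sup>2 f\<^sub>n - m\<^sup>2 f\<^sub>n \<rightarrow> 0\<close>, and a uniform limit \<open>h\<close>
  of \<open>T f\<^sub>n\<close> satisfies \<open>T\<^sup>2 h = m\<^sup>2 h\<close>; so \<open>T h + m h\<close> or \<open>h\<close> is an eigenvector.\<close>

lemma kernel_op_eigenvector:
  assumes K: "continuous_on UNIV K"
    and M: "\<And>f. f \<in> M \<Longrightarrow> continuous_on UNIV f"
    and add: "\<And>f h. f \<in> M \<Longrightarrow> h \<in> M \<Longrightarrow> (\<lambda>x. f x + h x) \<in> M"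
    and scale: "\<And>c f. f \<in> M \<Longrightarrow> (\<lambda>x. c * f x) \<in> M"
    and limit: "\<And>f h. (\<And>n. f n \<in> M) \<Longrightarrow> continuous_on UNIV h \<Longrightarrow> uniform_limit UNIV f h sequentially \<Longrightarrow> h \<in> M"
    and inv: "\<And>f. f \<in> M \<Longrightarrow> kernel_op K f \<in> M"
    and sym: "\<And>f h. f \<in> M \<Longrightarrow> h \<in> M \<Longrightarrow> L2_inner \<mu> (kernel_op K f) h = L2_inner \<mu> f (kernel_op K h)"
    and nz: "f0 \<in> M" "kernel_op K f0 \<noteq> (\<lambda>x. 0)"
  obtains \<kappa> \<phi> where "\<kappa> \<noteq> (0::real)" "\<phi> \<in> M" "\<phi> \<noteq> (\<lambda>x. 0)" "kernel_op K \<phi> = (\<lambda>x. complex_of_real \<kappa> * \<phi> x)"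
proof -
  let ?T = "kernel_op K" and ?N = "L2_norm \<mu>"
  note sq = continuous_square_integrable[OF M]
  obtain C where C0: "C > 0" "\<forall>x. cmod (K x) \<le> C" using kernel_bound[OF K] by (elim exE conjE)
  note C = C0(1) spec[OF C0(2)]
  have TC: "?N (?T f) \<le> C * ?N f" if "f \<in> M" for f
    by (rule norm_le_sup[OF M[OF inv[OF that]] kernel_op_bound[OF K sq[OF that] C(2)]])
  define R where "R = (\<lambda>f. ?N (?T f)) ` {f \<in> M. ?N f \<le> 1}"
  define m where "m = Sup R"
  have Tscale: "?T (\<lambda>x. c * f x) = (\<lambda>x. c * ?T f x)" if "f \<in> M" for c f
    by (rule kernel_op_linear(2)[OF K sq sq]) (rule that)+
  have bdd: "bdd_above R"
  proof (rule bdd_aboveI[of _ C])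
    fix y assume "y \<in> R"
    then obtain f where f: "f \<in> M" "?N f \<le> 1" "y = ?N (?T f)" by (auto simp: R_def)
    then show "y \<le> C" using TC[OF f(1)] mult_left_mono[OF f(2) less_imp_le[OF C(1)]] by linarith
  qed
  have le_m: "?N (?T f) \<le> m * ?N f" if f: "f \<in> M" for f
  proof (cases "?N f = 0")
    case True
    then show ?thesis using TC[OF f] by simp
  next
    case False
    define c where "c = complex_of_real (1 / ?N f)"
    have pos: "?N f > 0" using False norm_nonneg[of f] by simp
    have cm: "cmod c = 1 / ?N f" using pos by (simp add: c_def norm_divide)
    have "?N (\<lambda>x. c * f x) = 1" using pos by (simp add: norm_scale cm)
    then have "?N (?T (\<lambda>x. c * f x)) \<in> R" using scale[OF f, of c] by (auto simp: R_def)
    then have "?N (?T (\<lambda>x. c * f x)) \<le> m" unfolding m_def by (rule cSup_upper[OF _ bdd])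
    then have "?N (?T f) / ?N f \<le> m" using pos by (simp add: Tscale[OF f] norm_scale cm)
    then show ?thesis using pos by (simp add: field_simps)
  qed
  have m: "m > 0"
  proof (rule ccontr)
    assume "\<not> m > 0"
    then have "m * ?N f0 \<le> 0" using norm_nonneg[of f0] by (simp add: mult_nonpos_nonneg)
    then have "?N (?T f0) = 0" using le_m[OF nz(1)] norm_nonneg[of "?T f0"] by linarith
    then show False using continuous_norm_zero[OF M[OF inv[OF nz(1)]]] nz(2) by simp
  qed
  have R: "R \<noteq> {}"
  proof -
    have "(\<lambda>x. 0 * f0 x) \<in> M" by (rule scale[OF nz(1)])
    then have "(\<lambda>x. 0) \<in> M" by simp
    moreover have "?N (\<lambda>x. 0) \<le> 1" by (simp add: L2_norm_def)
    ultimately show ?thesis by (auto simp: R_def)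
  qed
  have "\<exists>f\<in>M. ?N f \<le> 1 \<and> m - 1 / Suc n < ?N (?T f)" for n
    using less_cSupD[OF R, of "m - 1 / Suc n"] by (auto simp: m_def R_def)
  then obtain f where f: "\<And>n. f n \<in> M" "\<And>n. ?N (f n) \<le> 1" "\<And>n. m - 1 / Suc n < ?N (?T (f n))" by metis
  have upper: "?N (?T (f n)) \<le> m" for n
    using le_m[OF f(1)[of n]] mult_left_mono[OF f(2)[of n] less_imp_le[OF m]] by linarith
  obtain r h where r: "strict_mono (r :: nat \<Rightarrow> nat)" and ul: "uniform_limit UNIV (\<lambda>n. ?T (f (r n))) h sequentially"
    and ch: "continuous_on UNIV h"
    by (rule kernel_op_compact[OF K sq[OF f(1)] f(2)])
  have hM: "h \<in> M" by (rule limit[OF inv[OF f(1)] ch ul])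
  have Th: "(\<lambda>n. ?N (\<lambda>x. ?T (f (r n)) x - h x)) \<longlonglongrightarrow> 0" by (rule uniform_limit_norm[OF M[OF inv[OF f(1)]] ch ul])
  have Nm: "(\<lambda>n. ?N (?T (f n))) \<longlonglongrightarrow> m"
  proof (rule tendsto_sandwich[OF _ _ _ tendsto_const])
    show "(\<lambda>n. m - 1 / real (Suc n)) \<longlonglongrightarrow> m"
      using tendsto_diff[OF tendsto_const LIMSEQ_Suc[OF lim_inverse_n'], of m] by (simp add: inverse_eq_divide)
  qed (use f(3) upper in \<open>auto intro!: always_eventually less_imp_le\<close>)
  have Nmr: "(\<lambda>n. ?N (?T (f (r n)))) \<longlonglongrightarrow> m" using LIMSEQ_subseq_LIMSEQ[OF Nm r] by (simp add: comp_def)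
  have h0: "?N h > 0"
  proof (rule ccontr)
    assume "\<not> ?N h > 0"
    then have "h = (\<lambda>x. 0)" using continuous_norm_zero[OF ch] norm_nonneg[of h] by simp
    then have "(\<lambda>n. ?N (?T (f (r n)))) \<longlonglongrightarrow> 0" using Th by simp
    then show False using LIMSEQ_unique[OF Nmr] m by simp
  qed
  define d where "d n = (\<lambda>x. ?T (?T (f (r n))) x - complex_of_real (m\<^sup>2) * f (r n) x)" for n
  have dest: "(?N (d n))\<^sup>2 \<le> m\<^sup>2 * (m\<^sup>2 - (?N (?T (f (r n))))\<^sup>2)" for n
  proof -
    let ?f = "f (r n)"
    have s: "square_integrable \<mu> (?T (?T ?f))" "square_integrable \<mu> (\<lambda>x. complex_of_real (m\<^sup>2) * ?f x)"
      using sq[OF inv[OF inv[OF f(1)]]] sq[OF scale[OF f(1)]] by auto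
    have "L2_inner \<mu> (?T (?T ?f)) ?f = complex_of_real ((?N (?T ?f))\<^sup>2)"
      using sym[OF inv[OF f(1)] f(1)] inner_self by simp
    then have "(?N (d n))\<^sup>2 = (?N (?T (?T ?f)))\<^sup>2 - 2 * (m\<^sup>2 * (?N (?T ?f))\<^sup>2) + (m\<^sup>2 * ?N ?f)\<^sup>2"
      unfolding d_def norm_square_diff[OF s] inner_scale_right norm_scale by (simp add: norm_power)
    moreover have "(?N (?T (?T ?f)))\<^sup>2 \<le> m\<^sup>2 * (?N (?T ?f))\<^sup>2"
      using power_mono[OF le_m[OF inv[OF f(1)]] norm_nonneg, of "r n" 2] by (simp add: power_mult_distrib)
    moreover have "(m\<^sup>2 * ?N ?f)\<^sup>2 \<le> (m\<^sup>2 * 1)\<^sup>2"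
      by (rule power_mono[OF mult_left_mono[OF f(2)]]) (simp_all add: norm_nonneg)
    ultimately show ?thesis by (simp add: algebra_simps power2_eq_square)
  qed
  have d0: "(\<lambda>n. ?N (d n)) \<longlonglongrightarrow> 0"
  proof -
    have "(\<lambda>n. m\<^sup>2 * (m\<^sup>2 - (?N (?T (f (r n))))\<^sup>2)) \<longlonglongrightarrow> m\<^sup>2 * (m\<^sup>2 - m\<^sup>2)"
      by (intro tendsto_intros Nmr)
    then have lim: "(\<lambda>n. m\<^sup>2 * (m\<^sup>2 - (?N (?T (f (r n))))\<^sup>2)) \<longlonglongrightarrow> 0" by simp
    have "(\<lambda>n. (?N (d n))\<^sup>2) \<longlonglongrightarrow> 0"
      by (rule tendsto_sandwich[OF always_eventually always_eventually tendsto_const lim]) (simp_all add: dest)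
    from tendsto_real_sqrt[OF this] show ?thesis by (simp add: norm_nonneg)
  qed
  have ds: "square_integrable \<mu> (d n)" for n
    unfolding d_def by (rule square_integrable_diff[OF sq[OF inv[OF inv[OF f(1)]]] sq[OF scale[OF f(1)]]])
  have sqz: "square_integrable \<mu> (\<lambda>x. 0)" by (rule continuous_square_integrable[OF continuous_on_const])
  have T2h: "?T (?T h) = (\<lambda>x. complex_of_real (m\<^sup>2) * h x)"
  proof
    fix x
    let ?a = "\<lambda>n. ?T (f (r n))"
    \<comment> \<open>All limits are taken pointwise at \<open>x\<close>, since \<open>T\<close> turns convergence in norm into this.\<close>
    have ax: "(\<lambda>n. ?a n x) \<longlonglongrightarrow> h x" by (rule tendsto_uniform_limitI[OF ul]) simp
    have "(\<lambda>n. ?T (?T (?a n)) x) \<longlonglongrightarrow> ?T (?T h) x"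
    proof (rule kernel_op_tendsto[OF K sq[OF inv[OF inv[OF f(1)]]] sq[OF inv[OF hM]]])
      have bd: "?N (\<lambda>y. ?T (?a n) y - ?T h y) \<le> C * ?N (\<lambda>y. ?a n y - h y)" for n
      proof -
        have "(\<lambda>y. ?a n y + (-1) * h y) \<in> M" by (rule add[OF inv[OF f(1)] scale[OF hM]])
        then have "(\<lambda>y. ?a n y - h y) \<in> M" by simp
        from TC[OF this] show ?thesis by (simp add: kernel_op_linear(3)[OF K sq[OF inv[OF f(1)]] sq[OF hM]])
      qed
      show "(\<lambda>n. ?N (\<lambda>y. ?T (?a n) y - ?T h y)) \<longlonglongrightarrow> 0"
        by (rule tendsto_sandwich[OF always_eventually always_eventually tendsto_const tendsto_mult_right_zero[OF Th, of C]])
          (simp_all add: norm_nonneg bd)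
    qed
    moreover have "(\<lambda>n. ?T (d n) x) \<longlonglongrightarrow> ?T (\<lambda>x. 0) x"
      by (rule kernel_op_tendsto[OF K ds sqz]) (use d0 in simp)
    moreover have "?T (?T (?a n)) x = ?T (d n) x + complex_of_real (m\<^sup>2) * ?a n x" for n
      unfolding d_def
      using fun_cong[OF kernel_op_linear(3)[OF K sq[OF inv[OF inv[OF f(1)]]] sq[OF scale[OF f(1)]]], of "r n" "complex_of_real (m\<^sup>2)" "r n" x]
      by (simp add: Tscale[OF f(1)])
    ultimately have "(\<lambda>n. ?T (d n) x + complex_of_real (m\<^sup>2) * ?a n x) \<longlonglongrightarrow> ?T (?T h) x"
      and "(\<lambda>n. ?T (d n) x) \<longlonglongrightarrow> 0" by (simp_all add: kernel_op_def)
    from LIMSEQ_unique[OF this(1) tendsto_add[OF this(2) tendsto_mult[OF tendsto_const ax]]]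
    show "?T (?T h) x = complex_of_real (m\<^sup>2) * h x" by simp
  qed
  define \<psi> where "\<psi> = (\<lambda>x. ?T h x + complex_of_real m * h x)"
  have \<psi>M: "\<psi> \<in> M" unfolding \<psi>_def by (rule add[OF inv[OF hM] scale[OF hM]])
  show thesis
  proof (cases "\<psi> = (\<lambda>x. 0)")
    case False
    have "?T \<psi> = (\<lambda>x. complex_of_real m * \<psi> x)"
      unfolding \<psi>_def kernel_op_linear(1)[OF K sq[OF inv[OF hM]] sq[OF scale[OF hM]]] Tscale[OF hM] T2h
      by (simp add: fun_eq_iff algebra_simps power2_eq_square)
    then show thesis using that[of m \<psi>] m \<psi>M False by simp
  next
    case True
    have "?T h x = complex_of_real (- m) * h x" for x
      using fun_cong[OF True, of x] by (simp add: \<psi>_def add_eq_0_iff2)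
    moreover have "h \<noteq> (\<lambda>x. 0)" using h0 by (auto simp: L2_norm_def)
    ultimately show thesis using that[of "- m" h] m hM by (simp add: fun_eq_iff)
  qed
qed

end

section \<open>Completeness of the eigenfunctions of an invariant symmetric operator\<close>

context lie_haar
begin

lemma pair_integrable:
  assumes "square_integrable \<mu> f" "square_integrable \<mu> h" "continuous_on UNIV K"
  shows "integrable (\<mu> \<Otimes>\<^sub>M \<mu>) (\<lambda>(x, z). K (x, z) * f z * cnj (h x))"
proof -
  note [measurable] = square_integrable_measurable[OF assms(1)] square_integrable_measurable[OF assms(2)]
  have [measurable]: "K \<in> borel_measurable (\<mu> \<Otimes>\<^sub>M \<mu>)"
    unfolding measurable_mu2 using assms(3) by (rule borel_measurable_continuous_onI)
  have cn: "(\<lambda>x. cnj (h x)) \<in> borel_measurable \<mu>"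
    by (rule measurable_compose[OF square_integrable_measurable[OF assms(2)]
        borel_measurable_continuous_onI[OF continuous_on_cnj[OF continuous_on_id]]])
  note [measurable] = cn
  obtain C where C: "C > 0" "\<forall>x. cmod (K x) \<le> C" using kernel_bound[OF assms(3)] by (elim exE conjE)
  have i: "integrable (\<mu> \<Otimes>\<^sub>M \<mu>) (\<lambda>x. C * (cmod (h (fst x)) * cmod (f (snd x))))"
  proof (rule Fubini_integrable)
    have "integrable \<mu> (\<lambda>x. C * (LINT z|\<mu>. cmod (f z)) * cmod (h x))"
      using integrable_square[OF assms(2)] by simp
    then show "integrable \<mu> (\<lambda>x. LINT z|\<mu>. norm (C * (cmod (h (fst (x, z))) * cmod (f (snd (x, z))))))"
      using C(1) by (simp add: abs_mult mult_ac)
    show "AE x in \<mu>. integrable \<mu> (\<lambda>z. C * (cmod (h (fst (x, z))) * cmod (f (snd (x, z)))))"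
      using integrable_square[OF assms(1)] by simp
  qed measurable
  show ?thesis
  proof (rule Bochner_Integration.integrable_bound[OF i])
    show "(\<lambda>(x, z). K (x, z) * f z * cnj (h x)) \<in> borel_measurable (\<mu> \<Otimes>\<^sub>M \<mu>)" by measurable
    have "cmod (K (x, z)) * cmod (f z) * cmod (h x) \<le> C * (cmod (h x) * cmod (f z))" for x z
    proof -
      have "cmod (K (x, z)) * (cmod (h x) * cmod (f z)) \<le> C * (cmod (h x) * cmod (f z))"
        by (rule mult_right_mono) (use C(2) in auto)
      then show ?thesis by (simp add: mult_ac)
    qed
    then show "AE x in \<mu> \<Otimes>\<^sub>M \<mu>. norm (case x of (x, z) \<Rightarrow> K (x, z) * f z * cnj (h x)) \<le>
        norm (C * (cmod (h (fst x)) * cmod (f (snd x))))"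
      using C(1) by (auto simp: norm_mult split: prod.split)
  qed
qed

lemma fubini_continuous:
  assumes "continuous_on UNIV (F :: 'g \<times> 'g \<Rightarrow> complex)"
  shows "(LINT x|\<mu>. LINT z|\<mu>. F (x, z)) = (LINT z|\<mu>. LINT x|\<mu>. F (x, z))"
proof -
  have "square_integrable \<mu> (\<lambda>x. 1)" by (rule continuous_square_integrable[OF continuous_on_const])
  from Fubini_integral[OF pair_integrable[OF this this assms]] show ?thesis by simp
qed

lemma kernel_op_symmetric:
  assumes "square_integrable \<mu> f" "square_integrable \<mu> h" "continuous_on UNIV K"
    and sym: "\<And>x z. K (z, x) = cnj (K (x, z))"
  shows "L2_inner \<mu> (kernel_op K f) h = L2_inner \<mu> f (kernel_op K h)"
proof -
  have "L2_inner \<mu> (kernel_op K f) h = (LINT x|\<mu>. LINT z|\<mu>. K (x, z) * f z * cnj (h x))"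
    by (simp add: L2_inner_def kernel_op_def)
  also have "\<dots> = (LINT z|\<mu>. LINT x|\<mu>. K (x, z) * f z * cnj (h x))"
    by (rule Fubini_integral[OF pair_integrable[OF assms(1-3)], symmetric])
  also have "\<dots> = (LINT z|\<mu>. f z * (LINT x|\<mu>. cnj (K (z, x) * h x)))"
  proof (rule Bochner_Integration.integral_cong[OF refl])
    fix z
    have "(LINT x|\<mu>. K (x, z) * f z * cnj (h x)) = (LINT x|\<mu>. f z * cnj (K (z, x) * h x))"
      by (rule Bochner_Integration.integral_cong[OF refl]) (simp add: sym[of z] mult_ac)
    then show "(LINT x|\<mu>. K (x, z) * f z * cnj (h x)) = f z * (LINT x|\<mu>. cnj (K (z, x) * h x))" by simp
  qed
  also have "\<dots> = L2_inner \<mu> f (kernel_op K h)"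
    unfolding L2_inner_def kernel_op_def Bochner_Integration.integral_cnj ..
  finally show ?thesis .
qed

text \<open>The operators to which the completeness theorem applies: here these are the Laplacian and
  \<open>i X\<close>.  The last condition says that the operator may be applied to one variable of a smooth
  kernel.\<close>

definition invariant_symmetric :: "(('g \<Rightarrow> complex) \<Rightarrow> ('g \<Rightarrow> complex)) \<Rightarrow> bool" where
  "invariant_symmetric D \<longleftrightarrow>
     (\<forall>f\<in>C_inf A. D f \<in> C_inf A) \<and>
     (\<forall>f\<in>C_inf A. \<forall>h\<in>C_inf A. D (\<lambda>x. f x + h x) = (\<lambda>x. D f x + D h x)) \<and>
     (\<forall>c. \<forall>f\<in>C_inf A. D (\<lambda>x. c * f x) = (\<lambda>x. c * D f x)) \<and>
     (\<forall>f\<in>C_inf A. \<forall>h\<in>C_inf A. L2_inner \<mu> (D f) h = L2_inner \<mu> f (D h)) \<and>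
     (\<forall>a. \<forall>f\<in>C_inf A. D (\<lambda>x. f (a \<cdot> x)) = (\<lambda>x. D f (a \<cdot> x))) \<and>
     (\<forall>K\<in>C_inf (prod_atlas A A). (\<lambda>x. D (\<lambda>y. K (fst x, y)) (snd x)) \<in> C_inf (prod_atlas A A))"

lemma invariant_symmetricD:
  assumes "invariant_symmetric D"
  shows "f \<in> C_inf A \<Longrightarrow> D f \<in> C_inf A"
    "f \<in> C_inf A \<Longrightarrow> h \<in> C_inf A \<Longrightarrow> D (\<lambda>x. f x + h x) = (\<lambda>x. D f x + D h x)"
    "f \<in> C_inf A \<Longrightarrow> D (\<lambda>x. c * f x) = (\<lambda>x. c * D f x)"
    "f \<in> C_inf A \<Longrightarrow> h \<in> C_inf A \<Longrightarrow> L2_inner \<mu> (D f) h = L2_inner \<mu> f (D h)"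
    "f \<in> C_inf A \<Longrightarrow> D (\<lambda>x. f (a \<cdot> x)) = (\<lambda>x. D f (a \<cdot> x))"
    "K \<in> C_inf (prod_atlas A A) \<Longrightarrow> (\<lambda>x. D (\<lambda>y. K (fst x, y)) (snd x)) \<in> C_inf (prod_atlas A A)"
  using assms unfolding invariant_symmetric_def by simp_all

definition eigenfunctions :: "(('g \<Rightarrow> complex) \<Rightarrow> ('g \<Rightarrow> complex)) \<Rightarrow> ('g \<Rightarrow> complex) set" where
  "eigenfunctions D = {u \<in> C_inf A. \<exists>l::real. D u = (\<lambda>x. complex_of_real l * u x)}"

text \<open>The integral operator with this kernel is convolution with \<open>k\<close> on the left.\<close>

definition conv_kernel :: "('g \<Rightarrow> real) \<Rightarrow> 'g \<times> 'g \<Rightarrow> complex" where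
  "conv_kernel k = (\<lambda>x. complex_of_real (k (fst x \<cdot> iv (snd x))))"

abbreviation "smoothing k \<equiv> kernel_op (conv_kernel k)"

lemma conv_kernel_C_inf: "k \<in> C_inf A \<Longrightarrow> conv_kernel k \<in> C_inf (prod_atlas A A)"
  unfolding conv_kernel_def
  by (rule C_inf_bounded_linear[OF ta2 bounded_linear_of_real C_inf_mul[OF ta2 smooth_map_fst[OF sa ta]
      smooth_iv_comp[OF ta2 smooth_map_snd[OF ta sa]]]])

lemma conv_kernel_continuous: "k \<in> C_inf A \<Longrightarrow> continuous_on UNIV (conv_kernel k)"
  by (rule C_inf_continuous[OF ta2 conv_kernel_C_inf])

lemma conv_kernel_sym:
  assumes "\<And>x. k (iv x) = k x"
  shows "conv_kernel k (z, x) = cnj (conv_kernel k (x, z))"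
  using assms[of "x \<cdot> iv z"] by (simp add: conv_kernel_def)

lemma kernel_op_C_inf:
  assumes "K \<in> C_inf (prod_atlas A A)" "continuous_on UNIV f"
  shows "kernel_op K f \<in> C_inf A"
proof (rule C_infI)
  fix U \<phi> assume U: "(U, \<phi>) \<in> A"
  have "smooth_on (\<phi> ` U) (\<lambda>p. LINT z|\<mu>. K (inv_into U \<phi> p, z) * f z)"
    by (rule smooth_on_parametric_integral[OF chart_image_open[OF ta U]],
        rule parametric_Ck_bilinear[OF bounded_bilinear.flip[OF bounded_bilinear_mult] chart_image_open[OF ta U]
          assms(2) parametric_Ck_C_inf[OF ta ta assms(1) U]])
  then show "smooth_on (\<phi> ` U) (\<lambda>q. kernel_op K f (inv_into U \<phi> q))" by (simp add: kernel_op_def)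
qed

lemma smoothing_translates:
  assumes k: "k \<in> C_inf A" and [measurable]: "f \<in> borel_measurable borel"
  shows "smoothing k f x = (LINT y|\<mu>. complex_of_real (k y) * f (iv y \<cdot> x))"
proof -
  have [measurable]: "k \<in> borel_measurable borel" by (rule borel_measurable_continuous_onI[OF C_inf_continuous[OF ta k]])
  have [measurable]: "(\<lambda>z. x \<cdot> iv z) \<in> borel_measurable borel" by (intro borel_measurable_continuous_onI continuous_intros)
  let ?F = "\<lambda>z. complex_of_real (k (x \<cdot> iv z)) * f z"
  have m: "?F \<in> borel_measurable borel" by measurable
  have m': "(\<lambda>z. ?F (z \<cdot> x)) \<in> borel_measurable borel" by (rule measurable_compose[OF measurable_translations(2) m])
  have "smoothing k f x = integral\<^sup>L \<mu> ?F" by (simp add: kernel_op_def conv_kernel_def)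
  also have "\<dots> = (LINT z|\<mu>. ?F (z \<cdot> x))" by (rule haar_integral_right[OF m, symmetric])
  also have "\<dots> = (LINT y|\<mu>. ?F (iv y \<cdot> x))" by (rule haar_integral_iv[OF m', symmetric])
  finally show ?thesis by simp
qed

text \<open>A smoothing operator is an average of left translations, so it commutes with left-invariant
  operators.  Testing against smooth functions avoids differentiating the average.\<close>

lemma smoothing_commutes:
  assumes D: "invariant_symmetric D" and k: "k \<in> C_inf A" and f: "f \<in> C_inf A"
  shows "D (smoothing k f) = smoothing k (D f)"
proof -
  note D = invariant_symmetricD[OF D]
  have weak: "L2_inner \<mu> (smoothing k f) h = (LINT y|\<mu>. complex_of_real (k y) * L2_inner \<mu> (\<lambda>x. f (iv y \<cdot> x)) h)"
    if f: "continuous_on UNIV f" and h: "continuous_on UNIV h" for f h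
  proof -
    have ck: "continuous_on UNIV k" by (rule C_inf_continuous[OF ta k])
    have "continuous_on UNIV (\<lambda>p. complex_of_real (k (snd p)) * f (iv (snd p) \<cdot> fst p) * cnj (h (fst p)))"
      by (intro continuous_intros continuous_on_compose2[OF ck continuous_on_snd] continuous_on_compose2[OF f]
          continuous_on_compose2[OF h continuous_on_fst]) auto
    from fubini_continuous[OF this]
    have "(LINT x|\<mu>. LINT y|\<mu>. complex_of_real (k y) * f (iv y \<cdot> x) * cnj (h x)) =
        (LINT y|\<mu>. LINT x|\<mu>. complex_of_real (k y) * f (iv y \<cdot> x) * cnj (h x))" by simp
    note swap = this
    have "L2_inner \<mu> (smoothing k f) h = (LINT x|\<mu>. (LINT y|\<mu>. complex_of_real (k y) * f (iv y \<cdot> x)) * cnj (h x))"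
      unfolding L2_inner_def smoothing_translates[OF k borel_measurable_continuous_onI[OF f]] ..
    also have "\<dots> = (LINT x|\<mu>. LINT y|\<mu>. complex_of_real (k y) * f (iv y \<cdot> x) * cnj (h x))"
      by (simp only: Bochner_Integration.integral_mult_left_zero)
    also have "\<dots> = (LINT y|\<mu>. complex_of_real (k y) * L2_inner \<mu> (\<lambda>x. f (iv y \<cdot> x)) h)"
      unfolding swap by (simp only: L2_inner_def mult.assoc Bochner_Integration.integral_mult_right_zero)
    finally show ?thesis .
  qed
  have Sf: "smoothing k f \<in> C_inf A" "smoothing k (D f) \<in> C_inf A"
    by (rule kernel_op_C_inf[OF conv_kernel_C_inf[OF k] C_inf_continuous[OF ta f]],
        rule kernel_op_C_inf[OF conv_kernel_C_inf[OF k] C_inf_continuous[OF ta D(1)[OF f]]])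
  have eq: "L2_inner \<mu> (smoothing k (D f)) h = L2_inner \<mu> (D (smoothing k f)) h" if h: "h \<in> C_inf A" for h
  proof -
    have "L2_inner \<mu> (smoothing k (D f)) h = (LINT y|\<mu>. complex_of_real (k y) * L2_inner \<mu> (D (\<lambda>x. f (iv y \<cdot> x))) h)"
      by (simp add: weak[OF C_inf_continuous[OF ta D(1)[OF f]] C_inf_continuous[OF ta h]] D(5)[OF f])
    also have "\<dots> = (LINT y|\<mu>. complex_of_real (k y) * L2_inner \<mu> (\<lambda>x. f (iv y \<cdot> x)) (D h))"
      by (simp add: D(4)[OF C_inf_left_translate[OF f] h])
    also have "\<dots> = L2_inner \<mu> (smoothing k f) (D h)"
      by (rule weak[OF C_inf_continuous[OF ta f] C_inf_continuous[OF ta D(1)[OF h]], symmetric])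
    finally show ?thesis by (simp add: D(4)[OF Sf(1) h])
  qed
  let ?d = "\<lambda>x. D (smoothing k f) x - smoothing k (D f) x"
  have d: "?d \<in> C_inf A" by (rule C_inf_diff[OF ta D(1)[OF Sf(1)] Sf(2)])
  have "L2_inner \<mu> ?d ?d = 0"
    using inner_diff[OF C_inf_square_integrable[OF D(1)[OF Sf(1)]] C_inf_square_integrable[OF Sf(2)] C_inf_square_integrable[OF d]]
      eq[OF d] by simp
  then have "L2_norm \<mu> ?d = 0" by (simp add: inner_self)
  from continuous_norm_zero[OF C_inf_continuous[OF ta d] this] show ?thesis by (simp add: fun_eq_iff)
qed

text \<open>Translating by elements close to the identity moves a continuous function little, uniformly on the
  group; so does averaging such translates.  Adding to a bump function its composition with inversion
  makes the kernel symmetric.\<close>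

lemma approximate_identity:
  assumes h: "continuous_on UNIV (h :: 'g \<Rightarrow> complex)" and \<epsilon>: "\<epsilon> > 0"
  obtains k where "k \<in> C_inf A" "\<And>x. k (iv x) = k x" "\<And>x. cmod (h x - smoothing k h x) \<le> \<epsilon>"
proof -
  have "continuous_on UNIV (\<lambda>p. h (iv (fst p) \<cdot> snd p))"
    by (intro continuous_on_compose2[OF h] continuous_intros) auto
  from kernel_near[OF this \<epsilon>, of e]
  obtain X where X: "e \<in> X" "open X" "\<forall>y\<in>X. \<forall>z. cmod (h (iv y \<cdot> z) - h z) \<le> \<epsilon>" by auto
  have oY: "open (X \<inter> iv -` X)" "e \<in> X \<inter> iv -` X"
    using X continuous_iv by (auto simp: continuous_on_open_vimage intro!: open_Int)
  obtain \<eta> :: "'g \<Rightarrow> real" where \<eta>: "\<eta> \<in> C_inf A" "\<And>y. 0 \<le> \<eta> y" "\<And>y. \<eta> y \<noteq> 0 \<Longrightarrow> y \<in> X \<inter> iv -` X" "\<eta> e = 1"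
    by (rule manifold_bump[OF sa oY]) blast
  define k0 where "k0 y = \<eta> y + \<eta> (iv y)" for y
  have k0: "k0 \<in> C_inf A" unfolding k0_def[abs_def] by (rule C_inf_add[OF ta \<eta>(1) C_inf_iv[OF \<eta>(1)]])
  have k0n: "0 \<le> k0 y" for y using \<eta>(2) by (simp add: k0_def)
  define c where "c = integral\<^sup>L \<mu> k0"
  have c: "c > 0"
  proof (rule ccontr)
    assume "\<not> c > 0"
    moreover have "c \<ge> 0" unfolding c_def using k0n by (rule integral_nonneg_AE[OF AE_I2])
    ultimately have "k0 = (\<lambda>x. 0)" using continuous_integral_zero[OF C_inf_continuous[OF ta k0] k0n] by (simp add: c_def)
    then have "k0 e = 0" by (rule fun_cong)
    then show False using \<eta>(4) by (simp add: k0_def)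
  qed
  define k where "k y = (1 / c) * k0 y" for y
  have k: "k \<in> C_inf A" unfolding k_def[abs_def] by (rule C_inf_mult[OF ta C_inf_const[OF ta] k0])
  have kn: "0 \<le> k y" for y using k0n c by (simp add: k_def)
  have k1: "integral\<^sup>L \<mu> k = 1" using c by (simp add: k_def[abs_def] c_def)
  have supp: "y \<in> X" if "k y \<noteq> 0" for y
  proof -
    have "\<eta> y \<noteq> 0 \<or> \<eta> (iv y) \<noteq> 0" using that by (auto simp: k_def k0_def)
    then show ?thesis using \<eta>(3)[of y] \<eta>(3)[of "iv y"] by auto
  qed
  have ik: "integrable \<mu> k" by (rule integrable_continuous[OF C_inf_continuous[OF ta k]])
  show thesis
  proof (rule that[OF k])
    show "k (iv x) = k x" for x by (simp add: k_def k0_def)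
    fix x
    have i: "integrable \<mu> (\<lambda>y. complex_of_real (k y) * h (iv y \<cdot> x))"
      by (rule integrable_continuous) (intro continuous_intros C_inf_continuous[OF ta k] continuous_on_compose2[OF h]; simp)
    have "h x - smoothing k h x = (LINT y|\<mu>. complex_of_real (k y) * h x) - (LINT y|\<mu>. complex_of_real (k y) * h (iv y \<cdot> x))"
      using k1 by (simp add: smoothing_translates[OF k borel_measurable_continuous_onI[OF h]])
    also have "\<dots> = (LINT y|\<mu>. complex_of_real (k y) * h x - complex_of_real (k y) * h (iv y \<cdot> x))"
      using i ik by simp
    also have "cmod \<dots> \<le> (LINT y|\<mu>. cmod (complex_of_real (k y) * h x - complex_of_real (k y) * h (iv y \<cdot> x)))"
      by (rule integral_norm_bound)
    also have "\<dots> \<le> (LINT y|\<mu>. k y * \<epsilon>)"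
    proof (rule integral_mono)
      show "integrable \<mu> (\<lambda>y. cmod (complex_of_real (k y) * h x - complex_of_real (k y) * h (iv y \<cdot> x)))"
        using i ik by (intro integrable_norm Bochner_Integration.integrable_diff) simp_all
      show "cmod (complex_of_real (k y) * h x - complex_of_real (k y) * h (iv y \<cdot> x)) \<le> k y * \<epsilon>" for y
      proof (cases "k y = 0")
        case False
        then have "cmod (h (iv y \<cdot> x) - h x) \<le> \<epsilon>" using X(3) supp by blast
        then have "k y * cmod (h x - h (iv y \<cdot> x)) \<le> k y * \<epsilon>" using kn by (simp add: mult_left_mono Real_Vector_Spaces.norm_minus_commute)
        then show ?thesis using kn[of y] by (simp add: norm_mult flip: right_diff_distrib)
      qed simp
    qed (use ik in simp)
    also have "\<dots> = \<epsilon>" using k1 by simp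
    finally show "cmod (h x - smoothing k h x) \<le> \<epsilon>" .
  qed
qed

text \<open>By second countability, countably many bump functions inside \<open>U\<close> have no common zero in \<open>U\<close>.\<close>

lemma open_indicator_limit:
  assumes "open U"
  obtains a :: "nat \<Rightarrow> 'g \<Rightarrow> real" where "\<And>n. continuous_on UNIV (a n)" "\<And>n x. 0 \<le> a n x \<and> a n x \<le> 1"
    "\<And>x. (\<lambda>n. a n x) \<longlonglongrightarrow> indicator U x"
proof (cases "U = {}")
  case True
  then show thesis using that[of "\<lambda>n x. 0"] by simp
next
  case False
  have "\<exists>\<eta> :: 'g \<Rightarrow> real. continuous_on UNIV \<eta> \<and> (\<forall>y. 0 \<le> \<eta> y) \<and> (\<forall>y. \<eta> y \<noteq> 0 \<longrightarrow> y \<in> U) \<and> \<eta> x = 1" if x: "x \<in> U" for x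
  proof -
    obtain \<eta> :: "'g \<Rightarrow> real" where "\<eta> \<in> C_inf A" "\<And>y. 0 \<le> \<eta> y" "\<And>y. \<eta> y \<noteq> 0 \<Longrightarrow> y \<in> U" "\<eta> x = 1"
      by (rule manifold_bump[OF sa assms x]) blast
    then show ?thesis using C_inf_continuous[OF ta, of \<eta>] by blast
  qed
  then obtain \<eta> :: "'g \<Rightarrow> 'g \<Rightarrow> real" where \<eta>: "\<And>x. x \<in> U \<Longrightarrow> continuous_on UNIV (\<eta> x)" "\<And>x y. x \<in> U \<Longrightarrow> 0 \<le> \<eta> x y"
    "\<And>x y. x \<in> U \<Longrightarrow> \<eta> x y \<noteq> 0 \<Longrightarrow> y \<in> U" "\<And>x. x \<in> U \<Longrightarrow> \<eta> x x = 1" by metis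
  have o: "open {y. \<eta> x y \<noteq> 0}" if "x \<in> U" for x
    by (rule open_Collect_neq[OF \<eta>(1)[OF that] continuous_on_const])
  obtain F' where F': "F' \<subseteq> (\<lambda>x. {y. \<eta> x y \<noteq> 0}) ` U" "countable F'" "\<Union>F' = \<Union>((\<lambda>x. {y. \<eta> x y \<noteq> 0}) ` U)"
    by (rule Lindelof[of "(\<lambda>x. {y. \<eta> x y \<noteq> 0}) ` U"]) (use o in auto)
  obtain I where I: "I \<subseteq> U" "countable I" "F' = (\<lambda>x. {y. \<eta> x y \<noteq> 0}) ` I"
    using countable_subset_image[THEN iffD1, OF conjI[OF F'(2,1)]] by blast
  have cover: "\<exists>x\<in>I. \<eta> x y \<noteq> 0" if "y \<in> U" for y
  proof -
    have "y \<in> \<Union>F'" unfolding F'(3) using \<eta>(4)[OF that] by (intro UN_I[OF that]) simp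
    then show ?thesis using I(3) by auto
  qed
  then have Ine: "I \<noteq> {}" using False by blast
  define b where "b i = \<eta> (from_nat_into I i)" for i
  have bU: "from_nat_into I i \<in> U" for i using from_nat_into[OF Ine] I(1) by blast
  define a where "a n y = min 1 (real n * (\<Sum>i<n. b i y))" for n y
  show thesis
  proof (rule that)
    show "continuous_on UNIV (a n)" for n
      unfolding a_def[abs_def] b_def by (intro continuous_intros \<eta>(1)[OF bU])
    have bn: "0 \<le> b i y" for i y unfolding b_def by (rule \<eta>(2)[OF bU])
    show "0 \<le> a n x \<and> a n x \<le> 1" for n x by (simp add: a_def bn sum_nonneg)
    fix y
    show "(\<lambda>n. a n y) \<longlonglongrightarrow> indicator U y"
    proof (cases "y \<in> U")
      case False
      have "b i y = 0" for i using \<eta>(3)[OF bU, of i y] False by (auto simp: b_def)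
      then show ?thesis using False by (simp add: a_def)
    next
      case True
      then obtain x where x: "x \<in> I" "\<eta> x y \<noteq> 0" using cover by blast
      then obtain i where i: "from_nat_into I i = x" using from_nat_into_surj[OF I(2)] by blast
      have biy: "b i y > 0" using x bn[of i y] i by (simp add: b_def)
      obtain N where N: "1 / b i y < real N" using reals_Archimedean2 by blast
      have "a n y = 1" if n: "n \<ge> max N (Suc i)" for n
      proof -
        have "b i y \<le> (\<Sum>i<n. b i y)" by (rule member_le_sum) (use n bn in auto)
        moreover have "1 \<le> real n * b i y"
        proof -
          have "1 < real N * b i y" using N biy by (simp add: field_simps)
          also have "\<dots> \<le> real n * b i y" using n biy by (intro mult_right_mono) auto
          finally show ?thesis by simp
        qed
        ultimately have "1 \<le> real n * (\<Sum>i<n. b i y)" using mult_left_mono[of "b i y" "\<Sum>i<n. b i y" "real n"] by linarith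
        then show ?thesis by (simp add: a_def)
      qed
      then show ?thesis using True by (intro tendsto_eventually) (auto simp: eventually_sequentially intro!: exI[of _ "max N (Suc i)"])
    qed
  qed
qed

text \<open>The indicator of an open set is a limit of continuous functions, so an integrable function
  orthogonal to the continuous functions has integral zero over open sets, hence over Borel sets.\<close>

lemma orthogonal_continuous_zero:
  assumes f: "square_integrable \<mu> f" and orth: "\<And>h. continuous_on UNIV h \<Longrightarrow> L2_inner \<mu> f h = 0"
  shows "AE x in \<mu>. f x = 0"
proof -
  note [measurable] = square_integrable_measurable[OF f]
  note fi = integrable_square[OF f]
  have fB: "integrable \<mu> (\<lambda>x. indicator B x *\<^sub>R f x)" if "B \<in> sets \<mu>" for B
    by (rule integrable_mult_indicator[OF that fi])
  have op: "(LINT x|\<mu>. indicator U x *\<^sub>R f x) = 0" if U: "open U" for U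
  proof -
    obtain a :: "nat \<Rightarrow> 'g \<Rightarrow> real" where a: "\<And>n. continuous_on UNIV (a n)" "\<And>n x. 0 \<le> a n x \<and> a n x \<le> 1"
      "\<And>x. (\<lambda>n. a n x) \<longlonglongrightarrow> indicator U x" by (rule open_indicator_limit[OF U]) blast
    have ci: "continuous_on UNIV (\<lambda>x. complex_of_real (a n x))" for n
      by (intro continuous_intros a(1))
    have z: "(LINT x|\<mu>. a n x *\<^sub>R f x) = 0" for n
      using orth[OF ci[of n]] by (simp add: L2_inner_def scaleR_conv_of_real mult.commute)
    have "(\<lambda>n. LINT x|\<mu>. a n x *\<^sub>R f x) \<longlonglongrightarrow> (LINT x|\<mu>. indicator U x *\<^sub>R f x)"
    proof (rule integral_dominated_convergence[where w = "\<lambda>x. cmod (f x)"])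
      have [measurable]: "a n \<in> borel_measurable \<mu>" for n using a(1) by (rule continuous_measurable)
      show "(\<lambda>x. a n x *\<^sub>R f x) \<in> borel_measurable \<mu>" for n by measurable
      have [measurable]: "U \<in> sets \<mu>" using U by (simp add: sets_mu)
      show "(\<lambda>x. indicator U x *\<^sub>R f x) \<in> borel_measurable \<mu>" by measurable
      show "integrable \<mu> (\<lambda>x. cmod (f x))" by (rule integrable_norm[OF fi])
      show "AE x in \<mu>. (\<lambda>n. a n x *\<^sub>R f x) \<longlonglongrightarrow> indicator U x *\<^sub>R f x"
        by (rule AE_I2) (intro tendsto_intros a(3))
      show "AE x in \<mu>. norm (a n x *\<^sub>R f x) \<le> cmod (f x)" for n
        using a(2) by (simp add: mult_left_le_one_le)
    qed
    then show ?thesis unfolding z by (rule LIMSEQ_unique) simp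
  qed
  have bor: "(LINT x|\<mu>. indicator B x *\<^sub>R f x) = 0" if "B \<in> sigma_sets UNIV {U. open U}" for B
  proof (rule sigma_sets_induct_disjoint[of "{U. open U}" UNIV B])
    show "Int_stable {U :: 'g set. open U}" by (auto simp: Int_stable_def)
    show "(LINT x|\<mu>. indicator B x *\<^sub>R f x) = 0" if "B \<in> {U. open U}" for B using that op by simp
    have s: "sigma_sets UNIV {U. open U} = sets \<mu>" by (simp add: sets_mu borel_def)
    show "(LINT x|\<mu>. indicator (UNIV - B) x *\<^sub>R f x) = 0"
      if B: "B \<in> sigma_sets UNIV {U. open U}" and z: "(LINT x|\<mu>. indicator B x *\<^sub>R f x) = 0" for B
    proof -
      have "(LINT x|\<mu>. indicator (UNIV - B) x *\<^sub>R f x) = (LINT x|\<mu>. indicator UNIV x *\<^sub>R f x - indicator B x *\<^sub>R f x)"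
        by (rule Bochner_Integration.integral_cong) (auto split: split_indicator)
      also have "\<dots> = 0" using fB[of B] fi B z op[of UNIV] by (simp add: s)
      finally show ?thesis .
    qed
    show "(LINT x|\<mu>. indicator (\<Union>i. B i) x *\<^sub>R f x) = 0"
      if dis: "disjoint_family B" and B: "range B \<subseteq> sigma_sets UNIV {U. open U}"
        and z: "\<And>i. (LINT x|\<mu>. indicator (B i) x *\<^sub>R f x) = 0" for B :: "nat \<Rightarrow> 'g set"
    proof -
      have Bm [measurable]: "B i \<in> sets \<mu>" for i using B s by auto
      have "(LINT x|\<mu>. indicator (\<Union>i<n. B i) x *\<^sub>R f x) = 0" for n
      proof -
        have d: "disjoint_family_on B {..<n}" using dis by (auto simp: disjoint_family_on_def)
        have "(LINT x|\<mu>. indicator (\<Union>i<n. B i) x *\<^sub>R f x) = (LINT x|\<mu>. (\<Sum>i<n. indicator (B i) x *\<^sub>R f x))"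
          by (rule Bochner_Integration.integral_cong)
            (simp_all add: indicator_UN_disjoint[OF _ d] scaleR_sum_left)
        also have "\<dots> = (\<Sum>i<n. LINT x|\<mu>. indicator (B i) x *\<^sub>R f x)"
          by (rule Bochner_Integration.integral_sum) (rule fB[OF Bm])
        also have "\<dots> = 0" by (simp add: z)
        finally show ?thesis .
      qed
      moreover have "(\<lambda>n. LINT x|\<mu>. indicator (\<Union>i<n. B i) x *\<^sub>R f x) \<longlonglongrightarrow> (LINT x|\<mu>. indicator (\<Union>i. B i) x *\<^sub>R f x)"
      proof (rule integral_dominated_convergence[where w = "\<lambda>x. cmod (f x)"])
        show "AE x in \<mu>. (\<lambda>n. indicator (\<Union>i<n. B i) x *\<^sub>R f x) \<longlonglongrightarrow> indicator (\<Union>i. B i) x *\<^sub>R f x"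
          by (rule AE_I2) (intro tendsto_scaleR LIMSEQ_indicator_UN tendsto_const)
      qed (use integrable_norm[OF fi] in \<open>auto split: split_indicator\<close>)
      ultimately have "(\<lambda>n. 0) \<longlonglongrightarrow> (LINT x|\<mu>. indicator (\<Union>i. B i) x *\<^sub>R f x)" by simp
      then show ?thesis by (rule LIMSEQ_unique[OF _ tendsto_const])
    qed
  qed (use that in auto)
  have bor': "(LINT x|\<mu>. indicator B x *\<^sub>R f x) = 0" if "B \<in> sets \<mu>" for B
    using bor[of B] that by (simp add: sets_mu borel_def)
  have real0: "AE x in \<mu>. r x \<le> 0" if r: "integrable \<mu> r" "\<And>B. B \<in> sets \<mu> \<Longrightarrow> (LINT x|\<mu>. indicator B x *\<^sub>R r x) = 0" for r :: "'g \<Rightarrow> real"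
  proof -
    have [measurable]: "r \<in> borel_measurable \<mu>" using r(1) by simp
    have B: "{x \<in> space \<mu>. r x > 0} \<in> sets \<mu>" by measurable
    let ?i = "\<lambda>x. indicator {x \<in> space \<mu>. r x > 0} x *\<^sub>R r x"
    have "AE x in \<mu>. ?i x = 0"
      using integral_nonneg_eq_0_iff_AE[OF integrable_mult_indicator[OF B r(1)]] r(2)[OF B]
      by (auto split: split_indicator)
    then show ?thesis by eventually_elim (auto split: split_indicator_asm)
  qed
  have reR: "(LINT x|\<mu>. indicator B x *\<^sub>R Re (c * f x)) = 0" if B: "B \<in> sets \<mu>" for B c
  proof -
    have i: "integrable \<mu> (\<lambda>x. c * (indicator B x *\<^sub>R f x))"
      by (rule Bochner_Integration.integrable_mult_right) (rule fB[OF B])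
    have "(LINT x|\<mu>. indicator B x *\<^sub>R Re (c * f x)) = (LINT x|\<mu>. Re (c * (indicator B x *\<^sub>R f x)))"
      by (rule Bochner_Integration.integral_cong) (simp_all add: mult_scaleR_right)
    also have "\<dots> = Re (LINT x|\<mu>. c * (indicator B x *\<^sub>R f x))" by (rule integral_Re[OF i])
    also have "\<dots> = 0" unfolding Bochner_Integration.integral_mult_right_zero bor'[OF B] by simp
    finally show ?thesis .
  qed
  have "AE x in \<mu>. Re (c * f x) \<le> 0" for c
    by (rule real0) (use fi reR in auto)
  from this[of 1] this[of "-1"] this[of "\<i>"] this[of "-\<i>"] show ?thesis
    by eventually_elim (simp add: complex_eq_iff)
qed

text \<open>Let \<open>h\<close> be orthogonal to all eigenfunctions.  If \<open>S h \<noteq> 0\<close> for a smoothing operator \<open>S\<close>, then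
  \<open>S\<close> has a non-zero eigenspace \<open>V\<close> inside the orthogonal complement.  It consists of smooth
  functions and is invariant under \<open>D\<close>, which acts on it as an integral operator, the derivatives
  being moved to the kernel.  So \<open>D\<close> has an eigenfunction in \<open>V\<close>, orthogonal to itself.\<close>

lemma smoothing_orthogonal_zero:
  assumes D: "invariant_symmetric D" and k: "k \<in> C_inf A" "\<And>x. k (iv x) = k x"
    and h: "continuous_on UNIV h" "\<And>u. u \<in> eigenfunctions D \<Longrightarrow> L2_inner \<mu> h u = 0"
  shows "smoothing k h = (\<lambda>x. 0)"
proof (rule ccontr)
  note DD = invariant_symmetricD[OF D]
  note cK = conv_kernel_continuous[OF k(1)]
  note Ssym = kernel_op_symmetric[OF _ _ cK conv_kernel_sym[of k, OF k(2)]]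
  let ?S = "smoothing k"
  assume nz: "?S h \<noteq> (\<lambda>x. 0)"
  define M where "M = {f. continuous_on UNIV f \<and> (\<forall>u\<in>eigenfunctions D. L2_inner \<mu> f u = 0)}"
  have Mc: "continuous_on UNIV f" if "f \<in> M" for f using that by (simp add: M_def)
  note Msq = continuous_square_integrable[OF Mc]
  have esm: "u \<in> C_inf A" if "u \<in> eigenfunctions D" for u using that by (simp add: eigenfunctions_def)
  have Se: "?S u \<in> eigenfunctions D" if u: "u \<in> eigenfunctions D" for u
  proof -
    obtain l where l: "D u = (\<lambda>x. complex_of_real l * u x)" using u by (auto simp: eigenfunctions_def)
    have squ: "square_integrable \<mu> u" by (rule C_inf_square_integrable[OF esm[OF u]])
    have "D (?S u) = (\<lambda>x. complex_of_real l * ?S u x)"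
      unfolding smoothing_commutes[OF D k(1) esm[OF u]] l by (rule kernel_op_linear(2)[OF cK squ squ])
    then show ?thesis using kernel_op_C_inf[OF conv_kernel_C_inf[OF k(1)] C_inf_continuous[OF ta esm[OF u]]]
      by (auto simp: eigenfunctions_def)
  qed
  have M_add: "(\<lambda>x. f x + h x) \<in> M" if "f \<in> M" "h \<in> M" for f h
    using that inner_add[OF Msq Msq C_inf_square_integrable[OF esm], OF that]
    by (auto simp: M_def intro: continuous_on_add)
  have M_scale: "(\<lambda>x. c * f x) \<in> M" if "f \<in> M" for c f
    using that by (auto simp: M_def inner_scale intro: continuous_intros)
  have M_limit: "f' \<in> M" if f: "\<And>n. f n \<in> M" and f': "continuous_on UNIV f'" "uniform_limit UNIV f f' sequentially" for f f'
  proof -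
    have "L2_inner \<mu> f' u = 0" if u: "u \<in> eigenfunctions D" for u
    proof -
      have "(\<lambda>n. L2_inner \<mu> (f n) u) \<longlonglongrightarrow> L2_inner \<mu> f' u"
        by (rule inner_tendsto[OF Msq[OF f] continuous_square_integrable[OF f'(1)] C_inf_square_integrable[OF esm[OF u]]
            uniform_limit_norm[OF Mc[OF f] f']])
      moreover have "L2_inner \<mu> (f n) u = 0" for n using f[of n] u by (simp add: M_def)
      ultimately show ?thesis by (simp add: LIMSEQ_const_iff)
    qed
    then show ?thesis using f'(1) by (simp add: M_def)
  qed
  have M_S: "?S f \<in> M" if f: "f \<in> M" for f
  proof -
    have "L2_inner \<mu> (?S f) u = 0" if u: "u \<in> eigenfunctions D" for u
      using Ssym[OF Msq[OF f] C_inf_square_integrable[OF esm[OF u]]] f Se[OF u] by (simp add: M_def)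
    then show ?thesis using kernel_op_continuous[OF cK Msq[OF f]] by (simp add: M_def)
  qed
  have hM: "h \<in> M" using h by (simp add: M_def)
  obtain \<kappa> \<phi> where \<kappa>: "\<kappa> \<noteq> (0::real)" and \<phi>: "\<phi> \<in> M" "\<phi> \<noteq> (\<lambda>x. 0)" "?S \<phi> = (\<lambda>x. complex_of_real \<kappa> * \<phi> x)"
    by (rule kernel_op_eigenvector[OF cK Mc M_add M_scale M_limit M_S Ssym[OF Msq Msq] hM nz])
  define V where "V = {f \<in> M. ?S f = (\<lambda>x. complex_of_real \<kappa> * f x)}"
  have VM: "f \<in> M" if "f \<in> V" for f using that by (simp add: V_def)
  have VS: "?S f = (\<lambda>x. complex_of_real \<kappa> * f x)" if "f \<in> V" for f using that by (simp add: V_def)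
  have Vsm: "f \<in> C_inf A" if f: "f \<in> V" for f
  proof -
    have "(\<lambda>x. complex_of_real (1 / \<kappa>) * ?S f x) \<in> C_inf A"
      by (rule C_inf_mult[OF ta C_inf_const[OF ta] kernel_op_C_inf[OF conv_kernel_C_inf[OF k(1)] Mc[OF VM[OF f]]]])
    moreover have "(\<lambda>x. complex_of_real (1 / \<kappa>) * ?S f x) = f" using \<kappa> by (simp add: VS[OF f])
    ultimately show ?thesis by simp
  qed
  have DV: "D f \<in> V" if f: "f \<in> V" for f
  proof -
    have "L2_inner \<mu> (D f) u = 0" if u: "u \<in> eigenfunctions D" for u
    proof -
      obtain l where l: "D u = (\<lambda>x. complex_of_real l * u x)" using u by (auto simp: eigenfunctions_def)
      have "L2_inner \<mu> f u = 0" using VM[OF f] u by (simp add: M_def)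
      then show ?thesis unfolding DD(4)[OF Vsm[OF f] esm[OF u]] l inner_scale_right by simp
    qed
    moreover have "?S (D f) = (\<lambda>x. complex_of_real \<kappa> * D f x)"
      unfolding smoothing_commutes[OF D k(1) Vsm[OF f], symmetric] VS[OF f] by (rule DD(3)[OF Vsm[OF f]])
    ultimately show ?thesis using C_inf_continuous[OF ta DD(1)[OF Vsm[OF f]]] by (simp add: V_def M_def)
  qed
  define K' where "K' = (\<lambda>p. complex_of_real (1 / \<kappa>) * cnj (D (\<lambda>y. conv_kernel k (fst p, y)) (snd p)))"
  have cK': "continuous_on UNIV K'"
    unfolding K'_def
    by (intro continuous_intros C_inf_continuous[OF ta2 DD(6)[OF conv_kernel_C_inf[OF k(1)]]])
  have DK: "kernel_op K' f = D f" if f: "f \<in> V" for f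
  proof
    fix x
    have sl: "(\<lambda>y. conv_kernel k (x, y)) \<in> C_inf A" by (rule C_inf_slice[OF ta sa conv_kernel_C_inf[OF k(1)]])
    have "complex_of_real \<kappa> * D f x = (LINT z|\<mu>. conv_kernel k (x, z) * D f z)"
      using fun_cong[OF VS[OF DV[OF f]], of x] by (simp add: kernel_op_def)
    also have "\<dots> = L2_inner \<mu> (D f) (\<lambda>y. conv_kernel k (x, y))"
      unfolding L2_inner_def by (rule Bochner_Integration.integral_cong[OF refl]) (simp add: conv_kernel_def)
    also have "\<dots> = (LINT z|\<mu>. f z * cnj (D (\<lambda>y. conv_kernel k (x, y)) z))"
      unfolding DD(4)[OF Vsm[OF f] sl] by (simp add: L2_inner_def)
    finally have "D f x = complex_of_real (1 / \<kappa>) * (LINT z|\<mu>. f z * cnj (D (\<lambda>y. conv_kernel k (x, y)) z))"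
      using \<kappa> by (simp add: field_simps)
    also have "\<dots> = (LINT z|\<mu>. complex_of_real (1 / \<kappa>) * (f z * cnj (D (\<lambda>y. conv_kernel k (x, y)) z)))"
      by (rule Bochner_Integration.integral_mult_right_zero[symmetric])
    also have "\<dots> = kernel_op K' f x"
      unfolding kernel_op_def K'_def by (rule Bochner_Integration.integral_cong[OF refl]) (simp add: mult_ac)
    finally show "kernel_op K' f x = D f x" by simp
  qed
  have no_eigen: "f = (\<lambda>x. 0)" if f: "f \<in> V" and eig: "D f = (\<lambda>x. complex_of_real l * f x)" for f and l :: real
  proof -
    have "f \<in> eigenfunctions D" using Vsm[OF f] eig by (auto simp: eigenfunctions_def)
    then have "L2_inner \<mu> f f = 0" using VM[OF f] by (simp add: M_def)
    then show ?thesis using continuous_norm_zero[OF Mc[OF VM[OF f]]] by (simp add: inner_self)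
  qed
  have \<phi>V: "\<phi> \<in> V" using \<phi> by (simp add: V_def)
  have nzD: "kernel_op K' \<phi> \<noteq> (\<lambda>x. 0)"
  proof
    assume "kernel_op K' \<phi> = (\<lambda>x. 0)"
    then have "D \<phi> = (\<lambda>x. complex_of_real 0 * \<phi> x)" using DK[OF \<phi>V] by simp
    from no_eigen[OF \<phi>V this] show False using \<phi>(2) by simp
  qed
  have Vsq: "square_integrable \<mu> f" if "f \<in> V" for f by (rule Msq[OF VM[OF that]])
  have V_add: "(\<lambda>x. f x + h x) \<in> V" if "f \<in> V" "h \<in> V" for f h
    using M_add[OF VM[OF that(1)] VM[OF that(2)]] kernel_op_linear(1)[OF cK Vsq[OF that(1)] Vsq[OF that(2)]]
      VS[OF that(1)] VS[OF that(2)] by (simp add: V_def distrib_left)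
  have V_scale: "(\<lambda>x. c * f x) \<in> V" if f: "f \<in> V" for c f
    using M_scale[OF VM[OF f], of c] kernel_op_linear(2)[OF cK Vsq[OF f] Vsq[OF f], of c] VS[OF f]
    by (simp add: V_def mult_ac)
  have V_limit: "f' \<in> V" if f: "\<And>n. f n \<in> V" and f': "continuous_on UNIV f'" "uniform_limit UNIV f f' sequentially" for f f'
  proof -
    have M': "f' \<in> M" by (rule M_limit[OF VM[OF f] f'])
    have "?S f' x = complex_of_real \<kappa> * f' x" for x
    proof -
      have "(\<lambda>n. ?S (f n) x) \<longlonglongrightarrow> ?S f' x"
        by (rule kernel_op_tendsto[OF cK Vsq[OF f] Msq[OF M'] uniform_limit_norm[OF Mc[OF VM[OF f]] f']])
      moreover have "(\<lambda>n. complex_of_real \<kappa> * f n x) \<longlonglongrightarrow> complex_of_real \<kappa> * f' x"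
        by (intro tendsto_intros tendsto_uniform_limitI[OF f'(2)]) simp
      ultimately show ?thesis using LIMSEQ_unique by (simp add: VS[OF f])
    qed
    then show ?thesis using M' by (simp add: V_def fun_eq_iff)
  qed
  have V_inv: "kernel_op K' f \<in> V" if "f \<in> V" for f using DV[OF that] DK[OF that] by simp
  have V_sym: "L2_inner \<mu> (kernel_op K' f) h = L2_inner \<mu> f (kernel_op K' h)" if "f \<in> V" "h \<in> V" for f h
    using DD(4)[OF Vsm[OF that(1)] Vsm[OF that(2)]] by (simp add: DK that)
  obtain l \<psi> where "\<psi> \<in> V" "\<psi> \<noteq> (\<lambda>x. 0)" "kernel_op K' \<psi> = (\<lambda>x. complex_of_real l * \<psi> x)"
    by (rule kernel_op_eigenvector[OF cK' Mc[OF VM] V_add V_scale V_limit V_inv V_sym \<phi>V nzD])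
  then show False using no_eigen[of \<psi> l] DK[of \<psi>] by simp
qed

text \<open>A smoothing operator \<open>S\<close> preserves eigenfunctions and is symmetric, so \<open>S f\<close> is continuous and
  still orthogonal to them.  Hence \<open>S (S f) = 0\<close>, thus \<open>S f = 0\<close>, and \<open>\<langle>f, S h\<rangle> = 0\<close> for each continuous \<open>h\<close>,
  which \<open>S h\<close> approximates.\<close>

theorem eigenfunctions_complete:
  assumes D: "invariant_symmetric D" and f: "square_integrable \<mu> f"
    and orth: "\<And>u. u \<in> eigenfunctions D \<Longrightarrow> L2_inner \<mu> f u = 0"
  shows "AE x in \<mu>. f x = 0"
proof (rule orthogonal_continuous_zero[OF f])
  have S0: "smoothing k f = (\<lambda>x. 0)" if k: "k \<in> C_inf A" "\<And>x. k (iv x) = k x" for k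
  proof -
    note cK = conv_kernel_continuous[OF k(1)]
    note Ssym = kernel_op_symmetric[OF _ _ cK conv_kernel_sym[of k, OF k(2)]]
    have cS: "continuous_on UNIV (smoothing k f)" by (rule kernel_op_continuous[OF cK f])
    note sS = continuous_square_integrable[OF cS]
    have "L2_inner \<mu> (smoothing k f) u = 0" if u: "u \<in> eigenfunctions D" for u
    proof -
      obtain l where l: "D u = (\<lambda>x. complex_of_real l * u x)" and usm: "u \<in> C_inf A" using u by (auto simp: eigenfunctions_def)
      note squ = C_inf_square_integrable[OF usm]
      have "D (smoothing k u) = (\<lambda>x. complex_of_real l * smoothing k u x)"
        unfolding smoothing_commutes[OF D k(1) usm] l by (rule kernel_op_linear(2)[OF cK squ squ])
      then have "smoothing k u \<in> eigenfunctions D"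
        using kernel_op_C_inf[OF conv_kernel_C_inf[OF k(1)] C_inf_continuous[OF ta usm]] by (auto simp: eigenfunctions_def)
      from orth[OF this] show ?thesis using Ssym[OF f squ] by simp
    qed
    from smoothing_orthogonal_zero[OF D k cS this] have "smoothing k (smoothing k f) = (\<lambda>x. 0)" .
    then have "L2_inner \<mu> (smoothing k f) (smoothing k f) = 0"
      using Ssym[OF f sS] by (simp add: L2_inner_def)
    then show ?thesis using continuous_norm_zero[OF cS] by (simp add: inner_self)
  qed
  fix h :: "'g \<Rightarrow> complex" assume h: "continuous_on UNIV h"
  note sqh = continuous_square_integrable[OF h]
  have small: "cmod (L2_inner \<mu> f h) \<le> \<epsilon> * L2_norm \<mu> f" if \<epsilon>: "\<epsilon> > 0" for \<epsilon>
  proof -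
    obtain k where k: "k \<in> C_inf A" "\<And>x. k (iv x) = k x" "\<And>x. cmod (h x - smoothing k h x) \<le> \<epsilon>"
      by (rule approximate_identity[OF h \<epsilon>]) blast
    note cK = conv_kernel_continuous[OF k(1)]
    have cS: "continuous_on UNIV (smoothing k h)" by (rule kernel_op_continuous[OF cK sqh])
    note sS = continuous_square_integrable[OF cS]
    have "L2_inner \<mu> f (smoothing k h) = 0"
      using kernel_op_symmetric[OF f sqh cK conv_kernel_sym[of k, OF k(2)]] S0[OF k(1,2)] by (simp add: L2_inner_def)
    then have "L2_inner \<mu> f h = L2_inner \<mu> f (\<lambda>x. h x - smoothing k h x)" by (simp add: inner_diff_right[OF f sqh sS])
    also have "cmod \<dots> \<le> L2_norm \<mu> f * L2_norm \<mu> (\<lambda>x. h x - smoothing k h x)"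
      by (rule Cauchy_Schwarz[OF f square_integrable_diff[OF sqh sS]])
    also have "\<dots> \<le> L2_norm \<mu> f * \<epsilon>"
      by (rule mult_left_mono[OF norm_le_sup[OF continuous_on_diff[OF h cS] k(3)] norm_nonneg])
    finally show ?thesis by (simp add: mult.commute)
  qed
  show "L2_inner \<mu> f h = 0"
  proof (rule ccontr)
    assume "L2_inner \<mu> f h \<noteq> 0"
    then have p: "cmod (L2_inner \<mu> f h) > 0" by simp
    let ?\<epsilon> = "cmod (L2_inner \<mu> f h) / 2 / (L2_norm \<mu> f + 1)"
    have "?\<epsilon> > 0" using p norm_nonneg[of f] by (simp add: add_nonneg_pos)
    from small[OF this] divide_succ_mult_le[OF norm_nonneg, of "cmod (L2_inner \<mu> f h) / 2" f] p show False by linarith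
  qed
qed

end

section \<open>Complexified vector fields\<close>

lemma complexify_alt: "complexify X f x = complex_of_real (X (\<lambda>y. Re (f y)) x) + \<i> * complex_of_real (X (\<lambda>y. Im (f y)) x)"
  by (simp add: complexify_def complex_eq_iff)

context
  fixes A :: "('m::topological_space, 'e::euclidean_space) chart set" and X :: "'m vf"
  assumes ta: "topological_atlas A" and X: "X \<in> vector_fields A"
begin

lemma vf_linear:
  assumes "a \<in> C_inf A" "b \<in> C_inf A"
  shows "X (\<lambda>x. a x + c * b x) = (\<lambda>x. X a x + c * X b x)"
  unfolding vector_fieldsD(3)[OF X assms(1) C_inf_mult[OF ta C_inf_const[OF ta] assms(2)]]
    vector_fieldsD(4)[OF X assms(2)] ..

lemma complexify_C_inf: "f \<in> C_inf A \<Longrightarrow> complexify X f \<in> C_inf A"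
  unfolding C_inf_complex_iff[OF ta] complexify_def by (simp add: vector_fieldsD(1)[OF X])

lemma complexify_add:
  "f \<in> C_inf A \<Longrightarrow> h \<in> C_inf A \<Longrightarrow> complexify X (\<lambda>x. f x + h x) = (\<lambda>x. complexify X f x + complexify X h x)"
  unfolding C_inf_complex_iff[OF ta] complexify_def by (simp add: vector_fieldsD(3)[OF X] complex_eq_iff fun_eq_iff)

lemma complexify_mult:
  assumes "f \<in> C_inf A" "h \<in> C_inf A"
  shows "complexify X (\<lambda>x. f x * h x) = (\<lambda>x. complexify X f x * h x + f x * complexify X h x)"
proof -
  have f: "(\<lambda>x. Re (f x)) \<in> C_inf A" "(\<lambda>x. Im (f x)) \<in> C_inf A"
    and h: "(\<lambda>x. Re (h x)) \<in> C_inf A" "(\<lambda>x. Im (h x)) \<in> C_inf A"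
    using assms C_inf_complex_iff[OF ta] by auto
  have "X (\<lambda>x. Re (f x) * Re (h x) + (-1) * (Im (f x) * Im (h x))) =
      (\<lambda>x. X (\<lambda>x. Re (f x) * Re (h x)) x + (-1) * X (\<lambda>x. Im (f x) * Im (h x)) x)"
    by (rule vf_linear[OF C_inf_mult[OF ta f(1) h(1)] C_inf_mult[OF ta f(2) h(2)]])
  moreover have "X (\<lambda>x. Re (f x) * Im (h x) + 1 * (Im (f x) * Re (h x))) =
      (\<lambda>x. X (\<lambda>x. Re (f x) * Im (h x)) x + 1 * X (\<lambda>x. Im (f x) * Re (h x)) x)"
    by (rule vf_linear[OF C_inf_mult[OF ta f(1) h(2)] C_inf_mult[OF ta f(2) h(1)]])
  ultimately show ?thesis
    using vector_fieldsD(5)[OF X f(1) h(1)] vector_fieldsD(5)[OF X f(2) h(2)]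
      vector_fieldsD(5)[OF X f(1) h(2)] vector_fieldsD(5)[OF X f(2) h(1)]
    by (simp add: complexify_def complex_eq_iff fun_eq_iff algebra_simps)
qed

lemma complexify_const: "complexify X (\<lambda>x. c) = (\<lambda>x. 0)"
  using derivation_at_const[OF ta derivation_at_vector_field[OF X]] by (simp add: complexify_def complex_eq_iff fun_eq_iff)

lemma complexify_scale: "f \<in> C_inf A \<Longrightarrow> complexify X (\<lambda>x. c * f x) = (\<lambda>x. c * complexify X f x)"
  using complexify_mult[OF C_inf_const[OF ta], of f c] complexify_const[of c] by simp

lemma complexify_cnj:
  assumes "f \<in> C_inf A" shows "complexify X (\<lambda>x. cnj (f x)) = (\<lambda>x. cnj (complexify X f x))"
proof -
  have "(\<lambda>x. Im (f x)) \<in> C_inf A" using assms C_inf_complex_iff[OF ta] by auto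
  from vector_fieldsD(4)[OF X this, of "-1"] show ?thesis by (simp add: complexify_def complex_eq_iff fun_eq_iff)
qed

end

context lie_haar
begin

text \<open>The factor \<open>i\<close> turns the skew-symmetric field into a symmetric operator.\<close>

definition momentum :: "'e \<Rightarrow> ('g \<Rightarrow> complex) \<Rightarrow> ('g \<Rightarrow> complex)" where
  "momentum v f = (\<lambda>x. \<i> * complexify (inv_field v) f x)"

lemma complexify_inv_field_skew:
  assumes "f \<in> C_inf A" "h \<in> C_inf A"
  shows "(LINT x|\<mu>. complexify (inv_field v) f x * h x) = - (LINT x|\<mu>. f x * complexify (inv_field v) h x)"
proof -
  note V = inv_field_vector_field[of v]
  have z: "integral\<^sup>L \<mu> (complexify (inv_field v) u) = 0" if u: "u \<in> C_inf A" for u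
  proof -
    have r: "(\<lambda>x. Re (u x)) \<in> C_inf A" "(\<lambda>x. Im (u x)) \<in> C_inf A" using u C_inf_complex_iff[OF ta] by auto
    have "integrable \<mu> (inv_field v (\<lambda>x. Re (u x)))" "integrable \<mu> (inv_field v (\<lambda>x. Im (u x)))"
      by (rule integrable_continuous[OF C_inf_continuous[OF ta vector_fieldsD(1)[OF V r(1)]]],
          rule integrable_continuous[OF C_inf_continuous[OF ta vector_fieldsD(1)[OF V r(2)]]])
    then show ?thesis using integral_inv_field[OF r(1), of v] integral_inv_field[OF r(2), of v]
      by (simp add: complexify_alt[abs_def])
  qed
  have i: "integrable \<mu> (\<lambda>x. complexify (inv_field v) f x * h x)" "integrable \<mu> (\<lambda>x. f x * complexify (inv_field v) h x)"
    by (rule integrable_continuous[OF C_inf_continuous[OF ta C_inf_mult[OF ta complexify_C_inf[OF ta V assms(1)] assms(2)]]],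
        rule integrable_continuous[OF C_inf_continuous[OF ta C_inf_mult[OF ta assms(1) complexify_C_inf[OF ta V assms(2)]]]])
  show ?thesis using z[OF C_inf_mult[OF ta assms]] i complexify_mult[OF ta V assms] by (simp add: add_eq_0_iff2)
qed

lemma invariant_symmetric_momentum: "invariant_symmetric (momentum v)"
  unfolding invariant_symmetric_def
proof (intro conjI ballI allI)
  note V = inv_field_vector_field[of v]
  fix f h :: "'g \<Rightarrow> complex" and c a
  assume f: "f \<in> C_inf A"
  show "momentum v f \<in> C_inf A" unfolding momentum_def by (rule C_inf_mult[OF ta C_inf_const[OF ta] complexify_C_inf[OF ta V f]])
  show "momentum v (\<lambda>x. c * f x) = (\<lambda>x. c * momentum v f x)"
    by (simp add: momentum_def complexify_scale[OF ta V f] mult_ac)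
  have r: "(\<lambda>x. Re (f x)) \<in> C_inf A" "(\<lambda>x. Im (f x)) \<in> C_inf A" using f C_inf_complex_iff[OF ta] by auto
  show "momentum v (\<lambda>x. f (a \<cdot> x)) = (\<lambda>x. momentum v f (a \<cdot> x))"
    using left_invariantD(2)[OF inv_field_left_invariant r(1), of v a] left_invariantD(2)[OF inv_field_left_invariant r(2), of v a]
    by (simp add: momentum_def complexify_def)
  assume h: "h \<in> C_inf A"
  show "momentum v (\<lambda>x. f x + h x) = (\<lambda>x. momentum v f x + momentum v h x)"
    by (simp add: momentum_def complexify_add[OF ta V f h] distrib_left)
  show "L2_inner \<mu> (momentum v f) h = L2_inner \<mu> f (momentum v h)"
    using complexify_inv_field_skew[OF f C_inf_cnj[OF ta h], of v]
    by (simp add: L2_inner_def momentum_def complexify_cnj[OF ta V h] mult.assoc mult.left_commute[of _ \<i>])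
next
  fix K :: "'g \<times> 'g \<Rightarrow> complex" assume "K \<in> C_inf (prod_atlas A A)"
  then have r: "(\<lambda>x. Re (K x)) \<in> C_inf (prod_atlas A A)" "(\<lambda>x. Im (K x)) \<in> C_inf (prod_atlas A A)"
    using C_inf_complex_iff[OF ta2] by auto
  note V = inv_field_vector_field[of v]
  have "(\<lambda>x. complexify (inv_field v) (\<lambda>y. K (fst x, y)) (snd x)) \<in> C_inf (prod_atlas A A)"
    unfolding C_inf_complex_iff[OF ta2] complexify_def
    using C_inf_vector_field_slice[OF ta sa r(1) V] C_inf_vector_field_slice[OF ta sa r(2) V] by simp
  then show "(\<lambda>x. momentum v (\<lambda>y. K (fst x, y)) (snd x)) \<in> C_inf (prod_atlas A A)"
    unfolding momentum_def by (rule C_inf_mult[OF ta2 C_inf_const[OF ta2]])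
qed

lemma invariant_symmetric_square:
  assumes D: "invariant_symmetric D" shows "invariant_symmetric (\<lambda>f. D (D f))"
proof -
  note D = invariant_symmetricD[OF D]
  show ?thesis unfolding invariant_symmetric_def
    using D(1-5) D(6)[OF D(6)] by simp
qed

lemma invariant_symmetric_sum:
  assumes "finite I" "\<And>i. i \<in> I \<Longrightarrow> invariant_symmetric (D i)"
  shows "invariant_symmetric (\<lambda>f x. \<Sum>i\<in>I. D i f x)"
  unfolding invariant_symmetric_def
proof (intro conjI ballI allI)
  note D = invariant_symmetricD[OF assms(2)]
  fix f h :: "'g \<Rightarrow> complex" and c a
  assume f: "f \<in> C_inf A"
  show "(\<lambda>x. \<Sum>i\<in>I. D i f x) \<in> C_inf A" by (rule C_inf_sum[OF ta D(1)[OF _ f]])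
  show "(\<lambda>x. \<Sum>i\<in>I. D i (\<lambda>x. c * f x) x) = (\<lambda>x. c * (\<Sum>i\<in>I. D i f x))"
    by (simp add: D(3)[OF _ f] sum_distrib_left)
  show "(\<lambda>x. \<Sum>i\<in>I. D i (\<lambda>x. f (a \<cdot> x)) x) = (\<lambda>x. \<Sum>i\<in>I. D i f (a \<cdot> x))" by (simp add: D(5)[OF _ f])
  assume h: "h \<in> C_inf A"
  show "(\<lambda>x. \<Sum>i\<in>I. D i (\<lambda>x. f x + h x) x) = (\<lambda>x. (\<Sum>i\<in>I. D i f x) + (\<Sum>i\<in>I. D i h x))"
    by (simp add: D(2)[OF _ f h] sum.distrib)
  have "L2_inner \<mu> (\<lambda>x. \<Sum>i\<in>I. D i f x) h = (\<Sum>i\<in>I. L2_inner \<mu> (D i f) h)"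
    unfolding L2_inner_def sum_distrib_right
    by (rule Bochner_Integration.integral_sum) (rule integrable_inner[OF C_inf_square_integrable[OF D(1)[OF _ f]] C_inf_square_integrable[OF h]])
  also have "\<dots> = (\<Sum>i\<in>I. L2_inner \<mu> f (D i h))" by (rule sum.cong[OF refl]) (rule D(4)[OF _ f h])
  also have "\<dots> = L2_inner \<mu> f (\<lambda>x. \<Sum>i\<in>I. D i h x)"
    unfolding L2_inner_def cnj_sum sum_distrib_left
    by (rule Bochner_Integration.integral_sum[symmetric]) (rule integrable_inner[OF C_inf_square_integrable[OF f] C_inf_square_integrable[OF D(1)[OF _ h]]])
  finally show "L2_inner \<mu> (\<lambda>x. \<Sum>i\<in>I. D i f x) h = L2_inner \<mu> f (\<lambda>x. \<Sum>i\<in>I. D i h x)" .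
next
  note D = invariant_symmetricD[OF assms(2)]
  fix K :: "'g \<times> 'g \<Rightarrow> complex" assume K: "K \<in> C_inf (prod_atlas A A)"
  show "(\<lambda>x. \<Sum>i\<in>I. D i (\<lambda>y. K (fst x, y)) (snd x)) \<in> C_inf (prod_atlas A A)"
    by (rule C_inf_sum[OF ta2 D(6)[OF _ K]])
qed

end

section \<open>Bessel potentials\<close>

context lie_metric
begin

text \<open>On smooth functions this is the positive Laplacian \<open>-\<Delta>\<close>, each momentum being \<open>i\<close> times a frame field.\<close>

definition Lap :: "('g \<Rightarrow> complex) \<Rightarrow> ('g \<Rightarrow> complex)" where
  "Lap f = (\<lambda>x. \<Sum>v\<in>frame. momentum v (momentum v f) x)"

lemma invariant_symmetric_Lap: "invariant_symmetric Lap"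
  unfolding Lap_def[abs_def]
  by (rule invariant_symmetric_sum[OF frame(1) invariant_symmetric_square[OF invariant_symmetric_momentum]])

lemmas Lap = invariant_symmetricD[OF invariant_symmetric_Lap]

lemma Lap_eq: "f \<in> C_inf A \<Longrightarrow> - complexify (laplacian A \<mu> g) f x = Lap f x"
proof -
  assume f: "f \<in> C_inf A"
  then have r: "(\<lambda>x. Re (f x)) \<in> C_inf A" "(\<lambda>x. Im (f x)) \<in> C_inf A" using C_inf_complex_iff[OF ta] by auto
  have m: "momentum v (momentum v f) x = - complexify (inv_field v) (complexify (inv_field v) f) x" for v
    by (simp add: momentum_def complexify_scale[OF ta inv_field_vector_field complexify_C_inf[OF ta inv_field_vector_field f]])
  show ?thesis
    unfolding Lap_def m sum_negf by (simp add: complexify_def laplacian_eq r complex_eq_iff)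
qed

abbreviation "eigenspace \<equiv> laplace_eigenspace A \<mu> g"

lemma eigenspace_iff: "u \<in> eigenspace l \<longleftrightarrow> u \<in> C_inf A \<and> Lap u = (\<lambda>x. complex_of_real l * u x)"
  unfolding laplace_eigenspace_def by (auto simp: Lap_eq fun_eq_iff)

lemma eigenspaceD: "u \<in> eigenspace l \<Longrightarrow> u \<in> C_inf A" "u \<in> eigenspace l \<Longrightarrow> Lap u = (\<lambda>x. complex_of_real l * u x)"
  "u \<in> eigenspace l \<Longrightarrow> square_integrable \<mu> u"
  using eigenspace_iff C_inf_square_integrable by blast+

lemma eigenspace_zero: "(\<lambda>x. 0) \<in> eigenspace l"
  unfolding eigenspace_iff using Lap(3)[OF C_inf_const[OF ta], of 0 0] C_inf_const[OF ta, of 0] by simp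

lemma eigenspace_add: "u \<in> eigenspace l \<Longrightarrow> w \<in> eigenspace l \<Longrightarrow> (\<lambda>x. u x + w x) \<in> eigenspace l"
  unfolding eigenspace_iff by (simp add: Lap(2) C_inf_add[OF ta] distrib_left)

lemma eigenspace_scale: "u \<in> eigenspace l \<Longrightarrow> (\<lambda>x. c * u x) \<in> eigenspace l"
  unfolding eigenspace_iff by (simp add: Lap(3) C_inf_mult[OF ta C_inf_const[OF ta]] mult_ac)

lemma eigenspace_orthogonal:
  assumes "u \<in> eigenspace l" "w \<in> eigenspace l'" "l \<noteq> l'"
  shows "L2_inner \<mu> u w = 0"
  using Lap(4)[OF eigenspaceD(1)[OF assms(1)] eigenspaceD(1)[OF assms(2)]] assms(3)
  unfolding eigenspaceD(2)[OF assms(1)] eigenspaceD(2)[OF assms(2)] inner_scale inner_scale_right by simp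

text \<open>The quadratic form of the Laplacian is the sum of the squared norms of the momenta.\<close>

lemma eigenvalue_nonneg:
  assumes u: "u \<in> eigenspace l" "u \<noteq> (\<lambda>x. 0)"
  shows "l \<ge> 0"
proof -
  note m = invariant_symmetricD[OF invariant_symmetric_momentum]
  note us = eigenspaceD(1)[OF u(1)]
  have "L2_inner \<mu> (Lap u) u = (\<Sum>v\<in>frame. L2_inner \<mu> (momentum v (momentum v u)) u)"
    unfolding L2_inner_def Lap_def sum_distrib_right
    by (rule Bochner_Integration.integral_sum)
      (rule integrable_inner[OF C_inf_square_integrable[OF m(1)[OF m(1)[OF us]]] C_inf_square_integrable[OF us]])
  also have "\<dots> = (\<Sum>v\<in>frame. complex_of_real ((L2_norm \<mu> (momentum v u))\<^sup>2))"
    by (simp only: m(4)[OF m(1)[OF us] us] inner_self)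
  finally have "complex_of_real (l * (L2_norm \<mu> u)\<^sup>2) = complex_of_real (\<Sum>v\<in>frame. (L2_norm \<mu> (momentum v u))\<^sup>2)"
    unfolding eigenspaceD(2)[OF u(1)] inner_scale inner_self by simp
  then have "l * (L2_norm \<mu> u)\<^sup>2 = (\<Sum>v\<in>frame. (L2_norm \<mu> (momentum v u))\<^sup>2)" by (simp only: of_real_eq_iff)
  then have "l * (L2_norm \<mu> u)\<^sup>2 \<ge> 0" by (simp add: sum_nonneg)
  moreover have "L2_norm \<mu> u \<noteq> 0" using continuous_norm_zero[OF C_inf_continuous[OF ta us]] u(2) by blast
  ultimately show ?thesis by (simp add: zero_le_mult_iff)
qed

text \<open>The multiplier of \<open>(Id - \<Delta>)\<^bsup>s/2\<^esup>\<close> on the eigenspace of \<open>l\<close>.\<close>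

definition wgt :: "real \<Rightarrow> real \<Rightarrow> real" where "wgt s l = (1 + l) powr (s / 2)"

text \<open>A finite sum of Laplace eigenfunctions is handled as the family of its components.\<close>

definition family :: "(real \<Rightarrow> 'g \<Rightarrow> complex) \<Rightarrow> bool" where
  "family F \<longleftrightarrow> (\<forall>l. F l \<in> eigenspace l) \<and> finite {l. F l \<noteq> (\<lambda>x. 0)}"

text \<open>The power \<open>(Id - \<Delta>)\<^bsup>s/2\<^esup>\<close> applied to the sum of the family.\<close>

definition fsum :: "real \<Rightarrow> (real \<Rightarrow> 'g \<Rightarrow> complex) \<Rightarrow> 'g \<Rightarrow> complex" where
  "fsum s F = (\<lambda>x. \<Sum>l | F l \<noteq> (\<lambda>x. 0). complex_of_real (wgt s l) * F l x)"

lemma wgt_add: "l \<ge> 0 \<Longrightarrow> wgt (s + r) l = wgt s l * wgt r l"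
  by (simp add: wgt_def add_divide_distrib powr_add)

lemma wgt_zero: "l \<ge> 0 \<Longrightarrow> wgt 0 l = 1" by (simp add: wgt_def)

lemma wgt_two: "l \<ge> 0 \<Longrightarrow> wgt 2 l = 1 + l" by (simp add: wgt_def)

lemma wgt_nonneg: "wgt s l \<ge> 0" by (simp add: wgt_def)

lemma wgt_mono: "l \<ge> 0 \<Longrightarrow> s \<le> r \<Longrightarrow> wgt s l \<le> wgt r l"
  by (simp add: wgt_def powr_mono)

lemma familyD: "family F \<Longrightarrow> F l \<in> eigenspace l" "family F \<Longrightarrow> finite {l. F l \<noteq> (\<lambda>x. 0)}"
  by (simp_all add: family_def)

lemma fsum_superset:
  assumes "finite S" "{l. F l \<noteq> (\<lambda>x. 0)} \<subseteq> S"
  shows "fsum s F = (\<lambda>x. \<Sum>l\<in>S. complex_of_real (wgt s l) * F l x)"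
  unfolding fsum_def by (intro ext sum.mono_neutral_left assms) auto

lemma fsum_C_inf: "family F \<Longrightarrow> fsum s F \<in> C_inf A"
  unfolding fsum_def by (rule C_inf_sum[OF ta C_inf_mult[OF ta C_inf_const[OF ta] eigenspaceD(1)[OF familyD(1)]]])

lemma fsum_sq: "family F \<Longrightarrow> square_integrable \<mu> (fsum s F)"
  by (rule C_inf_square_integrable[OF fsum_C_inf])

lemma family_add:
  assumes "family F" "family H"
  shows "family (\<lambda>l x. F l x + c * H l x)" "fsum s (\<lambda>l x. F l x + c * H l x) = (\<lambda>x. fsum s F x + c * fsum s H x)"
proof -
  let ?S = "{l. F l \<noteq> (\<lambda>x. 0)} \<union> {l. H l \<noteq> (\<lambda>x. 0)}"
  have S: "finite ?S" using assms by (simp add: family_def)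
  have sub: "{l. (\<lambda>x. F l x + c * H l x) \<noteq> (\<lambda>x. 0)} \<subseteq> ?S" by auto
  show "family (\<lambda>l x. F l x + c * H l x)"
    unfolding family_def
  proof (intro conjI allI)
    show "(\<lambda>x. F l x + c * H l x) \<in> eigenspace l" for l
      by (rule eigenspace_add[OF familyD(1)[OF assms(1)] eigenspace_scale[OF familyD(1)[OF assms(2)]]])
  qed (rule finite_subset[OF sub S])
  show "fsum s (\<lambda>l x. F l x + c * H l x) = (\<lambda>x. fsum s F x + c * fsum s H x)"
    unfolding fsum_superset[OF S sub] fsum_superset[OF S, of F, OF Un_upper1] fsum_superset[OF S, of H, OF Un_upper2]
    by (simp add: sum.distrib sum_distrib_left algebra_simps)
qed

lemma family_single:
  assumes "u \<in> eigenspace l" "l \<ge> 0"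
  shows "family (\<lambda>l'. if l' = l then u else (\<lambda>x. 0))" "fsum s (\<lambda>l'. if l' = l then u else (\<lambda>x. 0)) = (\<lambda>x. complex_of_real (wgt s l) * u x)"
proof -
  have sub: "{l'. (if l' = l then u else (\<lambda>x. 0)) \<noteq> (\<lambda>x. 0)} \<subseteq> {l}" by auto
  show "family (\<lambda>l'. if l' = l then u else (\<lambda>x. 0))"
    unfolding family_def using assms(1) eigenspace_zero finite_subset[OF sub] by auto
  show "fsum s (\<lambda>l'. if l' = l then u else (\<lambda>x. 0)) = (\<lambda>x. complex_of_real (wgt s l) * u x)"
    by (subst fsum_superset[OF _ sub]) simp_all
qed

lemma inner_fsum_left:
  assumes F: "family F" and h: "square_integrable \<mu> h"
  shows "L2_inner \<mu> h (fsum s F) = (\<Sum>l | F l \<noteq> (\<lambda>x. 0). complex_of_real (wgt s l) * L2_inner \<mu> h (F l))"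
proof -
  have "L2_inner \<mu> h (fsum s F) = (\<Sum>l | F l \<noteq> (\<lambda>x. 0). L2_inner \<mu> h (\<lambda>x. complex_of_real (wgt s l) * F l x))"
    unfolding L2_inner_def fsum_def cnj_sum sum_distrib_left
    by (rule Bochner_Integration.integral_sum)
      (rule integrable_inner[OF h square_integrable_scale[OF eigenspaceD(3)[OF familyD(1)[OF F]]]])
  then show ?thesis by (simp add: inner_scale_right)
qed

lemma family_support_nonneg: "family F \<Longrightarrow> F l \<noteq> (\<lambda>x. 0) \<Longrightarrow> l \<ge> 0"
  using eigenvalue_nonneg familyD(1) by blast

text \<open>The weights are real, so they pass from one side of the pairing to the other.\<close>

lemma fsum_inner_shift:
  assumes F: "family F" and f: "square_integrable \<mu> f" "square_integrable \<mu> h"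
    and eq: "\<And>l u. l \<ge> 0 \<Longrightarrow> u \<in> eigenspace l \<Longrightarrow> L2_inner \<mu> h u = complex_of_real (wgt r l) * L2_inner \<mu> f u"
  shows "L2_inner \<mu> h (fsum s F) = L2_inner \<mu> f (fsum (r + s) F)"
  unfolding inner_fsum_left[OF F f(1)] inner_fsum_left[OF F f(2)]
proof (rule sum.cong[OF refl])
  fix l assume "l \<in> {l. F l \<noteq> (\<lambda>x. 0)}"
  then have l: "l \<ge> 0" using family_support_nonneg[OF F] by blast
  show "complex_of_real (wgt s l) * L2_inner \<mu> h (F l) = complex_of_real (wgt (r + s) l) * L2_inner \<mu> f (F l)"
    unfolding eq[OF l familyD(1)[OF F]] wgt_add[OF l] by simp
qed

lemma fsum_inner_eigen:
  assumes F: "family F" and u: "u \<in> eigenspace l" "l \<ge> 0"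
  shows "L2_inner \<mu> (fsum (r + s) F) u = complex_of_real (wgt r l) * L2_inner \<mu> (fsum s F) u"
proof -
  have "L2_inner \<mu> u (fsum (r + s) F) = complex_of_real (wgt r l) * L2_inner \<mu> u (fsum s F)"
    unfolding inner_fsum_left[OF F eigenspaceD(3)[OF u(1)]] sum_distrib_left
  proof (rule sum.cong[OF refl])
    fix l' assume "l' \<in> {l. F l \<noteq> (\<lambda>x. 0)}"
    show "complex_of_real (wgt (r + s) l') * L2_inner \<mu> u (F l') = complex_of_real (wgt r l) * (complex_of_real (wgt s l') * L2_inner \<mu> u (F l'))"
    proof (cases "l' = l")
      case True then show ?thesis using u(2) by (simp add: wgt_add)
    next
      case False
      then show ?thesis using eigenspace_orthogonal[OF u(1) familyD(1)[OF F], of l'] by simp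
    qed
  qed
  then show ?thesis by (subst (1 2) inner_cnj) simp
qed

text \<open>The middle clause is what the induction needs: a new summand is orthogonal to the sum of the others.\<close>

lemma pythagoras:
  assumes "finite S" "\<And>l. l \<in> S \<Longrightarrow> square_integrable \<mu> (a l)"
    "\<And>l l'. l \<in> S \<Longrightarrow> l' \<in> S \<Longrightarrow> l \<noteq> l' \<Longrightarrow> L2_inner \<mu> (a l) (a l') = 0"
  shows "square_integrable \<mu> (\<lambda>x. \<Sum>l\<in>S. a l x) \<and> (\<forall>w. square_integrable \<mu> w \<longrightarrow> (\<forall>l\<in>S. L2_inner \<mu> w (a l) = 0) \<longrightarrow>
      L2_inner \<mu> w (\<lambda>x. \<Sum>l\<in>S. a l x) = 0) \<and> (L2_norm \<mu> (\<lambda>x. \<Sum>l\<in>S. a l x))\<^sup>2 = (\<Sum>l\<in>S. (L2_norm \<mu> (a l))\<^sup>2)"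
  using assms
proof (induction S)
  case empty
  show ?case by (simp add: L2_inner_def L2_norm_def continuous_square_integrable[OF continuous_on_const])
next
  case (insert l S)
  let ?s = "\<lambda>x. \<Sum>l\<in>S. a l x"
  have IH: "square_integrable \<mu> ?s" "\<And>w. square_integrable \<mu> w \<Longrightarrow> (\<forall>l\<in>S. L2_inner \<mu> w (a l) = 0) \<Longrightarrow> L2_inner \<mu> w ?s = 0"
    "(L2_norm \<mu> ?s)\<^sup>2 = (\<Sum>l\<in>S. (L2_norm \<mu> (a l))\<^sup>2)"
    using insert.IH insert.prems by auto
  have al: "square_integrable \<mu> (a l)" using insert.prems by simp
  have 0: "L2_inner \<mu> (a l) ?s = 0" by (rule IH(2)[OF al]) (use insert in auto)
  have m: "square_integrable \<mu> (\<lambda>x. (-1) * ?s x)" by (rule square_integrable_scale[OF IH(1)])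
  have "(L2_norm \<mu> (\<lambda>x. a l x - (-1) * ?s x))\<^sup>2 = (L2_norm \<mu> (a l))\<^sup>2 + (L2_norm \<mu> ?s)\<^sup>2"
    unfolding norm_square_diff[OF al m] inner_scale_right 0 norm_scale by simp
  then have "(L2_norm \<mu> (\<lambda>x. a l x + ?s x))\<^sup>2 = (L2_norm \<mu> (a l))\<^sup>2 + (L2_norm \<mu> ?s)\<^sup>2" by simp
  then show ?case
    using insert.hyps square_integrable_add[OF al IH(1)] IH(2,3) inner_add_right[OF _ al IH(1)] by simp
qed

lemma fsum_norm:
  assumes F: "family F"
  shows "(L2_norm \<mu> (fsum s F))\<^sup>2 = (\<Sum>l | F l \<noteq> (\<lambda>x. 0). (wgt s l * L2_norm \<mu> (F l))\<^sup>2)"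
proof -
  have "(L2_norm \<mu> (\<lambda>x. \<Sum>l | F l \<noteq> (\<lambda>x. 0). complex_of_real (wgt s l) * F l x))\<^sup>2 =
      (\<Sum>l | F l \<noteq> (\<lambda>x. 0). (L2_norm \<mu> (\<lambda>x. complex_of_real (wgt s l) * F l x))\<^sup>2)"
    by (rule conjunct2[OF conjunct2[OF pythagoras[OF familyD(2)[OF F] square_integrable_scale[OF eigenspaceD(3)[OF familyD(1)[OF F]]]]]])
      (simp add: inner_scale inner_scale_right eigenspace_orthogonal[OF familyD(1)[OF F] familyD(1)[OF F]])
  then show ?thesis unfolding fsum_def norm_scale by (simp add: wgt_nonneg)
qed

lemma fsum_norm_mono:
  assumes F: "family F" and "s \<le> r"
  shows "L2_norm \<mu> (fsum s F) \<le> L2_norm \<mu> (fsum r F)"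
proof (rule power2_le_imp_le[OF _ norm_nonneg])
  show "(L2_norm \<mu> (fsum s F))\<^sup>2 \<le> (L2_norm \<mu> (fsum r F))\<^sup>2"
    unfolding fsum_norm[OF F]
    by (intro sum_mono power_mono mult_right_mono wgt_mono assms(2) norm_nonneg mult_nonneg_nonneg wgt_nonneg)
      (use family_support_nonneg[OF F] in blast)
qed

lemma fsum_dense:
  assumes f: "square_integrable \<mu> f" and \<epsilon>: "\<epsilon> > 0"
  obtains F where "family F" "L2_norm \<mu> (\<lambda>x. f x - fsum 0 F x) < \<epsilon>"
proof -
  have fam0: "family (\<lambda>l x. 0)" by (simp add: family_def eigenspace_zero)
  have s0: "fsum 0 (\<lambda>l x. 0) = (\<lambda>x. 0)" by (simp add: fsum_def)
  have "\<exists>p\<in>{fsum 0 F | F. family F}. L2_norm \<mu> (\<lambda>x. f x - p x) < \<epsilon>"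
  proof (rule L2_dense[OF _ _ _ _ _ f \<epsilon>])
    show "(\<lambda>x. p x + q x) \<in> {fsum 0 F | F. family F}" if p: "p \<in> {fsum 0 F | F. family F}" and q: "q \<in> {fsum 0 F | F. family F}" for p q
    proof -
      obtain F H where FH: "p = fsum 0 F" "q = fsum 0 H" "family F" "family H" using p q by auto
      have "(\<lambda>x. p x + q x) = fsum 0 (\<lambda>l x. F l x + 1 * H l x)"
        unfolding family_add(2)[OF FH(3,4)] FH(1,2) by simp
      then show ?thesis using family_add(1)[OF FH(3,4)] by blast
    qed
    show "(\<lambda>x. c * p x) \<in> {fsum 0 F | F. family F}" if p: "p \<in> {fsum 0 F | F. family F}" for c p
    proof -
      obtain F where F: "p = fsum 0 F" "family F" using p by auto
      have "(\<lambda>x. c * p x) = fsum 0 (\<lambda>l x. 0 + c * F l x)"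
        unfolding family_add(2)[OF fam0 F(2)] s0 F(1) by simp
      then show ?thesis using family_add(1)[OF fam0 F(2)] by blast
    qed
    show "(\<lambda>x. 0) \<in> {fsum 0 F | F. family F}" using fam0 s0 by force
    fix h assume h: "square_integrable \<mu> h" and orth: "\<And>p. p \<in> {fsum 0 F | F. family F} \<Longrightarrow> L2_inner \<mu> h p = 0"
    show "AE x in \<mu>. h x = 0"
    proof (rule eigenfunctions_complete[OF invariant_symmetric_Lap h])
      fix u assume "u \<in> eigenfunctions Lap"
      then obtain l where u: "u \<in> eigenspace l" by (auto simp: eigenfunctions_def eigenspace_iff)
      show "L2_inner \<mu> h u = 0"
      proof (cases "u = (\<lambda>x. 0)")
        case True then show ?thesis by (simp add: L2_inner_def)
      next
        case False
        then have l: "l \<ge> 0" by (rule eigenvalue_nonneg[OF u])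
        have eq: "fsum 0 (\<lambda>l'. if l' = l then u else (\<lambda>x. 0)) = u"
          unfolding family_single(2)[OF u l] by (simp add: wgt_zero[OF l])
        have "fsum 0 (\<lambda>l'. if l' = l then u else (\<lambda>x. 0)) \<in> {fsum 0 F | F. family F}"
          using family_single(1)[OF u l] by blast
        from orth[OF this] show ?thesis unfolding eq .
      qed
    qed
  qed (auto intro: fsum_sq)
  then show thesis using that by blast
qed

text \<open>The sums of eigenfunctions are dense, so pairing with them already determines the norm.\<close>

lemma norm_le_dual:
  assumes h: "square_integrable \<mu> h" and C: "\<And>F. family F \<Longrightarrow> cmod (L2_inner \<mu> h (fsum 0 F)) \<le> C * L2_norm \<mu> (fsum 0 F)" "C \<ge> 0"
  shows "L2_norm \<mu> h \<le> C"
proof (rule field_le_epsilon)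
  fix \<epsilon> :: real assume \<epsilon>: "\<epsilon> > 0"
  show "L2_norm \<mu> h \<le> C + \<epsilon>"
  proof (rule ccontr)
    assume "\<not> L2_norm \<mu> h \<le> C + \<epsilon>"
    then have big: "L2_norm \<mu> h > C + \<epsilon>" by simp
    define N where "N = L2_norm \<mu> h"
    have N: "N > 0" "N > C + \<epsilon>" using big C(2) \<epsilon> by (simp_all add: N_def)
    \<comment> \<open>Small enough for \<open>(C + N) \<delta> < \<epsilon> N\<close>, which the estimate of \<open>N\<^sup>2\<close> below requires.\<close>
    define \<delta> where "\<delta> = \<epsilon> * N / (C + N + 1)"
    have CN: "C + N + 1 > 0" using C(2) N(1) by simp
    have \<delta>: "\<delta> > 0" using \<epsilon> N(1) CN by (simp add: \<delta>_def)
    obtain F where F: "family F" "L2_norm \<mu> (\<lambda>x. h x - fsum 0 F x) < \<delta>" by (rule fsum_dense[OF h \<delta>])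
    let ?p = "fsum 0 F" and ?d = "\<lambda>x. h x - fsum 0 F x"
    note p = fsum_sq[OF F(1), of 0]
    have d: "square_integrable \<mu> ?d" by (rule square_integrable_diff[OF h p])
    have np: "L2_norm \<mu> ?p \<le> N + \<delta>" using norm_triangle[OF h d] F(2) by (simp add: N_def)
    have "complex_of_real (N\<^sup>2) = L2_inner \<mu> h ?p + L2_inner \<mu> h ?d"
      unfolding N_def inner_self[symmetric] by (simp add: inner_diff_right[OF h h p])
    then have "N\<^sup>2 \<le> cmod (L2_inner \<mu> h ?p) + cmod (L2_inner \<mu> h ?d)"
      by (metis norm_triangle_ineq norm_of_real abs_power2)
    also have "\<dots> \<le> C * (N + \<delta>) + N * \<delta>"
      using C(1)[OF F(1)] mult_left_mono[OF np C(2)]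
        order_trans[OF Cauchy_Schwarz[OF h d, folded N_def] mult_left_mono[OF less_imp_le[OF F(2)] less_imp_le[OF N(1)]]]
      by linarith
    also have "\<dots> = C * N + (C + N) * \<delta>" by (simp add: algebra_simps)
    also have "\<dots> < C * N + (C + N + 1) * \<delta>" using \<delta> by simp
    also have "(C + N + 1) * \<delta> = \<epsilon> * N" using CN by (simp add: \<delta>_def)
    also have "C * N + \<epsilon> * N = (C + \<epsilon>) * N" by (simp add: distrib_right)
    also have "\<dots> < N * N" using N by simp
    finally show False by (simp add: power2_eq_square)
  qed
qed

definition Helmholtz :: "('g \<Rightarrow> complex) \<Rightarrow> ('g \<Rightarrow> complex)" where
  "Helmholtz f = (\<lambda>x. f x + Lap f x)"

text \<open>Integer powers of \<open>Id - \<Delta>\<close> act on all smooth functions, not only on sums of eigenfunctions; they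
  control the decay of the components of a smooth function.\<close>

lemma Helmholtz_power:
  assumes f: "f \<in> C_inf A"
  shows "(Helmholtz ^^ m) f \<in> C_inf A \<and> (\<forall>l\<ge>0. \<forall>u\<in>eigenspace l.
    L2_inner \<mu> ((Helmholtz ^^ m) f) u = complex_of_real (wgt (2 * real m) l) * L2_inner \<mu> f u)"
proof (induction m)
  case 0
  then show ?case using f by (simp add: wgt_zero)
next
  case (Suc m)
  let ?h = "(Helmholtz ^^ m) f"
  have h: "?h \<in> C_inf A" using Suc by simp
  have Hexp: "Helmholtz ?h = (\<lambda>x. ?h x + Lap ?h x)" by (rule Helmholtz_def)
  have sm: "Helmholtz ?h \<in> C_inf A" unfolding Hexp by (rule C_inf_add[OF ta h Lap(1)[OF h]])
  have "L2_inner \<mu> (Helmholtz ?h) u = complex_of_real (wgt (2 * real (Suc m)) l) * L2_inner \<mu> f u" if l: "l \<ge> 0" and u: "u \<in> eigenspace l" for l u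
  proof -
    note us = eigenspaceD(1)[OF u]
    have "L2_inner \<mu> (Helmholtz ?h) u = L2_inner \<mu> ?h u + L2_inner \<mu> ?h (Lap u)"
      unfolding Hexp
      using inner_add[OF C_inf_square_integrable[OF h] C_inf_square_integrable[OF Lap(1)[OF h]] C_inf_square_integrable[OF us]] Lap(4)[OF h us] by simp
    also have "\<dots> = complex_of_real (wgt 2 l) * L2_inner \<mu> ?h u"
      unfolding eigenspaceD(2)[OF u] inner_scale_right wgt_two[OF l] by (simp add: algebra_simps)
    also have "L2_inner \<mu> ?h u = complex_of_real (wgt (2 * real m) l) * L2_inner \<mu> f u" using Suc l u by simp
    finally show ?thesis using wgt_add[OF l, of 2 "2 * real m"] by (simp add: algebra_simps)
  qed
  then show ?case using sm by simp
qed

text \<open>Approximate \<open>(Id - \<Delta>)\<^sup>m f\<close> by finite sums of eigenfunctions and divide by the weights.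
  For \<open>s \<le> 2 m\<close> this makes \<open>(Id - \<Delta>)\<^bsup>s/2\<^esup>\<close> of the approximations converge.\<close>

lemma smooth_approximation:
  assumes f: "f \<in> C_inf A" and s: "s \<le> 2 * real m"
  obtains F where "\<And>n::nat. family (F n)" "(\<lambda>n. L2_norm \<mu> (\<lambda>x. (Helmholtz ^^ m) f x - fsum (2 * real m) (F n) x)) \<longlonglongrightarrow> 0"
    "(\<lambda>n. L2_norm \<mu> (\<lambda>x. f x - fsum 0 (F n) x)) \<longlonglongrightarrow> 0"
proof -
  let ?r = "2 * real m" and ?h = "(Helmholtz ^^ m) f"
  have h: "?h \<in> C_inf A" "\<And>l u. l \<ge> 0 \<Longrightarrow> u \<in> eigenspace l \<Longrightarrow> L2_inner \<mu> ?h u = complex_of_real (wgt ?r l) * L2_inner \<mu> f u"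
    using Helmholtz_power[OF f] by auto
  note hsq = C_inf_square_integrable[OF h(1)] and fsq = C_inf_square_integrable[OF f]
  have "\<exists>F. family F \<and> L2_norm \<mu> (\<lambda>x. ?h x - fsum 0 F x) < 1 / Suc n" for n
  proof -
    have "1 / real (Suc n) > 0" by simp
    from fsum_dense[OF hsq this] show ?thesis by blast
  qed
  then obtain P where P: "\<And>n. family (P n)" "\<And>n. L2_norm \<mu> (\<lambda>x. ?h x - fsum 0 (P n) x) < 1 / Suc n" by metis
  define F where "F n = (\<lambda>l x. complex_of_real (wgt (- ?r) l) * P n l x)" for n
  have fam: "family (F n)" for n
    unfolding family_def
  proof (intro conjI allI)
    show "F n l \<in> eigenspace l" for l unfolding F_def by (rule eigenspace_scale[OF familyD(1)[OF P(1)]])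
    have "{l. F n l \<noteq> (\<lambda>x. 0)} \<subseteq> {l. P n l \<noteq> (\<lambda>x. 0)}" by (auto simp: F_def)
    then show "finite {l. F n l \<noteq> (\<lambda>x. 0)}" by (rule finite_subset[OF _ familyD(2)[OF P(1)]])
  qed
  have Fs: "fsum s (F n) = fsum (s - ?r) (P n)" for s n
  proof -
    have sub: "{l. F n l \<noteq> (\<lambda>x. 0)} \<subseteq> {l. P n l \<noteq> (\<lambda>x. 0)}" by (auto simp: F_def)
    show ?thesis
      unfolding fsum_superset[OF familyD(2)[OF P(1)] sub] unfolding fsum_def
    proof (intro ext sum.cong[OF refl])
      fix x l assume "l \<in> {l. P n l \<noteq> (\<lambda>x. 0)}"
      then have "l \<ge> 0" using family_support_nonneg[OF P(1)] by blast
      from wgt_add[OF this, of s "- ?r"]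
      show "complex_of_real (wgt s l) * F n l x = complex_of_real (wgt (s - ?r) l) * P n l x" by (simp add: F_def)
    qed
  qed
  have lim: "(\<lambda>n. 1 / real (Suc n)) \<longlonglongrightarrow> 0" using LIMSEQ_Suc[OF lim_inverse_n'] by (simp add: inverse_eq_divide)
  have le: "L2_norm \<mu> (\<lambda>x. f x - fsum 0 (F n) x) \<le> L2_norm \<mu> (\<lambda>x. ?h x - fsum 0 (P n) x)" for n
  proof (rule norm_le_dual[OF square_integrable_diff[OF fsq fsum_sq[OF fam]] _ norm_nonneg])
    fix H assume H: "family H"
    have a: "L2_inner \<mu> f (fsum 0 H) = L2_inner \<mu> ?h (fsum (- ?r) H)"
      using fsum_inner_shift[OF H fsq hsq h(2), where s = "- ?r"] by simp
    have b: "L2_inner \<mu> (fsum 0 (F n)) (fsum 0 H) = L2_inner \<mu> (fsum 0 (P n)) (fsum (- ?r) H)"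
    proof -
      have "L2_inner \<mu> (fsum 0 (P n)) u = complex_of_real (wgt ?r l) * L2_inner \<mu> (fsum 0 (F n)) u" if "l \<ge> 0" "u \<in> eigenspace l" for l u
        using fsum_inner_eigen[OF P(1) that(2,1), where r = ?r and s = "- ?r"] by (simp add: Fs)
      from fsum_inner_shift[OF H fsum_sq[OF fam] fsum_sq[OF P(1)] this, where s = "- ?r"] show ?thesis by simp
    qed
    have "L2_inner \<mu> (\<lambda>x. f x - fsum 0 (F n) x) (fsum 0 H) = L2_inner \<mu> (\<lambda>x. ?h x - fsum 0 (P n) x) (fsum (- ?r) H)"
      unfolding inner_diff[OF fsq fsum_sq[OF fam] fsum_sq[OF H]] inner_diff[OF hsq fsum_sq[OF P(1)] fsum_sq[OF H]] a b ..
    also have "cmod \<dots> \<le> L2_norm \<mu> (\<lambda>x. ?h x - fsum 0 (P n) x) * L2_norm \<mu> (fsum (- ?r) H)"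
      by (rule Cauchy_Schwarz[OF square_integrable_diff[OF hsq fsum_sq[OF P(1)]] fsum_sq[OF H]])
    also have "\<dots> \<le> L2_norm \<mu> (\<lambda>x. ?h x - fsum 0 (P n) x) * L2_norm \<mu> (fsum 0 H)"
      by (rule mult_left_mono[OF fsum_norm_mono[OF H] norm_nonneg]) simp
    finally show "cmod (L2_inner \<mu> (\<lambda>x. f x - fsum 0 (F n) x) (fsum 0 H)) \<le>
        L2_norm \<mu> (\<lambda>x. ?h x - fsum 0 (P n) x) * L2_norm \<mu> (fsum 0 H)" .
  qed
  show thesis
  proof (rule that[OF fam])
    show "(\<lambda>n. L2_norm \<mu> (\<lambda>x. ?h x - fsum ?r (F n) x)) \<longlonglongrightarrow> 0"
      by (rule tendsto_sandwich[OF always_eventually always_eventually tendsto_const lim])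
        (use P(2) in \<open>simp_all add: Fs norm_nonneg less_imp_le\<close>)
    show "(\<lambda>n. L2_norm \<mu> (\<lambda>x. f x - fsum 0 (F n) x)) \<longlonglongrightarrow> 0"
      by (rule tendsto_sandwich[OF always_eventually always_eventually tendsto_const lim])
        (use order_trans[OF le less_imp_le[OF P(2)]] in \<open>simp_all add: norm_nonneg\<close>)
  qed
qed

text \<open>The defining property determines the components, and a function with these components is obtained as
  a limit of \<open>(Id - \<Delta>)\<^bsup>s/2\<^esup> p\<^sub>n\<close> for sums of eigenfunctions \<open>p\<^sub>n\<close> that approximate \<open>f\<close>.  Eigenspaces for negative
  \<open>l\<close> are zero, so they impose no condition.\<close>

lemma bessel_power:
  assumes f: "f \<in> C_inf A"
  shows "square_integrable \<mu> (bessel_power A \<mu> g s f)"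
    "l \<ge> 0 \<Longrightarrow> u \<in> eigenspace l \<Longrightarrow> L2_inner \<mu> (bessel_power A \<mu> g s f) u = complex_of_real (wgt s l) * L2_inner \<mu> f u"
proof -
  obtain m where m: "s / 2 \<le> real m" using real_arch_simple by blast
  then have sm: "s \<le> 2 * real m" by simp
  note fsq = C_inf_square_integrable[OF f]
  let ?h = "(Helmholtz ^^ m) f"
  have hsq: "square_integrable \<mu> ?h" using Helmholtz_power[OF f, of m] C_inf_square_integrable by blast
  obtain F where F: "\<And>n::nat. family (F n)" "(\<lambda>n. L2_norm \<mu> (\<lambda>x. ?h x - fsum (2 * real m) (F n) x)) \<longlonglongrightarrow> 0"
    "(\<lambda>n. L2_norm \<mu> (\<lambda>x. f x - fsum 0 (F n) x)) \<longlonglongrightarrow> 0"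
    by (rule smooth_approximation[OF f sm]) blast
  have Cauchy: "\<exists>N. \<forall>j\<ge>N. \<forall>n\<ge>N. L2_norm \<mu> (\<lambda>x. fsum s (F j) x - fsum s (F n) x) < \<epsilon>" if \<epsilon>: "\<epsilon> > 0" for \<epsilon>
  proof -
    have "\<epsilon> / 2 > 0" using \<epsilon> by simp
    from order_tendstoD(2)[OF F(2) this] obtain N where N: "\<And>n. n \<ge> N \<Longrightarrow> L2_norm \<mu> (\<lambda>x. ?h x - fsum (2 * real m) (F n) x) < \<epsilon> / 2"
      unfolding eventually_sequentially by blast
    have "L2_norm \<mu> (\<lambda>x. fsum s (F j) x - fsum s (F n) x) < \<epsilon>" if "j \<ge> N" "n \<ge> N" for j n
    proof -
      define H where "H = (\<lambda>l x. F j l x + (-1) * F n l x)"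
      have fa: "family H" "\<And>s. fsum s H = (\<lambda>x. fsum s (F j) x + (-1) * fsum s (F n) x)"
        unfolding H_def by (rule family_add(1)[OF F(1) F(1)], rule family_add(2)[OF F(1) F(1)])
      have "L2_norm \<mu> (\<lambda>x. fsum s (F j) x - fsum s (F n) x) \<le> L2_norm \<mu> (\<lambda>x. fsum (2 * real m) (F j) x - fsum (2 * real m) (F n) x)"
        using fsum_norm_mono[OF fa(1) sm] by (simp add: fa(2))
      also have "\<dots> \<le> L2_norm \<mu> (\<lambda>x. ?h x - fsum (2 * real m) (F j) x) + L2_norm \<mu> (\<lambda>x. ?h x - fsum (2 * real m) (F n) x)"
        using norm_triangle_diff[OF fsum_sq[OF F(1)] fsum_sq[OF F(1)] hsq, of "2 * real m" j "2 * real m" n]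
        by (simp add: norm_minus_commute[of ?h])
      also have "\<dots> < \<epsilon>" using N[OF that(1)] N[OF that(2)] by simp
      finally show ?thesis .
    qed
    then show ?thesis by blast
  qed
  obtain b where b: "square_integrable \<mu> b" "(\<lambda>n. L2_norm \<mu> (\<lambda>x. fsum s (F n) x - b x)) \<longlonglongrightarrow> 0"
    by (rule L2_complete[OF fsum_sq[OF F(1)] Cauchy])
  have spec: "L2_inner \<mu> b w = complex_of_real (wgt s l) * L2_inner \<mu> f w" if w: "w \<in> eigenspace l" and l: "l \<ge> 0" for w l
  proof (rule LIMSEQ_unique)
    note wsq = eigenspaceD(3)[OF w]
    show "(\<lambda>n. L2_inner \<mu> (fsum s (F n)) w) \<longlonglongrightarrow> L2_inner \<mu> b w" by (rule inner_tendsto[OF fsum_sq[OF F(1)] b(1) wsq b(2)])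
    have "(\<lambda>n. L2_inner \<mu> (fsum 0 (F n)) w) \<longlonglongrightarrow> L2_inner \<mu> f w"
      by (rule inner_tendsto[OF fsum_sq[OF F(1)] fsq wsq]) (use F(3) in \<open>simp add: norm_minus_commute[of f]\<close>)
    moreover have "L2_inner \<mu> (fsum s (F n)) w = complex_of_real (wgt s l) * L2_inner \<mu> (fsum 0 (F n)) w" for n
      using fsum_inner_eigen[OF F(1) w l, where r = s and s = 0] by simp
    ultimately show "(\<lambda>n. L2_inner \<mu> (fsum s (F n)) w) \<longlonglongrightarrow> complex_of_real (wgt s l) * L2_inner \<mu> f w"
      by (simp add: tendsto_mult_left)
  qed
  have "\<exists>h. square_integrable \<mu> h \<and> (\<forall>l. \<forall>w\<in>eigenspace l.
      L2_inner \<mu> h w = complex_of_real ((1 + l) powr (s / 2)) * L2_inner \<mu> f w)"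
  proof (intro exI[of _ b] conjI allI ballI b(1))
    fix l w assume w: "w \<in> eigenspace l"
    show "L2_inner \<mu> b w = complex_of_real ((1 + l) powr (s / 2)) * L2_inner \<mu> f w"
    proof (cases "w = (\<lambda>x. 0)")
      case True then show ?thesis by (simp add: L2_inner_def)
    next
      case False
      from spec[OF w eigenvalue_nonneg[OF w False]] show ?thesis by (simp add: wgt_def)
    qed
  qed
  from someI_ex[OF this]
  have *: "square_integrable \<mu> (bessel_power A \<mu> g s f) \<and> (\<forall>l. \<forall>w\<in>eigenspace l.
      L2_inner \<mu> (bessel_power A \<mu> g s f) w = complex_of_real ((1 + l) powr (s / 2)) * L2_inner \<mu> f w)"
    unfolding bessel_power_def .
  then show "square_integrable \<mu> (bessel_power A \<mu> g s f)" by blast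
  show "L2_inner \<mu> (bessel_power A \<mu> g s f) u = complex_of_real (wgt s l) * L2_inner \<mu> f u" if "l \<ge> 0" "u \<in> eigenspace l"
    using * that(2) unfolding wgt_def by blast
qed

end

section \<open>Sobolev norms of distributions\<close>

context lie_metric
begin

abbreviation "snorm \<equiv> sobolev_norm_smooth A \<mu> g"
abbreviation "approx \<equiv> sobolev_approx A \<mu> g"

lemma snorm_nonneg: "snorm s f \<ge> 0"
  by (simp add: sobolev_norm_smooth_def norm_nonneg)

lemma bessel_power_fsum:
  assumes "f \<in> C_inf A" "family F"
  shows "L2_inner \<mu> (bessel_power A \<mu> g s f) (fsum r F) = L2_inner \<mu> f (fsum (s + r) F)"
  by (rule fsum_inner_shift[OF assms(2) C_inf_square_integrable[OF assms(1)] bessel_power(1)[OF assms(1)] bessel_power(2)[OF assms(1)]])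

lemma snorm_pairing_fsum:
  assumes "f \<in> C_inf A" "family F"
  shows "cmod (L2_inner \<mu> f (fsum (s + r) F)) \<le> snorm s f * L2_norm \<mu> (fsum r F)"
  unfolding bessel_power_fsum[OF assms, symmetric] sobolev_norm_smooth_def
  by (rule Cauchy_Schwarz[OF bessel_power(1)[OF assms(1)] fsum_sq[OF assms(2)]])

text \<open>The norm of \<open>(Id - \<Delta>)\<^bsup>s/2\<^esup> f\<close> by duality, with the power moved to the other side.\<close>

lemma snorm_le:
  assumes f: "f \<in> C_inf A" and C: "\<And>F. family F \<Longrightarrow> cmod (L2_inner \<mu> f (fsum s F)) \<le> C * L2_norm \<mu> (fsum 0 F)" "C \<ge> 0"
  shows "snorm s f \<le> C"
  unfolding sobolev_norm_smooth_def
proof (rule norm_le_dual[OF bessel_power(1)[OF f] _ C(2)])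
  show "cmod (L2_inner \<mu> (bessel_power A \<mu> g s f) (fsum 0 F)) \<le> C * L2_norm \<mu> (fsum 0 F)" if "family F" for F
    using C(1)[OF that] by (simp add: bessel_power_fsum[OF f that])
qed

lemma snorm_add:
  assumes f: "f \<in> C_inf A" and h: "h \<in> C_inf A"
  shows "snorm s (\<lambda>x. f x + c * h x) \<le> snorm s f + cmod c * snorm s h"
proof (rule snorm_le)
  note ch = C_inf_mult[OF ta C_inf_const[OF ta] h]
  show "(\<lambda>x. f x + c * h x) \<in> C_inf A" by (rule C_inf_add[OF ta f ch])
  show "0 \<le> snorm s f + cmod c * snorm s h" by (simp add: snorm_nonneg)
  fix F assume F: "family F"
  have "L2_inner \<mu> (\<lambda>x. f x + c * h x) (fsum s F) = L2_inner \<mu> f (fsum s F) + c * L2_inner \<mu> h (fsum s F)"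
    using inner_add[OF C_inf_square_integrable[OF f] C_inf_square_integrable[OF ch] fsum_sq[OF F]] by (simp add: inner_scale)
  also have "cmod \<dots> \<le> cmod (L2_inner \<mu> f (fsum s F)) + cmod c * cmod (L2_inner \<mu> h (fsum s F))"
    by (rule order_trans[OF norm_triangle_ineq]) (simp add: norm_mult)
  also have "\<dots> \<le> snorm s f * L2_norm \<mu> (fsum 0 F) + cmod c * (snorm s h * L2_norm \<mu> (fsum 0 F))"
    using snorm_pairing_fsum[OF f F, of s 0] snorm_pairing_fsum[OF h F, of s 0] by (intro add_mono mult_left_mono) simp_all
  finally show "cmod (L2_inner \<mu> (\<lambda>x. f x + c * h x) (fsum s F)) \<le> (snorm s f + cmod c * snorm s h) * L2_norm \<mu> (fsum 0 F)"
    by (simp add: algebra_simps)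
qed

lemma snorm_diff_le:
  assumes f: "f \<in> C_inf A" and h: "h \<in> C_inf A"
  shows "\<bar>snorm s f - snorm s h\<bar> \<le> snorm s (\<lambda>x. f x - h x)"
proof -
  have d: "(\<lambda>x. f x - h x) \<in> C_inf A" by (rule C_inf_diff[OF ta f h])
  have "snorm s f \<le> snorm s (\<lambda>x. f x - h x) + snorm s h" using snorm_add[OF d h, of s 1] by simp
  moreover have "snorm s h \<le> snorm s f + snorm s (\<lambda>x. f x - h x)" using snorm_add[OF f d, of s "-1"] by simp
  ultimately show ?thesis by linarith
qed

text \<open>Duality between the orders \<open>s\<close> and \<open>-s\<close>: approximate \<open>h\<close> by sums of eigenfunctions on which
  \<open>(Id - \<Delta>)\<^bsup>-s/2\<^esup>\<close> stays bounded.\<close>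

lemma snorm_pairing:
  assumes h: "h \<in> C_inf A"
  shows "\<exists>C\<ge>0. \<forall>f\<in>C_inf A. cmod (L2_inner \<mu> f h) \<le> C * snorm s f"
proof -
  obtain m where "- s / 2 \<le> real m" using real_arch_simple by blast
  then have sm: "- s \<le> 2 * real m" by simp
  let ?h = "(Helmholtz ^^ m) h"
  have hsq: "square_integrable \<mu> ?h" using Helmholtz_power[OF h, of m] C_inf_square_integrable by blast
  obtain F where F: "\<And>n::nat. family (F n)" "(\<lambda>n. L2_norm \<mu> (\<lambda>x. ?h x - fsum (2 * real m) (F n) x)) \<longlonglongrightarrow> 0"
    "(\<lambda>n. L2_norm \<mu> (\<lambda>x. h x - fsum 0 (F n) x)) \<longlonglongrightarrow> 0"
    by (rule smooth_approximation[OF h sm]) blast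
  from order_tendstoD(2)[OF F(2) zero_less_one] obtain N where N: "\<And>n. n \<ge> N \<Longrightarrow> L2_norm \<mu> (\<lambda>x. ?h x - fsum (2 * real m) (F n) x) < 1"
    unfolding eventually_sequentially by blast
  define C where "C = L2_norm \<mu> ?h + 1"
  have C: "C \<ge> 0" using norm_nonneg[of ?h] by (simp add: C_def)
  have FC: "L2_norm \<mu> (fsum (- s) (F n)) \<le> C" if n: "n \<ge> N" for n
  proof -
    let ?p = "fsum (2 * real m) (F n)"
    have "L2_norm \<mu> (\<lambda>x. ?h x - (?h x - ?p x)) \<le> L2_norm \<mu> ?h + L2_norm \<mu> (\<lambda>x. ?h x - ?p x)"
      by (rule norm_triangle[OF hsq square_integrable_diff[OF hsq fsum_sq[OF F(1)]]])
    then have "L2_norm \<mu> ?p \<le> C" using N[OF n] by (simp add: C_def)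
    then show ?thesis using fsum_norm_mono[OF F(1) sm, of n] by linarith
  qed
  have "cmod (L2_inner \<mu> f h) \<le> C * snorm s f" if f: "f \<in> C_inf A" for f
  proof (rule LIMSEQ_le_const2[OF tendsto_norm])
    note fsq = C_inf_square_integrable[OF f] and hs = C_inf_square_integrable[OF h]
    have "(\<lambda>n. L2_inner \<mu> (fsum 0 (F n)) f) \<longlonglongrightarrow> L2_inner \<mu> h f"
      by (rule inner_tendsto[OF fsum_sq[OF F(1)] hs fsq]) (use F(3) in \<open>simp add: norm_minus_commute[of h]\<close>)
    from tendsto_cnj[OF this] show "(\<lambda>n. L2_inner \<mu> f (fsum 0 (F n))) \<longlonglongrightarrow> L2_inner \<mu> f h"
      by (simp flip: inner_cnj)
    have "cmod (L2_inner \<mu> f (fsum 0 (F n))) \<le> C * snorm s f" if n: "n \<ge> N" for n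
      using snorm_pairing_fsum[OF f F(1)[of n], of s "- s"] mult_left_mono[OF FC[OF n] snorm_nonneg[of s f]]
      by (simp add: mult.commute)
    then show "\<exists>N. \<forall>n\<ge>N. cmod (L2_inner \<mu> f (fsum 0 (F n))) \<le> C * snorm s f" by blast
  qed
  then show ?thesis using C by blast
qed

lemma approxD:
  assumes "approx s f u"
  shows "f n \<in> C_inf A" "\<epsilon> > 0 \<Longrightarrow> \<exists>N. \<forall>m\<ge>N. \<forall>n\<ge>N. snorm s (\<lambda>x. f m x - f n x) < \<epsilon>"
    "h \<in> C_inf A \<Longrightarrow> (\<lambda>n. dist_of_fun \<mu> (f n) h) \<longlonglongrightarrow> u h"
  using assms unfolding sobolev_approx_def by blast+

lemma dist_of_fun_inner: "dist_of_fun \<mu> f h = L2_inner \<mu> f (\<lambda>x. cnj (h x))"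
  by (simp add: dist_of_fun_def L2_inner_def)

lemma approx_add:
  assumes f: "approx s f u" and h: "approx s h w"
  shows "approx s (\<lambda>n x. f n x + c * h n x) (\<lambda>k. u k + c * w k)"
  unfolding sobolev_approx_def
proof (intro conjI allI impI ballI)
  note fs = approxD(1)[OF f] and hs = approxD(1)[OF h]
  show "(\<lambda>x. f n x + c * h n x) \<in> C_inf A" for n
    by (rule C_inf_add[OF ta fs C_inf_mult[OF ta C_inf_const[OF ta] hs]])
  fix \<epsilon> :: real assume \<epsilon>: "\<epsilon> > 0"
  define \<delta> where "\<delta> = \<epsilon> / 2 / (cmod c + 1)"
  have \<delta>: "\<delta> > 0" using \<epsilon> by (simp add: \<delta>_def add_nonneg_pos)
  have \<delta>e: "cmod c * \<delta> \<le> \<epsilon> / 2" using divide_succ_mult_le[of "cmod c" "\<epsilon> / 2"] \<epsilon> by (simp add: \<delta>_def mult.commute)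
  have e2: "\<epsilon> / 2 > 0" using \<epsilon> by simp
  obtain N1 where N1: "\<And>m n. m \<ge> N1 \<Longrightarrow> n \<ge> N1 \<Longrightarrow> snorm s (\<lambda>x. f m x - f n x) < \<epsilon> / 2" using approxD(2)[OF f e2] by blast
  obtain N2 where N2: "\<And>m n. m \<ge> N2 \<Longrightarrow> n \<ge> N2 \<Longrightarrow> snorm s (\<lambda>x. h m x - h n x) < \<delta>" using approxD(2)[OF h \<delta>] by blast
  have "snorm s (\<lambda>x. (f m x + c * h m x) - (f n x + c * h n x)) < \<epsilon>" if mn: "m \<ge> max N1 N2" "n \<ge> max N1 N2" for m n
  proof -
    have "snorm s (\<lambda>x. (f m x - f n x) + c * (h m x - h n x)) \<le> snorm s (\<lambda>x. f m x - f n x) + cmod c * snorm s (\<lambda>x. h m x - h n x)"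
      by (rule snorm_add[OF C_inf_diff[OF ta fs fs] C_inf_diff[OF ta hs hs]])
    moreover have "cmod c * snorm s (\<lambda>x. h m x - h n x) \<le> cmod c * \<delta>"
      by (rule mult_left_mono[OF less_imp_le[OF N2]]) (use mn in auto)
    moreover have "snorm s (\<lambda>x. f m x - f n x) < \<epsilon> / 2" by (rule N1) (use mn in auto)
    moreover have "(\<lambda>x. (f m x + c * h m x) - (f n x + c * h n x)) = (\<lambda>x. (f m x - f n x) + c * (h m x - h n x))"
      by (simp add: algebra_simps)
    ultimately show ?thesis using \<delta>e by simp
  qed
  then show "\<exists>N. \<forall>m\<ge>N. \<forall>n\<ge>N. snorm s (\<lambda>x. (f m x + c * h m x) - (f n x + c * h n x)) < \<epsilon>" by blast
next
  note fs = approxD(1)[OF f] and hs = approxD(1)[OF h]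
  fix k :: "'g \<Rightarrow> complex" assume k: "k \<in> C_inf A"
  have "dist_of_fun \<mu> (\<lambda>x. f n x + c * h n x) k = dist_of_fun \<mu> (f n) k + c * dist_of_fun \<mu> (h n) k" for n
    unfolding dist_of_fun_inner
      inner_add[OF C_inf_square_integrable[OF fs] square_integrable_scale[OF C_inf_square_integrable[OF hs]] C_inf_square_integrable[OF C_inf_cnj[OF ta k]]]
      inner_scale ..
  then show "(\<lambda>n. dist_of_fun \<mu> (\<lambda>x. f n x + c * h n x) k) \<longlonglongrightarrow> u k + c * w k"
    by (simp only:) (intro tendsto_intros approxD(3)[OF f k] approxD(3)[OF h k])
qed

text \<open>This is why the norm of a distribution is independent of the approximating sequence.  The pairing of
  \<open>d\<^sub>n\<close> with a fixed sum of eigenfunctions is the limit in \<open>m\<close> of that of \<open>d\<^sub>n - d\<^sub>m\<close>, which the Cauchy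
  property bounds.\<close>

lemma approx_zero:
  assumes d: "approx s d (\<lambda>h. 0)"
  shows "(\<lambda>n. snorm s (d n)) \<longlonglongrightarrow> 0"
proof (rule LIMSEQ_I)
  note ds = approxD(1)[OF d]
  fix \<epsilon> :: real assume \<epsilon>: "\<epsilon> > 0"
  then have e2: "\<epsilon> / 2 > 0" by simp
  obtain N where N: "\<And>m n. m \<ge> N \<Longrightarrow> n \<ge> N \<Longrightarrow> snorm s (\<lambda>x. d m x - d n x) < \<epsilon> / 2" using approxD(2)[OF d e2] by blast
  have "snorm s (d n) \<le> \<epsilon> / 2" if n: "n \<ge> N" for n
  proof (rule snorm_le[OF ds])
    fix F assume F: "family F"
    let ?p = "fsum s F"
    have "(\<lambda>m. L2_inner \<mu> (d m) ?p) \<longlonglongrightarrow> 0"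
      using approxD(3)[OF d C_inf_cnj[OF ta fsum_C_inf[OF F]]] by (simp add: dist_of_fun_inner)
    from tendsto_norm[OF tendsto_diff[OF tendsto_const this], of "L2_inner \<mu> (d n) ?p"]
    have lim: "(\<lambda>m. cmod (L2_inner \<mu> (d n) ?p - L2_inner \<mu> (d m) ?p)) \<longlonglongrightarrow> cmod (L2_inner \<mu> (d n) ?p)" by simp
    show "cmod (L2_inner \<mu> (d n) ?p) \<le> \<epsilon> / 2 * L2_norm \<mu> (fsum 0 F)"
    proof (rule LIMSEQ_le_const2[OF lim], intro exI[of _ N] allI impI)
      fix m assume m: "m \<ge> N"
      have "L2_inner \<mu> (d n) ?p - L2_inner \<mu> (d m) ?p = L2_inner \<mu> (\<lambda>x. d n x - d m x) ?p"
        by (simp add: inner_diff[OF C_inf_square_integrable[OF ds] C_inf_square_integrable[OF ds] fsum_sq[OF F]])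
      also have "cmod \<dots> \<le> snorm s (\<lambda>x. d n x - d m x) * L2_norm \<mu> (fsum 0 F)"
        using snorm_pairing_fsum[OF C_inf_diff[OF ta ds ds] F, where s = s and r = 0] by simp
      also have "\<dots> \<le> \<epsilon> / 2 * L2_norm \<mu> (fsum 0 F)"
        by (rule mult_right_mono[OF less_imp_le[OF N[OF n m]] norm_nonneg])
      finally show "cmod (L2_inner \<mu> (d n) ?p - L2_inner \<mu> (d m) ?p) \<le> \<epsilon> / 2 * L2_norm \<mu> (fsum 0 F)" .
    qed
  qed (use \<epsilon> in simp)
  then have "norm (snorm s (d n) - 0) < \<epsilon>" if "n \<ge> N" for n
    using that \<epsilon> snorm_nonneg[of s "d n"] by (fastforce intro: order_le_less_trans)
  then show "\<exists>no. \<forall>n\<ge>no. norm (snorm s (d n) - 0) < \<epsilon>" by blast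
qed

lemma sobolev_norm_limit:
  assumes f: "approx s f u"
  shows "(\<lambda>n. snorm s (f n)) \<longlonglongrightarrow> sobolev_norm A \<mu> g s u"
proof -
  note fs = approxD(1)[OF f]
  have "Cauchy (\<lambda>n. snorm s (f n))"
  proof (rule CauchyI)
    fix \<epsilon> :: real assume \<epsilon>: "\<epsilon> > 0"
    obtain N where N: "\<And>m n. m \<ge> N \<Longrightarrow> n \<ge> N \<Longrightarrow> snorm s (\<lambda>x. f m x - f n x) < \<epsilon>" using approxD(2)[OF f \<epsilon>] by blast
    have "norm (snorm s (f m) - snorm s (f n)) < \<epsilon>" if "m \<ge> N" "n \<ge> N" for m n
      using order_le_less_trans[OF snorm_diff_le[OF fs fs] N[OF that]] by simp
    then show "\<exists>M. \<forall>m\<ge>M. \<forall>n\<ge>M. norm (snorm s (f m) - snorm s (f n)) < \<epsilon>" by blast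
  qed
  then obtain r where r: "(\<lambda>n. snorm s (f n)) \<longlonglongrightarrow> r" by (auto simp: Cauchy_convergent_iff convergent_def)
  have "sobolev_norm A \<mu> g s u = r"
    unfolding sobolev_norm_def
  proof (rule the_equality)
    show "\<exists>f. approx s f u \<and> (\<lambda>n. snorm s (f n)) \<longlonglongrightarrow> r" using f r by blast
    fix r' assume "\<exists>f. approx s f u \<and> (\<lambda>n. snorm s (f n)) \<longlonglongrightarrow> r'"
    then obtain h where h: "approx s h u" "(\<lambda>n. snorm s (h n)) \<longlonglongrightarrow> r'" by blast
    note hs = approxD(1)[OF h(1)]
    have "approx s (\<lambda>n x. f n x + (-1) * h n x) (\<lambda>k. u k + (-1) * u k)" by (rule approx_add[OF f h(1)])
    then have "approx s (\<lambda>n x. f n x - h n x) (\<lambda>k. 0)" by simp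
    from approx_zero[OF this] have "(\<lambda>n. snorm s (\<lambda>x. f n x - h n x)) \<longlonglongrightarrow> 0" .
    from Lim_null_comparison[OF always_eventually this, of "\<lambda>n. snorm s (f n) - snorm s (h n)"]
    have "(\<lambda>n. snorm s (f n) - snorm s (h n)) \<longlonglongrightarrow> 0" using snorm_diff_le[OF fs hs] by simp
    from LIMSEQ_unique[OF this tendsto_diff[OF r h(2)]] show "r' = r" by simp
  qed
  then show ?thesis using r by simp
qed

lemma sobolev_spaceD:
  assumes "u \<in> sobolev_space A \<mu> g s"
  shows "u \<in> distributions A" "\<exists>f. approx s f u"
  using assms by (auto simp: sobolev_space_def)

text \<open>The bound for smooth functions passes to the limit along an approximating sequence.\<close>

lemma sobolev_norm_pairing:
  assumes h: "h \<in> C_inf A"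
  shows "\<exists>C. \<forall>u\<in>sobolev_space A \<mu> g s. cmod (u h) \<le> C * sobolev_norm A \<mu> g s u"
proof -
  obtain C where C: "\<forall>f\<in>C_inf A. cmod (L2_inner \<mu> f (\<lambda>x. cnj (h x))) \<le> C * snorm s f"
    using snorm_pairing[OF C_inf_cnj[OF ta h], of s] by blast
  have "cmod (u h) \<le> C * sobolev_norm A \<mu> g s u" if u: "u \<in> sobolev_space A \<mu> g s" for u
  proof -
    obtain f where f: "approx s f u" using sobolev_spaceD(2)[OF u] by blast
    show ?thesis
    proof (rule LIMSEQ_le[OF tendsto_norm[OF approxD(3)[OF f h]] tendsto_mult[OF tendsto_const sobolev_norm_limit[OF f]]])
      show "\<exists>N. \<forall>n\<ge>N. cmod (dist_of_fun \<mu> (f n) h) \<le> C * snorm s (f n)"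
        using C approxD(1)[OF f] by (simp add: dist_of_fun_inner)
    qed
  qed
  then show ?thesis by blast
qed

lemma distributionsD:
  assumes "u \<in> distributions A"
  shows "h \<in> C_inf A \<Longrightarrow> k \<in> C_inf A \<Longrightarrow> u (\<lambda>x. h x + k x) = u h + u k"
    "h \<in> C_inf A \<Longrightarrow> u (\<lambda>x. c * h x) = c * u h"
    "C_inf_null_seq A d \<Longrightarrow> (\<lambda>n. u (d n)) \<longlonglongrightarrow> 0"
  using assms by (simp_all add: distributions_def)

lemma sobolev_space_add:
  assumes u: "u \<in> sobolev_space A \<mu> g s" and w: "w \<in> sobolev_space A \<mu> g s"
  shows "(\<lambda>h. u h + c * w h) \<in> sobolev_space A \<mu> g s"
  unfolding sobolev_space_def
proof (intro CollectI conjI)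
  note du = distributionsD[OF sobolev_spaceD(1)[OF u]] and dw = distributionsD[OF sobolev_spaceD(1)[OF w]]
  show "(\<lambda>h. u h + c * w h) \<in> distributions A"
    unfolding distributions_def
  proof (intro CollectI conjI allI ballI impI)
    show "u (\<lambda>x. h x + k x) + c * w (\<lambda>x. h x + k x) = u h + c * w h + (u k + c * w k)" if "h \<in> C_inf A" "k \<in> C_inf A" for h k
      by (simp add: du(1)[OF that] dw(1)[OF that] algebra_simps)
    show "u (\<lambda>x. b * h x) + c * w (\<lambda>x. b * h x) = b * (u h + c * w h)" if "h \<in> C_inf A" for b h
      by (simp add: du(2)[OF that] dw(2)[OF that] algebra_simps)
    show "(\<lambda>n. u (d n) + c * w (d n)) \<longlonglongrightarrow> 0" if "C_inf_null_seq A d" for d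
      using tendsto_add[OF du(3)[OF that] tendsto_mult[OF tendsto_const dw(3)[OF that], of c]] by simp
  qed
  show "\<exists>f. approx s f (\<lambda>h. u h + c * w h)"
    using sobolev_spaceD(2)[OF u] sobolev_spaceD(2)[OF w] approx_add by blast
qed

section \<open>Solutions tested against a smooth function\<close>

lemma sobolev_tendsto_imp:
  assumes h: "h \<in> C_inf A" and w: "\<And>r. r \<in> I \<Longrightarrow> r \<noteq> t \<Longrightarrow> w r \<in> sobolev_space A \<mu> g s"
    and lim: "((\<lambda>r. sobolev_norm A \<mu> g s (w r)) \<longlongrightarrow> 0) (at t within I)"
  shows "((\<lambda>r. w r h) \<longlongrightarrow> 0) (at t within I)"
proof -
  obtain C where C: "\<forall>u\<in>sobolev_space A \<mu> g s. cmod (u h) \<le> C * sobolev_norm A \<mu> g s u"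
    using sobolev_norm_pairing[OF h] by blast
  have "\<forall>\<^sub>F r in at t within I. norm (w r h) \<le> C * sobolev_norm A \<mu> g s (w r)"
    unfolding eventually_at_filter using w C by (intro always_eventually) simp
  from Lim_null_comparison[OF this tendsto_mult_right_zero[OF lim]] show ?thesis .
qed

lemma sobolev_continuous_pairing:
  assumes u: "sobolev_continuous_on A \<mu> g s I u" and h: "h \<in> C_inf A"
  shows "continuous_on I (\<lambda>t. u t h)"
  unfolding continuous_on_def
proof (rule ballI)
  fix t assume t: "t \<in> I"
  have us: "u r \<in> sobolev_space A \<mu> g s" if "r \<in> I" for r using u that by (simp add: sobolev_continuous_on_def)
  have "((\<lambda>r. (\<lambda>h. u r h - u t h) h) \<longlongrightarrow> 0) (at t within I)"
  proof (rule sobolev_tendsto_imp[OF h])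
    show "(\<lambda>h. u r h - u t h) \<in> sobolev_space A \<mu> g s" if "r \<in> I" for r
      using sobolev_space_add[OF us[OF that] us[OF t], of "-1"] by simp
    show "((\<lambda>r. sobolev_norm A \<mu> g s (\<lambda>h. u r h - u t h)) \<longlongrightarrow> 0) (at t within I)"
      using u t by (simp add: sobolev_continuous_on_def)
  qed
  then show "((\<lambda>t. u t h) \<longlongrightarrow> u t h) (at t within I)" by (simp add: LIM_zero_iff)
qed

lemma sobolev_derivative_pairing:
  assumes u: "sobolev_has_derivative_on A \<mu> g s I u u'" and h: "h \<in> C_inf A" and t: "t \<in> I"
  shows "((\<lambda>t. u t h) has_vector_derivative u' t h) (at t within I)"
proof -
  have us: "u r \<in> sobolev_space A \<mu> g s" "u' r \<in> sobolev_space A \<mu> g s" if "r \<in> I" for r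
    using u that by (auto simp: sobolev_has_derivative_on_def)
  have l: "((\<lambda>r. (\<lambda>h. (u r h - u t h) / complex_of_real (r - t) - u' t h) h) \<longlongrightarrow> 0) (at t within I)"
  proof (rule sobolev_tendsto_imp[OF h])
    show "(\<lambda>h. (u r h - u t h) / complex_of_real (r - t) - u' t h) \<in> sobolev_space A \<mu> g s" if "r \<in> I" for r
    proof -
      define c where "c = 1 / complex_of_real (r - t)"
      have d: "(\<lambda>h. u r h + (-1) * u t h) \<in> sobolev_space A \<mu> g s" by (rule sobolev_space_add[OF us(1)[OF that] us(1)[OF t]])
      have "(\<lambda>h. (u r h + (-1) * u t h) + (c - 1) * (u r h + (-1) * u t h)) \<in> sobolev_space A \<mu> g s"
        by (rule sobolev_space_add[OF d d])
      from sobolev_space_add[OF this us(2)[OF t], of "-1"]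
      have "(\<lambda>h. (u r h + (-1) * u t h) + (c - 1) * (u r h + (-1) * u t h) + (-1) * u' t h) \<in> sobolev_space A \<mu> g s" .
      moreover have "(\<lambda>h. (u r h + (-1) * u t h) + (c - 1) * (u r h + (-1) * u t h) + (-1) * u' t h) =
          (\<lambda>h. (u r h - u t h) / complex_of_real (r - t) - u' t h)"
      proof
        fix h
        have "(u r h + (-1) * u t h) + (c - 1) * (u r h + (-1) * u t h) = c * (u r h - u t h)" by (simp add: algebra_simps)
        then show "(u r h + (-1) * u t h) + (c - 1) * (u r h + (-1) * u t h) + (-1) * u' t h =
          (u r h - u t h) / complex_of_real (r - t) - u' t h" by (simp add: c_def)
      qed
      ultimately show ?thesis by simp
    qed
    show "((\<lambda>r. sobolev_norm A \<mu> g s (\<lambda>h. (u r h - u t h) / complex_of_real (r - t) - u' t h)) \<longlongrightarrow> 0) (at t within I)"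
      using u t by (simp add: sobolev_has_derivative_on_def)
  qed
  show ?thesis
    unfolding has_vector_derivative_def has_derivative_iff_norm
  proof (intro conjI bounded_linear_scaleR_left)
    have "\<forall>\<^sub>F r in at t within I. norm ((u r h - u t h) / complex_of_real (r - t) - u' t h) =
        norm (u r h - u t h - (r - t) *\<^sub>R u' t h) / norm (r - t)"
      unfolding eventually_at_filter
    proof (intro always_eventually allI impI)
      fix r assume r: "r \<noteq> t"
      have "(u r h - u t h) / complex_of_real (r - t) - u' t h = (u r h - u t h - (r - t) *\<^sub>R u' t h) / complex_of_real (r - t)"
        using r by (simp add: diff_divide_distrib scaleR_conv_of_real)
      then show "norm ((u r h - u t h) / complex_of_real (r - t) - u' t h) = norm (u r h - u t h - (r - t) *\<^sub>R u' t h) / norm (r - t)"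
        by (simp only: norm_divide norm_of_real real_norm_def)
    qed
    from Lim_transform_eventually[OF tendsto_norm_zero[OF l] this]
    show "((\<lambda>r. norm (u r h - u t h - (r - t) *\<^sub>R u' t h) / norm (r - t)) \<longlongrightarrow> 0) (at t within I)" .
  qed
qed

end

section \<open>Powers of an eigenfunction\<close>

text \<open>Sequences of finite sums of terms \<open>c\<^sub>n a \<phi>\<^bsup>n-i\<^esup>\<close> with rapidly decreasing \<open>c\<^sub>n\<close>.  Differentiating
  a power costs a factor \<open>n\<close>, which such coefficients absorb.\<close>

inductive decaying :: "('m, 'e::euclidean_space) chart set \<Rightarrow> ('m \<Rightarrow> complex) \<Rightarrow> (nat \<Rightarrow> 'm \<Rightarrow> complex) \<Rightarrow> bool"
  for A \<phi> where
  base: "(\<And>j. (\<lambda>n. real n ^ j * cmod (c n)) \<longlonglongrightarrow> 0) \<Longrightarrow> a \<in> C_inf A \<Longrightarrow> decaying A \<phi> (\<lambda>n x. c n * (a x * \<phi> x ^ (n - i)))"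
| add: "decaying A \<phi> h \<Longrightarrow> decaying A \<phi> k \<Longrightarrow> decaying A \<phi> (\<lambda>n x. h n x + k n x)"

lemma complexify_power:
  assumes "topological_atlas A" "X \<in> vector_fields A" "\<phi> \<in> C_inf A"
  shows "complexify X (\<lambda>x. \<phi> x ^ k) = (\<lambda>x. of_nat k * \<phi> x ^ (k - 1) * complexify X \<phi> x)"
proof (induction k)
  case 0
  then show ?case using complexify_const[OF assms(1,2)] by simp
next
  case (Suc k)
  show ?case
    unfolding power_Suc complexify_mult[OF assms(1,2,3) C_inf_power[OF assms(1,3)]] Suc
    by (cases k) (simp_all add: fun_eq_iff algebra_simps)
qed

lemma decaying_C_inf:
  assumes "topological_atlas A" "\<phi> \<in> C_inf A" "decaying A \<phi> h"
  shows "h n \<in> C_inf A"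
  using assms(3)
proof (induction rule: decaying.induct)
  case (base c a i)
  show ?case by (rule C_inf_mult[OF assms(1) C_inf_const[OF assms(1)] C_inf_mult[OF assms(1) base(2) C_inf_power[OF assms(1,2)]]])
next
  case (add h k)
  then show ?case by (intro C_inf_add[OF assms(1)])
qed

text \<open>Differentiating \<open>c\<^sub>n a \<phi>\<^bsup>n-i\<^esup>\<close> gives two terms of the same kind: \<open>a\<close> becomes \<open>X a\<close>, or
  \<open>c\<^sub>n\<close>, \<open>a\<close> and \<open>i\<close> become \<open>(n - i) c\<^sub>n\<close>, \<open>a X \<phi>\<close> and \<open>i + 1\<close>.\<close>

lemma decaying_complexify:
  assumes "topological_atlas A" "\<phi> \<in> C_inf A" "X \<in> vector_fields A" "decaying A \<phi> h"
  shows "decaying A \<phi> (\<lambda>n. complexify X (h n))"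
  using assms(4)
proof (induction rule: decaying.induct)
  case (base c a i)
  note p = C_inf_power[OF assms(1,2)]
  have eq: "complexify X (\<lambda>x. c n * (a x * \<phi> x ^ (n - i))) =
      (\<lambda>x. c n * (complexify X a x * \<phi> x ^ (n - i)) + (c n * of_nat (n - i)) * ((a x * complexify X \<phi> x) * \<phi> x ^ (n - Suc i)))" for n
    unfolding complexify_scale[OF assms(1,3) C_inf_mult[OF assms(1) base(2) p]]
      complexify_mult[OF assms(1,3) base(2) p] complexify_power[OF assms(1,3,2)]
    by (simp add: algebra_simps)
  have "(\<lambda>n. real n ^ j * cmod (c n * of_nat (n - i))) \<longlonglongrightarrow> 0" for j
  proof (rule tendsto_sandwich[OF always_eventually always_eventually tendsto_const base(1)[of "Suc j"]]; intro allI)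
    fix n
    have "real n ^ j * cmod (c n * of_nat (n - i)) = (real n ^ j * cmod (c n)) * real (n - i)" by (simp add: norm_mult)
    also have "\<dots> \<le> (real n ^ j * cmod (c n)) * real n" by (intro mult_left_mono) auto
    finally show "real n ^ j * cmod (c n * of_nat (n - i)) \<le> real n ^ Suc j * cmod (c n)" by (simp add: mult_ac)
  qed simp
  then show ?case
    unfolding eq
    by (intro decaying.add decaying.base base complexify_C_inf[OF assms(1,3)] C_inf_mult[OF assms(1)] assms(2))
next
  case (add h k)
  have "complexify X (\<lambda>x. h n x + k n x) = (\<lambda>x. complexify X (h n) x + complexify X (k n) x)" for n
    by (rule complexify_add[OF assms(1,3) decaying_C_inf[OF assms(1,2) add(1)] decaying_C_inf[OF assms(1,2) add(2)]])
  then show ?case using decaying.add[OF add(3,4)] by simp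
qed

lemma power_times_geometric_tendsto_0:
  assumes "0 < \<rho>" "\<rho> < (1::real)"
  shows "(\<lambda>n. real n ^ j * \<rho> ^ n) \<longlonglongrightarrow> 0"
proof (cases "j = 0")
  case True
  then show ?thesis using assms by (simp add: LIMSEQ_power_zero)
next
  case False
  define r where "r = root j \<rho>"
  have r: "0 < r" "r < 1" "r ^ j = \<rho>" using assms False by (auto simp: r_def real_root_pow_pos2)
  have "(\<lambda>n. real n * r ^ n) \<longlonglongrightarrow> 0" using powser_times_n_limit_0[of r] r by simp
  from tendsto_power[OF this, of j] have "(\<lambda>n. (real n * r ^ n) ^ j) \<longlonglongrightarrow> 0" using False by (simp add: zero_power)
  moreover have "(real n * r ^ n) ^ j = real n ^ j * \<rho> ^ n" for n
    by (simp add: power_mult_distrib flip: power_mult r(3)) (simp add: mult.commute)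
  ultimately show ?thesis by simp
qed

context lie_haar
begin

lemma decaying_uniform_limit:
  assumes \<phi>: "\<And>x. cmod (\<phi> x) \<le> 1" and h: "decaying A \<phi> h"
  shows "uniform_limit UNIV h (\<lambda>x. 0) sequentially"
  using h
proof (induction rule: decaying.induct)
  case (base c a i)
  obtain B where B: "B > 0" "\<And>x. cmod (a x) \<le> B" by (rule continuous_bounded[OF C_inf_continuous[OF ta base(2)]]) blast
  show ?case
  proof (rule uniform_limitI)
    fix \<epsilon> :: real assume \<epsilon>: "\<epsilon> > 0"
    have "(\<lambda>n. cmod (c n) * B) \<longlonglongrightarrow> 0" using tendsto_mult_left_zero[OF base(1)[of 0]] by simp
    from order_tendstoD(2)[OF this \<epsilon>]
    show "\<forall>\<^sub>F n in sequentially. \<forall>x\<in>UNIV. dist (c n * (a x * \<phi> x ^ (n - i))) 0 < \<epsilon>"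
    proof eventually_elim
      case (elim n)
      have "cmod (c n * (a x * \<phi> x ^ (n - i))) \<le> cmod (c n) * B" for x
      proof -
        have "cmod (\<phi> x) ^ (n - i) \<le> 1" by (rule power_le_one) (simp_all add: \<phi>)
        then have "cmod (a x) * cmod (\<phi> x) ^ (n - i) \<le> B * 1" by (intro mult_mono) (use B in auto)
        then show ?thesis by (simp add: norm_mult norm_power mult_left_mono)
      qed
      then show ?case using elim by (auto intro: order_le_less_trans)
    qed
  qed
next
  case (add h k)
  from uniform_limit_add[OF add(3,4)] show ?case by simp
qed

lemma C_inf_null_seq_powers:
  assumes \<phi>: "\<phi> \<in> C_inf A" "\<And>x. cmod (\<phi> x) \<le> 1" and \<rho>: "0 < \<rho>" "\<rho> < 1"
  shows "C_inf_null_seq A (\<lambda>n x. complex_of_real (\<rho> ^ n) * \<phi> x ^ n)"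
proof -
  have "decaying A \<phi> (\<lambda>n x. complex_of_real (\<rho> ^ n) * (1 * \<phi> x ^ (n - 0)))"
    by (rule decaying.base[OF _ C_inf_const[OF ta]]) (use power_times_geometric_tendsto_0[OF \<rho>] \<rho> in \<open>simp add: norm_power\<close>)
  then have d: "decaying A \<phi> (\<lambda>n x. complex_of_real (\<rho> ^ n) * \<phi> x ^ n)" by simp
  have ys: "decaying A \<phi> (\<lambda>n. foldr complexify Ys (\<lambda>x. complex_of_real (\<rho> ^ n) * \<phi> x ^ n))" if "set Ys \<subseteq> vector_fields A" for Ys
    using that
  proof (induction Ys)
    case Nil
    show ?case using d by simp
  next
    case (Cons Y Ys)
    have "decaying A \<phi> (\<lambda>n. complexify Y (foldr complexify Ys (\<lambda>x. complex_of_real (\<rho> ^ n) * \<phi> x ^ n)))"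
      by (rule decaying_complexify[OF ta \<phi>(1)]) (use Cons in auto)
    then show ?case by simp
  qed
  show ?thesis
    unfolding C_inf_null_seq_def
  proof (intro conjI allI impI)
    show "(\<lambda>x. complex_of_real (\<rho> ^ n) * \<phi> x ^ n) \<in> C_inf A" for n
      by (rule decaying_C_inf[OF ta \<phi>(1) d])
    fix Ys :: "'g vf list" assume "set Ys \<subseteq> vector_fields A"
    then show "uniform_limit UNIV (\<lambda>n. foldr complexify Ys (\<lambda>x. complex_of_real (\<rho> ^ n) * \<phi> x ^ n)) (\<lambda>x. 0) sequentially"
      by (rule decaying_uniform_limit[of \<phi>, OF \<phi>(2) ys])
  qed
qed

text \<open>If every eigenfunction of \<open>i X\<close> had eigenvalue zero, then by completeness \<open>X\<close> would vanish.
  Passing to the complex conjugate changes the sign of the eigenvalue, and dividing by the maximum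
  normalizes the eigenfunction.\<close>

lemma left_invariant_eigenfunction:
  assumes X: "X \<in> left_invariant_vfs G A" "X \<noteq> zero_vf"
  obtains \<phi> \<kappa> where "\<phi> \<in> C_inf A" "\<kappa> < (0::real)" "complexify X \<phi> = (\<lambda>x. \<i> * complex_of_real \<kappa> * \<phi> x)"
    "\<And>x. cmod (\<phi> x) \<le> 1" "\<exists>x. cmod (\<phi> x) = 1"
proof -
  obtain v where v: "X = inv_field v" by (rule left_invariant_eq_inv_field[OF X(1)])
  note V = inv_field_vector_field[of v]
  note m = invariant_symmetricD[OF invariant_symmetric_momentum[of v]]
  have "\<exists>u l. u \<in> C_inf A \<and> momentum v u = (\<lambda>x. complex_of_real l * u x) \<and> momentum v u \<noteq> (\<lambda>x. 0)"
  proof (rule ccontr)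
    assume no: "\<nexists>u l. u \<in> C_inf A \<and> momentum v u = (\<lambda>x. complex_of_real l * u x) \<and> momentum v u \<noteq> (\<lambda>x. 0)"
    have z: "momentum v h = (\<lambda>x. 0)" if h: "h \<in> C_inf A" for h
    proof (rule AE_continuous_eq[OF C_inf_continuous[OF ta m(1)[OF h]] continuous_on_const])
      show "AE x in \<mu>. momentum v h x = 0"
      proof (rule eigenfunctions_complete[OF invariant_symmetric_momentum C_inf_square_integrable[OF m(1)[OF h]]])
        fix u assume "u \<in> eigenfunctions (momentum v)"
        then have u: "u \<in> C_inf A" "momentum v u = (\<lambda>x. 0)" using no by (auto simp: eigenfunctions_def)
        show "L2_inner \<mu> (momentum v h) u = 0" unfolding m(4)[OF h u(1)] u(2) by (simp add: L2_inner_def)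
      qed
    qed
    have "X f = (\<lambda>x. 0)" for f
    proof (cases "f \<in> C_inf A")
      case True
      have "(\<lambda>x. complex_of_real (f x)) \<in> C_inf A" by (rule C_inf_bounded_linear[OF ta bounded_linear_of_real True])
      from z[OF this] have "complexify X (\<lambda>x. complex_of_real (f x)) x = 0" for x
        unfolding momentum_def v by (metis mult_eq_0_iff complex_i_not_zero)
      then show ?thesis by (simp add: complexify_def complex_eq_iff fun_eq_iff)
    next
      case False
      then show ?thesis unfolding v by (simp add: inv_field_def)
    qed
    then have "X = zero_vf" by (simp add: zero_vf_def fun_eq_iff)
    then show False using X(2) by simp
  qed
  then obtain u l where u: "u \<in> C_inf A" "momentum v u = (\<lambda>x. complex_of_real l * u x)" "momentum v u \<noteq> (\<lambda>x. 0)" by blast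
  have l0: "l \<noteq> 0" and u0: "u \<noteq> (\<lambda>x. 0)" using u(2,3) by auto
  have Xu: "complexify X u x = \<i> * complex_of_real (- l) * u x" for x
  proof -
    have "\<i> * complexify X u x = complex_of_real l * u x" using fun_cong[OF u(2), of x] by (simp add: momentum_def v)
    then have "\<i> * (\<i> * complexify X u x) = \<i> * (complex_of_real l * u x)" by simp
    then have "- complexify X u x = \<i> * complex_of_real l * u x" by (simp add: mult.assoc[symmetric])
    then have "- (- complexify X u x) = - (\<i> * complex_of_real l * u x)" by (rule arg_cong)
    then show ?thesis by simp
  qed
  have "\<exists>w \<kappa>. w \<in> C_inf A \<and> \<kappa> < 0 \<and> complexify X w = (\<lambda>x. \<i> * complex_of_real \<kappa> * w x) \<and> w \<noteq> (\<lambda>x. 0)"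
  proof (cases "l > 0")
    case True
    then show ?thesis using u(1) u0 Xu by (intro exI[of _ u] exI[of _ "- l"]) (simp add: fun_eq_iff)
  next
    case False
    have "complexify X (\<lambda>x. cnj (u x)) = (\<lambda>x. cnj (complexify X u x))" unfolding v by (rule complexify_cnj[OF ta V u(1)])
    then have "complexify X (\<lambda>x. cnj (u x)) = (\<lambda>x. \<i> * complex_of_real l * cnj (u x))" by (simp add: Xu)
    moreover have "(\<lambda>x. cnj (u x)) \<noteq> (\<lambda>x. 0)" using u0 by (simp add: fun_eq_iff)
    ultimately show ?thesis using False l0 C_inf_cnj[OF ta u(1)] by (intro exI[of _ "\<lambda>x. cnj (u x)"] exI[of _ l]) simp
  qed
  then obtain w \<kappa> where w: "w \<in> C_inf A" "\<kappa> < 0" "complexify X w = (\<lambda>x. \<i> * complex_of_real \<kappa> * w x)" "w \<noteq> (\<lambda>x. 0)" by blast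
  have "\<exists>x\<in>UNIV. \<forall>y\<in>UNIV. cmod (w y) \<le> cmod (w x)"
    by (rule continuous_attains_sup[OF compact_G]) (auto intro!: continuous_on_norm C_inf_continuous[OF ta w(1)])
  then obtain x0 where x0: "\<And>y. cmod (w y) \<le> cmod (w x0)" by blast
  have pos: "cmod (w x0) > 0"
  proof (rule ccontr)
    assume "\<not> cmod (w x0) > 0"
    then have "cmod (w y) \<le> 0" for y using x0[of y] by simp
    then show False using w(4) by (simp add: fun_eq_iff)
  qed
  define c where "c = complex_of_real (1 / cmod (w x0))"
  have cm: "cmod c = 1 / cmod (w x0)" using pos by (simp add: c_def norm_divide)
  show thesis
  proof (rule that[of "\<lambda>x. c * w x" \<kappa>])
    show "(\<lambda>x. c * w x) \<in> C_inf A" by (rule C_inf_mult[OF ta C_inf_const[OF ta] w(1)])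
    have "complexify X (\<lambda>x. c * w x) = (\<lambda>x. c * complexify X w x)" unfolding v by (rule complexify_scale[OF ta V w(1)])
    then show "complexify X (\<lambda>x. c * w x) = (\<lambda>x. \<i> * complex_of_real \<kappa> * (c * w x))" unfolding w(3) by (simp add: mult_ac)
    show "cmod (c * w x) \<le> 1" for x using x0[of x] pos by (simp add: norm_mult cm)
    show "\<exists>x. cmod (c * w x) = 1" using pos by (intro exI[of _ x0]) (simp add: norm_mult cm)
  qed (rule w(2))
qed

end

section \<open>The ill-posed Cauchy problem\<close>

context lie_haar
begin

lemma eigenfunction_power:
  assumes X: "X \<in> left_invariant_vfs G A" and \<phi>: "\<phi> \<in> C_inf A"
    and ev: "complexify X \<phi> = (\<lambda>x. \<i> * complex_of_real \<kappa> * \<phi> x)"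
  shows "complexify X (\<lambda>x. \<phi> x ^ n) = (\<lambda>x. \<i> * complex_of_real (real n * \<kappa>) * \<phi> x ^ n)"
proof -
  have "X \<in> vector_fields A" using X by (simp add: left_invariant_vfs_def)
  note p = complexify_power[OF ta this \<phi>, of n]
  show ?thesis unfolding p ev by (cases n) (simp_all add: fun_eq_iff)
qed

text \<open>The powers belong to distinct eigenvalues of the symmetric operator \<open>i X\<close>.\<close>

lemma eigenfunction_powers_orthogonal:
  assumes X: "X \<in> left_invariant_vfs G A" and \<phi>: "\<phi> \<in> C_inf A"
    and ev: "complexify X \<phi> = (\<lambda>x. \<i> * complex_of_real \<kappa> * \<phi> x)" and \<kappa>: "\<kappa> \<noteq> 0" and nm: "n \<noteq> m"
  shows "L2_inner \<mu> (\<lambda>x. \<phi> x ^ n) (\<lambda>x. \<phi> x ^ m) = 0"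
proof -
  obtain v where v: "X = inv_field v" by (rule left_invariant_eq_inv_field[OF X])
  have m: "momentum v (\<lambda>x. \<phi> x ^ k) = (\<lambda>x. complex_of_real (- real k * \<kappa>) * \<phi> x ^ k)" for k
    unfolding momentum_def v[symmetric] eigenfunction_power[OF X \<phi> ev] by (simp add: fun_eq_iff mult.assoc[symmetric])
  let ?I = "L2_inner \<mu> (\<lambda>x. \<phi> x ^ n) (\<lambda>x. \<phi> x ^ m)"
  have "L2_inner \<mu> (momentum v (\<lambda>x. \<phi> x ^ n)) (\<lambda>x. \<phi> x ^ m) = L2_inner \<mu> (\<lambda>x. \<phi> x ^ n) (momentum v (\<lambda>x. \<phi> x ^ m))"
    by (rule invariant_symmetricD(4)[OF invariant_symmetric_momentum C_inf_power[OF ta \<phi>] C_inf_power[OF ta \<phi>]])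
  then have "complex_of_real (- real n * \<kappa>) * ?I = cnj (complex_of_real (- real m * \<kappa>)) * ?I"
    unfolding m inner_scale inner_scale_right .
  then have "complex_of_real ((real m - real n) * \<kappa>) * ?I = 0" by (auto simp: algebra_simps)
  then show ?thesis using \<kappa> nm by (metis mult_eq_0_iff of_real_eq_0_iff of_nat_eq_iff right_minus_eq)
qed

lemma geometric_remainder:
  assumes "z \<noteq> (1 :: complex)"
  shows "1 / (1 - z) = (\<Sum>m<M. z ^ m) + z ^ M * (1 / (1 - z))"
proof -
  have "1 - z \<noteq> 0" using assms by (metis right_minus_eq)
  moreover have "(\<Sum>m<M. z ^ m) = (1 - z ^ M) / (1 - z)"
    using one_diff_power_eq[of z M] \<open>1 - z \<noteq> 0\<close> by simp
  ultimately show ?thesis by (simp add: diff_divide_distrib)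
qed

definition geometric_datum :: "real \<Rightarrow> ('g \<Rightarrow> complex) \<Rightarrow> 'g \<Rightarrow> complex" where
  "geometric_datum \<sigma> \<phi> = (\<lambda>x. 1 / (1 - complex_of_real \<sigma> * cnj (\<phi> x)))"

text \<open>Expanding \<open>1 / (1 - \<sigma> cnj \<phi>)\<close> as a geometric series leaves, by orthogonality, only the term
  of order \<open>n\<close>.\<close>

lemma geometric_datum_pairing:
  assumes X: "X \<in> left_invariant_vfs G A" and \<phi>: "\<phi> \<in> C_inf A"
    and ev: "complexify X \<phi> = (\<lambda>x. \<i> * complex_of_real \<kappa> * \<phi> x)" and \<kappa>: "\<kappa> \<noteq> 0"
    and b: "\<And>x. cmod (\<phi> x) \<le> 1" and \<sigma>: "0 < \<sigma>" "\<sigma> < 1"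
  shows "continuous_on UNIV (geometric_datum \<sigma> \<phi>)"
    "(LINT x|\<mu>. geometric_datum \<sigma> \<phi> x * \<phi> x ^ n) = complex_of_real (\<sigma> ^ n * (LINT x|\<mu>. cmod (\<phi> x) ^ (2 * n)))"
proof -
  define d where "d = geometric_datum \<sigma> \<phi>"
  let ?q = "\<lambda>x. complex_of_real \<sigma> * cnj (\<phi> x)"
  have q: "cmod (?q x) \<le> \<sigma>" for x using b[of x] \<sigma> by (simp add: norm_mult mult_left_le)
  have q1: "?q x \<noteq> 1" for x using q[of x] \<sigma> by auto
  have c\<phi>: "continuous_on UNIV \<phi>" by (rule C_inf_continuous[OF ta \<phi>])
  have cd: "continuous_on UNIV d" unfolding d_def geometric_datum_def
  proof (rule continuous_on_divide[OF continuous_on_const])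
    show "continuous_on UNIV (\<lambda>x. 1 - ?q x)" by (intro continuous_intros c\<phi>)
    show "\<forall>x\<in>UNIV. 1 - ?q x \<noteq> 0" using q1 by (metis right_minus_eq)
  qed
  then show "continuous_on UNIV (geometric_datum \<sigma> \<phi>)" by (simp only: d_def)
  obtain B where B: "\<And>x. cmod (d x) \<le> B" by (rule continuous_bounded[OF cd]) blast
  have q1n: "cmod (\<phi> x ^ k) \<le> 1" for x k using b[of x] by (simp add: norm_power power_le_one)
  let ?I = "LINT x|\<mu>. d x * \<phi> x ^ n"
  let ?R = "\<lambda>M. LINT x|\<mu>. ?q x ^ M * d x * \<phi> x ^ n"
  have split: "d x = (\<Sum>m<M. ?q x ^ m) + ?q x ^ M * d x" for x M
    unfolding d_def geometric_datum_def by (rule geometric_remainder[OF q1])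
  have i1: "integrable \<mu> (\<lambda>x. ?q x ^ m * \<phi> x ^ n)" for m
    by (intro integrable_continuous continuous_intros c\<phi>)
  have i2: "integrable \<mu> (\<lambda>x. ?q x ^ M * d x * \<phi> x ^ n)" for M
    by (intro integrable_continuous continuous_intros c\<phi> cd)
  have main: "?I = complex_of_real (\<sigma> ^ n * (LINT x|\<mu>. cmod (\<phi> x) ^ (2 * n))) + ?R M" if M: "n < M" for M
  proof -
    have "?I = (LINT x|\<mu>. (\<Sum>m<M. ?q x ^ m * \<phi> x ^ n) + ?q x ^ M * d x * \<phi> x ^ n)"
    proof (rule Bochner_Integration.integral_cong[OF refl])
      fix x
      have "d x * \<phi> x ^ n = ((\<Sum>m<M. ?q x ^ m) + ?q x ^ M * d x) * \<phi> x ^ n" by (rule arg_cong[OF split])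
      then show "d x * \<phi> x ^ n = (\<Sum>m<M. ?q x ^ m * \<phi> x ^ n) + ?q x ^ M * d x * \<phi> x ^ n"
        by (simp only: distrib_right sum_distrib_right)
    qed
    also have "\<dots> = (LINT x|\<mu>. (\<Sum>m<M. ?q x ^ m * \<phi> x ^ n)) + ?R M"
      by (rule Bochner_Integration.integral_add[OF Bochner_Integration.integrable_sum[OF i1] i2])
    also have "(LINT x|\<mu>. (\<Sum>m<M. ?q x ^ m * \<phi> x ^ n)) = (\<Sum>m<M. (LINT x|\<mu>. ?q x ^ m * \<phi> x ^ n))"
      by (rule Bochner_Integration.integral_sum[OF i1])
    also have "(\<Sum>m<M. (LINT x|\<mu>. ?q x ^ m * \<phi> x ^ n)) = (\<Sum>m<M. if m = n then complex_of_real (\<sigma> ^ n * (LINT x|\<mu>. cmod (\<phi> x) ^ (2 * n))) else 0)"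
    proof (rule sum.cong[OF refl])
      fix m
      have "(LINT x|\<mu>. ?q x ^ m * \<phi> x ^ n) = complex_of_real (\<sigma> ^ m) * L2_inner \<mu> (\<lambda>x. \<phi> x ^ n) (\<lambda>x. \<phi> x ^ m)"
        unfolding L2_inner_def Bochner_Integration.integral_mult_right_zero[symmetric]
        by (rule Bochner_Integration.integral_cong[OF refl]) (simp add: power_mult_distrib mult_ac)
      moreover have "L2_inner \<mu> (\<lambda>x. \<phi> x ^ n) (\<lambda>x. \<phi> x ^ n) = complex_of_real (LINT x|\<mu>. cmod (\<phi> x) ^ (2 * n))"
        unfolding L2_inner_def integral_complex_of_real[symmetric]
      proof (rule Bochner_Integration.integral_cong[OF refl])
        fix x
        have "cmod (\<phi> x ^ n) ^ 2 = cmod (\<phi> x) ^ (2 * n)" by (simp add: norm_power power_mult[symmetric] mult.commute)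
        then show "\<phi> x ^ n * cnj (\<phi> x ^ n) = complex_of_real (cmod (\<phi> x) ^ (2 * n))"
          using complex_norm_square[of "\<phi> x ^ n"] by simp
      qed
      ultimately show "(LINT x|\<mu>. ?q x ^ m * \<phi> x ^ n) = (if m = n then complex_of_real (\<sigma> ^ n * (LINT x|\<mu>. cmod (\<phi> x) ^ (2 * n))) else 0)"
        using eigenfunction_powers_orthogonal[OF X \<phi> ev \<kappa>, of n m] by (cases "m = n") simp_all
    qed
    also have "\<dots> = complex_of_real (\<sigma> ^ n * (LINT x|\<mu>. cmod (\<phi> x) ^ (2 * n)))" using M by simp
    finally show ?thesis .
  qed
  have R: "cmod (?R M) \<le> \<sigma> ^ M * B" for M
  proof -
    have "cmod (?q x) ^ M * cmod (d x) * cmod (\<phi> x ^ n) \<le> \<sigma> ^ M * B * 1" for x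
      by (intro mult_mono power_mono mult_nonneg_nonneg zero_le_power norm_ge_zero order_trans[OF norm_ge_zero B] less_imp_le[OF \<sigma>(1)] q B q1n)
    then have "cmod (?q x ^ M * d x * \<phi> x ^ n) \<le> \<sigma> ^ M * B" for x
      by (simp add: norm_mult[of _ "\<phi> x ^ n"] norm_mult[of _ "d x"] norm_power[of "?q x"] del: norm_mult norm_power)
    then have "(LINT x|\<mu>. cmod (?q x ^ M * d x * \<phi> x ^ n)) \<le> (LINT x|\<mu>. \<sigma> ^ M * B)"
      by (intro integral_mono integrable_norm[OF i2]) simp_all
    then have "cmod (?R M) \<le> (LINT x|\<mu>. \<sigma> ^ M * B)"
      by (rule order_trans[OF integral_norm_bound])
    then show ?thesis by (simp add: measure_UNIV)
  qed
  have "(\<lambda>M. \<sigma> ^ M * B) \<longlonglongrightarrow> 0 * B" using \<sigma> by (intro tendsto_intros LIMSEQ_realpow_zero) auto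
  then have "(\<lambda>M. \<sigma> ^ M * B) \<longlonglongrightarrow> 0" by simp
  then have "?R \<longlonglongrightarrow> 0" by (rule Lim_null_comparison[rotated]) (simp add: R)
  from tendsto_add[OF tendsto_const this]
  have "(\<lambda>M. complex_of_real (\<sigma> ^ n * (LINT x|\<mu>. cmod (\<phi> x) ^ (2 * n))) + ?R M) \<longlonglongrightarrow>
    complex_of_real (\<sigma> ^ n * (LINT x|\<mu>. cmod (\<phi> x) ^ (2 * n)))" by simp
  moreover have "\<forall>\<^sub>F M in sequentially. complex_of_real (\<sigma> ^ n * (LINT x|\<mu>. cmod (\<phi> x) ^ (2 * n))) + ?R M = ?I"
    using eventually_gt_at_top[of n] by eventually_elim (rule main[symmetric])
  ultimately have "(\<lambda>M. ?I) \<longlonglongrightarrow> complex_of_real (\<sigma> ^ n * (LINT x|\<mu>. cmod (\<phi> x) ^ (2 * n)))"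
    by (rule Lim_transform_eventually)
  then have "?I = complex_of_real (\<sigma> ^ n * (LINT x|\<mu>. cmod (\<phi> x) ^ (2 * n)))" by (simp add: LIMSEQ_const_iff)
  then show "(LINT x|\<mu>. geometric_datum \<sigma> \<phi> x * \<phi> x ^ n) = complex_of_real (\<sigma> ^ n * (LINT x|\<mu>. cmod (\<phi> x) ^ (2 * n)))"
    by (simp only: d_def)
qed

text \<open>The set where \<open>\<bar>\<phi>\<bar> > \<sigma>\<close> is open and non-empty, hence has positive measure.\<close>

lemma integral_power_lower_bound:
  assumes c: "continuous_on UNIV (\<phi> :: 'g \<Rightarrow> complex)" and sup: "\<exists>x. cmod (\<phi> x) = 1" and \<sigma>: "0 < \<sigma>" "\<sigma> < 1"
  obtains c where "c > 0" "\<And>k. \<sigma> ^ k * c \<le> (LINT x|\<mu>. cmod (\<phi> x) ^ k)"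
proof -
  let ?U = "{x. \<sigma> < cmod (\<phi> x)}"
  have o: "open ?U" by (intro open_Collect_less continuous_intros c)
  have m: "?U \<in> sets \<mu>" using o by (simp add: sets_mu)
  have "?U \<noteq> {}" using sup \<sigma>(2) by (metis (mono_tags, lifting) empty_iff mem_Collect_eq)
  then have "emeasure \<mu> ?U \<noteq> 0" using open_null_empty[OF o] by blast
  then have pos: "measure \<mu> ?U > 0" by (simp add: measure_eq_emeasure_eq_ennreal emeasure_eq_measure zero_less_measure_iff)
  show thesis
  proof (rule that[OF pos])
    fix k
    have "\<sigma> ^ k * measure \<mu> ?U = (LINT x|\<mu>. \<sigma> ^ k * indicator ?U x)" using m by simp
    also have "\<dots> \<le> (LINT x|\<mu>. cmod (\<phi> x) ^ k)"
    proof (rule integral_mono)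
      show "integrable \<mu> (\<lambda>x. \<sigma> ^ k * indicator ?U x)" using m by (simp add: emeasure_eq_measure)
      show "integrable \<mu> (\<lambda>x. cmod (\<phi> x) ^ k)" by (intro integrable_continuous continuous_intros c)
      show "\<sigma> ^ k * indicator ?U x \<le> cmod (\<phi> x) ^ k" for x
        using \<sigma> by (cases "x \<in> ?U") (auto intro!: power_mono)
    qed
    finally show "\<sigma> ^ k * measure \<mu> ?U \<le> (LINT x|\<mu>. cmod (\<phi> x) ^ k)" .
  qed
qed

end

context lie_metric
begin

text \<open>Since \<open>u' = - i X u\<close> and \<open>X\<close> is skew, the pairing \<open>F\<close> of \<open>u\<close> with \<open>h\<close> satisfies \<open>F' = - l F\<close>
  inside the interval.  Continuity at the end points then gives \<open>F(T) = e\<^bsup>-lT\<^esup> F(0)\<close>.\<close>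

lemma solution_eigenfunction_pairing:
  assumes u: "cauchy_solution A \<mu> g X T s u\<^sub>0 u" and T: "T > 0" and h: "h \<in> C_inf A"
    and ev: "complexify X h = (\<lambda>x. \<i> * complex_of_real l * h x)"
  shows "u T h = complex_of_real (exp (- l * T)) * (LINT x|\<mu>. u\<^sub>0 x * h x)"
proof -
  obtain u' where uc: "sobolev_continuous_on A \<mu> g s {0..T} u" and ud: "sobolev_has_derivative_on A \<mu> g s {0<..<T} u u'"
    and eq: "\<And>t. t \<in> {0<..<T} \<Longrightarrow> dist_eq A (\<lambda>h. u' t h + \<i> * vf_on_dist X (u t) h) (\<lambda>h. 0)"
    and i: "dist_eq A (u 0) (dist_of_fun \<mu> u\<^sub>0)"
    using u unfolding cauchy_solution_def by blast
  define F where "F t = exp (complex_of_real (l * t)) * u t h" for t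
  have ode: "u' t h = - complex_of_real l * u t h" if t: "t \<in> {0<..<T}" for t
  proof -
    have "u t \<in> sobolev_space A \<mu> g s" using uc t by (simp add: sobolev_continuous_on_def)
    then have "u t (complexify X h) = \<i> * complex_of_real l * u t h"
      unfolding ev by (intro distributionsD(2)[OF sobolev_spaceD(1) h])
    moreover have "u' t h + \<i> * vf_on_dist X (u t) h = 0" using eq[OF t] h by (simp add: dist_eq_def)
    ultimately show ?thesis by (simp add: vf_on_dist_def algebra_simps add_eq_0_iff)
  qed
  have der: "(F has_derivative (\<lambda>y. 0)) (at t within {0..T})" if t: "t \<in> {0..T} - {0, T}" for t
  proof -
    have t': "t \<in> {0<..<T}" using t by auto
    have "((\<lambda>t. u t h) has_vector_derivative u' t h) (at t)"
      using sobolev_derivative_pairing[OF ud h t'] at_within_open[OF t' open_greaterThanLessThan] by simp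
    moreover have "((\<lambda>t. exp (complex_of_real (l * t))) has_vector_derivative complex_of_real l * exp (complex_of_real (l * t))) (at t)"
      unfolding exp_of_real of_real_mult[symmetric]
      by (rule has_vector_derivative_of_real) (auto intro!: derivative_eq_intros)
    ultimately have "(F has_vector_derivative (exp (complex_of_real (l * t)) * u' t h + complex_of_real l * exp (complex_of_real (l * t)) * u t h)) (at t)"
      unfolding F_def by (intro has_vector_derivative_mult)
    then have "(F has_vector_derivative 0) (at t)" by (simp add: ode[OF t'])
    then show ?thesis unfolding has_vector_derivative_def by (auto intro: has_derivative_at_withinI)
  qed
  have "F T = F 0"
  proof (rule has_derivative_zero_unique_strong_convex[of "{0..T}" "{0, T}"])
    show "continuous_on {0..T} F"
      unfolding F_def by (intro continuous_intros sobolev_continuous_pairing[OF uc h])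
  qed (use T der in auto)
  then have "complex_of_real (exp (l * T)) * u T h = u 0 h" by (simp add: F_def exp_of_real[symmetric])
  then have "complex_of_real (exp (- l * T)) * (complex_of_real (exp (l * T)) * u T h) = complex_of_real (exp (- l * T)) * u 0 h" by simp
  then have "u T h = complex_of_real (exp (- l * T)) * u 0 h"
    unfolding mult.assoc[symmetric] of_real_mult[symmetric] exp_add[symmetric] by simp
  moreover have "u 0 h = (LINT x|\<mu>. u\<^sub>0 x * h x)" using i h by (simp add: dist_eq_def dist_of_fun_def)
  ultimately show ?thesis by simp
qed

end

theorem theorem3p1:
  fixes G :: "'g::{t2_space, second_countable_topology} monoid"
    and A :: "('g, 'e::euclidean_space) chart set"
    and \<mu> :: "'g measure"
    and g :: "'g metric_tensor"
    and X :: "'g vf"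
    and T :: real
  assumes "compact_lie_group G A"
    and "normalized_haar G \<mu>"
    and "bi_invariant_metric G A g"
    and "X \<in> left_invariant_vfs G A" and "X \<noteq> zero_vf"
    and "T > 0"
  shows "\<exists>u\<^sub>0. square_integrable \<mu> u\<^sub>0 \<and>
           (\<forall>s::real. \<not> (\<exists>u. cauchy_solution A \<mu> g X T s u\<^sub>0 u))"
proof -
  interpret lie_metric G A \<mu> g by unfold_locales (fact assms(1-3))+
  obtain \<phi> \<kappa> where \<phi>: "\<phi> \<in> C_inf A" "\<kappa> < 0" "complexify X \<phi> = (\<lambda>x. \<i> * complex_of_real \<kappa> * \<phi> x)"
      "\<And>x. cmod (\<phi> x) \<le> 1" "\<exists>x. cmod (\<phi> x) = 1"
    by (rule left_invariant_eigenfunction[OF assms(4,5)]) blast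
  \<comment> \<open>For the power \<open>\<phi>\<^sup>n\<close>, the growth up to time \<open>T\<close> is \<open>\<sigma>\<^bsup>-4n\<^esup>\<close>.  A factor \<open>\<sigma>\<^sup>n\<close> is lost in the
    initial datum, \<open>\<sigma>\<^bsup>2n\<^esup>\<close> in the bound for the integral of \<open>\<bar>\<phi>\<bar>\<^bsup>2n\<^esup>\<close>, and \<open>\<sigma>\<^sup>n\<close> in making the test
    functions a null sequence.\<close>
  define \<sigma> where "\<sigma> = exp (\<kappa> * T / 4)"
  have "\<kappa> * T < 0" using \<phi>(2) \<open>T > 0\<close> by (rule mult_neg_pos)
  then have \<sigma>: "0 < \<sigma>" "\<sigma> < 1" unfolding \<sigma>_def by simp_all
  have \<sigma>4: "\<sigma> ^ 4 * exp (- \<kappa> * T) = 1"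
    unfolding \<sigma>_def exp_of_nat_mult[symmetric] exp_add[symmetric] by simp
  define u\<^sub>0 where "u\<^sub>0 = geometric_datum \<sigma> \<phi>"
  have \<kappa>0: "\<kappa> \<noteq> 0" using \<phi>(2) by simp
  note d = geometric_datum_pairing[OF assms(4) \<phi>(1,3) \<kappa>0 \<phi>(4) \<sigma>, folded u\<^sub>0_def]
  obtain c where c: "c > 0" "\<And>k. \<sigma> ^ k * c \<le> (LINT x|\<mu>. cmod (\<phi> x) ^ k)"
    by (rule integral_power_lower_bound[OF C_inf_continuous[OF ta \<phi>(1)] \<phi>(5) \<sigma>]) blast
  have False if u: "cauchy_solution A \<mu> g X T s u\<^sub>0 u" for s u
  proof -
    have "u T \<in> sobolev_space A \<mu> g s"
      using u \<open>T > 0\<close> by (simp add: cauchy_solution_def sobolev_continuous_on_def)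
    note D = distributionsD[OF sobolev_spaceD(1)[OF this]]
    have "c \<le> cmod (u T (\<lambda>x. complex_of_real (\<sigma> ^ n) * \<phi> x ^ n))" for n
    proof -
      let ?J = "LINT x|\<mu>. cmod (\<phi> x) ^ (2 * n)"
      have "u T (\<lambda>x. \<phi> x ^ n) = complex_of_real (exp (- (real n * \<kappa>) * T)) * complex_of_real (\<sigma> ^ n * ?J)"
        using solution_eigenfunction_pairing[OF u \<open>T > 0\<close> C_inf_power[OF ta \<phi>(1)] eigenfunction_power[OF assms(4) \<phi>(1,3)], of n]
        by (simp only: d(2))
      moreover have "exp (- (real n * \<kappa>) * T) = exp (- \<kappa> * T) ^ n" by (simp add: exp_of_nat_mult[symmetric])
      ultimately have "u T (\<lambda>x. complex_of_real (\<sigma> ^ n) * \<phi> x ^ n) = complex_of_real (\<sigma> ^ n * (exp (- \<kappa> * T) ^ n * (\<sigma> ^ n * ?J)))"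
        unfolding D(2)[OF C_inf_power[OF ta \<phi>(1)]] by simp
      then have "cmod (u T (\<lambda>x. complex_of_real (\<sigma> ^ n) * \<phi> x ^ n)) = \<bar>\<sigma> ^ n * (exp (- \<kappa> * T) ^ n * (\<sigma> ^ n * ?J))\<bar>"
        by (simp only: norm_of_real)
      also have "\<dots> = \<sigma> ^ n * (exp (- \<kappa> * T) ^ n * (\<sigma> ^ n * ?J))"
        using \<sigma> by (intro abs_of_nonneg mult_nonneg_nonneg integral_nonneg_AE) simp_all
      finally have eq: "cmod (u T (\<lambda>x. complex_of_real (\<sigma> ^ n) * \<phi> x ^ n)) = \<sigma> ^ n * (exp (- \<kappa> * T) ^ n * (\<sigma> ^ n * ?J))" .
      have "\<sigma> ^ n * (exp (- \<kappa> * T) ^ n * (\<sigma> ^ n * ?J)) \<ge> \<sigma> ^ n * (exp (- \<kappa> * T) ^ n * (\<sigma> ^ n * (\<sigma> ^ (2 * n) * c)))"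
        using \<sigma> c(2) by (intro mult_left_mono) simp_all
      moreover have "\<sigma> ^ n * (exp (- \<kappa> * T) ^ n * (\<sigma> ^ n * (\<sigma> ^ (2 * n) * c))) = c"
      proof -
        have "\<sigma> ^ n * (exp (- \<kappa> * T) ^ n * (\<sigma> ^ n * (\<sigma> ^ (2 * n) * c))) = (\<sigma> * (exp (- \<kappa> * T) * (\<sigma> * \<sigma> ^ 2))) ^ n * c"
          by (simp only: power_mult_distrib power_mult mult.assoc)
        also have "\<sigma> * (exp (- \<kappa> * T) * (\<sigma> * \<sigma> ^ 2)) = 1" using \<sigma>4 by (simp add: eval_nat_numeral mult_ac)
        finally show ?thesis by simp
      qed
      ultimately show ?thesis unfolding eq by linarith
    qed
    moreover have "(\<lambda>n. cmod (u T (\<lambda>x. complex_of_real (\<sigma> ^ n) * \<phi> x ^ n))) \<longlonglongrightarrow> 0"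
      by (rule tendsto_norm_zero[OF D(3)[OF C_inf_null_seq_powers[OF \<phi>(1,4) \<sigma>]]])
    ultimately have "c \<le> 0" by (intro LIMSEQ_le_const) blast+
    then show False using c(1) by simp
  qed
  then show ?thesis using continuous_square_integrable[OF d(1)] by blast
qed

end
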